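(* Let $\mathfrak m$ be a simple matroid of rank at least one. The Bergman fan $\Sigma_{\mathfrak m}$ and the augmented Bergman fan $\widehat\Sigma_{\mathfrak m}$ of $\mathfrak m$ are quasilinear. More generally, any generalized Bergman fan is quasilinear.
   Context: **Fans.** $N$ is a free abelian group of finite rank, $N_{\mathbb R}=N\otimes\mathbb R$. A rational fan $\Sigma$ in $N_{\mathbb R}$ is a non-empty finite collection of strongly convex rational polyhedral cones, closed under taking faces, any two of which meet in a common face; $|\Sigma|$ is its support, $\Sigma_k$ the set of its $k$-dimensional cones, $\underline 0=\{0\}$; facets are maximal cones. For a cone $\sigma$, $N_\sigma=N\cap\mathrm{span}(\sigma)$ and $N^\sigma=N/N_\sigma$. If $\tau$ is a codimension one face of $\sigma$, $\mathfrak n_{\sigma/\tau}\in N_\sigma$ denotes any vector lying on the same side of $\mathrm{span}(\tau)$ as $\sigma$ with $N_\tau+\mathbb Z\,\mathfrak n_{\sigma/\tau}=N_\sigma$, and $e^\tau_\sigma$ is its image in $N^\tau$. The star fan $\Sigma^\sigma$ is the fan in $N^\sigma_{\mathbb R}$ formed by the images $\eta^\sigma$ of the cones $\eta\in\Sigma$ containing $\sigma$. **Tropical fans.** $\mathrm{MW}_p(\Sigma)$ is the group of Minkowski weights: maps $w\colon\Sigma_p\to\mathbb Z$ with $\sum_{\sigma\supset\tau,\,\sigma\in\Sigma_p}w(\sigma)e^\tau_\sigma=0$ in $N^\tau$ for all $\tau\in\Sigma_{p-1}$. A tropical fan $(\Sigma,\omega_\Sigma)$ of dimension $d$ is a rational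 fan of pure dimension $d$ with an orientation, i.e. an element $\omega_\Sigma\in\mathrm{MW}_d(\Sigma)$ taking only non-zero values. Star fans carry the induced orientation $\omega_{\Sigma^\sigma}(\eta^\sigma)=\omega_\Sigma(\eta)$; products carry $\omega(\sigma\times\sigma')=\omega_\Sigma(\sigma)\omega_{\Sigma'}(\sigma')$. Tropical fans are considered up to isomorphism (integral linear isomorphisms of the lattices $N\cap\mathrm{span}|\Sigma|$ matching cones and orientations). **Bergman fans.** Let $\mathfrak m$ be a simple matroid (no loops, no parallel elements) on a finite ground set $E$, of rank at least one. For $A\subseteq E$, $e_A=\sum_{i\in A}e_i$, with $(e_i)$ the standard basis of $\mathbb R^E$. The Bergman fan $\Sigma_{\mathfrak m}$ lives in $\mathbb R^E/\mathbb R e_E$ with lattice $\mathbb Z^E/\mathbb Z e_E$; its cones are $\sigma_{\mathscr F}=\sum_j\mathbb R_{\ge0}e_{F_j}$ for all flags $\mathscr F\colon F_1\subsetneq\dots\subsetneq F_\ell$ of nonempty proper flats ($\ell\geq 0$). The augmented Bergman fan $\widehat\Sigma_{\mathfrak m}$ lives in $\mathbb R^E$ with lattice $\mathbb Z^E$; its cones are $\sigma_{I,\mathscr F}=\sum_{i\in I}\mathbb R_{\ge0}e_i+\sum_{F\in\mathscr F}\mathbb R_{\ge0}(-e_{E\setminus F})$ for all pairs $(I,\mathscr F)$ of an independent set $I$ and a (possibly empty) flag $\mathscr F\colon F_1\subsetneq\dots\subsetneq F_\ell$ of (possibly empty) proper flats with $I\subseteq F_1$ (no condition if $\mathscr F$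 is empty). Both are tropical fans with all weights equal to $1$. A generalized Bergman fan is any fan isomorphic to a rational fan with support $|\Sigma_{\mathfrak m}|$, considered with the same lattice, for some simple matroid $\mathfrak m$ of rank at least one on a finite ground set, with all weights equal to $1$. **Meromorphic functions, divisors, tropical modifications.** A meromorphic function $f$ on $\Sigma$ is a continuous function $|\Sigma|\to\mathbb R$ whose restriction to each cone $\sigma$ is given by an integral linear form $f_\sigma\in\mathrm{Hom}(N_\sigma,\mathbb Z)$. For $\tau\in\Sigma_{d-1}$, $\mathrm{ord}_\tau(f)=-\sum_{\sigma\supset\tau}\omega_\Sigma(\sigma)f_\sigma(\mathfrak n_{\sigma/\tau})+f_\tau\bigl(\sum_{\sigma\supset\tau}\omega_\Sigma(\sigma)\mathfrak n_{\sigma/\tau}\bigr)$ (sums over $\sigma\in\Sigma_d$), and $\mathrm{div}(f)\in\mathrm{MW}_{d-1}(\Sigma)$ is $\tau\mapsto\mathrm{ord}_\tau(f)$. When not identically zero, $\mathrm{div}(f)$ is identified with the tropical fan $\Delta$ consisting of all $\tau\in\Sigma_{d-1}$ with $\mathrm{ord}_\tau(f)\ne0$ and their faces, oriented by $\mathrm{ord}(f)$; when zero, $\mathrm{div}(f)$ is called trivial and $\Delta=\varnothing$. The tropical modification $\mathrm{TM}_f(\Sigma)$ is the tropical fan in $(N\times\mathbb Z)_{\mathbb R}$ with cones $\sigma_o=\{(x,f(x)):x\in\sigma\}$ for $\sigma\in\Sigma$ and $\delta_\uparrow=\delta_o+\mathbb R_{\ge0}(0,1)$ for $\delta\in\Delta$,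 with orientation $\sigma_o\mapsto\omega_\Sigma(\sigma)$ ($\sigma\in\Sigma_d$), $\delta_\uparrow\mapsto\mathrm{ord}_\delta(f)$ ($\delta\in\Delta_{d-1}$). **Blow-ups.** For $\sigma\in\Sigma$ and a rational ray $\rho$ in the relative interior of $\sigma$, the blow-up (stellar subdivision) $\Sigma_{(\rho)}$ is obtained by removing all cones containing $\sigma$ and adding the cones $\tau+\rho$ for $\tau$ a face, not containing $\sigma$, of some $\eta\in\Sigma$ with $\eta\supseteq\sigma$; each facet gets the weight of the facet of $\Sigma$ containing it. **Quasilinear fans.** A class $\mathscr S$ of tropical fans is $\mathcal T$-stable if: (i) $\Sigma,\Sigma'\in\mathscr S$ implies $\Sigma\times\Sigma'\in\mathscr S$; (ii) if $\Sigma\in\mathscr S$ and $f$ is meromorphic on $\Sigma$ with $\mathrm{div}(f)$ trivial or in $\mathscr S$, then $\mathrm{TM}_f(\Sigma)\in\mathscr S$; (iii) for every tropical fan $\Sigma$, $\sigma\in\Sigma$ and rational ray $\rho$ in the relative interior of $\sigma$ with $\Sigma^\sigma\in\mathscr S$, one has $\Sigma\in\mathscr S\Leftrightarrow\Sigma_{(\rho)}\in\mathscr S$. Let $\mathcal B$ consist of the zero-dimensional tropical fans $(\underline 0,n)$, $n\in\mathbb Z\setminus\{0\}$ (the fan $\{\underline0\}$ with weight $n$), and of the complete fan $\Lambda=\{\underline0,\mathbb R_{\ge0},\mathbb R_{\le0}\}$ in $\mathbb R$ (lattice $\mathbb Z$) with weights equal to $1$. A tropical fan is quasilinear if it belongs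 to the smallest $\mathcal T$-stable class containing $\mathcal B$. *)

theory Defs
  imports "HOL-Analysis.Analysis" "HOL-Analysis.Finite_Function_Topology"
begin

section \<open>Lattices\<close>

text \<open>
  A lattice is kept as a subgroup of a real vector space which is freely
  generated, over the integers, by finitely many vectors that are linearly independent over the
  reals. Its real span then plays the role of the scalar extension to the reals, so the ambient
  space itself carries no information and may be infinite-dimensional.
\<close>

definition is_lattice :: "'v::real_vector set \<Rightarrow> bool" where
  "is_lattice N \<longleftrightarrow>
     (\<exists>B. finite B \<and> independent B \<and> N = range (\<lambda>c. \<Sum>b\<in>B. of_int (c b) *\<^sub>R b))"

text \<open>
  The quotient of a vector space by a subspace \<open>S\<close> is realised inside the same space, as
  the image of a linear map whose kernel is \<open>S\<close>; accordingly the quotient of a lattice is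
  the image of the lattice.
\<close>

definition quot_map :: "'v::real_vector set \<Rightarrow> 'v \<Rightarrow> 'v" where
  "quot_map S = (SOME p. linear p \<and> {x. p x = 0} = S)"

lemma quot_map:
  fixes S :: "'v::real_vector set"
  assumes "subspace S"
  shows "linear (quot_map S)" and "{x. quot_map S x = 0} = S"
proof -
  obtain B where B: "B \<subseteq> S" "independent B" "S \<subseteq> span B"
    using real_vector.maximal_independent_subset[of S] by blast
  have SB: "S = span B"
    using B assms by (simp add: span_minimal subset_antisym)
  obtain C where C: "B \<subseteq> C" "independent C" "UNIV \<subseteq> span C"
    using real_vector.maximal_independent_subset_extend[of B UNIV] B(2) by auto
  obtain p :: "'v \<Rightarrow> 'v" where p: "linear p" "\<forall>x\<in>C. p x = (if x \<in> B then 0 else x)"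
    using real_vector.linear_independent_extend[OF C(2), of "\<lambda>x. if x \<in> B then 0 else x"] by blast
  have pB: "p x = 0" if "x \<in> span B" for x
    by (rule real_vector.linear_eq_0_on_span[OF p(1) _ that]) (use C(1) p(2) in auto)
  have pC: "p x = x" if "x \<in> span (C - B)" for x
    by (rule real_vector.linear_eq_on[OF p(1) real_vector.linear_ident that]) (use p(2) in auto)
  have "x \<in> span B" if px: "p x = 0" for x
  proof -
    have "x \<in> span (B \<union> (C - B))"
      using C by (auto simp: Un_absorb1)
    then obtain y z where yz: "x = y + z" "y \<in> span B" "z \<in> span (C - B)"
      unfolding real_vector.span_Un by blast
    then have "p x = z"
      using pB pC by (simp add: linear_add[OF p(1)])
    then show ?thesis using px yz by simp
  qed
  then have "linear p \<and> {x. p x = 0} = S"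
    using p(1) pB SB by auto
  then have "linear (quot_map S) \<and> {x. quot_map S x = 0} = S"
    unfolding quot_map_def by (rule someI[where P = "\<lambda>p. linear p \<and> {x. p x = 0} = S"])
  then show "linear (quot_map S)" and "{x. quot_map S x = 0} = S" by auto
qed


section \<open>Rational fans\<close>

definition rational_cone :: "'v::real_vector set \<Rightarrow> 'v set \<Rightarrow> bool" where
  "rational_cone N \<sigma> \<longleftrightarrow> (\<exists>V. finite V \<and> V \<subseteq> N \<and> \<sigma> = convex_cone hull V)"

definition strongly_convex :: "'v::real_vector set \<Rightarrow> bool" where
  "strongly_convex \<sigma> \<longleftrightarrow> \<sigma> \<inter> uminus ` \<sigma> = {0}"

text \<open>The library relation \<^const>\<open>face_of\<close> also counts the empty set as a face.\<close>

definition cone_face :: "'v::real_vector set \<Rightarrow> 'v set \<Rightarrow> bool" where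
  "cone_face \<tau> \<sigma> \<longleftrightarrow> \<tau> face_of \<sigma> \<and> \<tau> \<noteq> {}"

definition rational_fan :: "'v::real_vector set \<Rightarrow> 'v set set \<Rightarrow> bool" where
  "rational_fan N \<Sigma> \<longleftrightarrow>
     is_lattice N \<and> finite \<Sigma> \<and> \<Sigma> \<noteq> {} \<and>
     (\<forall>\<sigma>\<in>\<Sigma>. rational_cone N \<sigma> \<and> strongly_convex \<sigma>) \<and>
     (\<forall>\<sigma>\<in>\<Sigma>. \<forall>\<tau>. cone_face \<tau> \<sigma> \<longrightarrow> \<tau> \<in> \<Sigma>) \<and>
     (\<forall>\<sigma>\<in>\<Sigma>. \<forall>\<sigma>'\<in>\<Sigma>. cone_face (\<sigma> \<inter> \<sigma>') \<sigma> \<and> cone_face (\<sigma> \<inter> \<sigma>') \<sigma>')"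

definition cones_of_dim :: "'v::real_vector set set \<Rightarrow> nat \<Rightarrow> 'v set set" where
  "cones_of_dim \<Sigma> k = {\<sigma>\<in>\<Sigma>. dim \<sigma> = k}"

definition facets :: "'v set set \<Rightarrow> 'v set set" where
  "facets \<Sigma> = {\<sigma>\<in>\<Sigma>. \<forall>\<eta>\<in>\<Sigma>. \<sigma> \<subseteq> \<eta> \<longrightarrow> \<eta> = \<sigma>}"

definition fan_dim :: "'v::real_vector set set \<Rightarrow> nat" where
  "fan_dim \<Sigma> = Max (dim ` \<Sigma>)"

definition cone_lattice :: "'v::real_vector set \<Rightarrow> 'v set \<Rightarrow> 'v set" where
  "cone_lattice N \<sigma> = N \<inter> span \<sigma>"

text \<open>
  For a codimension one face \<open>\<tau>\<close> of \<open>\<sigma>\<close>, the set \<open>\<sigma> + span \<tau>\<close> is the closed half-space of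
  \<open>span \<sigma>\<close> bounded by \<open>span \<tau>\<close> on the side of \<open>\<sigma>\<close>. The choice of the normal vector is
  immaterial: two choices differ by an element of \<open>cone_lattice N \<tau>\<close>.
\<close>

definition normal_vector :: "'v::real_vector set \<Rightarrow> 'v set \<Rightarrow> 'v set \<Rightarrow> 'v" where
  "normal_vector N \<sigma> \<tau> = (SOME n. n \<in> cone_lattice N \<sigma> \<and> n \<in> \<sigma> + span \<tau> \<and>
     cone_lattice N \<tau> + range (\<lambda>k::int. of_int k *\<^sub>R n) = cone_lattice N \<sigma>)"


section \<open>Tropical fans\<close>

definition minkowski_weight ::
    "'v::real_vector set \<Rightarrow> 'v set set \<Rightarrow> nat \<Rightarrow> ('v set \<Rightarrow> int) \<Rightarrow> bool" where
  "minkowski_weight N \<Sigma> p w \<longleftrightarrow> (\<forall>\<tau>\<in>\<Sigma>. dim \<tau> + 1 = p \<longrightarrow>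
     (\<Sum>\<sigma>\<in>{\<sigma>\<in>cones_of_dim \<Sigma> p. \<tau> \<subseteq> \<sigma>}.
        of_int (w \<sigma>) *\<^sub>R quot_map (span \<tau>) (normal_vector N \<sigma> \<tau>)) = 0)"

text \<open>Only the values of the orientation \<open>orient\<close> on facets are meaningful.\<close>

record 'v tfan =
  lat :: "'v set"
  cones :: "'v set set"
  orient :: "'v set \<Rightarrow> int"

definition tropical_fan :: "'v::real_vector tfan \<Rightarrow> bool" where
  "tropical_fan X \<longleftrightarrow>
     rational_fan (lat X) (cones X) \<and>
     (\<forall>\<sigma>\<in>facets (cones X). dim \<sigma> = fan_dim (cones X)) \<and>
     minkowski_weight (lat X) (cones X) (fan_dim (cones X)) (orient X) \<and>
     (\<forall>\<sigma>\<in>cones_of_dim (cones X) (fan_dim (cones X)). orient X \<sigma> \<noteq> 0)"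

definition support :: "'v tfan \<Rightarrow> 'v set" where
  "support X = \<Union>(cones X)"

text \<open>
  Only the lattice inside the span of the support matters for isomorphisms, and the two fans may
  live in different ambient spaces. A linear isomorphism between the spans of the supports is
  recorded by an arbitrary linear extension to the ambient space.
\<close>

definition trop_iso :: "'v::real_vector tfan \<Rightarrow> 'w::real_vector tfan \<Rightarrow> bool" where
  "trop_iso X Y \<longleftrightarrow> (\<exists>\<phi>. linear \<phi> \<and>
     bij_betw \<phi> (lat X \<inter> span (support X)) (lat Y \<inter> span (support Y)) \<and>
     cones Y = (\<lambda>\<sigma>. \<phi> ` \<sigma>) ` cones X \<and>
     (\<forall>\<sigma>\<in>facets (cones X). orient Y (\<phi> ` \<sigma>) = orient X \<sigma>))"

definition star_fan :: "'v::real_vector tfan \<Rightarrow> 'v set \<Rightarrow> 'v tfan" where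
  "star_fan X \<sigma> = (let p = quot_map (span \<sigma>) in
     \<lparr>lat = p ` lat X,
      cones = {p ` \<eta> | \<eta>. \<eta> \<in> cones X \<and> \<sigma> \<subseteq> \<eta>},
      orient = (\<lambda>C. orient X (THE \<eta>. \<eta> \<in> cones X \<and> \<sigma> \<subseteq> \<eta> \<and> C = p ` \<eta>))\<rparr>)"

definition product_fan :: "'v tfan \<Rightarrow> 'w tfan \<Rightarrow> ('v \<times> 'w) tfan" where
  "product_fan X Y =
     \<lparr>lat = lat X \<times> lat Y,
      cones = {\<sigma> \<times> \<sigma>' | \<sigma> \<sigma>'. \<sigma> \<in> cones X \<and> \<sigma>' \<in> cones Y},
      orient = (\<lambda>C. orient X (fst ` C) * orient Y (snd ` C))\<rparr>"


section \<open>Meromorphic functions, divisors and tropical modifications\<close>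

definition integral_form_on ::
    "'v::real_vector set \<Rightarrow> ('v \<Rightarrow> real) \<Rightarrow> 'v set \<Rightarrow> ('v \<Rightarrow> real) \<Rightarrow> bool" where
  "integral_form_on N f \<sigma> g \<longleftrightarrow>
     linear g \<and> g ` cone_lattice N \<sigma> \<subseteq> \<int> \<and> (\<forall>x\<in>\<sigma>. f x = g x)"

definition meromorphic_on :: "'v::real_normed_vector tfan \<Rightarrow> ('v \<Rightarrow> real) \<Rightarrow> bool" where
  "meromorphic_on X f \<longleftrightarrow>
     continuous_on (support X) f \<and> (\<forall>\<sigma>\<in>cones X. \<exists>g. integral_form_on (lat X) f \<sigma> g)"

text \<open>The form is unique as a function on \<open>span \<sigma>\<close>, the only place where it is evaluated.\<close>

definition form_on :: "'v::real_vector tfan \<Rightarrow> ('v \<Rightarrow> real) \<Rightarrow> 'v set \<Rightarrow> 'v \<Rightarrow> real" where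
  "form_on X f \<sigma> = (SOME g. integral_form_on (lat X) f \<sigma> g)"

text \<open>
  For a meromorphic \<open>f\<close> on a tropical fan the real number below is an integer, because
  the forms are integral and the argument of \<open>form_on X f \<tau>\<close> lies in \<open>cone_lattice (lat X) \<tau>\<close> by
  the balancing condition; \<^const>\<open>floor\<close> only changes its type.
\<close>

definition ord_fun :: "'v::real_vector tfan \<Rightarrow> ('v \<Rightarrow> real) \<Rightarrow> 'v set \<Rightarrow> int" where
  "ord_fun X f \<tau> =
     (let A = {\<sigma>\<in>cones_of_dim (cones X) (fan_dim (cones X)). \<tau> \<subseteq> \<sigma>} in
      \<lfloor>- (\<Sum>\<sigma>\<in>A. of_int (orient X \<sigma>) * form_on X f \<sigma> (normal_vector (lat X) \<sigma> \<tau>))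
       + form_on X f \<tau> (\<Sum>\<sigma>\<in>A. of_int (orient X \<sigma>) *\<^sub>R normal_vector (lat X) \<sigma> \<tau>)\<rfloor>)"

definition div_facets :: "'v::real_vector tfan \<Rightarrow> ('v \<Rightarrow> real) \<Rightarrow> 'v set set" where
  "div_facets X f = {\<tau>\<in>cones X. dim \<tau> + 1 = fan_dim (cones X) \<and> ord_fun X f \<tau> \<noteq> 0}"

definition div_trivial :: "'v::real_vector tfan \<Rightarrow> ('v \<Rightarrow> real) \<Rightarrow> bool" where
  "div_trivial X f \<longleftrightarrow> div_facets X f = {}"

definition div_fan :: "'v::real_vector tfan \<Rightarrow> ('v \<Rightarrow> real) \<Rightarrow> 'v tfan" where
  "div_fan X f =
     \<lparr>lat = lat X,
      cones = {\<delta>. \<exists>\<tau>\<in>div_facets X f. cone_face \<delta> \<tau>},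
      orient = ord_fun X f\<rparr>"

definition graph_cone :: "('v \<Rightarrow> real) \<Rightarrow> 'v set \<Rightarrow> ('v \<times> real) set" where
  "graph_cone f \<sigma> = (\<lambda>x. (x, f x)) ` \<sigma>"

definition up_cone :: "('v::real_vector \<Rightarrow> real) \<Rightarrow> 'v set \<Rightarrow> ('v \<times> real) set" where
  "up_cone f \<delta> = graph_cone f \<delta> + {0} \<times> {0..}"

text \<open>
  The first projection of a cone of the modification is the underlying cone of the original fan.
\<close>

definition tropical_modification ::
    "'v::real_vector tfan \<Rightarrow> ('v \<Rightarrow> real) \<Rightarrow> ('v \<times> real) tfan" where
  "tropical_modification X f =
     \<lparr>lat = lat X \<times> \<int>,
      cones = graph_cone f ` cones X \<union> up_cone f ` cones (div_fan X f),
      orient = (\<lambda>C. if C \<in> graph_cone f ` cones X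
                    then orient X (fst ` C) else ord_fun X f (fst ` C))\<rparr>"


section \<open>Blow-ups\<close>

definition rational_ray :: "'v::real_vector set \<Rightarrow> 'v set \<Rightarrow> bool" where
  "rational_ray N \<rho> \<longleftrightarrow> (\<exists>v\<in>N. v \<noteq> 0 \<and> \<rho> = convex_cone hull {v})"

definition blow_up :: "'v::real_vector tfan \<Rightarrow> 'v set \<Rightarrow> 'v set \<Rightarrow> 'v tfan" where
  "blow_up X \<sigma> \<rho> =
     \<lparr>lat = lat X,
      cones = {\<eta>\<in>cones X. \<not> \<sigma> \<subseteq> \<eta>} \<union>
              {\<tau> + \<rho> | \<tau> \<eta>. \<eta> \<in> cones X \<and> \<sigma> \<subseteq> \<eta> \<and> cone_face \<tau> \<eta> \<and> \<not> \<sigma> \<subseteq> \<tau>},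
      orient = (\<lambda>C. orient X (THE \<eta>. \<eta> \<in> facets (cones X) \<and> C \<subseteq> \<eta>))\<rparr>"


section \<open>Quasilinear fans\<close>

text \<open>
  Every tropical fan is isomorphic to one in the space of finitely supported real
  sequences. A class of tropical fans, taken up to isomorphism, is therefore given by an
  isomorphism-closed set of tropical fans in that space, and a tropical fan in an arbitrary ambient
  space belongs to the class if it is isomorphic to an element of this set.
\<close>

type_synonym universe = "nat \<Rightarrow>\<^sub>0 real"

definition in_class :: "'v::real_vector tfan \<Rightarrow> universe tfan set \<Rightarrow> bool" where
  "in_class X \<S> \<longleftrightarrow> (\<exists>Y\<in>\<S>. trop_iso X Y)"

definition tropical_class :: "universe tfan set \<Rightarrow> bool" where
  "tropical_class \<S> \<longleftrightarrow> (\<forall>X\<in>\<S>. tropical_fan X) \<and>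
     (\<forall>X\<in>\<S>. \<forall>Y. tropical_fan Y \<and> trop_iso X Y \<longrightarrow> Y \<in> \<S>)"

text \<open>A ray in the relative interior of a cone lies there except for its apex.\<close>

definition T_stable :: "universe tfan set \<Rightarrow> bool" where
  "T_stable \<S> \<longleftrightarrow> tropical_class \<S> \<and>
     (\<forall>X\<in>\<S>. \<forall>Y\<in>\<S>. in_class (product_fan X Y) \<S>) \<and>
     (\<forall>X\<in>\<S>. \<forall>f. meromorphic_on X f \<and> (div_trivial X f \<or> in_class (div_fan X f) \<S>)
        \<longrightarrow> in_class (tropical_modification X f) \<S>) \<and>
     (\<forall>X :: universe tfan. tropical_fan X \<longrightarrow>
        (\<forall>\<sigma>\<in>cones X. \<forall>\<rho>. rational_ray (lat X) \<rho> \<and> \<rho> - {0} \<subseteq> rel_interior \<sigma> \<and>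
           in_class (star_fan X \<sigma>) \<S>
           \<longrightarrow> (in_class X \<S> \<longleftrightarrow> in_class (blow_up X \<sigma> \<rho>) \<S>)))"

definition point_fan :: "int \<Rightarrow> real tfan" where
  "point_fan n = \<lparr>lat = {0}, cones = {{0}}, orient = (\<lambda>_. n)\<rparr>"

definition line_fan :: "real tfan" where
  "line_fan = \<lparr>lat = \<int>, cones = {{0}, {0..}, {..0}}, orient = (\<lambda>_. 1)\<rparr>"

definition contains_base :: "universe tfan set \<Rightarrow> bool" where
  "contains_base \<S> \<longleftrightarrow> (\<forall>n. n \<noteq> 0 \<longrightarrow> in_class (point_fan n) \<S>) \<and> in_class line_fan \<S>"

definition quasilinear_class :: "universe tfan set" where
  "quasilinear_class = \<Inter>{\<S>. T_stable \<S> \<and> contains_base \<S>}"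

definition quasilinear :: "'v::real_vector tfan \<Rightarrow> bool" where
  "quasilinear X \<longleftrightarrow> tropical_fan X \<and> in_class X quasilinear_class"


section \<open>Matroids and Bergman fans\<close>

definition matroid :: "'a set \<Rightarrow> ('a set \<Rightarrow> bool) \<Rightarrow> bool" where
  "matroid E indep \<longleftrightarrow> finite E \<and> (\<forall>I. indep I \<longrightarrow> I \<subseteq> E) \<and> indep {} \<and>
     (\<forall>I J. indep J \<and> I \<subseteq> J \<longrightarrow> indep I) \<and>
     (\<forall>I J. indep I \<and> indep J \<and> card I < card J \<longrightarrow> (\<exists>x\<in>J - I. indep (insert x I)))"

definition simple_matroid :: "'a set \<Rightarrow> ('a set \<Rightarrow> bool) \<Rightarrow> bool" where
  "simple_matroid E indep \<longleftrightarrow> matroid E indep \<and>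
     (\<forall>i\<in>E. indep {i}) \<and> (\<forall>i\<in>E. \<forall>j\<in>E. i \<noteq> j \<longrightarrow> indep {i, j})"

definition mrank :: "('a set \<Rightarrow> bool) \<Rightarrow> 'a set \<Rightarrow> nat" where
  "mrank indep A = Max (card ` {I. I \<subseteq> A \<and> indep I})"

definition flat :: "'a set \<Rightarrow> ('a set \<Rightarrow> bool) \<Rightarrow> 'a set \<Rightarrow> bool" where
  "flat E indep F \<longleftrightarrow> F \<subseteq> E \<and> (\<forall>x\<in>E - F. mrank indep F < mrank indep (insert x F))"

definition proper_flats :: "'a set \<Rightarrow> ('a set \<Rightarrow> bool) \<Rightarrow> 'a set set" where
  "proper_flats E indep = {F. flat E indep F \<and> F \<noteq> E}"

text \<open>
  The coordinate space on \<open>E\<close> is the space of finitely supported functions on the type of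
  elements which vanish outside \<open>E\<close>.
\<close>

definition evec :: "'a set \<Rightarrow> 'a \<Rightarrow>\<^sub>0 real" where
  "evec A = (\<Sum>i\<in>A. Poly_Mapping.single i 1)"

definition int_lattice :: "'a set \<Rightarrow> ('a \<Rightarrow>\<^sub>0 real) set" where
  "int_lattice E = {v. Poly_Mapping.keys v \<subseteq> E \<and> (\<forall>i. Poly_Mapping.lookup v i \<in> \<int>)}"

definition bergman_lattice :: "'a set \<Rightarrow> ('a \<Rightarrow>\<^sub>0 real) set" where
  "bergman_lattice E = quot_map (span {evec E}) ` int_lattice E"

definition bergman_fan :: "'a set \<Rightarrow> ('a set \<Rightarrow> bool) \<Rightarrow> ('a \<Rightarrow>\<^sub>0 real) tfan" where
  "bergman_fan E indep =
     \<lparr>lat = bergman_lattice E,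
      cones = {convex_cone hull ((\<lambda>F. quot_map (span {evec E}) (evec F)) ` \<F>) | \<F>.
                 subset.chain (proper_flats E indep - {{}}) \<F>},
      orient = (\<lambda>_. 1)\<rparr>"

definition augmented_bergman_fan ::
    "'a set \<Rightarrow> ('a set \<Rightarrow> bool) \<Rightarrow> ('a \<Rightarrow>\<^sub>0 real) tfan" where
  "augmented_bergman_fan E indep =
     \<lparr>lat = int_lattice E,
      cones = {convex_cone hull ((\<lambda>i. evec {i}) ` I \<union> (\<lambda>F. - evec (E - F)) ` \<F>) | I \<F>.
                 indep I \<and> subset.chain (proper_flats E indep) \<F> \<and> (\<forall>F\<in>\<F>. I \<subseteq> F)},
      orient = (\<lambda>_. 1)\<rparr>"

definition generalized_bergman_fan ::
    "'a set \<Rightarrow> ('a set \<Rightarrow> bool) \<Rightarrow> 'v::real_vector tfan \<Rightarrow> bool" where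
  "generalized_bergman_fan E indep X \<longleftrightarrow> rational_fan (lat X) (cones X) \<and>
     (\<exists>\<Sigma>. rational_fan (bergman_lattice E) \<Sigma> \<and> \<Union>\<Sigma> = support (bergman_fan E indep) \<and>
        trop_iso \<lparr>lat = bergman_lattice E, cones = \<Sigma>, orient = (\<lambda>_. 1)\<rparr> X)"

end

theory Submission
 imports Defs
begin

text \<open>
 Subdividing along hyperplanes relates any two fans of the same support through blow-ups at rays, and
 these preserve membership in a \<open>\<T>\<close>-stable class once it is known for the stars. The proof therefore
 works with supports and uses induction on the dimension of the lattice. Call a support matroidal if it
 is the image of a tropical linear space \<open>P\<close> (all superlevel sets are flats) modulo invariant directions.
 Stars of fans with matroidal support are again such fans, by passing to initial matroids. Unless \<open>P\<close> is a
 linear space, and hence supports a product of lines, some coordinate \<open>i\<close> can be forgotten: \<open>P\<close> is then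
 the graph of a piecewise linear function on the support of the deletion of \<open>i\<close>, completed upwards
 over the support of the contraction, that is, a tropical modification along the contraction. Finally
 Bergman fans are of this kind because a vector is the combination of its level sets, and augmented Bergman fans because they are Bergman fans
 of the free coextension.
\<close>

text \<open>Stars have more invariant directions than the all-ones vector, hence supports modulo
  arbitrary kernels of invariant directions. On such a quotient single coordinates make no sense;
  only differences inside a separator survive. This is why the modifying function uses circuits
  inside one block and is normalised at a second element of it. Balancing is read off from the
  support: near a codimension one cone the support is the tropical space of an initial matroid,
  modulo the span of the cone a union of rays. Unless these form a line, they are spanned by the
  indicator vectors of parallel classes, whose total sum is the invariant all-ones vector. The
  divisor is not computed from its definition either: the modified fan is balanced because of its
  support, and its balancing at the graph of a codimension one cone determines the order there. The
  induction runs over the dimension of the lattice because stars of nonzero cones, deletions and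
  contractions live in proper quotients of it.\<close>

type_synonym 'a fvec = "'a \<Rightarrow>\<^sub>0 real"

abbreviation lookup :: "('a \<Rightarrow>\<^sub>0 'b::zero) => 'a => 'b" where "lookup == Poly_Mapping.lookup"

abbreviation scaleR_infix :: "real => 'a::real_vector => 'a" (infixr "*R" 75) where "scaleR_infix == scaleR"

abbreviation iff_infix :: "bool => bool => bool" (infixr "<->" 25) where "A <-> B == A = B"

section \<open>Lattices and linear algebra\<close>

definition int_span :: "'v::real_vector set => 'v set" where
 "int_span B = range (%c. \<Sum>b\<in>B. of_int (c b) *R b)"

lemma is_lattice_iff: "is_lattice N <-> (EX B. finite B & independent B & N = int_span B)"
 unfolding is_lattice_def int_span_def ..

definition add_subgroup :: "'v::real_vector set => bool" where
 "add_subgroup G <-> 0:G & (ALL x:G. ALL y:G. x - y:G)"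

lemma add_subgroup_0: "add_subgroup G ==> 0:G"
 by (simp add: add_subgroup_def)

lemma add_subgroup_diff: "add_subgroup G ==> x:G ==> y:G ==> x - y:G"
 by (simp add: add_subgroup_def)

lemma add_subgroup_uminus: "add_subgroup G ==> x:G ==> - x:G"
 using add_subgroup_diff[of G 0 x] add_subgroup_0 by auto

lemma add_subgroup_add: "add_subgroup G ==> x:G ==> y:G ==> x + y:G"
 using add_subgroup_diff[of G x "-y"] add_subgroup_uminus by auto

lemma add_subgroup_scale:
 assumes "add_subgroup G" "x:G" shows "of_int k *R x:G"
proof -
 have *: "of_nat n *R x:G" for n
 proof (induction n)
  case 0 thus ?case using add_subgroup_0[OF assms(1)] by simp
 next
  case (Suc n)
  thus ?case using add_subgroup_add[OF assms(1) assms(2) Suc] by (simp add: algebra_simps)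
 qed
 show ?thesis
 proof (cases "k >= 0")
  case True thus ?thesis using *[of "nat k"] by simp
 next
  case False
  thus ?thesis using add_subgroup_uminus[OF assms(1) *[of "nat (-k)"]] by simp
 qed
qed

lemma add_subgroup_sum:
 assumes "add_subgroup G" "!!i. i:I ==> f i:G" shows "sum f I:G"
 using assms(2)
 by (induction I rule: infinite_finite_induct)
   (auto intro: add_subgroup_add[OF assms(1)] add_subgroup_0[OF assms(1)])

lemma add_subgroup_Int: "add_subgroup G ==> add_subgroup H ==> add_subgroup (G Int H)"
 by (simp add: add_subgroup_def)

lemma add_subgroup_subspace: "subspace W ==> add_subgroup W"
 by (simp add: add_subgroup_def subspace_0 subspace_diff)

lemma add_subgroup_linear_image:
 assumes "linear f" "add_subgroup G" shows "add_subgroup (f ` G)"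
 unfolding add_subgroup_def
proof safe
 show "0:f ` G" using add_subgroup_0[OF assms(2)] linear_0[OF assms(1)] by force
 fix x y assume "x:G" "y:G"
 thus "f x - f y:f ` G"
  using add_subgroup_diff[OF assms(2)] by (metis assms(1) image_eqI linear_diff)
qed

lemma add_subgroup_int_span: "add_subgroup (int_span B)"
 unfolding add_subgroup_def int_span_def
proof safe
 show "0:range (%c. \<Sum>b\<in>B. of_int (c b) *R b)"
  by (rule range_eqI[of _ _ "%_. 0"]) simp
 fix c d :: "'a => int"
 show "(\<Sum>b\<in>B. of_int (c b) *R b) - (\<Sum>b\<in>B. of_int (d b) *R b):range (%c. \<Sum>b\<in>B. of_int (c b) *R b)"
  by (rule range_eqI[of _ _ "%b. c b - d b"]) (simp add: sum_subtractf algebra_simps)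
qed

lemma int_span_base: "finite B ==> b:B ==> b:int_span B"
 unfolding int_span_def
 by (rule range_eqI[of _ _ "%x. if x = b then 1 else 0"])
   (simp add: if_distrib[of real_of_int] if_distrib[of "%r. r *R _"] cong: if_cong)

lemma int_span_minimal: "add_subgroup G ==> B <= G ==> int_span B <= G"
 unfolding int_span_def by (auto intro!: add_subgroup_sum add_subgroup_scale)

lemma int_span_subset_span: "int_span B <= span B"
 by (rule int_span_minimal) (auto simp: add_subgroup_subspace span_base)

lemma span_int_span: "finite B ==> span (int_span B) = span B"
proof
 show "span (int_span B) <= span B" by (rule span_minimal[OF int_span_subset_span subspace_span])
 assume "finite B"
 thus "span B <= span (int_span B)" by (intro span_mono) (auto simp: int_span_base)
qed

lemma int_span_insert:
 assumes "finite B" "b~:B"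
 shows "int_span (insert b B) = {of_int k *R b + y | k y. y:int_span B}"
proof safe
 fix x assume "x:int_span (insert b B)"
 then obtain c where "x = (\<Sum>b\<in>insert b B. of_int (c b) *R b)" unfolding int_span_def by auto
 hence "x = of_int (c b) *R b + (\<Sum>b\<in>B. of_int (c b) *R b)" using assms by simp
 thus "EX k y. x = real_of_int k *R b + y & y:int_span B" unfolding int_span_def by blast
next
 fix k y assume "y:int_span B"
 moreover have "int_span B <= int_span (insert b B)"
  using assms by (intro int_span_minimal add_subgroup_int_span) (auto intro: int_span_base)
 ultimately show "of_int k *R b + y:int_span (insert b B)"
  using assms by (intro add_subgroup_add add_subgroup_scale add_subgroup_int_span) (auto intro: int_span_base)
qed

text \<open>Induction on the basis: the coefficients at \<open>b\<close> of elements of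
  \<open>G\<close> form a subgroup of the integers, hence the multiples of a least positive
  \<open>m\<close> unless all vanish. An element \<open>g\<close> of \<open>G\<close> with
  coefficient \<open>m\<close>, added to a basis of the part of \<open>G\<close> without
  \<open>b\<close>, gives a basis of \<open>G\<close>.\<close>

lemma sublattice_int_span:
 assumes "finite B" "independent B" "add_subgroup G" "G <= int_span B"
 shows "is_lattice G"
 using assms
proof (induction B arbitrary: G rule: finite_induct)
 case empty
 hence "G = {0}" using add_subgroup_0 by (auto simp: int_span_def)
 thus ?case unfolding is_lattice_iff by (intro exI[of _ "{}"]) (auto simp: int_span_def independent_empty)
next
 case (insert b B)
 have ind: "independent B" and b: "b~:span B"
  using insert.prems(1) insert.hyps by (auto simp: independent_insert)
 define G0 where "G0 = G Int int_span B"
 have sG0: "add_subgroup G0" unfolding G0_def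
  by (rule add_subgroup_Int[OF insert.prems(2) add_subgroup_int_span])
 obtain C where C: "finite C" "independent C" "G0 = int_span C"
  using insert.IH[OF ind sG0] by (auto simp: G0_def is_lattice_iff)
 define M where "M = {k. EX y:int_span B. of_int k *R b + y:G}"
 have dec: "EX k:M. EX y:int_span B. x = of_int k *R b + y" if "x:G" for x
 proof -
  obtain k y where ky: "x = of_int k *R b + y" "y:int_span B"
   using subsetD[OF insert.prems(3) \<open>x:G\<close>] unfolding int_span_insert[OF insert.hyps(1,2)] by blast
  hence "k:M" using that unfolding M_def by blast
  thus ?thesis using ky by blast
 qed
 show ?case
 proof (cases "M <= {0}")
  case True
  hence "G = G0" using dec unfolding G0_def by fastforce
  thus ?thesis using C unfolding is_lattice_iff by blast
 next
  case False
  have Mm: "a - q * c:M" if ac: "a:M" "c:M" for a c q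
  proof -
   obtain y z where y: "y:int_span B" "of_int a *R b + y:G" and z: "z:int_span B" "of_int c *R b + z:G"
    using ac unfolding M_def by blast
   have "(of_int a *R b + y) - of_int q *R (of_int c *R b + z):G"
    using insert.prems(2) y z by (intro add_subgroup_diff add_subgroup_scale)
   moreover have "(of_int a *R b + y) - of_int q *R (of_int c *R b + z)
     = of_int (a - q * c) *R b + (y - of_int q *R z)"
    by (simp add: algebra_simps)
   moreover have "y - of_int q *R z:int_span B"
    using y z by (intro add_subgroup_diff add_subgroup_scale add_subgroup_int_span)
   ultimately show ?thesis unfolding M_def by (metis (mono_tags, lifting) mem_Collect_eq)
  qed
  from False obtain k where k: "k:M" "k ~= 0" by auto
  have "0:M" using Mm[OF k(1) k(1), of 1] by simp
  hence "-k:M" using Mm[OF _ k(1), of 0 1] by simp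
  hence "EX n>0. int n:M" using k
   by (intro exI[of _ "nat \<bar>k\<bar>"]) (auto simp: abs_if)
  then obtain m where m: "m > 0" "int m:M" and least: "!!j. j < m ==> ~ (j > 0 & int j:M)"
   using exists_least_iff[of "%n. n > 0 & int n:M"] by blast
  have dvd: "int m dvd a" if "a:M" for a
  proof -
   have "a mod int m:M" using Mm[OF that m(2), of "a div int m"] by (simp add: minus_div_mult_eq_mod)
   hence "~ nat (a mod int m) > 0" using least[of "nat (a mod int m)"] m
    by (auto simp: nat_less_iff)
   hence "~ a mod int m > 0" by simp
   hence "a mod int m = 0" using m(1) pos_mod_sign[of "int m" a] by linarith
   thus ?thesis by auto
  qed
  obtain y where y: "y:int_span B" "of_int (int m) *R b + y:G" using m unfolding M_def by blast
  define g where "g = of_int (int m) *R b + y"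
  have "C <= int_span B" using C int_span_base[OF C(1)] unfolding G0_def by blast
  hence CB: "span C <= span B" using int_span_subset_span by (metis order_trans span_minimal subspace_span)
  have gC: "g~:span C"
  proof
   assume "g:span C"
   hence "g - y:span B" using CB y int_span_subset_span by (meson span_diff subsetD)
   hence "(1 / of_nat m) *R (g - y):span B" by (rule span_scale)
   moreover have "(1 / of_nat m) *R (g - y) = b" 
   proof -
    have "(1 / of_nat m) * of_int (int m) = (1::real)" using m(1) by simp
    thus ?thesis unfolding g_def by (simp only: add_diff_cancel_right' scaleR_scaleR scaleR_one)
   qed
   ultimately show False using b by metis
  qed
  have "C <= G" using C int_span_base[OF C(1)] unfolding G0_def by blast
  have "G = int_span (insert g C)"
  proof
   show "int_span (insert g C) <= G"
    using y insert.prems(2) \<open>C <= G\<close> by (intro int_span_minimal) (auto simp: g_def)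
   show "G <= int_span (insert g C)"
   proof
    fix x assume x: "x:G"
    obtain a z where a: "a:M" "z:int_span B" "x = of_int a *R b + z" using dec[OF x] by blast
    obtain q where q: "a = int m * q" using dvd[OF a(1)] by (auto elim: dvdE)
    have "x - of_int q *R g = z - of_int q *R y" unfolding a g_def q by (simp add: algebra_simps)
    moreover have "x - of_int q *R g:G"
     using x y insert.prems(2) unfolding g_def by (intro add_subgroup_diff add_subgroup_scale)
    moreover have "z - of_int q *R y:int_span B"
     using y a by (intro add_subgroup_diff add_subgroup_scale add_subgroup_int_span)
    ultimately have "x - of_int q *R g:int_span C" using C(3) unfolding G0_def by (metis IntI)
    hence "x - of_int q *R g:int_span (insert g C)"
     using int_span_minimal[OF add_subgroup_int_span, of C "insert g C"] C int_span_base[of "insert g C"] by blast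
    hence "(x - of_int q *R g) + of_int q *R g:int_span (insert g C)"
     using C by (intro add_subgroup_add add_subgroup_scale add_subgroup_int_span) (auto intro: int_span_base)
    thus "x:int_span (insert g C)" by simp
   qed
  qed
  moreover have "independent (insert g C)" using gC C by (simp add: independent_insertI)
  ultimately show ?thesis using C unfolding is_lattice_iff by blast
 qed
qed

lemma is_lattice_add_subgroup: "is_lattice N ==> add_subgroup N"
 unfolding is_lattice_iff using add_subgroup_int_span by blast

lemma sublattice: "is_lattice N ==> add_subgroup G ==> G <= N ==> is_lattice G"
 using sublattice_int_span unfolding is_lattice_iff[of N] by blast

lemma is_lattice_Int_subspace: "is_lattice N ==> subspace W ==> is_lattice (N Int W)"
 by (rule sublattice) (auto intro: add_subgroup_Int is_lattice_add_subgroup add_subgroup_subspace)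

section \<open>Dimension arguments for finite-dimensional subsets of an arbitrary real vector
  space\<close>

definition fin_dim :: "'v::real_vector set => bool" where
 "fin_dim W <-> (EX B. finite B & W <= span B)"

lemma fin_dim_subset: "fin_dim W ==> V <= W ==> fin_dim V"
 unfolding fin_dim_def by blast

lemma fin_dim_span: "fin_dim W ==> fin_dim (span W)"
 unfolding fin_dim_def by (meson span_minimal subspace_span)

lemma fin_dim_lattice: "is_lattice N ==> fin_dim N"
 unfolding is_lattice_iff fin_dim_def using int_span_subset_span by blast

lemma fin_dim_indep_finite: "fin_dim W ==> independent A ==> A <= W ==> finite A"
 unfolding fin_dim_def using independent_span_bound by blast

lemma fin_dim_basis:
 assumes "fin_dim W" "A <= W" "independent A"
 obtains B where "finite B" "A <= B" "B <= W" "independent B" "span B = span W" "card B = dim W"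
proof -
 obtain B where B: "A <= B" "B <= W" "independent B" "W <= span B"
  using maximal_independent_subset_extend[OF assms(2,3)] by blast
 moreover have "finite B" using fin_dim_indep_finite[OF assms(1)] B by blast
 moreover have "span B = span W" using B by (metis span_mono span_span subset_antisym)
 ultimately show ?thesis using that basis_card_eq_dim by blast
qed

lemma fin_dim_basis0:
 assumes "fin_dim W"
 obtains B where "finite B" "B <= W" "independent B" "span B = span W" "card B = dim W"
 using fin_dim_basis[OF assms empty_subsetI independent_empty] by metis

text \<open>Finiteness of \<open>T\<close> matters: an infinite-dimensional set has
  \<open>dim\<close> equal to 0.\<close>

lemma fin_dim_dim_mono:
 assumes "fin_dim T" "S <= span T" shows "dim S <= dim T"
proof -
 obtain B where B: "finite B" "B <= T" "independent B" "span B = span T" "card B = dim T"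
  using fin_dim_basis0[OF assms(1)] .
 thus ?thesis using dim_le_card[of S B] assms(2) by simp
qed

lemma fin_dim_span_eq:
 assumes "fin_dim T" "S <= span T" "dim T <= dim S" shows "span S = span T"
proof -
 have S: "fin_dim S" using assms fin_dim_span fin_dim_subset by blast
 obtain A where A: "finite A" "A <= S" "independent A" "span A = span S" "card A = dim S"
  using fin_dim_basis0[OF S] .
 obtain B where B: "finite B" "A <= B" "B <= span T" "independent B" "span B = span (span T)" "card B = dim (span T)"
  using fin_dim_basis[OF fin_dim_span[OF assms(1)], of A] A assms(2) by (metis subset_trans)
 have "card B <= card A" using A B assms by simp
 hence "A = B" using B by (simp add: card_seteq)
 hence "span A = span T" using B by simp
 thus ?thesis using A by simp
qed

lemma dim_insert_notin:
 assumes "fin_dim S" "x~:span S" shows "dim (insert x S) = Suc (dim S)"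
proof -
 obtain B where B: "finite B" "B <= S" "independent B" "span B = span S" "card B = dim S"
  using fin_dim_basis0[OF assms(1)] .
 have "x~:B" using B assms span_superset by blast
 have "dim (insert x S) = card (insert x B)"
 proof (rule dim_unique)
  show "insert x B <= insert x S" using B by blast
  show "insert x S <= span (insert x B)" using B
   by (metis insert_subset span_base span_mono span_superset insertI1 subset_insertI subset_trans)
  show "independent (insert x B)" using B assms by (simp add: independent_insertI)
 qed simp
 thus ?thesis using B \<open>x~:B\<close> by simp
qed

lemma dual_coordinates:
 fixes B :: "'v::real_vector set"
 assumes "finite B" "independent B"
 obtains d :: "'v => 'v => real" where "ALL b. linear (d b)"
  "ALL b:B. ALL b':B. d b b' = (if b = b' then 1 else 0)"
  "ALL x:span B. (\<Sum>b\<in>B. d b x *R b) = x"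
  "ALL b:B. ALL x:int_span B. d b x:\<int>"
proof -
 have "ALL b. EX f::'v => real. linear f & (ALL x:B. f x = (if b = x then 1 else 0))"
  using linear_independent_extend[OF assms(2)] by (intro allI)
 then obtain d :: "'v => 'v => real" where d: "!!b. linear (d b)" "!!b x. x:B ==> d b x = (if b = x then 1 else 0)"
  by metis
 have ex: "(\<Sum>b\<in>B. d b x *R b) = x" if "x:span B" for x
 proof (rule linear_eq_on[where f = "%x. \<Sum>b\<in>B. d b x *R b" and g = "%x. x", OF _ _ that])
  show "linear (%x. \<Sum>b\<in>B. d b x *R b)"
   by (rule linearI) (simp_all add: linear_add[OF d(1)] linear_scale[OF d(1)] scaleR_left_distrib sum.distrib scaleR_sum_right)
  show "linear (%x::'v. x)" by (rule linear_ident)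
  fix x assume "x:B"
  thus "(\<Sum>b\<in>B. d b x *R b) = x"
   using assms(1) by (simp add: d(2) if_distrib[of "%r. r *R _"] cong: if_cong)
 qed
 have int: "d b x:\<int>" if x: "x:int_span B" and b: "b:B" for b x
 proof -
  obtain c where "x = (\<Sum>b\<in>B. of_int (c b) *R b)" using x unfolding int_span_def by auto
  hence "d b x = (\<Sum>b'\<in>B. of_int (c b') * d b b')" by (simp add: linear_sum[OF d(1)] linear_scale[OF d(1)])
  also have "... = of_int (c b)" using assms(1) b by (simp add: d(2) if_distrib[of "%r. _ * r"] cong: if_cong)
  finally show ?thesis by simp
 qed
 show ?thesis by (rule that[of d]) (use d ex int in auto)
qed

lemma lattice_dual:
 fixes N :: "'v::real_vector set"
 assumes "is_lattice N"
 obtains D :: "('v => real) set" where "finite D" "!!h. h:D ==> linear h" "!!h x. h:D ==> x:N ==> h x:\<int>"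
  "!!x. x:span N ==> (ALL h:D. h x = 0) ==> x = 0"
  "!!x. x:span N ==> (ALL h:D. h x:\<int>) ==> x:N"
proof -
 obtain B where B: "finite B" "independent B" "N = int_span B" using assms by (auto simp: is_lattice_iff)
 obtain d :: "'v => 'v => real" where d: "ALL b. linear (d b)"
  "ALL b:B. ALL b':B. d b b' = (if b = b' then 1 else 0)"
  "ALL x:span B. (\<Sum>b\<in>B. d b x *R b) = x"
  "ALL b:B. ALL x:int_span B. d b x:\<int>"
  using dual_coordinates[OF B(1,2)] .
 have sp: "span N = span B" using B span_int_span by blast
 show ?thesis
 proof (rule that[of "d ` B"])
  fix x assume x: "x:span N" "ALL h:d ` B. h x = 0"
  moreover have "(\<Sum>b\<in>B. d b x *R b) = x" using d(3) x(1) sp by blast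
  ultimately show "x = 0" by simp
 next
  fix x assume x: "x:span N" "ALL h:d ` B. h x:\<int>"
  have "x = (\<Sum>b\<in>B. d b x *R b)" using d(3) x sp by simp
  also have "... = (\<Sum>b\<in>B. of_int \<lfloor>d b x\<rfloor> *R b)" using x by (intro sum.cong) auto
  also have "...:N" unfolding B int_span_def by (rule range_eqI[OF refl])
  finally show "x:N" .
 qed (use B d in auto)
qed

lemma independent_disjoint_span:
 assumes "independent B" "A <= B" "x:span A" "x:span (B - A)" shows "x = 0"
proof -
 obtain g where g: "linear g" "ALL b:B. g b = (if b:A then b else 0)"
  using linear_independent_extend[OF assms(1), of "%b. if b:A then b else 0"] by blast
 have "g x = x" by (rule linear_eq_on[OF g(1) linear_ident assms(3)]) (use g assms in auto)
 moreover have "g x = 0" by (rule linear_eq_0_on_span[OF g(1) _ assms(4)]) (use g in auto)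
 ultimately show ?thesis by simp
qed

text \<open>A basis of the kernel is extended to one of \<open>W\<close>; the added vectors
  \<open>B - A\<close> span a complement on which \<open>q\<close> is injective. This replaces
  quotient spaces in \<open>rank_nullity\<close> and \<open>factor_through\<close>.\<close>

lemma kernel_complement:
 assumes "linear q" "subspace W" "fin_dim W"
 obtains A B where "finite B" "A <= B" "independent B" "span B = W" "span A = {z:W. q z = 0}"
  "inj_on q (span (B - A))"
proof -
 define K where "K = {z:W. q z = 0}"
 have sK: "subspace K" unfolding K_def using assms(1,2)
  by (auto simp: subspace_def linear_0 linear_add linear_scale)
 have "K <= W" by (auto simp: K_def)
 obtain A where A: "finite A" "A <= K" "independent A" "span A = span K" "card A = dim K"
  using fin_dim_basis0[OF fin_dim_subset[OF assms(3) \<open>K <= W\<close>]] .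
 obtain B where B: "finite B" "A <= B" "B <= W" "independent B" "span B = span W" "card B = dim W"
  using fin_dim_basis[OF assms(3), of A] A \<open>K <= W\<close> by blast
 have AK: "span A = K" using A sK by (simp add: span_eq_iff)
 have BW: "span B = W" using B assms(2) by (metis span_eq_iff)
 have inj: "inj_on q (span (B - A))"
 proof (rule inj_onI)
  fix x y assume xy: "x:span (B - A)" "y:span (B - A)" "q x = q y"
  have d: "x - y:span (B - A)" using xy by (simp add: span_diff)
  hence "x - y:W" using BW span_mono[of "B - A" B] by blast
  hence "x - y:span A" using xy AK by (simp add: K_def linear_diff[OF assms(1)])
  hence "x - y = 0" by (rule independent_disjoint_span[OF B(4) B(2) _ d])
  thus "x = y" by simp
 qed
 show ?thesis using that[OF B(1,2,4) BW _ inj] AK unfolding K_def by blast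
qed

lemma image_kernel_complement:
 assumes "linear q" "span A = {z:span B. q z = 0}" "A <= B" "x:span B"
 obtains y where "y:span (B - A)" "q y = q x"
proof -
 have "x:span (A Un (B - A))" using assms by (simp add: Un_absorb1)
 then obtain a y where "x = a + y" "a:span A" "y:span (B - A)" unfolding span_Un by blast
 thus ?thesis using that[of y] assms(1,2) by (simp add: linear_add)
qed

lemma rank_nullity:
 assumes "linear q" "subspace W" "fin_dim W"
 shows "dim (q ` W) + dim {z:W. q z = 0} = dim W"
proof -
 obtain A B where AB: "finite B" "A <= B" "independent B" "span B = W" "span A = {z:W. q z = 0}"
  "inj_on q (span (B - A))" using kernel_complement[OF assms] .
 have iA: "independent A" "independent (B - A)" using AB independent_mono by blast+
 have "q ` W = span (q ` (B - A))"
 proof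
  show "q ` W <= span (q ` (B - A))"
  proof safe
   fix x assume "x:W"
   then obtain y where "y:span (B - A)" "q y = q x"
    using image_kernel_complement[of q A B x] assms AB by auto
   thus "q x:span (q ` (B - A))" using linear_span_image[OF assms(1)] by (metis imageI)
  qed
  show "span (q ` (B - A)) <= q ` W"
   using AB span_mono[of "B - A" B] linear_span_image[OF assms(1)] by blast
 qed
 moreover have "independent (q ` (B - A))"
  using linear_independent_injective_image[OF assms(1) iA(2)] AB by blast
 moreover have "card (q ` (B - A)) = card (B - A)"
  using card_image inj_on_subset[OF AB(6) span_superset] by blast
 ultimately have "dim (q ` W) = card (B - A)" using dim_span_eq_card_independent by metis
 moreover have "dim {z:W. q z = 0} = card A" using AB iA dim_span_eq_card_independent by metis
 moreover have "dim W = card B" using AB dim_span_eq_card_independent by metis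
 ultimately show ?thesis using AB by (simp add: card_Diff_subset finite_subset card_mono)
qed

text \<open>\<open>g\<close> inverts \<open>q\<close> on a complement of the kernel and is extended
  arbitrarily. Coordinate differences will descend to quotients of the coordinate space in this
  way.\<close>

lemma factor_through:
 assumes "linear q" "subspace W" "fin_dim W" "linear ph" "!!x. x:W ==> q x = 0 ==> ph x = 0"
 obtains g where "linear g" "!!x. x:W ==> g (q x) = ph x"
proof -
 obtain A B where AB: "finite B" "A <= B" "independent B" "span B = W" "span A = {z:W. q z = 0}"
  "inj_on q (span (B - A))" using kernel_complement[OF assms(1-3)] .
 have ind: "independent (q ` (B - A))"
  using linear_independent_injective_image[OF assms(1) independent_mono[OF AB(3)]] AB by blast
 have inj: "inj_on q (B - A)" using inj_on_subset[OF AB(6) span_superset] .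
 obtain g where g: "linear g" "ALL y:q ` (B - A). g y = ph (the_inv_into (B - A) q y)"
  using linear_independent_extend[OF ind, of "%y. ph (the_inv_into (B - A) q y)"] by blast
 have gq: "g (q x) = ph x" if "x:span (B - A)" for x
  by (rule linear_eq_on[OF linear_compose[OF assms(1) g(1), unfolded o_def] assms(4) that])
    (use g inj in \<open>auto simp: the_inv_into_f_f\<close>)
 show ?thesis
 proof (rule that[OF g(1)])
  fix x assume x: "x:W"
  obtain y where y: "y:span (B - A)" "q y = q x"
   using image_kernel_complement[of q A B x] assms AB x by auto
  have yW: "y:W" using y AB span_mono[of "B - A" B] by blast
  have "ph (x - y) = 0" using assms(5)[of "x - y"] x yW y assms(2)
   by (simp add: subspace_diff linear_diff[OF assms(1)])
  thus "g (q x) = ph x" using gq[OF y(1)] y by (simp add: linear_diff[OF assms(4)])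
 qed
qed

text \<open>Pigeonhole: reducing the multiples of \<open>x\<close> modulo the group generated by
  \<open>C\<close> leaves vectors \<open>y k\<close> of \<open>N\<close> whose coefficients at
  \<open>C\<close> are fractional parts. They are bounded, so only finitely many occur, and two
  equal ones give a multiple of \<open>x\<close> in \<open>int_span C\<close>.\<close>

lemma rational_combination:
 assumes N: "is_lattice N" and C: "finite C" "independent C" "C <= N" and x: "x:N" "x:span C"
 shows "EX k>0. of_int k *R x:int_span C"
proof -
 obtain B where B: "finite B" "independent B" "N = int_span B" using N by (auto simp: is_lattice_iff)
 obtain d :: "'a => 'a => real" where d: "ALL b. linear (d b)"
  "ALL b:B. ALL b':B. d b b' = (if b = b' then 1 else 0)"
  "ALL x:span B. (\<Sum>b\<in>B. d b x *R b) = x"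
  "ALL b:B. ALL x:int_span B. d b x:\<int>"
  using dual_coordinates[OF B(1,2)] .
 obtain e :: "'a => 'a => real" where "ALL b. linear (e b)"
  "ALL b:C. ALL b':C. e b b' = (if b = b' then 1 else 0)"
  and e: "ALL x:span C. (\<Sum>b\<in>C. e b x *R b) = x"
  and "ALL b:C. ALL x:int_span C. e b x:\<int>"
  using dual_coordinates[OF C(1,2)] .
 have sN: "add_subgroup N" using N by (rule is_lattice_add_subgroup)
 define y where "y k = (\<Sum>c\<in>C. frac (of_nat k * e c x) *R c)" for k :: nat
 have yk: "y k = of_nat k *R x - (\<Sum>c\<in>C. of_int \<lfloor>of_nat k * e c x\<rfloor> *R c)" for k
 proof -
  have "of_nat k *R x = (\<Sum>c\<in>C. (of_nat k * e c x) *R c)"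
   by (subst e[rule_format, OF x(2), symmetric]) (simp add: scaleR_sum_right)
  thus ?thesis unfolding y_def frac_def by (simp add: algebra_simps sum_subtractf)
 qed
 have yN: "y k:N" for k
  unfolding yk using sN x(1) C add_subgroup_scale[OF sN x(1), of "int k"]
  by (intro add_subgroup_diff add_subgroup_sum add_subgroup_scale) auto
 define M where "M = (\<Sum>b\<in>B. \<Sum>c\<in>C. \<bar>d b c\<bar>)"
 have bound: "\<bar>d b (y k)\<bar> <= M" if "b:B" for b k
 proof -
  have "\<bar>d b (y k)\<bar> <= (\<Sum>c\<in>C. \<bar>frac (of_nat k * e c x) * d b c\<bar>)"
   unfolding y_def by (simp add: linear_sum[OF d(1)[rule_format]] linear_scale[OF d(1)[rule_format]] sum_abs)
  also have "... <= (\<Sum>c\<in>C. \<bar>d b c\<bar>)"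
  proof (rule sum_mono)
   fix c
   have "\<bar>frac (of_nat k * e c x)\<bar> <= 1" using frac_lt_1[of "of_nat k * e c x"] by (simp add: less_imp_le)
   thus "\<bar>frac (of_nat k * e c x) * d b c\<bar> <= \<bar>d b c\<bar>"
    by (simp add: abs_mult mult_left_le_one_le)
  qed
  also have "... <= M" unfolding M_def
   by (rule member_le_sum[OF that]) (use B in \<open>auto intro: sum_nonneg\<close>)
  finally show ?thesis .
 qed
 have "range y <= (%z. \<Sum>b\<in>B. of_int (z b) *R b) ` (\<Pi>\<^sub>E b\<in>B. {- \<lceil>M\<rceil>..\<lceil>M\<rceil>})"
 proof safe
  fix k
  have "y k = (\<Sum>b\<in>B. d b (y k) *R b)"
   using d(3)[rule_format, of "y k"] yN[of k] B(3) int_span_subset_span[of B] by (metis subsetD)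
  also have "... = (\<Sum>b\<in>B. of_int ((\<lambda>b\<in>B. \<lfloor>d b (y k)\<rfloor>) b) *R b)"
   using d(4) yN[of k] B by (intro sum.cong) auto
  finally have eq: "y k = (\<Sum>b\<in>B. of_int ((\<lambda>b\<in>B. \<lfloor>d b (y k)\<rfloor>) b) *R b)" .
  have "(\<lambda>b\<in>B. \<lfloor>d b (y k)\<rfloor>):(\<Pi>\<^sub>E b\<in>B. {- \<lceil>M\<rceil>..\<lceil>M\<rceil>})"
  proof (rule restrict_PiE_iff[THEN iffD2, rule_format])
   fix b assume "b:B"
   hence "\<bar>d b (y k)\<bar> <= M" by (rule bound)
   moreover have "d b (y k):\<int>" using d(4) yN B \<open>b:B\<close> by auto
   ultimately show "\<lfloor>d b (y k)\<rfloor>:{- \<lceil>M\<rceil>..\<lceil>M\<rceil>}"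
    by (simp add: le_floor_iff floor_le_iff abs_le_iff) linarith
  qed
  thus "y k:(%z. \<Sum>b\<in>B. of_int (z b) *R b) ` (\<Pi>\<^sub>E b\<in>B. {- \<lceil>M\<rceil>..\<lceil>M\<rceil>})"
   using eq by blast
 qed
 hence "finite (range y)" using B by (meson finite_PiE finite_atLeastAtMost_int finite_imageI finite_subset)
 hence "~ inj y" using finite_imageD infinite_UNIV_nat by blast
 then obtain k l where kl: "y k = y l" "k < l" by (metis injI linorder_less_linear)
 have "of_int (int l - int k) *R x
   = (\<Sum>c\<in>C. of_int \<lfloor>of_nat l * e c x\<rfloor> *R c) - (\<Sum>c\<in>C. of_int \<lfloor>of_nat k * e c x\<rfloor> *R c)"
  using kl(1) unfolding yk by (simp add: algebra_simps)
 also have "...:int_span C"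
  using C by (intro add_subgroup_diff add_subgroup_sum add_subgroup_scale add_subgroup_int_span) (auto intro: int_span_base)
 finally show ?thesis using kl(2) by (intro exI[of _ "int l - int k"]) auto
qed

text \<open>The image modulo an irrational subspace could be dense, so the kernel is required to be
  spanned by lattice vectors. A basis \<open>A\<close> of it extends to a real basis
  \<open>E\<close> of lattice vectors. With \<open>D\<close> a common denominator of the lattice
  basis in terms of \<open>E\<close>, the image lies in the lattice generated by the vectors
  \<open>(1 / of_int D) *R p e\<close>.\<close>

lemma quotient_lattice:
 assumes N: "is_lattice N" and p: "linear p" and C: "C <= N" "{x:span N. p x = 0} = span C"
 shows "is_lattice (p ` N)"
proof -
 obtain B where B: "finite B" "independent B" "N = int_span B" using N by (auto simp: is_lattice_iff)
 have fN: "fin_dim N" using N by (rule fin_dim_lattice)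
 obtain A where A: "finite A" "A <= C" "independent A" "span A = span C"
  using fin_dim_basis0[OF fin_dim_subset[OF fN C(1)]] .
 obtain E where E: "finite E" "A <= E" "E <= N" "independent E" "span E = span N"
  using fin_dim_basis[OF fN, of A] A C by (metis order_trans)
 have "ALL b:B. EX k>0. of_int k *R b:int_span E"
  using rational_combination[OF N E(1,4,3)] B E(5) int_span_base by (metis span_base)
 then obtain k where k: "!!b. b:B ==> k b > (0::int)" "!!b. b:B ==> of_int (k b) *R b:int_span E" by metis
 define D where "D = prod k B"
 have D: "D > 0" unfolding D_def by (rule prod_pos) (use k in auto)
 have Db: "of_int D *R b:int_span E" if b: "b:B" for b
 proof -
  have "D = prod k (B - {b}) * k b" unfolding D_def using b B by (metis mult.commute prod.remove)
  hence "of_int D *R b = of_int (prod k (B - {b})) *R (of_int (k b) *R b)" by simp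
  thus ?thesis using add_subgroup_scale[OF add_subgroup_int_span k(2)[OF b]] by metis
 qed
 define F where "F = (%e. (1 / of_int D) *R p e) ` (E - A)"
 have inj: "inj_on p (span (E - A))"
 proof (rule inj_onI)
  fix x y assume xy: "x:span (E - A)" "y:span (E - A)" "p x = p y"
  have d: "x - y:span (E - A)" using xy by (simp add: span_diff)
  hence "x - y:span N" using E span_mono[of "E - A" E] by blast
  hence "x - y:span A" using xy A C by (auto simp: linear_diff[OF p])
  hence "x - y = 0" by (rule independent_disjoint_span[OF E(4) E(2) _ d])
  thus "x = y" by simp
 qed
 have iE: "independent (E - A)" using E independent_mono by blast
 have lq: "linear (%e. (1 / of_int D) *R p e)" using p by (rule linear_compose_scale_right)
 have iF: "independent F" unfolding F_def
  by (rule linear_independent_injective_image[OF lq iE])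
    (use inj D in \<open>auto simp: inj_on_def\<close>)
 have "p ` N <= int_span F"
 proof -
  have pre: "add_subgroup {x. p x:int_span F}"
   using p add_subgroup_int_span[of F] by (auto simp: add_subgroup_def linear_0 linear_diff)
  have "p b:int_span F" if b: "b:B" for b
  proof -
   have "add_subgroup {x. (1 / of_int D) *R p x:int_span F}"
    using lq add_subgroup_int_span[of F] p by (auto simp: add_subgroup_def linear_0 linear_diff scaleR_diff_right)
   moreover have "E <= {x. (1 / of_int D) *R p x:int_span F}"
   proof
    fix e assume e: "e:E"
    show "e:{x. (1 / of_int D) *R p x:int_span F}"
    proof (cases "e:A")
     case True
     hence "e:span C" using A span_base by blast
     hence "p e = 0" using C by auto
     thus ?thesis using add_subgroup_0[OF add_subgroup_int_span] by auto
    next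
     case False
     hence "(1 / of_int D) *R p e:F" using e unfolding F_def by blast
     thus ?thesis using E int_span_base[of F] unfolding F_def by blast
    qed
   qed
   ultimately have "int_span E <= {x. (1 / of_int D) *R p x:int_span F}" by (rule int_span_minimal)
   hence "(1 / of_int D) *R p (of_int D *R b):int_span F" using Db[OF b] by blast
   thus ?thesis using D by (simp add: linear_scale[OF p])
  qed
  hence "N <= {x. p x:int_span F}" unfolding B(3) by (intro int_span_minimal pre) auto
  thus ?thesis by blast
 qed
 thus ?thesis
  using iF E sublattice_int_span[of F "p ` N"] add_subgroup_linear_image[OF p is_lattice_add_subgroup[OF N]]
  unfolding F_def by blast
qed

section \<open>Polyhedral cones\<close>

lemma convex_coneI:
 "[|0:S; !!x y. x:S ==> y:S ==> x + y:S; !!x c. x:S ==> 0 <= c ==> c *R x:S|] ==> convex_cone S"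
 by (simp add: convex_cone_iff)

lemma convex_cone_sum:
 assumes "convex_cone S" "!!i. i:I ==> f i:S" shows "sum f I:S"
 using assms(2)
 by (induction I rule: infinite_finite_induct)
   (auto intro: convex_cone_add[OF assms(1)] convex_cone_contains_0[OF assms(1)])

lemma convex_cone_hull_finite:
 assumes "finite V"
 shows "convex_cone hull V = {\<Sum>v\<in>V. c v *R v | c. ALL v:V. 0 <= c v}" (is "_ = ?R")
proof
 have "convex_cone ?R"
  unfolding convex_cone_iff
 proof (intro conjI ballI allI impI)
  show "0:?R" by (intro CollectI exI[of _ "%_. 0"]) auto
  fix x y assume "x:?R" "y:?R"
  then obtain c d where "x = (\<Sum>v\<in>V. c v *R v)" "ALL v:V. 0 <= c v" "y = (\<Sum>v\<in>V. d v *R v)" "ALL v:V. 0 <= d v"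
   by blast
  thus "x + y:?R"
   by (intro CollectI exI[of _ "%v. c v + d v"]) (auto simp: scaleR_left_distrib sum.distrib)
 next
  fix x and a :: real assume "x:?R" "0 <= a"
  then obtain c where "x = (\<Sum>v\<in>V. c v *R v)" "ALL v:V. 0 <= c v" by blast
  thus "a *R x:?R" using \<open>0 <= a\<close>
   by (intro CollectI exI[of _ "%v. a * c v"]) (auto simp: scaleR_sum_right)
 qed
 moreover have "V <= ?R"
 proof
  fix v assume "v:V"
  thus "v:?R" using assms
   by (intro CollectI exI[of _ "%w. if w = v then 1 else 0"])
     (auto simp: if_distrib[of "%r. r *R _"] cong: if_cong)
 qed
 ultimately show "convex_cone hull V <= ?R" by (simp add: hull_minimal)
 show "?R <= convex_cone hull V"
  by (auto intro!: convex_cone_sum[OF convex_cone_convex_cone_hull] convex_cone_hull_mul intro: hull_inc)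
qed

lemma convex_cone_hull_minimal: "convex_cone si ==> V <= si ==> convex_cone hull V <= si"
 by (simp add: hull_minimal)

lemma convex_cone_hull_insert:
 "convex_cone hull (insert v V) = {x + t *R v | x t. x:convex_cone hull V & 0 <= t}"
proof -
 have v: "convex_cone hull {v} = {t *R v | t. 0 <= t}"
  unfolding convex_cone_hull_finite[OF finite.insertI[OF finite.emptyI]] by auto
 have "convex_cone hull (V Un {v}) = {x + t *R v | x t. x:convex_cone hull V & 0 <= t}"
  unfolding convex_cone_hull_Un v by blast
 thus ?thesis by simp
qed

lemma convex_cone_hull_linear_image:
 assumes "linear f" shows "f ` (convex_cone hull V) = convex_cone hull (f ` V)"
proof
 have "convex_cone {x. f x:convex_cone hull (f ` V)}"
  by (rule convex_coneI)
    (auto simp: linear_0[OF assms] linear_add[OF assms] linear_scale[OF assms]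
     convex_cone_hull_contains_0 convex_cone_hull_add convex_cone_hull_mul)
 hence "convex_cone hull V <= {x. f x:convex_cone hull (f ` V)}"
  by (rule convex_cone_hull_minimal) (auto intro: hull_inc)
 thus "f ` (convex_cone hull V) <= convex_cone hull (f ` V)" by blast
 show "convex_cone hull (f ` V) <= f ` (convex_cone hull V)"
  using assms by (intro convex_cone_hull_minimal convex_cone_linear_image)
   (auto intro: hull_inc convex_cone_convex_cone_hull)
qed

lemma span_convex_cone:
 assumes "convex_cone si" shows "span si = {a - b | a b. a:si & b:si}"
proof
 have "subspace {a - b | a b. a:si & b:si}" (is "subspace ?D")
  unfolding subspace_def
 proof (intro conjI ballI allI)
  show "0:?D" using convex_cone_contains_0[OF assms] by force
  fix x y assume "x:?D" "y:?D"
  then obtain a b c d where *: "x = a - b" "y = c - d" "a:si" "b:si" "c:si" "d:si" by blast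
  show "x + y:?D"
   by (intro CollectI exI[of _ "a + c"] exI[of _ "b + d"]) (use * assms in \<open>auto intro: convex_cone_add\<close>)
 next
  fix r x assume "x:?D"
  then obtain a b where *: "x = a - b" "a:si" "b:si" by blast
  show "r *R x:?D"
  proof (cases "r >= 0")
   case True
   thus ?thesis
    by (intro CollectI exI[of _ "r *R a"] exI[of _ "r *R b"])
      (use * assms in \<open>auto simp: scaleR_diff_right intro: convex_cone_scaleR\<close>)
  next
   case False
   thus ?thesis
    by (intro CollectI exI[of _ "(-r) *R b"] exI[of _ "(-r) *R a"])
      (use * assms in \<open>auto simp: algebra_simps intro: convex_cone_scaleR[OF assms, of "-r", simplified]\<close>)
  qed
 qed
 thus "span si <= {a - b | a b. a:si & b:si}"
  by (rule span_minimal[rotated]) (use convex_cone_contains_0[OF assms] in force)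
 show "{a - b | a b. a:si & b:si} <= span si"
  by (auto intro: span_diff span_base)
qed

text \<open>For convex cones, faces are the subcones that contain the summands of their elements.\<close>

definition cface :: "'v::real_vector set => 'v set => bool" where
 "cface ta si <-> ta <= si & convex_cone ta & (ALL a:si. ALL b:si. a + b:ta --> a:ta)"

lemma cfaceI:
 "[|ta <= si; convex_cone ta; !!a b. a:si ==> b:si ==> a + b:ta ==> a:ta|] ==> cface ta si"
 unfolding cface_def by blast

lemma cface_subset: "cface ta si ==> ta <= si"
 and cface_cone: "cface ta si ==> convex_cone ta"
 and cfaceD1: "cface ta si ==> a:si ==> b:si ==> a + b:ta ==> a:ta"
 unfolding cface_def by blast+

lemma cfaceD2: "cface ta si ==> a:si ==> b:si ==> a + b:ta ==> b:ta"
 using cfaceD1[of ta si b a] by (simp add: add.commute)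

text \<open>A nonempty face is closed under dilation because each of its nonzero points lies inside
  a segment from 0 to a larger multiple. Sums and segments are exchanged by halving:
  \<open>a + b\<close> is twice the midpoint of \<open>a\<close> and \<open>b\<close>.\<close>

lemma cone_face_iff:
 assumes si: "convex_cone si" shows "cone_face ta si <-> cface ta si"
proof
 assume "cone_face ta si"
 hence f: "ta face_of si" and ne: "ta ~= {}" by (auto simp: cone_face_def)
 hence sub: "ta <= si" and cv: "convex ta"
  and seg: "!!a b x. a:si ==> b:si ==> x:ta ==> x:open_segment a b ==> a:ta & b:ta"
  unfolding face_of_def by auto
 have si0: "0:si" using si by (rule convex_cone_contains_0)
 have big: "C *R x:ta & 0:ta" if x: "x:ta" and C: "C > 1" for x and C :: real
 proof (cases "x = 0")
  case False
  have "x:open_segment 0 (C *R x)"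
   unfolding in_segment using False C by (intro conjI exI[of _ "1 / C"]) auto
  thus ?thesis using seg[OF si0 _ x] x sub C convex_cone_scaleR[OF si, of C x] by auto
 qed (use x in auto)
 obtain x0 where "x0:ta" using ne by blast
 hence 0: "0:ta" using big[of x0 2] by simp
 have sc: "c *R x:ta" if x: "x:ta" and c: "c >= 0" for c x
 proof -
  define C where "C = c + 2"
  have "C *R x:ta" using big[OF x, of C] c by (simp add: C_def)
  hence "(1 - c / C) *R 0 + (c / C) *R (C *R x):ta"
   using c by (intro convexD[OF cv 0]) (auto simp: C_def)
  moreover have "C ~= 0" using c by (simp add: C_def)
  ultimately show ?thesis by simp
 qed
 have ad: "x + y:ta" if "x:ta" "y:ta" for x y
 proof -
  have "(1/2) *R x + (1/2) *R y:ta" using that by (intro convexD[OF cv]) auto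
  hence "2 *R ((1/2) *R x + (1/2) *R y):ta" by (intro sc) auto
  thus ?thesis by (simp add: scaleR_right_distrib)
 qed
 show "cface ta si"
 proof (rule cfaceI[OF sub])
  show "convex_cone ta" using 0 sc ad by (simp add: convex_cone_iff)
  fix a b assume ab: "a:si" "b:si" "a + b:ta"
  have m: "(1/2) *R (a + b):ta" using ab by (intro sc) auto
  show "a:ta"
  proof (cases "a = b")
   case True thus ?thesis using m by (simp add: scaleR_right_distrib flip: scaleR_left_distrib)
  next
   case False
   have "(1/2) *R (a + b):open_segment a b"
    unfolding in_segment using False by (intro conjI exI[of _ "1/2"]) (auto simp: scaleR_right_distrib)
   thus ?thesis using seg ab m by blast
  qed
 qed
next
 assume c: "cface ta si"
 note cc = cface_cone[OF c]
 have key: "a:ta" if "a:si" "b:si" "(1 - u) *R a + u *R b:ta" "0 < u" "u < 1" for a b and u :: real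
 proof -
  have "(1 - u) *R a:ta"
   by (rule cfaceD1[OF c _ _ that(3)]) (use that si in \<open>auto intro: convex_cone_scaleR\<close>)
  hence "(1 / (1 - u)) *R ((1 - u) *R a):ta"
   by (rule convex_cone_scaleR[OF cc, rotated]) (use that in auto)
  moreover have "(1 / (1 - u)) * (1 - u) = 1" using that by simp
  ultimately show ?thesis by (metis scaleR_scaleR scaleR_one)
 qed
 have "ta face_of si"
  unfolding face_of_def
 proof (intro conjI ballI impI)
  show "ta <= si" using c by (rule cface_subset)
  show "convex ta" using cc by (simp add: convex_cone_def)
  fix a b x assume *: "a:si" "b:si" "x:ta" "x:open_segment a b"
  then obtain u where u: "0 < u" "u < 1" "x = (1 - u) *R a + u *R b" unfolding in_segment by blast
  show "a:ta" using key[of a b u] * u by blast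
  have "(1 - (1 - u)) *R b + (1 - u) *R a:ta" using * u by (simp add: add.commute)
  thus "b:ta" using key[of b a "1 - u"] * u by auto
 qed
 thus "cone_face ta si" using convex_cone_nonempty[OF cc] by (simp add: cone_face_def)
qed

lemma cface_refl: "convex_cone si ==> cface si si"
 by (auto intro: cfaceI)

lemma cface_trans: "cface rh ta ==> cface ta si ==> cface rh si"
proof (rule cfaceI)
 assume *: "cface rh ta" "cface ta si"
 show "rh <= si" "convex_cone rh" using * by (auto dest: cface_subset cface_cone)
 fix a b assume ab: "a:si" "b:si" "a + b:rh"
 hence "a + b:ta" using cface_subset[OF *(1)] by blast
 hence "a:ta" "b:ta" using cfaceD1[OF *(2) ab(1,2)] cfaceD2[OF *(2) ab(1,2)] by auto
 thus "a:rh" using cfaceD1[OF *(1)] ab by blast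
qed

lemma cface_mono: "cface rh si ==> rh <= ta ==> ta <= si ==> cface rh ta"
 unfolding cface_def by blast

lemma convex_cone_Int: "convex_cone S ==> convex_cone T ==> convex_cone (S Int T)"
 by (simp add: convex_cone_iff)

lemma cface_Int_cone:
 assumes "cface ta si" "convex_cone C" shows "cface (ta Int C) (si Int C)"
 using assms unfolding cface_def by (auto intro: convex_cone_Int)

lemma cface_sum:
 assumes "cface ta si" "convex_cone si" "finite I" "!!i. i:I ==> f i:si" "sum f I:ta" "i:I"
 shows "f i:ta"
proof -
 have "sum f I = f i + sum f (I - {i})" using assms by (simp add: sum.remove)
 thus ?thesis
  using cfaceD1[OF assms(1), of "f i" "sum f (I - {i})"] assms convex_cone_sum[OF assms(2), of "I - {i}" f] by simp
qed

lemma cface_scale: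
 assumes "cface ta si" "c *R x:ta" "0 < c" shows "x:ta"
 using convex_cone_scaleR[OF cface_cone[OF assms(1)], of "1 / c" "c *R x"] assms by simp

text \<open>If a combination of generators lies in a face, so does every summand, hence every
  generator with nonzero coefficient. Faces of rational cones are therefore rational.\<close>

lemma cface_hull:
 assumes "finite V" "cface ta (convex_cone hull V)" shows "ta = convex_cone hull (V Int ta)"
proof
 show "convex_cone hull (V Int ta) <= ta" using cface_cone[OF assms(2)] by (intro convex_cone_hull_minimal) auto
 show "ta <= convex_cone hull (V Int ta)"
 proof
  fix x assume x: "x:ta"
  hence "x:convex_cone hull V" using cface_subset[OF assms(2)] by blast
  then obtain c where c: "x = (\<Sum>v\<in>V. c v *R v)" "ALL v:V. 0 <= c v"
   unfolding convex_cone_hull_finite[OF assms(1)] by blast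
  have m: "c v *R v:ta" if "v:V" for v
   by (rule cface_sum[OF assms(2) convex_cone_convex_cone_hull assms(1)])
     (use c x that in \<open>auto intro: convex_cone_hull_mul hull_inc\<close>)
  show "x:convex_cone hull (V Int ta)"
   unfolding c(1)
  proof (rule convex_cone_sum[OF convex_cone_convex_cone_hull])
   fix v assume v: "v:V"
   show "c v *R v:convex_cone hull (V Int ta)"
   proof (cases "c v = 0")
    case False
    hence "v:ta" using cface_scale[OF assms(2) m[OF v]] c v by force
    thus ?thesis using v c by (intro convex_cone_hull_mul hull_inc) auto
   qed (simp add: convex_cone_hull_contains_0)
  qed
 qed
qed

lemma rational_cone_convex_cone: "rational_cone N si ==> convex_cone si"
 unfolding rational_cone_def using convex_cone_convex_cone_hull by blast

lemma rational_cone_cface: "rational_cone N si ==> cface ta si ==> rational_cone N ta"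
 unfolding rational_cone_def by (metis cface_hull finite_Int inf.coboundedI1)

lemma rational_cone_span: "rational_cone N si ==> si <= span N"
 unfolding rational_cone_def
 by (metis convex_cone_hull_minimal convex_cone_span span_superset subset_trans)

lemma span_rational_cone:
 assumes "rational_cone N si" shows "span (N Int si) = span si"
proof
 show "span (N Int si) <= span si" by (intro span_mono) auto
 obtain V where V: "finite V" "V <= N" "si = convex_cone hull V" using assms by (auto simp: rational_cone_def)
 have "si <= span (N Int si)"
  unfolding V(3) using V hull_subset[of V convex_cone]
  by (intro convex_cone_hull_minimal convex_cone_span) (auto intro!: span_base)
 thus "span si <= span (N Int si)" by (simp add: span_minimal)
qed

section \<open>Relative interiors and minimal faces\<close>

definition rint :: "'v::real_vector set => 'v set" where
 "rint si = {x:si. ALL y:si. EX e>0. x - e *R y:si}"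

text \<open>The smallest face of \<open>si\<close> that contains \<open>x\<close>. Like
  \<open>rint\<close> it is expressed by subtracting small multiples, so both make sense in spaces
  without a topology.\<close>

definition min_face :: "'v::real_vector set => 'v => 'v set" where
 "min_face si x = {y:si. EX e>0. x - e *R y:si}"

lemma rint_subset: "rint si <= si"
 by (auto simp: rint_def)

lemma cone_shrink:
 assumes si: "convex_cone si" and x: "x:si" "x - e *R y:si" and d: "0 <= d" "d <= e"
 shows "x - d *R y:si"
proof (cases "e = 0")
 case False
 hence e: "e > 0" using d by simp
 have "(1 - d / e) *R x + (d / e) *R (x - e *R y):si"
  using e d x by (intro convex_cone_add[OF si] convex_cone_scaleR[OF si]) auto
 moreover have "(1 - d / e) *R x + (d / e) *R (x - e *R y) = x - d *R y"
  using e by (simp add: algebra_simps)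
 ultimately show ?thesis by simp
qed (use assms in auto)

lemma min_face_cface:
 assumes si: "convex_cone si" and x: "x:si" shows "cface (min_face si x) si"
proof (rule cfaceI)
 show "min_face si x <= si" by (auto simp: min_face_def)
 show "convex_cone (min_face si x)"
  unfolding convex_cone_iff
 proof (intro conjI ballI allI impI)
  show "0:min_face si x" using x convex_cone_contains_0[OF si] by (auto simp: min_face_def intro: exI[of _ 1])
  fix a b assume "a:min_face si x" "b:min_face si x"
  then obtain d e where *: "a:si" "b:si" "d > 0" "e > 0" "x - d *R a:si" "x - e *R b:si"
   by (auto simp: min_face_def)
  define m where "m = min d e"
  have m: "m > 0" "x - m *R a:si" "x - m *R b:si"
   using * cone_shrink[OF si x] by (auto simp: m_def)
  have "(1/2) *R (x - m *R a) + (1/2) *R (x - m *R b):si"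
   using m by (intro convex_cone_add[OF si] convex_cone_scaleR[OF si]) auto
  moreover have "(1/2) *R (x - m *R a) + (1/2) *R (x - m *R b) = x - (m/2) *R (a + b)"
   by (simp add: algebra_simps flip: scaleR_left_distrib)
  ultimately show "a + b:min_face si x"
   using * m convex_cone_add[OF si] unfolding min_face_def by (auto intro!: exI[of _ "m/2"])
 next
  fix a and c :: real assume "a:min_face si x" "0 <= c"
  then obtain d where *: "a:si" "d > 0" "x - d *R a:si" by (auto simp: min_face_def)
  have "x - (d / (c + 1)) *R (c *R a) = x - (d * (c / (c + 1))) *R a" by simp
  also have "...:si" using \<open>0 <= c\<close> * by (intro cone_shrink[OF si x *(3)]) (auto simp: field_simps)
  finally show "c *R a:min_face si x"
   using * \<open>0 <= c\<close> convex_cone_scaleR[OF si] unfolding min_face_def by (auto intro!: exI[of _ "d / (c + 1)"])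
 qed
 fix a b assume "a:si" "b:si" "a + b:min_face si x"
 then obtain e where *: "e > 0" "x - e *R (a + b):si" by (auto simp: min_face_def)
 have "x - e *R a = (x - e *R (a + b)) + e *R b" by (simp add: algebra_simps)
 also have "...:si" using * \<open>b:si\<close> by (intro convex_cone_add[OF si] convex_cone_scaleR[OF si]) auto
 finally show "a:min_face si x" using * \<open>a:si\<close> by (auto simp: min_face_def)
qed

lemma min_face_self:
 assumes "convex_cone si" "x:si" shows "x:min_face si x"
 using assms convex_cone_contains_0 unfolding min_face_def by (auto intro!: exI[of _ 1])

lemma rint_min_face:
 assumes si: "convex_cone si" and x: "x:si" shows "x:rint (min_face si x)"
 unfolding rint_def
proof (intro CollectI conjI ballI)
 show "x:min_face si x" by (rule min_face_self[OF assms])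
 fix y assume y: "y:min_face si x"
 then obtain e where e: "e > 0" "x - e *R y:si" by (auto simp: min_face_def)
 have "x - e *R y:min_face si x"
 proof (rule cfaceD1[OF min_face_cface[OF assms], of _ "e *R y"])
  show "e *R y:si" using y e by (auto simp: min_face_def intro: convex_cone_scaleR[OF si])
  show "x - e *R y + e *R y:min_face si x" using min_face_self[OF assms] by simp
 qed (rule e)
 thus "EX e>0. x - e *R y:min_face si x" using e by blast
qed

lemma rint_cface_subset:
 assumes si: "convex_cone si" and x: "x:rint si" "x:ta" and f: "cface (si Int ta) si"
 shows "si <= ta"
proof
 fix y assume y: "y:si"
 then obtain e where e: "e > 0" "x - e *R y:si" using x by (auto simp: rint_def)
 have "e *R y:si Int ta"
 proof (rule cfaceD2[OF f e(2)])
  show "e *R y:si" using y e by (auto intro: convex_cone_scaleR[OF si])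
  show "x - e *R y + e *R y:si Int ta" using x rint_subset by auto
 qed
 thus "y:ta" using cface_scale[OF f _ e(1)] by blast
qed

lemma min_face_eq:
 assumes "convex_cone si" "cface ta si" "x:rint ta" shows "min_face si x = ta"
proof
 have x: "x:ta" "x:si" using assms rint_subset cface_subset by blast+
 show "ta <= min_face si x" using assms(2,3) unfolding min_face_def rint_def cface_def by blast
 show "min_face si x <= ta"
 proof
  fix y assume "y:min_face si x"
  then obtain e where e: "e > 0" "x - e *R y:si" "y:si" by (auto simp: min_face_def)
  have "e *R y:ta"
   using cfaceD2[OF assms(2) e(2), of "e *R y"] e x convex_cone_scaleR[OF assms(1), of e y] by simp
  thus "y:ta" using cface_scale[OF assms(2) _ e(1)] by blast
 qed
qed

lemma rint_add:
 assumes si: "convex_cone si" and x: "x:rint si" and z: "z:si" shows "x + z:rint si"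
 unfolding rint_def
proof (intro CollectI conjI ballI)
 show "x + z:si" using x z rint_subset by (blast intro: convex_cone_add[OF si])
 fix y assume "y:si"
 then obtain e where e: "e > 0" "x - e *R y:si" using x by (auto simp: rint_def)
 have "(x - e *R y) + z:si" using e z by (intro convex_cone_add[OF si])
 thus "EX e>0. x + z - e *R y:si" using e by (auto simp: algebra_simps)
qed

lemma rint_scale:
 assumes si: "convex_cone si" and x: "x:rint si" and c: "c > 0" shows "c *R x:rint si"
 unfolding rint_def
proof (intro CollectI conjI ballI)
 show "c *R x:si" using x c rint_subset by (force intro: convex_cone_scaleR[OF si])
 fix y assume "y:si"
 then obtain e where e: "e > 0" "x - e *R y:si" using x by (auto simp: rint_def)
 have "c *R (x - e *R y):si" using e c by (intro convex_cone_scaleR[OF si]) auto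
 thus "EX e>0. c *R x - e *R y:si" using e c by (intro exI[of _ "c * e"]) (auto simp: algebra_simps)
qed

lemma rint_sum_generators:
 assumes "finite V" shows "(\<Sum>V) \<in> rint (convex_cone hull V)"
 unfolding rint_def
proof (intro CollectI conjI ballI)
 show "\<Sum>V \<in> convex_cone hull V"
  by (intro convex_cone_sum convex_cone_convex_cone_hull) (auto intro: hull_inc)
 fix y assume "y:convex_cone hull V"
 then obtain c where c: "y = (\<Sum>v\<in>V. c v *R v)" "ALL v:V. 0 <= c v"
  unfolding convex_cone_hull_finite[OF assms] by blast
 \<comment> \<open>\<open>M\<close> dominates every coefficient; the summand 1 keeps it positive
   even if all coefficients vanish.\<close>
 define M where "M = 1 + sum c V"
 have M: "M > 0" "!!v. v:V ==> c v <= M"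
 proof -
  show "M > 0" using c sum_nonneg[of V c] by (simp add: M_def)
  fix v assume "v:V"
  thus "c v <= M" using c member_le_sum[of v V c] assms by (auto simp: M_def)
 qed
 have "\<Sum>V - (1 / M) *R y = (\<Sum>v\<in>V. (1 - c v / M) *R v)"
  unfolding c(1) by (simp add: algebra_simps sum_subtractf scaleR_sum_right)
 also have "...:convex_cone hull V"
  by (intro convex_cone_sum convex_cone_convex_cone_hull convex_cone_hull_mul hull_inc) (use M in auto)
 finally show "EX e>0. \<Sum>V - e *R y \<in> convex_cone hull V" using M by (intro exI[of _ "1 / M"]) auto
qed

lemma rint_span:
 assumes si: "convex_cone si" and x: "x:rint si" and s: "s:span si"
 obtains e where "e > 0" "!!t. 0 <= t ==> t <= e ==> x + t *R s:si"
proof -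
 obtain a b where ab: "s = a - b" "a:si" "b:si" using s span_convex_cone[OF si] by blast
 obtain e where e: "e > 0" "x - e *R b:si" using x ab by (auto simp: rint_def)
 show ?thesis
 proof (rule that[OF e(1)])
  fix t assume t: "0 <= t" "t <= e"
  have "x - t *R b:si" using cone_shrink[OF si _ e(2) t] x rint_subset by blast
  hence "(x - t *R b) + t *R a:si" using ab t by (intro convex_cone_add[OF si] convex_cone_scaleR[OF si])
  thus "x + t *R s:si" unfolding ab(1) scaleR_diff_right by (metis add_diff_eq diff_add_eq)
 qed
qed

lemma cface_span_Int:
 assumes "convex_cone si" "cface ta si" shows "span ta Int si = ta"
proof
 show "span ta Int si <= ta"
 proof safe
  fix y assume y: "y:span ta" "y:si"
  then obtain a b where ab: "y = a - b" "a:ta" "b:ta"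
   using span_convex_cone[OF cface_cone[OF assms(2)]] by blast
  thus "y:ta" using cfaceD1[OF assms(2) y(2), of b] cface_subset[OF assms(2)] by auto
 qed
 show "ta <= span ta Int si" using cface_subset[OF assms(2)] span_superset by blast
qed

lemma rational_cone_rint:
 assumes N: "add_subgroup N" and "rational_cone N si" obtains v where "v:N" "v:rint si"
proof -
 obtain V where "finite V" "V <= N" "si = convex_cone hull V" using assms by (auto simp: rational_cone_def)
 thus ?thesis using that[of "\<Sum>V"] rint_sum_generators[of V] add_subgroup_sum[OF N, of V "%v. v"] by auto
qed

definition int_form :: "'v::real_vector set => ('v => real) => bool" where
 "int_form N h <-> linear h & h ` N <= \<int>"

lemma int_form_linear: "int_form N h ==> linear h"
 and int_form_Ints: "int_form N h ==> x:N ==> h x:\<int>"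
 by (auto simp: int_form_def)

lemma int_form_uminus: "int_form N h ==> int_form N (%x. - h x)"
 by (auto simp: int_form_def intro: linear_compose_neg)

text \<open>Fourier--Motzkin elimination of the coefficient of the new generator gives the induction step.\<close>

lemma rational_cone_halfspaces:
 fixes N :: "'v::real_vector set"
 assumes N: "is_lattice N" and si: "rational_cone N si"
 shows "EX H. finite H & (ALL h:H. int_form N h) & si = {x:span N. ALL h:H. 0 <= h x}"
proof -
 obtain V where V: "finite V" "V <= N" "si = convex_cone hull V" using si by (auto simp: rational_cone_def)
 have "finite V ==> V <= N ==> EX H. finite H & (ALL h:H. int_form N h) &
   convex_cone hull V = {x:span N. ALL h:H. 0 <= h x}"
 proof (induction V rule: finite_induct)
  case empty
  obtain D :: "('v => real) set" where D: "finite D" "!!h. h:D ==> linear h" "!!h x. h:D ==> x:N ==> h x:\<int>"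
   "!!x. x:span N ==> (ALL h:D. h x = 0) ==> x = 0" using lattice_dual[OF N] by metis
  have "convex_cone hull {} = {0::'v}" by (simp add: convex_cone_hull_finite)
  moreover have "{0} = {x:span N. ALL h:D Un (%h x. - h x) ` D. 0 <= h x}"
  proof safe
   fix x assume x: "x:span N" "ALL h:D Un (%h x. - h x) ` D. 0 <= h x"
   hence "ALL h:D. h x = 0" by (simp add: ball_Un order_antisym)
   thus "x = 0" using D(4) x by blast
  qed (auto simp: span_zero linear_0[OF D(2)])
  moreover have "ALL h:D Un (%h x. - h x) ` D. int_form N h"
   using D(2,3) by (auto simp: int_form_def intro: linear_compose_neg)
  ultimately show ?case using D(1) by (intro exI[of _ "D Un (%h x. - h x) ` D"]) auto
 next
  case (insert v V)
  then obtain H where H: "finite H" "!!h. h:H ==> int_form N h" "convex_cone hull V = {x:span N. ALL h:H. 0 <= h x}"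
   by auto
  have v: "v:N" "v:span N" using insert.prems by (auto intro: span_base)
  note lin = int_form_linear[OF H(2)]
  define P where "P = {h:H. h v > 0}"
  define M where "M = {h:H. h v < 0}"
  \<comment> \<open>A form positive at \<open>v\<close> and one negative at \<open>v\<close> are
    combined so that the value at \<open>v\<close> cancels; forms nonnegative at \<open>v\<close>
    are kept.\<close>
  define H' where "H' = {h:H. h v >= 0} Un (%(h, k) x. h x * (- k v) + k x * h v) ` (P \<times> M)"
  have "int_form N (%x. h x * (- k v) + k x * h v)" if "h:P" "k:M" for h k
  proof -
   have hk: "int_form N h" "int_form N k" using that H by (auto simp: P_def M_def)
   have "linear (%x. h x * (- k v) + k x * h v)"
    by (rule linearI) (simp_all add: linear_add[OF int_form_linear[OF hk(1)]] linear_add[OF int_form_linear[OF hk(2)]]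
      linear_scale[OF int_form_linear[OF hk(1)]] linear_scale[OF int_form_linear[OF hk(2)]] algebra_simps)
   thus ?thesis using int_form_Ints[OF hk(1)] int_form_Ints[OF hk(2)] v by (auto simp: int_form_def)
  qed
  hence int: "ALL h:H'. int_form N h" using H by (auto simp: H'_def)
  have "convex_cone hull (insert v V) = {x:span N. ALL h:H'. 0 <= h x}"
  proof (intro equalityI subsetI)
   fix x assume "x:convex_cone hull (insert v V)"
   then obtain y t where y: "x = y + t *R v" "y:convex_cone hull V" "0 <= t"
    unfolding convex_cone_hull_insert by blast
   hence y': "y:span N" "!!h. h:H ==> 0 <= h y" unfolding H(3) by auto
   have hx: "h x = h y + t * h v" if "h:H" for h
    using lin[OF that] by (simp add: y linear_add linear_scale)
   have "0 <= h x * (- k v) + k x * h v" if "h:P" "k:M" for h k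
   proof -
    have hk: "h:H" "k:H" "h v > 0" "k v < 0" using that by (auto simp: P_def M_def)
    have "h x * (- k v) + k x * h v = h y * (- k v) + k y * h v"
     by (simp add: hx hk algebra_simps)
    also have "... >= 0" using hk y' by (intro add_nonneg_nonneg mult_nonneg_nonneg) auto
    finally show ?thesis .
   qed
   moreover have "0 <= h x" if "h:H" "h v >= 0" for h using hx[OF that(1)] y(3) y'(2)[OF that(1)] that(2) by simp
   moreover have "x:span N" unfolding y using y' v by (intro span_add span_scale)
   ultimately show "x:{x:span N. ALL h:H'. 0 <= h x}" by (auto simp: H'_def)
  next
   fix x assume "x:{x:span N. ALL h:H'. 0 <= h x}"
   hence x1: "x:span N" and all: "ALL h:H'. 0 <= h x" by auto
   have x: "x:span N" "!!h. h:H ==> h v >= 0 ==> 0 <= h x"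
    using x1 all by (auto simp: H'_def)
   have x2: "0 <= h x * (- k v) + k x * h v" if "h:P" "k:M" for h k
   proof -
    have "(%x. h x * (- k v) + k x * h v):H'"
     unfolding H'_def using that by (intro UnI2 image_eqI[of _ _ "(h, k)"]) auto
    from bspec[OF all this] show ?thesis .
   qed
   \<comment> \<open>The least nonnegative multiple of \<open>v\<close> whose removal from
     \<open>x\<close> makes all forms in \<open>M\<close> nonnegative; the combined forms then keep
     those in \<open>P\<close> nonnegative.\<close>
   define t where "t = Max (insert 0 ((%k. k x / k v) ` M))"
   have finM: "finite M" using H by (simp add: M_def)
   have t0: "t >= 0" unfolding t_def using finM by simp
   have tM: "t >= k x / k v" if "k:M" for k unfolding t_def using finM that by simp
   have tin: "t = 0 | (EX k:M. t = k x / k v)"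
    using Max_in[of "insert 0 ((%k. k x / k v) ` M)"] finM unfolding t_def by auto
   have "0 <= h (x - t *R v)" if h: "h:H" for h
   proof -
    have eq: "h (x - t *R v) = h x - t * h v" using lin[OF h] by (simp add: linear_diff linear_scale)
    consider "h v < 0" | "h v = 0" | "h v > 0" by linarith
    thus ?thesis
    proof cases
     case 1
     hence "t >= h x / h v" using tM h by (simp add: M_def)
     hence "t * h v <= h x" using 1 by (simp add: neg_divide_le_eq)
     thus ?thesis using eq by simp
    next
     case 2 thus ?thesis using eq x(2)[OF h] by simp
    next
     case 3
     show ?thesis
     proof (cases "t = 0")
      case True thus ?thesis using eq x(2)[OF h] 3 by simp
     next
      case False
      then obtain k where k: "k:M" "t = k x / k v" using tin by blast
      have kv: "k v < 0" using k by (simp add: M_def)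
      have "0 <= h x * (- k v) + k x * h v" using x2 k h 3 by (simp add: P_def)
      also have "... = (- k v) * (h x - t * h v)" using kv k by (simp add: field_simps)
      finally show ?thesis unfolding eq using kv by (simp only: zero_le_mult_iff) auto
     qed
    qed
   qed
   hence "x - t *R v:convex_cone hull V" unfolding H(3) using x v by (simp add: span_diff span_scale)
   thus "x:convex_cone hull (insert v V)"
    unfolding convex_cone_hull_insert using t0 by (intro CollectI exI[of _ "x - t *R v"] exI[of _ t]) simp
  qed
  moreover have "finite H'" using H(1) by (auto simp: H'_def P_def M_def)
  ultimately show ?case using int by blast
 qed
 thus ?thesis using V by blast
qed

text \<open>Along \<open>- v\<close> only forms positive at \<open>v\<close> decrease, and there are
  some because \<open>- v\<close> is outside the cone. The smallest ratio of the values at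
  \<open>x\<close> and at \<open>v\<close> is the time at which the first of them vanishes.\<close>

lemma cone_exit:
 assumes "is_lattice N" "rational_cone N et" "x:et" "v:et" "- v~:et"
 obtains a where "a >= 0" "x - a *R v:et" "!!e. e > 0 ==> x - a *R v - e *R v~:et"
proof -
 obtain H where H: "finite H" "!!h. h:H ==> int_form N h" "et = {x:span N. ALL h:H. 0 <= h x}"
  using rational_cone_halfspaces[OF assms(1,2)] by blast
 note lin = int_form_linear[OF H(2)]
 have sp: "x:span N" "v:span N" using assms H by auto
 define P where "P = {h:H. h v > 0}"
 have "P ~= {}"
 proof
  assume "P = {}"
  hence "ALL h:H. h (- v) >= 0" using lin by (auto simp: P_def linear_neg not_less)
  thus False using assms sp H by (auto simp: span_neg)
 qed
 define a where "a = Min ((%h. h x / h v) ` P)"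
 have finP: "finite P" using H by (simp add: P_def)
 have aP: "a <= h x / h v" if "h:P" for h unfolding a_def using finP that by simp
 have "a:(%h. h x / h v) ` P" unfolding a_def using finP \<open>P ~= {}\<close> by simp
 then obtain h0 where h0: "h0:P" "a = h0 x / h0 v" by blast
 have ev: "h (x - c *R v) = h x - c * h v" if "h:H" for h c using lin[OF that] by (simp add: linear_diff linear_scale)
 show ?thesis
 proof (rule that)
  show a0: "a >= 0" using h0 assms H by (auto simp: P_def)
  show "x - a *R v:et"
   unfolding H(3)
  proof (intro CollectI conjI ballI)
   show "x - a *R v:span N" using sp by (simp add: span_diff span_scale)
   fix h assume h: "h:H"
   show "0 <= h (x - a *R v)"
   proof (cases "h:P")
    case True
    thus ?thesis using aP[OF True] ev[OF h] by (simp add: P_def pos_le_divide_eq)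
   next
    case False
    hence "a * h v <= 0" using a0 h by (simp add: P_def mult_nonneg_nonpos)
    moreover have "0 <= h x" using assms(3) H h by auto
    ultimately show ?thesis using ev[OF h] by simp
   qed
  qed
  fix e :: real assume e: "e > 0"
  have "x - a *R v - e *R v = x - (a + e) *R v" by (simp add: algebra_simps)
  moreover have "h0 (x - (a + e) *R v) = - e * h0 v"
  proof -
   have "a * h0 v = h0 x" using h0 by (simp add: P_def)
   thus ?thesis using ev[of h0 "a + e"] h0(1) unfolding distrib_right by (simp add: P_def)
  qed
  moreover have "- e * h0 v < 0" using e h0 by (simp add: P_def)
  ultimately have neg: "h0 (x - a *R v - e *R v) < 0" by metis
  show "x - a *R v - e *R v~:et"
  proof
   assume "x - a *R v - e *R v:et"
   hence "0 <= h0 (x - a *R v - e *R v)" using h0(1) unfolding H(3) P_def by blast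
   thus False using neg by simp
  qed
 qed
qed

text \<open>The half-space description yields closedness along a line without any topology on the
  space.\<close>

lemma rational_cone_closed:
 assumes "is_lattice N" "rational_cone N et" "!!e. e > 0 ==> EX t. 0 < t & t < e & x + t *R v:et"
 shows "x:et"
proof -
 obtain H where H: "finite H" "!!h. h:H ==> int_form N h" "et = {x:span N. ALL h:H. 0 <= h x}"
  using rational_cone_halfspaces[OF assms(1,2)] by blast
 obtain t where t: "t > 0" "x + t *R v:et" using assms(3)[of 1] by auto
 obtain s where s: "s > 0" "s < t" "x + s *R v:et" using assms(3)[OF t(1)] by auto
 have "(x + t *R v) - (x + s *R v):span N" using t s H by (intro span_diff) auto
 hence "(t - s) *R v:span N" by (simp add: algebra_simps)
 hence "(1 / (t - s)) *R ((t - s) *R v):span N" by (rule span_scale)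
 hence v: "v:span N" using s by simp
 have "(x + t *R v) - t *R v:span N" using t v H by (intro span_diff span_scale) auto
 hence x: "x:span N" by simp
 have "0 <= h x" if h: "h:H" for h
 proof (rule ccontr)
  assume neg: "~ 0 <= h x"
  have lin: "linear h" using H h by (auto dest: int_form_linear)
  \<comment> \<open>Below \<open>e\<close> the term \<open>u * h v\<close> cannot compensate the
    negative value \<open>h x\<close>; the 1 in the denominator covers the case
    \<open>h v = 0\<close>.\<close>
  define e where "e = - h x / (1 + \<bar>h v\<bar>)"
  have "e > 0" unfolding e_def using neg by (intro divide_pos_pos) auto
  then obtain u where u: "0 < u" "u < e" "x + u *R v:et" using assms(3) by blast
  hence "0 <= h x + u * h v" using h H lin by (auto simp: linear_add linear_scale)
  moreover have "u * h v <= u * (1 + \<bar>h v\<bar>)" using u by (intro mult_left_mono) auto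
  moreover have "u * (1 + \<bar>h v\<bar>) < e * (1 + \<bar>h v\<bar>)" using u by (intro mult_strict_right_mono) auto
  moreover have "e * (1 + \<bar>h v\<bar>) = - h x" by (simp add: e_def add_nonneg_eq_0_iff)
  ultimately show False by linarith
 qed
 thus ?thesis using x H by blast
qed

lemma add_subgroup_scale_Ints:
 assumes "add_subgroup G" "x:G" "c:\<int>" shows "c *R x:G"
 using assms by (auto elim!: Ints_cases intro: add_subgroup_scale)

text \<open>New generators arise where the cone spanned by a positive and a negative generator meets
  the hyperplane. They are integral because the coefficients are values of \<open>h\<close>.\<close>

lemma rational_cone_halfspace:
 assumes N: "add_subgroup N" and si: "rational_cone N si" and h: "int_form N h"
 shows "rational_cone N (si Int {x. 0 <= h x})"
proof -
 obtain V where V: "finite V" "V <= N" "si = convex_cone hull V" using si by (auto simp: rational_cone_def)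
 note lin = int_form_linear[OF h]
 define P where "P = {v:V. h v > 0}"
 define M where "M = {v:V. h v < 0}"
 define Z where "Z = {v:V. h v = 0}"
 define z where "z = (%(u, w). h u *R w + (- h w) *R u)"
 define V' where "V' = P Un Z Un z ` (P \<times> M)"
 have fin: "finite P" "finite M" "finite Z" using V by (auto simp: P_def M_def Z_def)
 have zc: "z (u, w):si" "h (z (u, w)) = 0" "z (u, w):N" if "u:P" "w:M" for u w
 proof -
  show "z (u, w):si" unfolding z_def V(3) prod.case using that
   by (intro convex_cone_hull_add convex_cone_hull_mul hull_inc) (auto simp: P_def M_def)
  show "h (z (u, w)) = 0" unfolding z_def using lin by (simp add: linear_add linear_scale linear_neg linear_diff)
  show "z (u, w):N" unfolding z_def using that V int_form_Ints[OF h]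
   by (auto intro!: add_subgroup_add[OF N] add_subgroup_scale_Ints[OF N] add_subgroup_diff[OF N] simp: P_def M_def)
 qed
 have "si Int {x. 0 <= h x} = convex_cone hull V'"
 proof
  have "convex_cone (si Int {x. 0 <= h x})"
   using lin unfolding V(3)
   by (intro convex_cone_Int convex_cone_convex_cone_hull convex_coneI) (auto simp: linear_0 linear_add linear_scale)
  moreover have "V' <= si Int {x. 0 <= h x}"
   using zc unfolding V'_def P_def Z_def V(3) by (auto intro: hull_inc)
  ultimately show "convex_cone hull V' <= si Int {x. 0 <= h x}" by (rule convex_cone_hull_minimal)
  show "si Int {x. 0 <= h x} <= convex_cone hull V'"
  proof
   fix x assume "x:si Int {x. 0 <= h x}"
   then obtain c where c: "x = (\<Sum>v\<in>V. c v *R v)" "ALL v:V. 0 <= c v" and hx: "0 <= h x"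
    unfolding V(3) convex_cone_hull_finite[OF V(1)] by blast
   have VPMZ: "V = Z Un (P Un M)" "Z Int (P Un M) = {}" "P Int M = {}" by (auto simp: P_def M_def Z_def)
   have split: "sum f V = sum f Z + (sum f P + sum f M)" for f :: "'a => 'b::comm_monoid_add"
    using fin VPMZ by (metis finite_Un sum.union_disjoint)
   define p where "p = (\<Sum>u\<in>P. c u * h u)"
   define n where "n = (\<Sum>w\<in>M. c w * (- h w))"
   have "h x = (\<Sum>v\<in>V. c v * h v)" unfolding c(1) using lin by (simp add: linear_sum linear_scale)
   also have "... = p - n" unfolding split p_def n_def by (simp add: Z_def sum_negf)
   finally have pn: "n <= p" using hx by simp
   have n0: "n >= 0" unfolding n_def using c by (intro sum_nonneg) (auto simp: M_def mult_nonneg_nonpos)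
   note cc = convex_cone_convex_cone_hull[of V']
   have Zin: "(\<Sum>v\<in>Z. c v *R v):convex_cone hull V'"
    using c by (intro convex_cone_sum[OF cc] convex_cone_hull_mul hull_inc) (auto simp: V'_def Z_def)
   have Pin: "(\<Sum>v\<in>P. c v *R v):convex_cone hull V'"
    using c by (intro convex_cone_sum[OF cc] convex_cone_hull_mul hull_inc) (auto simp: V'_def P_def)
   show "x:convex_cone hull V'"
   proof (cases "n = 0")
    case True
    hence "ALL w:M. c w * (- h w) = 0" unfolding n_def using fin c
     by (subst (asm) sum_nonneg_eq_0_iff) (auto simp: M_def mult_nonneg_nonpos)
    hence "ALL w:M. c w = 0" by (auto simp: M_def)
    hence "x = (\<Sum>v\<in>Z. c v *R v) + (\<Sum>v\<in>P. c v *R v)" unfolding c(1) split by simp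
    thus ?thesis using Zin Pin convex_cone_add[OF cc] by simp
   next
    case False
    hence p: "p > 0" "n > 0" using n0 pn by auto
    \<comment> \<open>The pair of \<open>u\<close> and \<open>w\<close> gets weight
      \<open>c u * c w / p\<close>. Then \<open>y\<close> contains the whole part over
      \<open>M\<close> and the fraction \<open>n / p\<close> of the part over \<open>P\<close>, and
      \<open>n <= p\<close> leaves a nonnegative rest.\<close>
    define y where "y = (\<Sum>u\<in>P. \<Sum>w\<in>M. (c u * c w / p) *R z (u, w))"
    have yin: "y:convex_cone hull V'"
     unfolding y_def using c p
     by (intro convex_cone_sum[OF cc] convex_cone_hull_mul hull_inc) (auto simp: V'_def P_def M_def)
    have "y = (\<Sum>u\<in>P. \<Sum>w\<in>M. (c u * h u * (c w / p)) *R w) + (\<Sum>u\<in>P. \<Sum>w\<in>M. (c w * (- h w) * (c u / p)) *R u)"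
     unfolding y_def z_def sum.distrib[symmetric] by (intro sum.cong refl) (simp add: algebra_simps)
    also have "(\<Sum>u\<in>P. \<Sum>w\<in>M. (c u * h u * (c w / p)) *R w) = (\<Sum>w\<in>M. (p * (c w / p)) *R w)"
     by (subst sum.swap) (simp only: p_def sum_distrib_right scaleR_sum_left)
    also have "... = (\<Sum>w\<in>M. c w *R w)" using p by simp
    also have "(\<Sum>u\<in>P. \<Sum>w\<in>M. (c w * (- h w) * (c u / p)) *R u) = (\<Sum>u\<in>P. (n * (c u / p)) *R u)"
     by (simp only: n_def sum_distrib_right scaleR_sum_left)
    also have "... = (n / p) *R (\<Sum>u\<in>P. c u *R u)" by (simp add: scaleR_sum_right)
    finally have y: "y = (\<Sum>w\<in>M. c w *R w) + (n / p) *R (\<Sum>u\<in>P. c u *R u)" .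
    have "x = (\<Sum>v\<in>Z. c v *R v) + ((1 - n / p) *R (\<Sum>u\<in>P. c u *R u) + y)"
     unfolding c(1) split y by (simp add: algebra_simps)
    also have "...:convex_cone hull V'"
     using Zin Pin yin p pn by (intro convex_cone_add[OF cc] convex_cone_hull_mul) auto
    finally show ?thesis .
   qed
  qed
 qed
 moreover have "finite V'" "V' <= N" using fin V zc by (auto simp: V'_def P_def Z_def)
 ultimately show ?thesis unfolding rational_cone_def by blast
qed

lemma rational_cone_halfspace_neg:
 assumes "add_subgroup N" "rational_cone N si" "int_form N h"
 shows "rational_cone N (si Int {x. h x <= 0})"
 using rational_cone_halfspace[OF assms(1,2) int_form_uminus[OF assms(3)]] by simp

lemma rational_cone_hyperplane:
 assumes "add_subgroup N" "rational_cone N si" "int_form N h"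
 shows "rational_cone N (si Int {x. h x = 0})"
proof -
 have "si Int {x. h x = 0} = (si Int {x. 0 <= h x}) Int {x. h x <= 0}" by auto
 thus ?thesis using rational_cone_halfspace rational_cone_halfspace_neg assms by metis
qed

section \<open>Fans, hyperplane cuts and blow-ups\<close>

lemma rational_fan_iff:
 "rational_fan N Si <-> is_lattice N & finite Si & Si ~= {} &
   (ALL si:Si. rational_cone N si & strongly_convex si) &
   (ALL si:Si. ALL ta. cface ta si --> ta:Si) & (ALL si:Si. ALL si':Si. cface (si Int si') si)" (is "?L = ?R")
proof -
 have *: "cone_face ta si = cface ta si" if "ALL si:Si. rational_cone N si & strongly_convex si" "si:Si" for ta si
  using that cone_face_iff rational_cone_convex_cone by blast
 show ?thesis
 proof
  assume L: ?L
  hence "ALL si:Si. rational_cone N si & strongly_convex si" unfolding rational_fan_def by blast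
  from *[OF this] show ?R using L unfolding rational_fan_def by auto
 next
  assume R: ?R
  hence r: "ALL si:Si. rational_cone N si & strongly_convex si" by blast
  have "cone_face (si Int si') si & cone_face (si Int si') si'" if "si:Si" "si':Si" for si si'
   using R that *[OF r] by (metis Int_commute)
  thus ?L using R *[OF r] unfolding rational_fan_def by auto
 qed
qed

lemma strongly_convexD: "strongly_convex si ==> x:si ==> - x:si ==> x = 0"
 unfolding strongly_convex_def by (metis IntI image_eqI minus_minus singletonD)

lemma strongly_convexI:
 "convex_cone si ==> (!!x. x:si ==> - x:si ==> x = 0) ==> strongly_convex si"
 unfolding strongly_convex_def using convex_cone_contains_0 by fastforce

lemma strongly_convex_subset:
 "strongly_convex si ==> convex_cone ta ==> ta <= si ==> strongly_convex ta"
 by (rule strongly_convexI) (auto dest: strongly_convexD)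

lemma rational_fanI:
 assumes "is_lattice N" "finite Si" "Si ~= {}"
  and "!!si. si:Si ==> rational_cone N si" "!!si. si:Si ==> strongly_convex si"
  and "!!si ta. si:Si ==> cface ta si ==> ta:Si"
  and "!!si si'. si:Si ==> si':Si ==> cface (si Int si') si"
 shows "rational_fan N Si"
 unfolding rational_fan_iff using assms by blast

lemma
 assumes "rational_fan N Si"
 shows fan_lattice: "is_lattice N" and fan_finite: "finite Si" and fan_nonempty: "Si ~= {}"
  and fan_rational: "si:Si ==> rational_cone N si" and fan_strongly: "si:Si ==> strongly_convex si"
  and fan_face: "si:Si ==> cface ta si ==> ta:Si"
  and fan_Int: "si:Si ==> si':Si ==> cface (si Int si') si"
 using assms unfolding rational_fan_iff by blast+

lemma fan_cone: "rational_fan N Si ==> si:Si ==> convex_cone si"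
 using fan_rational rational_cone_convex_cone by blast

lemma fan_Int_in: "rational_fan N Si ==> si:Si ==> si':Si ==> si Int si':Si"
 using fan_Int fan_face by blast

lemma fan_subset_cface: "rational_fan N Si ==> si:Si ==> ta:Si ==> ta <= si ==> cface ta si"
 using fan_Int[of N Si si ta] by (simp add: Int_absorb1)

lemma cface_zero: "convex_cone si ==> strongly_convex si ==> cface {0} si"
 by (rule cfaceI) (auto simp: convex_cone_contains_0 add_eq_0_iff dest: strongly_convexD)

lemma fan_support_span: "rational_fan N Si ==> \<Union>Si <= span N"
 using fan_rational rational_cone_span by blast

lemma fan_rint:
 assumes "rational_fan N Si" "si:Si" "x:si"
 obtains ta where "ta:Si" "ta <= si" "x:rint ta"
 using that[of "min_face si x"] assms fan_cone fan_face min_face_cface rint_min_face cface_subset by metis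

lemma fan_rint_subset:
 assumes "rational_fan N Si" "si:Si" "ta:Si" "x:rint ta" "x:si" shows "ta <= si"
 using rint_cface_subset[OF fan_cone[OF assms(1,3)] assms(4,5) fan_Int[OF assms(1,3,2)]] .

text \<open>The minimal face of the exit point does not contain \<open>v\<close>, since otherwise
  the motion could continue. Writing \<open>x\<close> as exit point plus a multiple of
  \<open>v\<close> is what makes the cones of a blow-up cover the old support.\<close>

lemma fan_exit:
 assumes f: "rational_fan N Si" and e: "et:Si" "x:et" "v:et" "v ~= 0"
 obtains a ta where "0 <= a" "ta:Si" "ta <= et" "v~:ta" "x - a *R v:ta"
proof -
 note c = fan_cone[OF f e(1)]
 have "- v~:et" using strongly_convexD[OF fan_strongly[OF f e(1)]] e by blast
 then obtain a where a: "a >= 0" "x - a *R v:et" "!!d. d > 0 ==> x - a *R v - d *R v~:et"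
  using cone_exit[OF fan_lattice[OF f] fan_rational[OF f e(1)] e(2,3)] by blast
 show ?thesis
  using a min_face_self[OF c a(2)] fan_face[OF f e(1) min_face_cface[OF c a(2)]]
  by (intro that[of a "min_face et (x - a *R v)"]) (auto simp: min_face_def)
qed

lemma rational_cface_rint:
 assumes "add_subgroup N" "rational_cone N C" "cface F C"
 obtains x where "x:C" "F = min_face C x"
proof -
 obtain x where x: "x:rint F" using rational_cone_rint rational_cone_cface assms by metis
 thus ?thesis
  using that[of x] min_face_eq[OF rational_cone_convex_cone[OF assms(2)] assms(3) x] rint_subset cface_subset assms(3) by blast
qed

subsection \<open>Cutting a fan by a hyperplane\<close>

text \<open>The hyperplane is included so that cutting produces a collection closed under
  faces.\<close>

definition halves :: "('v => real) => 'v set set" where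
 "halves h = {{x. 0 <= h x}, {x. h x <= 0}, {x. h x = 0}}"

definition cut :: "('v => real) => 'v set set => 'v set set" where
 "cut h Si = {si Int A | si A. si:Si & A:halves h}"

lemma halves_uminus: "halves (%x. - h x) = halves h"
 unfolding halves_def by auto

lemma halves_cone: "linear h ==> A:halves h ==> convex_cone A"
 unfolding halves_def by (auto intro!: convex_coneI simp: linear_0 linear_add linear_scale mult_nonneg_nonpos)

lemma cface_hyperplane:
 assumes h: "linear h" and si: "convex_cone si" and A: "A:halves h"
 shows "cface (si Int {x. h x = 0}) (si Int A)"
proof (rule cfaceI)
 show "convex_cone (si Int {x. h x = 0})" using halves_cone[OF h, of "{x. h x = 0}"] si
  by (auto simp: halves_def intro: convex_cone_Int)
qed (use A h in \<open>auto simp: halves_def linear_add\<close>)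

lemma small_step:
 assumes "0 < e" "0 < c" "0 <= b" obtains d :: real where "0 < d" "d <= e" "d * b <= c"
proof (rule that[of "min e (c / (1 + b))"])
 have "min e (c / (1 + b)) * b <= c / (1 + b) * (1 + b)" using assms by (intro mult_mono) auto
 thus "min e (c / (1 + b)) * b <= c" using assms by simp
qed (use assms in auto)

text \<open>If \<open>h x\<close> is positive, the half-space imposes nothing near \<open>x\<close>.
  If it is zero, a vector of the half-space can be subtracted from \<open>x\<close> only if it lies
  on the hyperplane.\<close>

lemma min_face_halfspace:
 assumes h: "linear h" and si: "convex_cone si" and x: "x:si" "0 <= h x"
 shows "EX A:halves h. min_face (si Int {x. 0 <= h x}) x = min_face si x Int A"
proof (cases "h x = 0")
 case True
 have "min_face (si Int {x. 0 <= h x}) x = min_face si x Int {x. h x = 0}"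
  using True h by (auto simp: min_face_def linear_diff linear_scale mult_le_0_iff)
 thus ?thesis by (auto simp: halves_def)
next
 case False
 have "y:min_face (si Int {x. 0 <= h x}) x" if y: "y:min_face si x" "0 <= h y" for y
 proof -
  obtain e where e: "e > 0" "x - e *R y:si" "y:si" using y(1) by (auto simp: min_face_def)
  obtain d where d: "0 < d" "d <= e" "d * h y <= h x" using small_step[of e "h x" "h y"] e y False x by auto
  thus ?thesis using cone_shrink[OF si x(1) e(2), of d] e y h
   unfolding min_face_def by (auto simp: linear_diff linear_scale)
 qed
 hence "min_face (si Int {x. 0 <= h x}) x = min_face si x Int {x. 0 <= h x}" by (auto simp: min_face_def)
 thus ?thesis by (auto simp: halves_def)
qed

lemma min_face_cut:
 assumes h: "linear h" and si: "convex_cone si" and x: "x:si Int A" and A: "A:halves h"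
 shows "EX B:halves h. min_face (si Int A) x = min_face si x Int B"
proof -
 consider "A = {x. 0 <= h x}" | "A = {x. h x <= 0}" | "A = {x. h x = 0}" using A by (auto simp: halves_def)
 thus ?thesis
 proof cases
  case 1 thus ?thesis using min_face_halfspace[OF h si] x by auto
 next
  case 2
  thus ?thesis using min_face_halfspace[OF linear_compose_neg[OF h] si, of x] x
   unfolding halves_uminus by auto
 next
  case 3
  have "min_face (si Int A) x = min_face si x Int A"
   using x 3 h by (auto simp: min_face_def linear_diff linear_scale)
  thus ?thesis using A by blast
 qed
qed

lemma rational_cone_halves:
 "add_subgroup N ==> rational_cone N si ==> int_form N h ==> A:halves h ==> rational_cone N (si Int A)"
 unfolding halves_def
 using rational_cone_halfspace rational_cone_halfspace_neg rational_cone_hyperplane by blast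

text \<open>Every face of a rational cone is the minimal face of some point, so
  \<open>min_face_cut\<close> settles closure under faces. Two halves meet in the first of them or
  in the hyperplane, which cuts out a face of every cut cone.\<close>

lemma cut_fan:
 assumes f: "rational_fan N Si" and h: "int_form N h"
 shows "rational_fan N (cut h Si)"
proof (rule rational_fanI)
 note lin = int_form_linear[OF h]
 show N: "is_lattice N" using f by (rule fan_lattice)
 have "cut h Si = (%(si, A). si Int A) ` (Si \<times> halves h)" unfolding cut_def by auto
 thus "finite (cut h Si)" using fan_finite[OF f] by (simp add: halves_def)
 show "cut h Si ~= {}" using fan_nonempty[OF f] unfolding cut_def halves_def by blast
 have rat: "rational_cone N (si Int A)" if "si:Si" "A:halves h" for si A
  using rational_cone_halves[OF is_lattice_add_subgroup[OF N] fan_rational[OF f] h] that by blast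
 fix C assume "C:cut h Si"
 then obtain si A where C: "C = si Int A" "si:Si" "A:halves h" unfolding cut_def by blast
 show rC: "rational_cone N C" using rat C by blast
 show "strongly_convex C"
  using strongly_convex_subset[OF fan_strongly[OF f C(2)] rational_cone_convex_cone[OF rC]] C by blast
 {
  fix F assume F: "cface F C"
  then obtain x where x: "x:C" "F = min_face C x"
   using rational_cface_rint[OF is_lattice_add_subgroup[OF N] rC] by blast
  hence xC: "x:si Int A" using C by blast
  then obtain B where B: "B:halves h" "F = min_face si x Int B"
   using min_face_cut[OF lin fan_cone[OF f C(2)] xC C(3)] x(2) unfolding C(1) by metis
  moreover have "min_face si x:Si"
   using fan_face[OF f C(2) min_face_cface[OF fan_cone[OF f C(2)]]] xC by blast
  ultimately show "F:cut h Si" unfolding cut_def by blast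
 }
 fix C' assume "C':cut h Si"
 then obtain si' B where C': "C' = si' Int B" "si':Si" "B:halves h" unfolding cut_def by blast
 have i: "cface (si Int si') si" using fan_Int[OF f C(2) C'(2)] .
 have "A Int B = A | A Int B = {x. h x = 0}" using C(3) C'(3) unfolding halves_def by auto
 thus "cface (C Int C') C"
 proof
  assume "A Int B = A"
  hence "C Int C' = (si Int si') Int A" using C C' by blast
  thus ?thesis using cface_Int_cone[OF i halves_cone[OF lin C(3)]] C by simp
 next
  assume "A Int B = {x. h x = 0}"
  hence "C Int C' = (si Int si') Int {x. h x = 0}" using C C' by blast
  moreover have "cface ((si Int si') Int {x. h x = 0}) (si Int {x. h x = 0})"
   by (rule cface_Int_cone[OF i halves_cone[OF lin]]) (simp add: halves_def)
  ultimately show ?thesis using cface_trans cface_hyperplane[OF lin fan_cone[OF f C(2)] C(3)] C by metis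
 qed
qed

lemma cut_support: "\<Union>(cut h Si) = \<Union>Si"
proof
 show "\<Union>(cut h Si) <= \<Union>Si" unfolding cut_def by blast
 show "\<Union>Si <= \<Union>(cut h Si)"
 proof safe
  fix x si assume *: "x:si" "si:Si"
  have "x:si Int {x. 0 <= h x} | x:si Int {x. h x <= 0}" using * by auto
  thus "x:\<Union>(cut h Si)" using * unfolding cut_def halves_def by blast
 qed
qed

definition uncrossed :: "('v => real) => 'v set set => bool" where
 "uncrossed h Si <-> (ALL si:Si. (ALL x:si. 0 <= h x) | (ALL x:si. h x <= 0))"

lemma uncrossed_half:
 assumes "uncrossed h Si" "si:Si" obtains A where "A:halves h" "si <= A"
proof -
 have "(si <= {x. 0 <= h x}) | (si <= {x. h x <= 0})" using assms unfolding uncrossed_def by blast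
 thus ?thesis using that unfolding halves_def by blast
qed

lemma uncrossed_cut: "uncrossed h (cut h Si)"
 unfolding uncrossed_def cut_def halves_def by auto

lemma uncrossed_cut_other: "uncrossed k Si ==> uncrossed k (cut h Si)"
 unfolding uncrossed_def cut_def by blast

text \<open>A cone on one side of the hyperplane meets it in a face, so every piece is already a
  cone of the fan.\<close>

lemma cut_uncrossed:
 assumes f: "rational_fan N Si" and h: "linear h" and u: "uncrossed h Si" shows "cut h Si = Si"
proof
 have 0: "si Int {x. h x = 0}:Si" if s: "si:Si" for si
 proof -
  obtain A where A: "A:halves h" "si <= A" using uncrossed_half[OF u s] .
  hence "cface (si Int {x. h x = 0}) si"
   using cface_hyperplane[OF h fan_cone[OF f s] A(1)] by (simp add: Int_absorb2)
  thus ?thesis using fan_face[OF f s] by blast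
 qed
 show "Si <= cut h Si"
 proof
  fix si assume s: "si:Si"
  obtain A where A: "A:halves h" "si <= A" using uncrossed_half[OF u s] .
  hence "si = si Int A" by blast
  thus "si:cut h Si" using s A(1) unfolding cut_def by blast
 qed
 show "cut h Si <= Si"
 proof
  fix C assume "C:cut h Si"
  then obtain si A where C: "C = si Int A" "si:Si" "A:halves h" unfolding cut_def by blast
  have "C = si | C = si Int {x. h x = 0}"
   using u C unfolding uncrossed_def halves_def by (auto intro: order_antisym)
  thus "C:Si" using 0 C by auto
 qed
qed

subsection \<open>Blow-ups\<close>

definition join :: "'v::real_vector set => 'v => 'v set" where
 "join ta v = {x + t *R v | x t. x:ta & 0 <= t}"

text \<open>
 The blow-up at the ray of \<open>v\<close>; the cone containing \<open>v\<close> in its relative interior is determined by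
 \<open>v\<close>, and a cone of the fan contains it iff it contains \<open>v\<close>.
\<close>

definition blow :: "'v::real_vector set set => 'v => 'v set set" where
 "blow Si v = {et:Si. v~:et} Un {join ta v | ta. ta:Si & v~:ta & (EX et:Si. v:et & ta <= et)}"

lemma blow_old: "et:Si ==> v~:et ==> et:blow Si v"
 and blow_join: "ta:Si ==> v~:ta ==> et:Si ==> v:et ==> ta <= et ==> join ta v:blow Si v"
 unfolding blow_def by blast+

lemma join_hull: "join (convex_cone hull V) v = convex_cone hull (insert v V)"
 unfolding join_def convex_cone_hull_insert ..

lemma join_superset: "ta <= join ta v"
 unfolding join_def by force

lemma join_apex: "convex_cone ta ==> v:join ta v"
 unfolding join_def using convex_cone_contains_0 by (intro CollectI exI[of _ 0] exI[of _ 1]) auto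

lemma join_cone: "convex_cone ta ==> convex_cone (join ta v)"
 using join_hull[of ta v] by (metis convex_cone_convex_cone_hull hull_same)

lemma join_subset: "convex_cone et ==> ta <= et ==> v:et ==> join ta v <= et"
 unfolding join_def by (auto intro!: convex_cone_add convex_cone_scaleR)

lemma join_mem: "x:ta ==> 0 <= t ==> x + t *R v:join ta v"
 unfolding join_def by blast

lemma rational_join: "rational_cone N ta ==> v:N ==> rational_cone N (join ta v)"
 unfolding rational_cone_def by (metis finite_insert insert_subset join_hull)

text \<open>If \<open>ta\<close> is a face of \<open>et\<close> and \<open>v \<in> et - ta\<close>, no multiple of \<open>v\<close> is a difference of points of \<open>ta\<close> and \<open>et\<close>.\<close>

lemma join_unique:
 assumes "convex_cone et" "cface ta et" "v:et" "v~:ta" "x:et" "x + t *R v:ta" "0 <= t"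
 shows "t = 0"
proof (rule ccontr)
 assume "t ~= 0"
 hence t: "t > 0" using assms by simp
 have "t *R v:ta" using cfaceD2[OF assms(2,5) _ assms(6)] convex_cone_scaleR[OF assms(1,7,3)] by blast
 thus False using cface_scale[OF assms(2) _ t] assms(4) by blast
qed

lemma cface_join_base:
 assumes e: "convex_cone et" "cface ta et" "v:et" "v~:ta" shows "cface ta (join ta v)"
proof (rule cface_mono[OF e(2) join_superset])
 show "join ta v <= et" using join_subset[OF e(1) cface_subset[OF e(2)] e(3)] .
qed

lemma join_param_unique:
 assumes e: "convex_cone et" "cface ta et" "v:et" "v~:ta"
  and x: "x:ta" "y:ta" "x + s *R v = y + t *R v" "0 <= s" "0 <= t"
 shows "x = y & s = t"
proof -
 have "s - t = 0" if "s >= t" "x:ta" "y:ta" "x + s *R v = y + t *R v" for x y s t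
 proof (rule join_unique[OF e(1,2,3,4)])
  show "x:et" using that cface_subset[OF e(2)] by blast
  have "x + (s - t) *R v = y" using that(4) by (simp add: algebra_simps)
  thus "x + (s - t) *R v:ta" using that by simp
 qed (use that in simp)
 from this[of t s x y] this[of s t y x] have "s = t" using x by (metis eq_iff_diff_eq_0 linear)
 thus ?thesis using x by simp
qed

lemma min_face_join:
 assumes e: "convex_cone et" "cface ta et" "v:et" "v~:ta" and x: "x:ta" and t: "0 < t"
 shows "min_face (join ta v) (x + t *R v) = join (min_face ta x) v"
proof
 note tac = cface_cone[OF e(2)]
 show "min_face (join ta v) (x + t *R v) <= join (min_face ta x) v"
 proof
  fix w assume "w:min_face (join ta v) (x + t *R v)"
  then obtain d where d: "w:join ta v" "d > 0" "x + t *R v - d *R w:join ta v" unfolding min_face_def by blast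
  obtain y b where w: "w = y + b *R v" "y:ta" "0 <= b" using d(1) unfolding join_def by blast
  obtain z c where z: "x + t *R v - d *R w = z + c *R v" "z:ta" "0 <= c" using d(3) unfolding join_def by blast
  have "x = (z + d *R y) & t = c + d * b"
  proof (rule join_param_unique[OF e x])
   show "z + d *R y:ta" using z w d by (intro convex_cone_add[OF tac] convex_cone_scaleR[OF tac]) auto
   have "x + t *R v = z + c *R v + d *R w" using z(1) by (simp add: algebra_simps)
   thus "x + t *R v = z + d *R y + (c + d * b) *R v" unfolding w(1) by (simp add: algebra_simps)
  qed (use t z w d in auto)
  hence "x - d *R y:ta" using z by simp
  hence "y:min_face ta x" using w d unfolding min_face_def by blast
  thus "w:join (min_face ta x) v" using w join_mem by blast
 qed
 show "join (min_face ta x) v <= min_face (join ta v) (x + t *R v)"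
 proof
  fix w assume "w:join (min_face ta x) v"
  then obtain y b where w: "w = y + b *R v" "y:min_face ta x" "0 <= b" unfolding join_def by blast
  obtain d where d: "d > 0" "x - d *R y:ta" "y:ta" using w(2) unfolding min_face_def by blast
  obtain m where m: "0 < m" "m <= d" and mb: "m * b <= t" using small_step[OF d(1) t w(3)] .
  have "x - m *R y:ta" using cone_shrink[OF tac x d(2)] m by simp
  hence "(x - m *R y) + (t - m * b) *R v:join ta v" using mb by (intro join_mem) auto
  hence "x + t *R v - m *R w:join ta v" unfolding w(1) by (simp add: algebra_simps)
  moreover have "w:join ta v" using w d join_mem by blast
  ultimately show "w:min_face (join ta v) (x + t *R v)" using m unfolding min_face_def by blast
 qed
qed

lemma cface_join:
 assumes e: "convex_cone et" "cface ta et" "v:et" "v~:ta" and g: "cface ga ta"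
 shows "cface (join ga v) (join ta v)"
proof (rule cfaceI)
 show "join ga v <= join ta v" using cface_subset[OF g] unfolding join_def by blast
 show "convex_cone (join ga v)" using join_cone cface_cone g by blast
 fix a b assume "a:join ta v" "b:join ta v" and ab: "a + b:join ga v"
 then obtain x s y t where *: "a = x + s *R v" "b = y + t *R v" "x:ta" "y:ta" "0 <= s" "0 <= t"
  unfolding join_def by blast
 obtain z u where z: "a + b = z + u *R v" "z:ga" "0 <= u" using ab unfolding join_def by blast
 have "x + y = z & s + t = u"
 proof (rule join_param_unique[OF e])
  show "x + y:ta" using * by (intro convex_cone_add cface_cone[OF e(2)])
  show "z:ta" using z cface_subset[OF g] by blast
  show "x + y + (s + t) *R v = z + u *R v" using z(1) unfolding *(1,2) by (simp add: algebra_simps)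
 qed (use * z in auto)
 hence "x:ga" using cfaceD1[OF g *(3,4)] z by simp
 thus "a:join ga v" using * join_mem by blast
qed

lemma blow_cases:
 assumes "C:blow Si v"
 obtains "C:Si" "v~:C"
 | ta et where "C = join ta v" "ta:Si" "v~:ta" "et:Si" "v:et" "ta <= et"
 using assms unfolding blow_def by blast

lemma fan_join_unique:
 assumes f: "rational_fan N Si" and e: "et:Si" "v:et" "x:et"
  and g: "ga:Si" "v~:ga" "x + t *R v:ga" and t: "0 <= t"
 shows "t = 0"
proof (rule join_unique[OF fan_cone[OF f e(1)] fan_Int[OF f e(1) g(1)] e(2) _ e(3) _ t])
 show "x + t *R v:et Int ga"
  using g e t by (auto intro!: convex_cone_add[OF fan_cone[OF f]] convex_cone_scaleR[OF fan_cone[OF f]])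
qed (use g in blast)

text \<open>If a point \<open>x + t *R v\<close> of the join with positive \<open>t\<close> lay in
  \<open>ga\<close>, the face \<open>et Int ga\<close> of \<open>et\<close> would contain the
  summand \<open>t *R v\<close>, hence \<open>v\<close>.\<close>

lemma fan_Int_join:
 assumes f: "rational_fan N Si" and g: "ga:Si" "v~:ga" and e: "et:Si" "v:et" "ta <= et"
 shows "ga Int join ta v = ga Int ta"
proof -
 have "t = 0" if "x:ta" "0 <= t" "x + t *R v:ga" for x t
  using fan_join_unique[OF f e(1,2) _ g] that e(3) by blast
 thus ?thesis using join_superset[of ta v] unfolding join_def by force
qed

text \<open>The decomposition into a base point and a multiple of \<open>v\<close> is unique even
  between two joins, since different multiples would put \<open>v\<close> into one of the
  bases.\<close>

lemma join_Int_join: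
 assumes f: "rational_fan N Si"
  and 1: "ta:Si" "v~:ta" "et:Si" "v:et" "ta <= et" and 2: "ta':Si" "v~:ta'" "et':Si" "v:et'" "ta' <= et'"
 shows "join ta v Int join ta' v = join (ta Int ta') v"
proof -
 have *: "x = y & s = t" if *: "x:ta" "0 <= s" "y:ta'" "0 <= t" "x + s *R v = y + t *R v" for x y s t
 proof -
  have "x + (s - t) *R v = y" "y + (t - s) *R v = x" using *(5) by (simp_all add: algebra_simps)
  hence "s = t"
   using fan_join_unique[OF f 1(3,4) _ 2(1,2), of x "s - t"] fan_join_unique[OF f 2(3,4) _ 1(1,2), of y "t - s"] 1(5) 2(5) *
   by (cases "t <= s") auto
  thus ?thesis using *(5) by simp
 qed
 show ?thesis
 proof (intro equalityI subsetI)
  fix z assume "z:join ta v Int join ta' v"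
  then obtain x s y t where "z = x + s *R v" "z = y + t *R v" "x:ta" "y:ta'" "0 <= s" "0 <= t" unfolding join_def by blast
  thus "z:join (ta Int ta') v" using *[of x s y t] join_mem[of x "ta Int ta'" s v] by (metis IntI)
 qed (auto simp: join_def)
qed

lemma blow_refines:
 assumes "rational_fan N Si" "C:blow Si v" shows "EX et:Si. C <= et"
 using assms(2) by (rule blow_cases) (use join_subset fan_cone[OF assms(1)] in blast)+

lemma blow_support:
 assumes f: "rational_fan N Si" and v: "v ~= 0" shows "\<Union>(blow Si v) = \<Union>Si"
proof
 show "\<Union>(blow Si v) <= \<Union>Si" using blow_refines[OF f] by blast
 show "\<Union>Si <= \<Union>(blow Si v)"
 proof
  fix x assume "x:\<Union>Si"
  then obtain et where e: "et:Si" "x:et" by blast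
  show "x:\<Union>(blow Si v)"
  proof (cases "v:et")
   case True
   obtain a ta where a: "0 <= a" "ta:Si" "ta <= et" "v~:ta" "x - a *R v:ta" using fan_exit[OF f e True v] .
   thus ?thesis using join_mem[OF a(5,1), of v] blow_join[OF a(2,4) e(1) True a(3)] by auto
  qed (use e blow_old in blast)
 qed
qed

text \<open>A face of a join is the minimal face of some \<open>x + t *R v\<close>: the join of the
  minimal face of \<open>x\<close> if \<open>t\<close> is positive, and that minimal face itself if
  \<open>t = 0\<close>. Intersections are given by \<open>fan_Int_join\<close> and
  \<open>join_Int_join\<close>.\<close>

lemma blow_fan:
 assumes f: "rational_fan N Si" and v: "v:N" "v ~= 0"
 shows "rational_fan N (blow Si v)"
proof (rule rational_fanI)
 note N = fan_lattice[OF f]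
 note sub = fan_subset_cface[OF f] and c = fan_cone[OF f]
 show "is_lattice N" by (rule N)
 have "blow Si v <= Si Un (%ta. join ta v) ` Si" unfolding blow_def by blast
 thus "finite (blow Si v)" using fan_finite[OF f] by (simp add: finite_subset)
 show "blow Si v ~= {}" using blow_support[OF f v(2)] fan_nonempty[OF f] c convex_cone_contains_0 by blast
 fix C assume C: "C:blow Si v"
 show rC: "rational_cone N C"
  using C fan_rational[OF f] rational_join[OF _ v(1)] by (blast elim: blow_cases)
 show "strongly_convex C"
  using C by (rule blow_cases) (metis strongly_convex_subset fan_strongly[OF f] join_cone join_subset c)+
 {
  fix F assume F: "cface F C"
  obtain w where w: "w:C" "F = min_face C w"
   using rational_cface_rint[OF is_lattice_add_subgroup[OF N] rC F] .
  from C show "F:blow Si v"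
  proof (cases rule: blow_cases)
   case 1 thus ?thesis using fan_face[OF f _ F] cface_subset[OF F] blow_old by blast
  next
   case (2 ta et)
   note e = c[OF 2(4)] sub[OF 2(4,2,6)] 2(5,3)
   obtain x t where xt: "w = x + t *R v" "x:ta" "0 <= t" using w 2 unfolding join_def by blast
   have mf: "cface (min_face ta x) ta" using min_face_cface c 2 xt by blast
   hence m: "min_face ta x:Si" "v~:min_face ta x" "min_face ta x <= et"
    using fan_face[OF f 2(2)] cface_subset 2(3,6) by blast+
   show ?thesis
   proof (cases "t = 0")
    case False
    hence "F = join (min_face ta x) v" using min_face_join[OF e] w 2 xt by auto
    thus ?thesis using blow_join[OF m(1,2) 2(4,5) m(3)] by simp
   next
    case True
    have "cface (min_face ta x) C" unfolding 2(1) using cface_trans[OF mf cface_join_base[OF e]] .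
    hence "F = min_face ta x"
     using True xt w min_face_eq[OF rational_cone_convex_cone[OF rC] _ rint_min_face[OF c[OF 2(2)] xt(2)]] by simp
    thus ?thesis using blow_old m by simp
   qed
  qed
 }
 fix C' assume C': "C':blow Si v"
 from C show "cface (C Int C') C"
 proof (cases rule: blow_cases)
  case 1
  from C' show ?thesis by (rule blow_cases) (use fan_Int[OF f 1(1)] fan_Int_join[OF f 1] in auto)
 next
  case 1: (2 ta et)
  note e = c[OF 1(4)] sub[OF 1(4,2,6)] 1(5,3)
  from C' show ?thesis
  proof (cases rule: blow_cases)
   case 2: 1
   thus ?thesis using cface_trans[OF fan_Int[OF f 1(2) 2(1)] cface_join_base[OF e]] fan_Int_join[OF f 2 1(4-6)] 1(1)
    by (simp add: Int_commute)
  next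
   case 2
   show ?thesis unfolding 1(1) 2(1) join_Int_join[OF f 1(2-6) 2(2-6)] by (rule cface_join[OF e fan_Int[OF f 1(2) 2(2)]])
  qed
 qed
qed

text \<open>Adding multiples of a vector of the hyperplane does not change the side, so joining with
  \<open>v\<close> commutes with intersecting with a half.\<close>

lemma cut_blow:
 assumes f: "rational_fan N Si" and h: "linear h" and v: "h v = 0"
 shows "cut h (blow Si v) = blow (cut h Si) v"
proof -
 have vA: "v:A" if "A:halves h" for A using that v unfolding halves_def by auto
 have "x + t *R v:A <-> x:A" if "A:halves h" for x t A
  using that v h unfolding halves_def by (auto simp: linear_add linear_scale)
 hence jA: "join ta v Int A = join (ta Int A) v" if "A:halves h" for ta A using that unfolding join_def by blast
 show ?thesis
 proof (intro equalityI subsetI)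
  fix C assume "C:cut h (blow Si v)"
  then obtain D A where D: "C = D Int A" "D:blow Si v" "A:halves h" unfolding cut_def by blast
  from D(2) show "C:blow (cut h Si) v"
  proof (cases rule: blow_cases)
   case 1
   hence "C:cut h Si" "v~:C" using D vA unfolding cut_def by blast+
   thus ?thesis by (rule blow_old)
  next
   case (2 ta et)
   hence "ta Int A:cut h Si" "et Int A:cut h Si" "v:et Int A" "ta Int A <= et Int A" "v~:ta Int A" "C = join (ta Int A) v"
    using D vA jA unfolding cut_def by auto
   thus ?thesis using blow_join by metis
  qed
 next
  fix C assume "C:blow (cut h Si) v"
  thus "C:cut h (blow Si v)"
  proof (cases rule: blow_cases)
   case 1
   then obtain et A where E: "C = et Int A" "et:Si" "A:halves h" unfolding cut_def by blast
   hence "et:blow Si v" using 1 vA blow_old by blast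
   thus ?thesis using E unfolding cut_def by blast
  next
   case (2 T E)
   obtain ta B et A where T: "T = ta Int B" "ta:Si" "B:halves h" and E: "E = et Int A" "et:Si" "A:halves h"
    using 2 unfolding cut_def by blast
   \<comment> \<open>\<open>ta\<close> need not lie in \<open>et\<close>; replacing it by its
     intersection with \<open>et\<close> does not change the cut piece, which lies in
     \<open>et\<close>.\<close>
   have "T = (ta Int et) Int B" using T E 2 by blast
   hence "C = join (ta Int et) v Int B" using 2 jA T by simp
   moreover have "join (ta Int et) v:blow Si v"
    by (rule blow_join[OF fan_Int_in[OF f T(2) E(2)] _ E(2)]) (use 2 T vA E in auto)
   ultimately show ?thesis using T unfolding cut_def by blast
  qed
 qed
qed

text \<open>The number of these pairs is the measure for the subdivision of a fan along a hyperplane.\<close>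

definition crossing_pairs :: "('v::real_vector => real) => 'v set set => ('v set \<times> 'v set) set" where
 "crossing_pairs h Si = {(al, be). al:Si & be:Si & al ~= {0} & be ~= {0} &
   (ALL x:al. x ~= 0 --> 0 < h x) & (ALL x:be. x ~= 0 --> h x < 0) & (EX et:Si. al <= et & be <= et)}"

text \<open>Take a minimal cone with a point \<open>x\<close> where \<open>h\<close> is positive. A
  nonzero \<open>y\<close> in it with \<open>h y <= 0\<close> could be subtracted from
  \<open>x\<close> until a proper face is reached, where \<open>h\<close> is still positive.\<close>

lemma positive_face:
 fixes h :: "'v::real_vector => real"
 assumes f: "rational_fan N Si" and h: "linear h" and si: "si:Si" and x: "x:si" "0 < h x"
 obtains al where "al:Si" "al <= si" "al ~= {0}" "ALL x:al. x ~= 0 --> 0 < h x"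
proof -
 define F where "F = {ta:Si. ta <= si & (EX x:ta. 0 < h x)}"
 have "finite F" "F ~= {}" using fan_finite[OF f] si x by (auto simp: F_def)
 then obtain al where al: "al:F" "!!be. be:F ==> be <= al ==> al = be"
  using finite_has_minimal[of F] by blast
 then obtain x where x: "x:al" "0 < h x" and s: "al:Si" "al <= si" unfolding F_def by blast
 note cc = fan_cone[OF f s(1)]
 show ?thesis
 proof (rule that[OF s])
  show "al ~= {0}"
  proof
   assume "al = {0}"
   hence "x = 0" using x(1) by blast
   thus False using x(2) linear_0[OF h] by simp
  qed
  show "ALL y:al. y ~= 0 --> 0 < h y"
  proof (intro ballI impI, rule ccontr)
   fix y assume y: "y:al" "y ~= 0" "~ 0 < h y"
   have "- y~:al" using strongly_convexD[OF fan_strongly[OF f s(1)] y(1)] y by blast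
   then obtain a where a: "a >= 0" "x - a *R y:al" "!!e. e > 0 ==> x - a *R y - e *R y~:al"
    using cone_exit[OF fan_lattice[OF f] fan_rational[OF f s(1)] x(1) y(1)] by blast
   define be where "be = min_face al (x - a *R y)"
   have be: "cface be al" unfolding be_def using min_face_cface[OF cc a(2)] .
   have "a * h y <= 0" using a y by (simp add: mult_nonneg_nonpos)
   hence "0 < h (x - a *R y)" using x h by (simp add: linear_diff linear_scale)
   moreover have "x - a *R y:be" unfolding be_def using min_face_self[OF cc a(2)] .
   ultimately have "be:F" using fan_face[OF f s(1) be] cface_subset[OF be] s unfolding F_def by blast
   hence "al = be" using al(2) cface_subset[OF be] by blast
   thus False using y a(3) unfolding be_def min_face_def by blast
  qed
 qed
qed

text \<open>Interior lattice points \<open>a\<close> and \<open>b\<close> of a crossing pair are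
  combined to a vector \<open>v\<close> of the hyperplane. A cone containing both contains
  \<open>a + b\<close>, hence the cone \<open>si\<close> around it, hence \<open>v\<close>; so
  neither an old cone without \<open>v\<close> nor the base of a join contains the pair. New cones
  contain \<open>v\<close>, where \<open>h\<close> vanishes, so they belong to no pair.\<close>

lemma crossing_pairs_blow:
 assumes f: "rational_fan N Si" and h: "int_form N h" and u: "~ uncrossed h Si"
 obtains si v where "si:Si" "v:N" "v:rint si" "v ~= 0" "h v = 0"
  "crossing_pairs h (blow Si v) \<subset> crossing_pairs h Si"
proof -
 note lin = int_form_linear[OF h] and c = fan_cone[OF f]
 obtain et x y where e: "et:Si" "x:et" "0 < h x" "y:et" "h y < 0"
  using u unfolding uncrossed_def by (meson not_le)
 obtain al where al: "al:Si" "al <= et" "al ~= {0}" "ALL x:al. x ~= 0 --> 0 < h x"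
  using positive_face[OF f lin e(1-3)] .
 obtain be where be: "be:Si" "be <= et" "be ~= {0}" "ALL x:be. x ~= 0 --> h x < 0"
  using positive_face[OF f linear_compose_neg[OF lin] e(1,4)] e(5) by auto
 have N: "add_subgroup N" using fan_lattice[OF f] is_lattice_add_subgroup by blast
 obtain a where a: "a:N" "a:rint al" using rational_cone_rint[OF N fan_rational[OF f al(1)]] .
 obtain b where b: "b:N" "b:rint be" using rational_cone_rint[OF N fan_rational[OF f be(1)]] .
 have nz: "ga = {0}" if g: "ga:Si" "0:rint ga" for ga
  using rint_cface_subset[OF c[OF g(1)] g(2), of "{0}"]
   cface_zero[OF c[OF g(1)] fan_strongly[OF f g(1)]] convex_cone_contains_0[OF c[OF g(1)]] by auto
 have mem: "a:al" "b:be" using a b rint_subset by blast+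
 have "a ~= 0" "b ~= 0" using nz al be a b by blast+
 hence ha: "0 < h a" "h b < 0" using al(4) be(4) mem by auto
 have ab: "a:et" "b:et" using mem al(2) be(2) by auto
 then obtain si where si: "si:Si" "si <= et" "a + b:rint si"
  using fan_rint[OF f e(1) convex_cone_add[OF c[OF e(1)]]] by metis
 have abs: "a:si" "b:si"
  using cfaceD1[OF fan_subset_cface[OF f e(1) si(1,2)] ab] cfaceD2[OF fan_subset_cface[OF f e(1) si(1,2)] ab] si(3) rint_subset by auto
 define v where "v = (- h b) *R a + h a *R b"
 define m where "m = min (- h b) (h a)"
 have v: "v:N" "h v = 0" unfolding v_def
  using a b int_form_Ints[OF h] by (intro add_subgroup_add[OF N] add_subgroup_scale_Ints[OF N]) (simp_all add: linear_diff[OF lin] linear_scale[OF lin])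
 \<comment> \<open>Splitting off a positive multiple of \<open>a + b\<close> shows that
   \<open>v\<close> lies in the relative interior of \<open>si\<close>.\<close>
 have "m *R (a + b) + ((- h b - m) *R a + (h a - m) *R b):rint si"
  using ha abs si(3) c[OF si(1)] by (intro rint_add rint_scale si(3) convex_cone_add[of si] convex_cone_scaleR) (auto simp: m_def)
 hence vr: "v:rint si" unfolding v_def by (simp add: algebra_simps)
 have v0: "v ~= 0" using nz[OF si(1)] vr abs ha linear_0[OF lin] by auto
 have oldc: "C:Si" if C: "C:blow Si v" and sg: "(ALL x:C. x ~= 0 --> 0 < h x) | (ALL x:C. x ~= 0 --> h x < 0)" for C
  using C by (rule blow_cases) (use join_apex[OF c] sg v v0 in auto)
 have "crossing_pairs h (blow Si v) <= crossing_pairs h Si"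
 proof (rule subrelI)
  fix A B assume *: "(A, B):crossing_pairs h (blow Si v)"
  then obtain C where C: "C:blow Si v" "A <= C" "B <= C" by (auto simp: crossing_pairs_def)
  have "EX ze:Si. A <= ze & B <= ze" using blow_refines[OF f C(1)] C by blast
  thus "(A, B):crossing_pairs h Si" using * oldc unfolding crossing_pairs_def by simp
 qed
 moreover have "(al, be):crossing_pairs h Si" using al be e unfolding crossing_pairs_def by blast
 moreover have "(al, be)~:crossing_pairs h (blow Si v)"
 proof
  assume "(al, be):crossing_pairs h (blow Si v)"
  then obtain C where C: "C:blow Si v" "al <= C" "be <= C" by (auto simp: crossing_pairs_def)
  have contra: False if "ta:Si" "v~:ta" "a:ta" "b:ta" for ta
   using fan_rint_subset[OF f that(1) si(1,3) convex_cone_add[OF c[OF that(1)] that(3,4)]] vr rint_subset that(2) by blast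
  from C(1) show False
  proof (cases rule: blow_cases)
   case 1 thus ?thesis using contra mem C by blast
  next
   case (2 ta ze)
   have "v~:al" "v~:be" using al be v v0 by auto
   hence "a:ta" "b:ta"
    using fan_Int_join[OF f al(1) _ 2(4-6)] fan_Int_join[OF f be(1) _ 2(4-6)] mem C 2(1) by blast+
   thus ?thesis using contra 2 by blast
  qed
 qed
 ultimately show ?thesis using that[OF si(1) v(1) vr v0 v(2)] by blast
qed

lemma finite_crossing_pairs: "finite Si ==> finite (crossing_pairs h Si)"
 by (rule finite_subset[of _ "Si \<times> Si"]) (auto simp: crossing_pairs_def)

text \<open>Cutting by a form of \<open>H\<close> preserves this property. If moreover no form of
  \<open>H\<close> crosses a cone, the fan is determined by its support and \<open>H\<close>, which
  is how two fans become equal.\<close>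

definition halfspace_cut :: "'v::real_vector set => ('v => real) set => 'v set => bool" where
 "halfspace_cut W H C <-> (EX K<=H. EX L<=H. C = {x:W. (ALL h:K. 0 <= h x) & (ALL h:L. h x <= 0)})"

lemma halfspace_cut_halves:
 assumes "halfspace_cut W H C" "h:H" "A:halves h"
 shows "halfspace_cut W H (C Int A)"
proof -
 obtain K L where K: "K <= H" "L <= H" "C = {x:W. (ALL h:K. 0 <= h x) & (ALL h:L. h x <= 0)}"
  using assms(1) unfolding halfspace_cut_def by blast
 have "{x. h x = 0} = {x. 0 <= h x & h x <= 0}" by auto
 then obtain K' L' where L: "K' <= {h}" "L' <= {h}" "A = {x. (ALL h:K'. 0 <= h x) & (ALL h:L'. h x <= 0)}"
  using that[of "{}" "{h}"] that[of "{h}" "{}"] that[of "{h}" "{h}"] assms(3) by (auto simp: halves_def)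
 have "C Int A = {x:W. (ALL h:K Un K'. 0 <= h x) & (ALL h:L Un L'. h x <= 0)}" using K L by auto
 moreover have "K Un K' <= H" "L Un L' <= H" using K L assms by auto
 ultimately show ?thesis unfolding halfspace_cut_def by blast
qed

text \<open>An uncrossed fan of this kind consists of the cells of the hyperplane arrangement.\<close>

lemma uncrossed_fan_cells:
 assumes f: "rational_fan N Si" and u: "!!h. h:H ==> linear h & uncrossed h Si"
  and c: "!!C. C:Si ==> halfspace_cut (span N) H C"
 shows "Si = (%x. {y:span N. ALL h:H. (0 <= h x --> 0 <= h y) & (h x <= 0 --> h y <= 0)}) ` \<Union>Si" (is "_ = ?cell ` _")
proof -
 have eq: "C = ?cell x" if C: "C:Si" "x:rint C" for C x
 proof
  have xC: "x:C" using C rint_subset by blast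
  have "(0 <= h x --> 0 <= h y) & (h x <= 0 --> h y <= 0)" if h: "h:H" and y: "y:C" for h y
  proof -
   obtain e where e: "e > 0" "x - e *R y:C" using C y unfolding rint_def by blast
   have "h (x - e *R y) = h x - e * h y" using u[OF h] by (simp add: linear_diff linear_scale)
   moreover have "(0 <= h y & 0 <= h (x - e *R y)) | (h y <= 0 & h (x - e *R y) <= 0)"
    using u[OF h] C y e unfolding uncrossed_def by blast
   ultimately show ?thesis using e by (smt (verit) mult_pos_pos mult_pos_neg)
  qed
  thus "C <= ?cell x" using C fan_support_span[OF f] by blast
  show "?cell x <= C" using c[OF C(1)] xC unfolding halfspace_cut_def by blast
 qed
 show ?thesis
 proof (intro equalityI subsetI)
  fix C assume C: "C:Si"
  obtain x where "x:rint C"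
   using rational_cone_rint[OF is_lattice_add_subgroup[OF fan_lattice[OF f]] fan_rational[OF f C]] .
  thus "C:?cell ` \<Union>Si" using eq[OF C] C rint_subset by blast
 next
  fix C assume "C:?cell ` \<Union>Si"
  then obtain x E where x: "C = ?cell x" "E:Si" "x:E" by blast
  obtain D where "D:Si" "x:rint D" using fan_rint[OF f x(2,3)] .
  thus "C:Si" using eq x by simp
 qed
qed

section \<open>Invariance under blow-ups and fans with equal support\<close>

context
 fixes N P Q
 assumes step: "!!Si si v. rational_fan N Si ==> \<Union>Si = P ==> si:Si ==> v:N ==> v:rint si ==> v ~= 0 ==> Q Si <-> Q (blow Si v)"
begin

text \<open>Blowing up at a ray of the hyperplane commutes with cutting, so both fans reach a common blow-up.\<close>

lemma cut_equiv:
 assumes h: "int_form N h" and f: "rational_fan N Si" "\<Union>Si = P"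
 shows "Q Si <-> Q (cut h Si)"
 using f
proof (induction "card (crossing_pairs h Si)" arbitrary: Si rule: less_induct)
 case less
 note f = less.prems
 note lin = int_form_linear[OF h]
 show ?case
 proof (cases "uncrossed h Si")
  case True thus ?thesis using cut_uncrossed[OF f(1) lin] by simp
 next
  case False
  obtain si v where v: "si:Si" "v:N" "v:rint si" "v ~= 0" "h v = 0"
   "crossing_pairs h (blow Si v) \<subset> crossing_pairs h Si"
   using crossing_pairs_blow[OF f(1) h False] .
  have "card (crossing_pairs h (blow Si v)) < card (crossing_pairs h Si)"
   using v(6) finite_crossing_pairs[OF fan_finite[OF f(1)]] by (rule psubset_card_mono[rotated])
  hence "Q (blow Si v) <-> Q (cut h (blow Si v))"
   using less.hyps blow_fan[OF f(1) v(2,4)] blow_support[OF f(1) v(4)] f(2) by blast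
  moreover have "Q (cut h Si) <-> Q (blow (cut h Si) v)"
  proof (rule step[OF cut_fan[OF f(1) h] _ _ v(2) _ v(4)])
   show "\<Union> (cut h Si) = P" using f(2) by (simp add: cut_support)
   show "si Int {x. h x = 0}:cut h Si" using v(1) unfolding cut_def halves_def by blast
   show "v:rint (si Int {x. h x = 0})" using v(3,5) lin unfolding rint_def by (auto simp: linear_diff linear_scale)
  qed
  ultimately show ?thesis using step[OF f v(1-4)] cut_blow[OF f(1) lin v(5)] by simp
 qed
qed

lemma fan_refine:
 assumes "finite G" "!!h. h:G ==> int_form N h" and f: "rational_fan N Si" "\<Union>Si = P"
 shows "EX Si'. rational_fan N Si' & \<Union>Si' = P & (Q Si <-> Q Si') & (ALL h:G. uncrossed h Si') &
  (G <= H --> (ALL C:Si. halfspace_cut (span N) H C) --> (ALL C:Si'. halfspace_cut (span N) H C))"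
 using assms(1,2)
proof (induction G rule: finite_induct)
 case empty thus ?case using f by blast
next
 case (insert h G)
 then obtain Si' where s: "rational_fan N Si'" "\<Union>Si' = P" "Q Si <-> Q Si'" "ALL h:G. uncrossed h Si'"
  "G <= H ==> ALL C:Si. halfspace_cut (span N) H C ==> ALL C:Si'. halfspace_cut (span N) H C"
  by auto
 have h: "int_form N h" using insert.prems by simp
 have "ALL C:cut h Si'. halfspace_cut (span N) H C" if "insert h G <= H" "ALL C:Si. halfspace_cut (span N) H C"
  using s(5) that halfspace_cut_halves unfolding cut_def by blast
 moreover have "ALL k:insert h G. uncrossed k (cut h Si')" using s(4) uncrossed_cut uncrossed_cut_other by blast
 ultimately show ?case using cut_fan[OF s(1) h] cut_support[of h Si'] cut_equiv[OF h s(1,2)] s(2,3) by metis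
qed

text \<open>Both fans are cut by all forms that define a cone of either. The results consist of the
  cells of one arrangement inside \<open>P\<close>, so they coincide, and \<open>cut_equiv\<close>
  carries \<open>Q\<close> along the cuts.\<close>

theorem fan_support_equiv:
 assumes f1: "rational_fan N Si\<^sub>1" "\<Union>Si\<^sub>1 = P" and f2: "rational_fan N Si\<^sub>2" "\<Union>Si\<^sub>2 = P"
 shows "Q Si\<^sub>1 <-> Q Si\<^sub>2"
proof -
 have "ALL C:Si\<^sub>1 Un Si\<^sub>2. EX H. finite H & (ALL h:H. int_form N h) & C = {x:span N. ALL h:H. 0 <= h x}"
  by (intro ballI rational_cone_halfspaces[OF fan_lattice[OF f1(1)]]) (use fan_rational[OF f1(1)] fan_rational[OF f2(1)] in blast)
 from bchoice[OF this] obtain HH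
  where "ALL C:Si\<^sub>1 Un Si\<^sub>2. finite (HH C) & (ALL h:HH C. int_form N h) & C = {x:span N. ALL h:HH C. 0 <= h x}" ..
 note HH = bspec[OF this]
 define H where "H = (\<Union>C\<in>Si\<^sub>1 Un Si\<^sub>2. HH C)"
 have fin: "finite H" unfolding H_def using HH by (intro finite_UN_I) (auto simp: fan_finite[OF f1(1)] fan_finite[OF f2(1)])
 have int: "int_form N h" if "h:H" for h using that HH unfolding H_def by blast
 have hc: "halfspace_cut (span N) H C" if "C:Si\<^sub>1 Un Si\<^sub>2" for C
  unfolding halfspace_cut_def using HH[OF that] that by (intro exI[of _ "HH C"] exI[of _ "{}"] conjI) (auto simp: H_def)
 let ?A = "(%x. {y:span N. ALL h:H. (0 <= h x --> 0 <= h y) & (h x <= 0 --> h y <= 0)}) ` P"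
 have "Q Si <-> Q ?A" if f: "rational_fan N Si" "\<Union>Si = P" "Si <= Si\<^sub>1 Un Si\<^sub>2" for Si
 proof -
  obtain Si' where s: "rational_fan N Si'" "\<Union>Si' = P" "Q Si <-> Q Si'" "ALL h:H. uncrossed h Si'" "ALL C:Si'. halfspace_cut (span N) H C"
   using fan_refine[OF fin int f(1,2), of H] hc f(3) by blast
  have "Si' = ?A" unfolding s(2)[symmetric]
   by (rule uncrossed_fan_cells[OF s(1)]) (use s int_form_linear[OF int] in blast)+
  thus ?thesis using s(3) by simp
 qed
 from this[OF f1] this[OF f2] show ?thesis by simp
qed

end

section \<open>Fans with unit weights, stars and isomorphisms\<close>

definition unit_fan :: "'v set => 'v set set => 'v tfan" where
 "unit_fan N Si = \<lparr>lat = N, cones = Si, orient = (%_. 1)\<rparr>"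

lemma unit_fan_simps [simp]: "lat (unit_fan N Si) = N" "cones (unit_fan N Si) = Si" "orient (unit_fan N Si) C = 1"
 by (simp_all add: unit_fan_def)

lemma blow_up_unit_fan:
 assumes f: "rational_fan N Si" and si: "si:Si" and v: "v:rint si"
 shows "blow_up (unit_fan N Si) si (convex_cone hull {v}) = unit_fan N (blow Si v)"
proof -
 have iff: "si <= et <-> v:et" if "et:Si" for et
  using fan_rint_subset[OF f that si v] v rint_subset by blast
 have ray: "convex_cone hull {v} = {t *R v | t. 0 <= t}"
  unfolding convex_cone_hull_finite[OF finite.insertI[OF finite.emptyI]] by auto
 have j: "ta + convex_cone hull {v} = join ta v" for ta
  unfolding ray join_def set_plus_def by blast
 have cf: "cone_face ta et <-> ta:Si & ta <= et" if "et:Si" for ta et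
  using that cone_face_iff[OF fan_cone[OF f that]] fan_face[OF f that] fan_subset_cface[OF f that] cface_subset
  by blast
 have "{et:Si. ~ si <= et} = {et:Si. v~:et}" using iff by blast
 moreover have "(et:Si & si <= et & cone_face ta et & ~ si <= ta) <-> (ta:Si & v~:ta & et:Si & v:et & ta <= et)" for ta et
  using iff cf by metis
 hence "{join ta v | ta et. et:Si & si <= et & cone_face ta et & ~ si <= ta}
  = {join ta v | ta. ta:Si & v~:ta & (EX et:Si. v:et & ta <= et)}" by (simp only:) blast
 ultimately have "{et:Si. ~ si <= et} Un {ta + convex_cone hull {v} | ta et. et:Si & si <= et & cone_face ta et & ~ si <= ta}
   = blow Si v"
  unfolding blow_def j by simp
 thus ?thesis unfolding blow_up_def unit_fan_def by simp
qed

section \<open>Stars and tangent cones\<close>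

definition star :: "('v::real_vector => 'v) => 'v set set => 'v set => 'v set set" where
 "star p Si si = {p ` et | et. et:Si & si <= et}"

lemma star_fan_unit_fan:
 "star_fan (unit_fan N Si) si = unit_fan (quot_map (span si) ` N) (star (quot_map (span si)) Si si)"
 unfolding star_fan_def unit_fan_def star_def Let_def by simp

lemma quot_map_zero_iff: "subspace S ==> quot_map S x = 0 <-> x:S"
 using quot_map(2)[of S] by auto

lemma rational_cone_linear_image:
 "linear p ==> rational_cone N si ==> rational_cone (p ` N) (p ` si)"
 unfolding rational_cone_def
 by (metis convex_cone_hull_linear_image finite_imageI image_mono)

lemma dim_pos: "fin_dim W ==> v:W ==> v ~= 0 ==> 0 < dim W"
proof (rule ccontr)
 assume W: "fin_dim W" "v:W" "v ~= 0" "~ 0 < dim W"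
 obtain B where B: "finite B" "B <= W" "independent B" "span B = span W" "card B = dim W"
  using fin_dim_basis0[OF W(1)] .
 hence "B = {}" using W by simp
 hence "span W = {0}" using B(4) by simp
 thus False using W(2,3) span_base[of v W] by blast
qed

lemma quotient_by_cone:
 assumes N: "is_lattice N" and si: "rational_cone N si" and p: "linear p" "!!x. p x = 0 <-> x:span si"
 shows "is_lattice (p ` N)" and "dim (p ` N) + dim si = dim N"
proof -
 have ss: "span si <= span N" using rational_cone_span[OF si] by (simp add: span_minimal)
 have k: "{x:span N. p x = 0} = span si" using p ss by auto
 show "is_lattice (p ` N)"
  using quotient_lattice[OF N p(1), of "N Int si"] k span_rational_cone[OF si] by simp
 have "dim (p ` span N) + dim {x:span N. p x = 0} = dim (span N)"
  by (rule rank_nullity[OF p(1) subspace_span fin_dim_span[OF fin_dim_lattice[OF N]]])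
 thus "dim (p ` N) + dim si = dim N"
  unfolding k using linear_span_image[OF p(1), of N] by (metis dim_span)
qed

text \<open>Two points with the same image become equal after adding elements of \<open>si\<close>
  to both (\<open>eqE\<close>). All cones involved contain \<open>si\<close>, so the sums stay
  inside, and the face property removes the added summands again.\<close>

lemma star_rational_fan:
 assumes f: "rational_fan N Si" and si: "si:Si" and p: "linear p" "!!x. p x = 0 <-> x:span si"
 shows "rational_fan (p ` N) (star p Si si)"
proof (rule rational_fanI)
 note pd = linear_diff[OF p(1)] linear_add[OF p(1)]
 note sic = fan_cone[OF f si]
 have eqE: "EX a:si. EX b:si. x + a = y + b" if "p x = p y" for x y
 proof -
  have "y - x:span si" using that p(2)[of "y - x"] by (simp add: pd)
  then obtain a b where "y - x = a - b" "a:si" "b:si" unfolding span_convex_cone[OF sic] by blast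
  thus ?thesis by (metis add.commute add_diff_cancel_left' diff_add_cancel diff_diff_eq2)
 qed
 have p0: "p s = 0" if "s:si" for s using p(2) that span_base by blast
 show "is_lattice (p ` N)" using quotient_by_cone[OF fan_lattice[OF f] fan_rational[OF f si] p] by blast
 have "star p Si si <= (%et. p ` et) ` Si" unfolding star_def by blast
 thus "finite (star p Si si)" using fan_finite[OF f] by (simp add: finite_subset)
 show "star p Si si ~= {}" using si unfolding star_def by blast
 have face_image: "cface (p ` ta) (p ` et)" if e: "et:Si" "cface ta et" "si <= ta" for ta et
 proof (rule cfaceI)
  show "p ` ta <= p ` et" using cface_subset[OF e(2)] by blast
  show "convex_cone (p ` ta)" using convex_cone_linear_image cface_cone[OF e(2)] p(1) by blast
  fix a b assume "a:p ` et" "b:p ` et" "a + b:p ` ta"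
  then obtain x y z where *: "a = p x" "b = p y" "x:et" "y:et" "z:ta" "p (x + y) = p z"
   by (auto simp: pd)
  obtain s t where st: "s:si" "t:si" "x + y + s = z + t" using eqE[OF *(6)] by blast
  have "z + t:ta" using * st e by (intro convex_cone_add[OF cface_cone[OF e(2)]]) auto
  hence "x + (y + s):ta" using st(3) by (simp add: add.assoc)
  moreover have "y + s:et" using * st e cface_subset[OF e(2)] by (intro convex_cone_add[OF fan_cone[OF f e(1)]]) auto
  ultimately have "x:ta" using cfaceD1[OF e(2) *(3)] by blast
  thus "a:p ` ta" using * by blast
 qed
 fix C assume "C:star p Si si"
 then obtain et where C: "C = p ` et" "et:Si" "si <= et" unfolding star_def by blast
 note etc = fan_cone[OF f C(2)]
 have siet: "cface si et" using fan_subset_cface[OF f C(2) si C(3)] .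
 show "rational_cone (p ` N) C" unfolding C(1) using rational_cone_linear_image[OF p(1) fan_rational[OF f C(2)]] .
 show "strongly_convex C"
 proof (rule strongly_convexI)
  show "convex_cone C" unfolding C(1) using convex_cone_linear_image etc p(1) by blast
  fix w assume "w:C" "- w:C"
  then obtain x y where *: "w = p x" "- w = p y" "x:et" "y:et" unfolding C(1) by blast
  have "p (x + y) = p 0" using * by (metis linear_0[OF p(1)] pd(2) add.right_inverse)
  then obtain s t where st: "s:si" "t:si" "x + y + s = 0 + t" using eqE by blast
  have "y + s:et" using * st C by (intro convex_cone_add[OF etc]) auto
  moreover have "x + (y + s):si" using st by (simp add: add.assoc)
  ultimately have "x:si" using cfaceD1[OF siet *(3)] by blast
  thus "w = 0" using p0 * by simp
 qed
 {
  fix F assume F: "cface F C"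
  define ta where "ta = {x:et. p x:F}"
  have F0: "0:F" using convex_cone_contains_0 cface_cone[OF F] by blast
  have "cface ta et"
  proof (rule cfaceI)
   show "ta <= et" unfolding ta_def by blast
   have lin: "0:ta" unfolding ta_def using F0 linear_0[OF p(1)] convex_cone_contains_0[OF etc] by simp
   show "convex_cone ta"
    by (rule convex_coneI[OF lin])
      (auto simp: ta_def pd linear_scale[OF p(1)] intro: convex_cone_add[OF etc] convex_cone_scaleR[OF etc]
       convex_cone_add[OF cface_cone[OF F]] convex_cone_scaleR[OF cface_cone[OF F]])
   fix a b assume "a:et" "b:et" "a + b:ta"
   thus "a:ta" using cfaceD1[OF F, of "p a" "p b"] C(1) unfolding ta_def by (simp add: pd)
  qed
  moreover have "si <= ta" unfolding ta_def using C(3) p0 F0 by auto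
  moreover have "F = p ` ta" unfolding ta_def using cface_subset[OF F] C(1) by blast
  ultimately show "F:star p Si si" using fan_face[OF f C(2)] unfolding star_def by blast
 }
 fix C' assume "C':star p Si si"
 then obtain et' where C': "C' = p ` et'" "et':Si" "si <= et'" unfolding star_def by blast
 have fi: "cface (et Int et') et" using fan_Int[OF f C(2) C'(2)] .
 have "p ` et Int p ` et' = p ` (et Int et')"
 proof
  show "p ` et Int p ` et' <= p ` (et Int et')"
  proof
   fix w assume "w:p ` et Int p ` et'"
   then obtain x y where w: "w = p x" and xy: "p x = p y" "x:et" "y:et'" by blast
   obtain s t where st: "s:si" "t:si" "x + s = y + t" using eqE[OF xy(1)] by blast
   have "x + s:et" using xy st C by (intro convex_cone_add[OF etc]) auto
   moreover have "x + s:et'" unfolding st(3) using xy st C' by (intro convex_cone_add[OF fan_cone[OF f C'(2)]]) auto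
   moreover have "s:et" using st C by blast
   ultimately have "x:et Int et'" using cfaceD1[OF fi xy(2)] by blast
   thus "w:p ` (et Int et')" using w by blast
  qed
 qed blast
 thus "cface (C Int C') C" using face_image[OF C(2) fi] C C' by simp
qed

text \<open>The tangent cone at \<open>x\<close>. It depends on \<open>P\<close> alone, and its
  image is the support of the star (\<open>star_support\<close>), so supports of stars can be
  studied without the fan.\<close>

definition tcone :: "'v::real_vector set => 'v => 'v set" where
 "tcone P x = {v. EX e>0. ALL t. 0 < t --> t < e --> x + t *R v:P}"

text \<open>There are finitely many cones, so one of them contains points \<open>x + t *R v\<close>
  with arbitrarily small \<open>t\<close>. By closedness it contains \<open>x\<close>, hence
  \<open>si\<close>. Conversely \<open>rint_span\<close> allows small steps in all directions of
  \<open>span si\<close>.\<close>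

lemma tcone_fan:
 assumes f: "rational_fan N Si" and si: "si:Si" "x:rint si"
 shows "tcone (\<Union>Si) x = {y + s | y s. EX et:Si. si <= et & y:et & s:span si}"
proof
 show "tcone (\<Union>Si) x <= {y + s | y s. EX et:Si. si <= et & y:et & s:span si}"
 proof
  fix v assume "v:tcone (\<Union>Si) x"
  then obtain e where e: "e > 0" "!!t. 0 < t ==> t < e ==> x + t *R v:\<Union>Si" unfolding tcone_def by blast
  have "EX et:Si. ALL d>0. EX t. 0 < t & t < d & x + t *R v:et"
  proof (rule ccontr)
   assume "~ ?thesis"
   hence "ALL et:Si. EX d>0. ALL t. 0 < t --> t < d --> x + t *R v~:et" by blast
   from bchoice[OF this] obtain d where d: "ALL et:Si. d et > 0 & (ALL t. 0 < t --> t < d et --> x + t *R v~:et)" ..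
   define m where "m = Min (insert e (d ` Si))"
   have fin: "finite (insert e (d ` Si))" using fan_finite[OF f] by simp
   have m: "m > 0" unfolding m_def using fin d e by (subst Min_gr_iff) auto
   have "m <= e" "!!et. et:Si ==> m <= d et" unfolding m_def using fin by auto
   hence "x + (m / 2) *R v~:et" if "et:Si" for et
    using bspec[OF d that] that m by (metis field_sum_of_halves half_gt_zero less_add_same_cancel1 less_le_trans)
   thus False using e(2)[of "m / 2"] m \<open>m <= e\<close> by auto
  qed
  then obtain et where h: "et:Si" "!!d. d > 0 ==> EX t. 0 < t & t < d & x + t *R v:et" by blast
  have "x:et" by (rule rational_cone_closed[OF fan_lattice[OF f] fan_rational[OF f h(1)] h(2)])
  hence s: "si <= et" using fan_rint_subset[OF f h(1) si] by blast
  obtain t where t: "0 < t" "x + t *R v:et" using h(2)[of 1] by auto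
  have "(1 / t) *R (x + t *R v):et" using t by (intro convex_cone_scaleR[OF fan_cone[OF f h(1)]]) auto
  moreover have "- (1 / t) *R x:span si" using si(2) rint_subset by (intro span_scale span_base) auto
  moreover have "v = (1 / t) *R (x + t *R v) + (- (1 / t) *R x)" using t by (simp add: scaleR_add_right)
  ultimately show "v:{y + s | y s. EX et:Si. si <= et & y:et & s:span si}" using h(1) s by blast
 qed
 show "{y + s | y s. EX et:Si. si <= et & y:et & s:span si} <= tcone (\<Union>Si) x"
 proof safe
  fix y s et assume h: "et:Si" "si <= et" "y:et" "s:span si"
  obtain e where e: "e > 0" "!!t. 0 <= t ==> t <= e ==> x + t *R s:si"
   using rint_span[OF fan_cone[OF f si(1)] si(2) h(4)] by blast
  have "x + t *R (y + s):\<Union>Si" if "0 < t" "t < e" for t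
  proof -
   have "(x + t *R s) + t *R y:et"
   proof (rule convex_cone_add[OF fan_cone[OF f h(1)]])
    show "x + t *R s:et" using e(2)[of t] that h by auto
    show "t *R y:et" using that h by (intro convex_cone_scaleR[OF fan_cone[OF f h(1)]]) auto
   qed
   thus ?thesis using h(1) by (auto simp: algebra_simps)
  qed
  thus "y + s:tcone (\<Union>Si) x" unfolding tcone_def using e(1) by blast
 qed
qed

lemma star_support:
 assumes f: "rational_fan N Si" and si: "si:Si" "x:rint si" and p: "linear p" "!!x. p x = 0 <-> x:span si"
 shows "\<Union>(star p Si si) = p ` tcone (\<Union>Si) x"
proof -
 have ps: "p s = 0" if "s:span si" for s using p that by blast
 show ?thesis
  unfolding tcone_fan[OF f si] star_def
 proof (intro equalityI subsetI)
  fix w assume "w:\<Union> {p ` et |et. et:Si & si <= et}"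
  then obtain et y where "et:Si" "si <= et" "y:et" "w = p y" by blast
  moreover have "y = y + 0" "0:span si" by (auto simp: span_zero)
  ultimately show "w:p ` {y + s |y s. EX et:Si. si <= et & y:et & s:span si}" by blast
 next
  fix w assume "w:p ` {y + s |y s. EX et:Si. si <= et & y:et & s:span si}"
  then obtain et y s where *: "et:Si" "si <= et" "y:et" "s:span si" "w = p (y + s)" by blast
  hence "w = p y" using ps by (simp add: linear_add[OF p(1)])
  thus "w:\<Union> {p ` et |et. et:Si & si <= et}" using * by blast
 qed
qed

lemma tcone_invariant:
 assumes f: "rational_fan N Si" and si: "si:Si" "x:rint si" and v: "v:tcone (\<Union>Si) x" "s:span si"
 shows "v + s:tcone (\<Union>Si) x"
proof -
 obtain y r et where *: "v = y + r" "et:Si" "si <= et" "y:et" "r:span si"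
  using v(1) unfolding tcone_fan[OF f si] by blast
 have "v + s = y + (r + s)" "r + s:span si" using * v(2) by (auto simp: add.assoc intro: span_add)
 thus ?thesis unfolding tcone_fan[OF f si] using * by blast
qed

section \<open>Linear images of lattices and fans, isomorphisms\<close>

lemma int_span_linear_image:
 assumes "linear f" "inj_on f B" "finite B" shows "f ` int_span B = int_span (f ` B)"
proof
 have sub: "add_subgroup {x. f x:int_span (f ` B)}"
  using add_subgroup_int_span[of "f ` B"] assms(1) by (auto simp: add_subgroup_def linear_0 linear_diff)
 have "int_span B <= {x. f x:int_span (f ` B)}"
  by (rule int_span_minimal[OF sub]) (use assms in \<open>auto intro: int_span_base\<close>)
 thus "f ` int_span B <= int_span (f ` B)" by blast
 show "int_span (f ` B) <= f ` int_span B"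
  by (rule int_span_minimal[OF add_subgroup_linear_image[OF assms(1) add_subgroup_int_span]])
    (use assms in \<open>auto intro: int_span_base\<close>)
qed

lemma is_lattice_linear_image:
 assumes N: "is_lattice N" and f: "linear f" "inj_on f (span N)" shows "is_lattice (f ` N)"
proof -
 obtain B where B: "finite B" "independent B" "N = int_span B" using N by (auto simp: is_lattice_iff)
 have inj: "inj_on f (span B)" using f(2) B span_int_span by metis
 have "f ` N = int_span (f ` B)"
  using int_span_linear_image[OF f(1) _ B(1)] B(3) inj_on_subset[OF inj span_superset] by blast
 moreover have "independent (f ` B)" by (rule linear_independent_injective_image[OF f(1) B(2) inj])
 ultimately show ?thesis using B(1) unfolding is_lattice_iff by blast
qed

lemma fan_linear_image:
 assumes F: "rational_fan N Si" and f: "linear f" "inj_on f (span N)"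
 shows "rational_fan (f ` N) ((`) f ` Si)"
proof (rule rational_fanI)
 have sp: "si <= span N" if "si:Si" for si using fan_support_span[OF F] that by blast
 have inj: "x = y" if "f x = f y" "x:si" "si:Si" "y:ta" "ta:Si" for x y si ta
  using inj_onD[OF f(2) that(1)] sp that by blast
 show "is_lattice (f ` N)" using is_lattice_linear_image[OF fan_lattice[OF F] f] .
 show "finite ((`) f ` Si)" "(`) f ` Si ~= {}" using fan_finite[OF F] fan_nonempty[OF F] by auto
 have face_image: "cface (f ` ta) (f ` si)" if s: "si:Si" "cface ta si" for ta si
 proof (rule cfaceI)
  show "f ` ta <= f ` si" using cface_subset[OF s(2)] by blast
  show "convex_cone (f ` ta)" using convex_cone_linear_image cface_cone[OF s(2)] f(1) by blast
  fix a b assume "a:f ` si" "b:f ` si" "a + b:f ` ta"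
  then obtain x y z where *: "a = f x" "b = f y" "x:si" "y:si" "z:ta" "f (x + y) = f z"
   by (auto simp: linear_add[OF f(1)])
  have "x + y:si" "z:si" using * convex_cone_add[OF fan_cone[OF F s(1)]] cface_subset[OF s(2)] by auto
  hence "x + y = z" using inj *(6) s(1) by blast
  thus "a:f ` ta" using cfaceD1[OF s(2) *(3,4)] * by blast
 qed
 fix C assume "C:(`) f ` Si"
 then obtain si where C: "C = f ` si" "si:Si" by blast
 note sic = fan_cone[OF F C(2)]
 show "rational_cone (f ` N) C" unfolding C(1) using rational_cone_linear_image[OF f(1) fan_rational[OF F C(2)]] .
 show "strongly_convex C"
 proof (rule strongly_convexI)
  show "convex_cone C" unfolding C(1) using convex_cone_linear_image sic f(1) by blast
  fix w assume "w:C" "- w:C"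
  then obtain x y where *: "w = f x" "- w = f y" "x:si" "y:si" unfolding C(1) by blast
  have "f (x + y) = f 0" using * by (metis linear_0[OF f(1)] linear_add[OF f(1)] add.right_inverse)
  hence "x + y = 0"
   using inj[of "x + y" 0 si si] convex_cone_add[OF sic *(3,4)] convex_cone_contains_0[OF sic] C(2) by blast
  hence "- x:si" using *(4) by (metis add_eq_0_iff)
  hence "x = 0" using strongly_convexD[OF fan_strongly[OF F C(2)] *(3)] by blast
  thus "w = 0" using * linear_0[OF f(1)] by simp
 qed
 {
  fix G assume G: "cface G C"
  define ta where "ta = {x:si. f x:G}"
  have "cface ta si"
  proof (rule cfaceI)
   show "ta <= si" unfolding ta_def by blast
   have z: "0:ta" unfolding ta_def using linear_0[OF f(1)] convex_cone_contains_0[OF sic] convex_cone_contains_0[OF cface_cone[OF G]] by simp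
   show "convex_cone ta"
    by (rule convex_coneI[OF z])
      (auto simp: ta_def linear_add[OF f(1)] linear_scale[OF f(1)] intro: convex_cone_add[OF sic] convex_cone_scaleR[OF sic]
       convex_cone_add[OF cface_cone[OF G]] convex_cone_scaleR[OF cface_cone[OF G]])
   fix a b assume "a:si" "b:si" "a + b:ta"
   thus "a:ta" using cfaceD1[OF G, of "f a" "f b"] C(1) unfolding ta_def by (simp add: linear_add[OF f(1)])
  qed
  moreover have "G = f ` ta" unfolding ta_def using cface_subset[OF G] C(1) by blast
  ultimately show "G:(`) f ` Si" using fan_face[OF F C(2)] by blast
 }
 fix C' assume "C':(`) f ` Si"
 then obtain si' where C': "C' = f ` si'" "si':Si" by blast
 have "f ` si Int f ` si' = f ` (si Int si')" using inj C C' by blast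
 thus "cface (C Int C') C" using face_image[OF C(2) fan_Int[OF F C(2) C'(2)]] C C' by simp
qed

lemma support_unit_fan [simp]: "support (unit_fan N Si) = \<Union>Si"
 by (simp add: support_def)

lemma trop_iso_unit_fan:
 assumes F: "rational_fan N Si" and f: "linear f" "inj_on f (span N)"
 shows "trop_iso (unit_fan N Si) (unit_fan (f ` N) ((`) f ` Si))"
 unfolding trop_iso_def
proof (intro exI conjI)
 have sP: "span (\<Union>Si) <= span N" using fan_support_span[OF F] by (simp add: span_minimal)
 have "\<Union>((`) f ` Si) = f ` \<Union>Si" by blast
 hence e: "span (\<Union>((`) f ` Si)) = f ` span (\<Union>Si)" using linear_span_image[OF f(1)] by metis
 have "f ` N Int f ` span (\<Union>Si) = f ` (N Int span (\<Union>Si))"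
  using inj_on_image_Int[OF f(2) span_superset sP] by simp
 moreover have "inj_on f (N Int span (\<Union>Si))" using inj_on_subset[OF f(2)] sP by blast
 ultimately show "bij_betw f (lat (unit_fan N Si) Int span (support (unit_fan N Si)))
   (lat (unit_fan (f ` N) ((`) f ` Si)) Int span (support (unit_fan (f ` N) ((`) f ` Si))))"
  by (simp add: e bij_betw_def)
qed (use f in auto)

lemma trop_iso_same:
 assumes "lat X = lat Y" "cones X = cones Y" "!!si. si:facets (cones X) ==> orient X si = orient Y si"
 shows "trop_iso X Y"
 unfolding trop_iso_def
 by (rule exI[of _ "%x. x"]) (use assms in \<open>auto simp: support_def linear_ident bij_betw_def\<close>)

lemma span_lattice_support:
 assumes "!!si. si:cones X ==> rational_cone (lat X) si"
 shows "span (lat X Int span (support X)) = span (support X)"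
proof
 show "span (lat X Int span (support X)) <= span (support X)" by (metis inf_le2 span_mono span_span)
 have "si <= span (lat X Int span (support X))" if s: "si:cones X" for si
 proof -
  have "lat X Int si <= lat X Int span (support X)" using s unfolding support_def by (auto intro: span_base)
  thus ?thesis using span_rational_cone[OF assms[OF s]] span_mono span_superset by blast
 qed
 thus "span (support X) <= span (lat X Int span (support X))"
  unfolding support_def by (intro span_minimal) auto
qed

text \<open>An isomorphism is prescribed only between the lattices of the spans. Its inverse on a
  basis of the target lattice is extended linearly to \<open>g\<close>; lattice vectors span the
  span of the support, so \<open>g\<close> is a left inverse there.\<close>

lemma trop_iso_inverse:
 assumes iso: "trop_iso X Y" and X: "rational_fan (lat X) (cones X)" and Y: "is_lattice (lat Y)"
 obtains f g where "linear f" "linear g" "ALL x:span (support X). g (f x) = x"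
  "f ` (lat X Int span (support X)) = lat Y Int span (support Y)"
  "cones Y = (%si. f ` si) ` cones X" "ALL si:facets (cones X). orient Y (f ` si) = orient X si"
proof -
 define M where "M = lat X Int span (support X)"
 define M' where "M' = lat Y Int span (support Y)"
 obtain f where f: "linear f" "bij_betw f M M'" "cones Y = (%si. f ` si) ` cones X"
  "ALL si:facets (cones X). orient Y (f ` si) = orient X si"
  using iso unfolding trop_iso_def M_def M'_def by blast
 have "is_lattice M'" unfolding M'_def by (rule is_lattice_Int_subspace[OF Y subspace_span])
 then obtain B where B: "finite B" "independent B" "M' = int_span B" by (auto simp: is_lattice_iff)
 obtain g where g: "linear g" "ALL b:B. g b = the_inv_into M f b"
  using linear_independent_extend[OF B(2), of "the_inv_into M f"] by blast
 have inj: "inj_on f M" and im: "f ` M = M'" using f(2) by (auto simp: bij_betw_def)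
 have sM': "add_subgroup M'" using is_lattice_add_subgroup[OF \<open>is_lattice M'\<close>] .
 have sM: "add_subgroup M" unfolding M_def
  by (intro add_subgroup_Int is_lattice_add_subgroup fan_lattice[OF X] add_subgroup_subspace subspace_span)
 have fg: "f (g y) = y & g y:M" if "y:B" for y
 proof -
  have "y:f ` M" using that B int_span_base im by auto
  thus ?thesis using g(2) that f_the_inv_into_f[OF inj] the_inv_into_into[OF inj _ order_refl] by simp
 qed
 have "add_subgroup {y. f (g y) = y & g y:M}" using sM
  by (auto simp: add_subgroup_def linear_0[OF g(1)] linear_0[OF f(1)] linear_diff[OF g(1)] linear_diff[OF f(1)])
 hence "int_span B <= {y. f (g y) = y & g y:M}" using fg by (intro int_span_minimal) auto
 hence fg': "f (g y) = y" "g y:M" if "y:M'" for y using that B by auto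
 have gfM: "g (f x) = x" if x: "x:M" for x
 proof -
  have "f x:M'" using im x by blast
  thus ?thesis using inj_onD[OF inj fg'(1)[of "f x"] fg'(2) x] by blast
 qed
 have "g (f x) = x" if "x:span (support X)" for x
 proof (rule linear_eq_on[OF linear_compose[OF f(1) g(1), unfolded o_def] linear_ident])
  show "x:span M" using that span_lattice_support[of X] fan_rational[OF X] unfolding M_def by simp
 qed (rule gfM)
 thus ?thesis by (intro that[OF f(1) g(1) _ _ f(3,4)]) (use im in \<open>simp_all add: M_def M'_def\<close>)
qed

lemma facets_image:
 assumes "cones Y = (%si. f ` si) ` cones X" and g: "ALL x:span (support X). g (f x) = x"
 shows "facets (cones Y) = (%si. f ` si) ` facets (cones X)"
proof -
 have sub: "si <= support X" if "si:cones X" for si using that unfolding support_def by blast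
 have le: "f ` si <= f ` et <-> si <= et" if "si:cones X" "et:cones X" for si et
 proof
  assume l: "f ` si <= f ` et"
  show "si <= et"
  proof
   fix x assume x: "x:si"
   then obtain y where y: "y:et" "f x = f y" using l by blast
   have "x:span (support X)" "y:span (support X)" using x y sub that span_superset by blast+
   hence "x = y" using g y(2) by metis
   thus "x:et" using y by simp
  qed
 qed blast
 have eq: "f ` si = f ` et <-> si = et" if "si:cones X" "et:cones X" for si et
  using le that by (metis subset_antisym order_refl)
 have iff: "f ` si:facets (cones Y) <-> si:facets (cones X)" if s: "si:cones X" for si
  unfolding facets_def assms(1) using s le[OF s] eq[OF _ s] by simp
 have fc': "facets (cones X) <= cones X" unfolding facets_def by blast
 show ?thesis
 proof (intro equalityI subsetI)
  fix C assume C: "C:facets (cones Y)"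
  hence "C:cones Y" by (simp add: facets_def)
  then obtain si where "si:cones X" "C = f ` si" unfolding assms(1) by (rule imageE)
  thus "C:(%si. f ` si) ` facets (cones X)" using iff C by blast
 next
  fix C assume "C:(%si. f ` si) ` facets (cones X)"
  then obtain si where si: "si:facets (cones X)" "C = f ` si" by blast
  thus "C:facets (cones Y)" using iff[OF subsetD[OF fc' si(1)]] by blast
 qed
qed

lemma trop_iso_sym:
 assumes iso: "trop_iso X Y" and X: "rational_fan (lat X) (cones X)" and Y: "is_lattice (lat Y)"
 shows "trop_iso Y X"
proof -
 obtain f g where fg: "linear f" "linear g" "ALL x:span (support X). g (f x) = x"
  "f ` (lat X Int span (support X)) = lat Y Int span (support Y)"
  "cones Y = (%si. f ` si) ` cones X" "ALL si:facets (cones X). orient Y (f ` si) = orient X si"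
  using trop_iso_inverse[OF iso X Y] .
 have gf: "g ` f ` si = si" if "si:cones X" for si
 proof -
  have "ALL x:si. g (f x) = x" using fg(3) that span_base[of _ "support X"] unfolding support_def by blast
  thus ?thesis by (simp add: image_image)
 qed
 have "cones X = (%si. g ` si) ` cones Y" unfolding fg(5) using gf by (simp add: image_image)
 moreover have "bij_betw g (lat Y Int span (support Y)) (lat X Int span (support X))"
  unfolding fg(4)[symmetric] bij_betw_def
 proof
  show "inj_on g (f ` (lat X Int span (support X)))"
   by (rule inj_onI) (use fg(3) in auto)
  show "g ` f ` (lat X Int span (support X)) = lat X Int span (support X)"
   using fg(3) by (force simp: image_image)
 qed
 moreover have "orient X (g ` si) = orient Y si" if si: "si:facets (cones Y)" for si
 proof -
  obtain et where et: "et:facets (cones X)" "si = f ` et" using si unfolding facets_image[OF fg(5,3)] by blast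
  hence "g ` si = et" using gf unfolding facets_def by blast
  thus ?thesis using fg(6) et by simp
 qed
 ultimately show ?thesis unfolding trop_iso_def using fg(2) by blast
qed

lemma trop_iso_trans:
 assumes i: "trop_iso X Y" "trop_iso Y Z" and X: "rational_fan (lat X) (cones X)" and Y: "is_lattice (lat Y)"
 shows "trop_iso X Z"
proof -
 obtain f g where fg: "linear f" "linear g" "ALL x:span (support X). g (f x) = x"
  "f ` (lat X Int span (support X)) = lat Y Int span (support Y)"
  "cones Y = (%si. f ` si) ` cones X" "ALL si:facets (cones X). orient Y (f ` si) = orient X si"
  using trop_iso_inverse[OF i(1) X Y] .
 obtain k where k: "linear k" "bij_betw k (lat Y Int span (support Y)) (lat Z Int span (support Z))"
  "cones Z = (%si. k ` si) ` cones Y" "ALL si:facets (cones Y). orient Z (k ` si) = orient Y si"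
  using i(2) unfolding trop_iso_def by blast
 have "inj_on f (lat X Int span (support X))" by (rule inj_on_inverseI[of _ g]) (use fg(3) in blast)
 hence b: "bij_betw f (lat X Int span (support X)) (lat Y Int span (support Y))"
  using fg(4) unfolding bij_betw_def by blast
 show ?thesis
  unfolding trop_iso_def
 proof (intro exI[of _ "k o f"] conjI ballI)
  show "linear (k o f)" using fg(1) k(1) by (rule linear_compose)
  show "bij_betw (k o f) (lat X Int span (support X)) (lat Z Int span (support Z))"
   using b k(2) by (rule bij_betw_trans)
  show "cones Z = (%si. (k o f) ` si) ` cones X" unfolding k(3) fg(5) by (simp add: image_image image_comp)
  fix si assume si: "si:facets (cones X)"
  hence "f ` si:facets (cones Y)" unfolding facets_image[OF fg(5,3)] by blast
  moreover have "(k o f) ` si = k ` (f ` si)" by (simp add: image_comp)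
  ultimately show "orient Z ((k o f) ` si) = orient X si" using k(4) fg(6) si by metis
 qed
qed

text \<open>\<open>X\<close> may live in another space than \<open>Z\<close>, so the closure of the
  class under isomorphism is applied to the representative of \<open>X\<close> in the
  universe.\<close>

lemma in_class_iso:
 assumes S: "tropical_class \<S>" and X: "rational_fan (lat X) (cones X)" "in_class X \<S>"
  and Z: "trop_iso X Z" "tropical_fan Z"
 shows "Z:\<S>"
proof -
 obtain Y where Y: "Y:\<S>" "trop_iso X Y" using X(2) unfolding in_class_def by blast
 have fY: "rational_fan (lat Y) (cones Y)" using S Y(1) unfolding tropical_class_def tropical_fan_def by blast
 have "trop_iso Y X" using trop_iso_sym[OF Y(2) X(1) fan_lattice[OF fY]] .
 hence "trop_iso Y Z" using trop_iso_trans[OF _ Z(1) fY fan_lattice[OF X(1)]] by blast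
 thus ?thesis using S Y(1) Z(2) unfolding tropical_class_def by blast
qed

section \<open>Matroid rank functions and tropical linear spaces\<close>

lemma lookup_scaleR [simp]: "lookup (c *R x) i = c * lookup (x :: 'a fvec) i"
proof -
 have "finite {i. c *R lookup x i ~= 0}"
  by (rule finite_subset[OF _ finite_keys[of x]]) (auto simp: in_keys_iff)
 thus ?thesis unfolding scaleR_poly_mapping_def by simp
qed

lemma lookup_evec: "finite A ==> lookup (evec A) i = (if i:A then 1 else 0)"
 unfolding evec_def by (simp add: lookup_sum lookup_single when_def)

definition coords :: "'a set => 'a fvec set" where
 "coords E = {x. Poly_Mapping.keys x <= E}"

lemma coords_iff: "x:coords E <-> (ALL i. i~:E --> lookup x i = 0)"
 unfolding coords_def by (auto simp: in_keys_iff)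

lemma coords_subspace: "subspace (coords E)"
 by (auto simp: subspace_def coords_iff lookup_add)

lemmas coords_add = subspace_add[OF coords_subspace] and coords_diff = subspace_diff[OF coords_subspace]
 and coords_scale = subspace_scale[OF coords_subspace]

lemma coords_eqI: "x:coords E ==> y:coords E ==> (!!i. i:E ==> lookup x i = lookup y i) ==> x = y"
 unfolding coords_iff by (rule poly_mapping_eqI) metis

lemma evec_coords: "finite A ==> A <= E ==> evec A:coords E"
 unfolding coords_iff by (auto simp: lookup_evec)

lemma int_lattice_iff: "x:int_lattice E <-> x:coords E & (ALL i. lookup x i:\<int>)"
 unfolding int_lattice_def coords_def by blast

lemma evec_int_lattice: "finite A ==> A <= E ==> evec A:int_lattice E"
 unfolding int_lattice_iff by (auto simp: evec_coords lookup_evec)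

lemma lookup_sum_scaleR:
 "lookup (\<Sum>i\<in>A. c i *R f i) j = (\<Sum>i\<in>A. c i * lookup (f i :: 'a fvec) j)"
 by (simp add: lookup_sum)

lemma chain_Union_mem:
 assumes "finite S" "S ~= {}" "!!F G. F:S ==> G:S ==> F <= G | G <= F"
 shows "\<Union>S \<in> S" "\<Inter>S \<in> S"
proof -
 have "\<Union>S \<in> S & \<Inter>S \<in> S" using assms
 proof (induction S rule: finite_ne_induct)
  case (insert F S)
  have i: "\<Union>S \<in> S" "\<Inter>S \<in> S" using insert by auto
  have "F <= \<Union>S | \<Union>S <= F" "F <= \<Inter>S | \<Inter>S <= F" using insert.prems i by auto
  hence "\<Union>(insert F S) = F | \<Union>(insert F S) = \<Union>S" "\<Inter>(insert F S) = F | \<Inter>(insert F S) = \<Inter>S" by auto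
  thus ?case using i by auto
 qed auto
 thus "\<Union>S \<in> S" "\<Inter>S \<in> S" by auto
qed

text \<open>The matroid is given by its rank function because deletions, contractions and initial
  matroids are all described by formulas for the rank. Integer values allow the differences in these
  formulas.\<close>

locale rank_function =
 fixes E :: "'a set" and r :: "'a set => int"
 assumes fin: "finite E" and rank_empty: "r {} = 0"
  and rank_insert_mono: "A <= E ==> i:E ==> r A <= r (insert i A)"
  and rank_insert_le: "A <= E ==> i:E ==> r (insert i A) <= r A + 1"
  and rank_submodular: "A <= E ==> B <= E ==> r (A Un B) + r (A Int B) <= r A + r B"
begin

definition rflat :: "'a set => bool" where
 "rflat F <-> F <= E & (ALL i:E - F. r F < r (insert i F))"

definition rcl :: "'a set => 'a set" where
 "rcl A = {i:E. r (insert i A) = r A}"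

lemma finite_subset_E: "A <= E ==> finite A"
 using fin finite_subset by blast

lemma rank_mono: "A <= B ==> B <= E ==> r A <= r B"
proof -
 assume AB: "A <= B" "B <= E"
 have "finite C ==> C <= E ==> r A <= r (A Un C)" for C
 proof (induction C rule: finite_induct)
  case (insert i C)
  moreover have "A <= E" using AB by blast
  ultimately show ?case using rank_insert_mono[of "A Un C" i] by simp
 qed simp
 from this[of B] show ?thesis using AB finite_subset_E by (simp add: Un_absorb1)
qed

lemma rank_stable: "A <= B ==> B <= E ==> i:E ==> r (insert i A) = r A ==> r (insert i B) = r B"
proof (cases "i:B")
 case False
 assume *: "A <= B" "B <= E" "i:E" "r (insert i A) = r A"
 have "insert i A Un B = insert i B" "insert i A Int B = A" using * False by auto
 hence "r (insert i B) <= r B" using rank_submodular[of "insert i A" B] * by auto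
 thus ?thesis using rank_insert_mono[of B i] * by simp
qed (simp add: insert_absorb)

lemma rflat_subset: "rflat F ==> F <= E"
 by (simp add: rflat_def)

lemma rflat_strict: "rflat F ==> A <= F ==> i:E - F ==> r A < r (insert i A)"
proof -
 assume F: "rflat F" "A <= F" "i:E - F"
 have "r F < r (insert i F)" using F unfolding rflat_def by blast
 hence "r (insert i A) ~= r A" using rank_stable[of A F i] F rflat_subset by auto
 thus ?thesis using rank_insert_mono[of A i] F rflat_subset[OF F(1)] by fastforce
qed

lemma rflat_E: "rflat E"
 by (simp add: rflat_def)

lemma rflat_Int: "rflat F ==> rflat G ==> rflat (F Int G)"
 using rflat_strict[of F "F Int G"] rflat_strict[of G "F Int G"] unfolding rflat_def[of "F Int G"]
 by (auto dest: rflat_subset)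

lemma rank_eq_of_stable:
 assumes "A <= B" "B <= E" "!!i. i:B ==> r (insert i A) = r A" shows "r B = r A"
proof -
 have "finite C ==> C <= B ==> r (A Un C) = r A" for C
 proof (induction C rule: finite_induct)
  case (insert i C)
  have "r (insert i (A Un C)) = r (A Un C)"
   using rank_stable[of A "A Un C" i] insert assms by auto
  thus ?case using insert by simp
 qed simp
 from this[of B] show ?thesis using assms finite_subset_E by (simp add: Un_absorb1)
qed

lemma rcl_superset: "A <= E ==> A <= rcl A"
 unfolding rcl_def by (auto simp: insert_absorb)

lemma rank_rcl: "A <= E ==> r (rcl A) = r A"
 by (rule rank_eq_of_stable[OF rcl_superset]) (auto simp: rcl_def)

lemma rflat_rcl: assumes A: "A <= E" shows "rflat (rcl A)"
 unfolding rflat_def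
proof (intro conjI ballI)
 show s: "rcl A <= E" unfolding rcl_def by blast
 fix i assume i: "i:E - rcl A"
 have "r A ~= r (insert i A)" using i unfolding rcl_def by auto
 hence "r A < r (insert i A)" using rank_insert_mono[OF A, of i] i by simp
 also have "... <= r (insert i (rcl A))" using rcl_superset[OF A] s i by (intro rank_mono) auto
 finally show "r (rcl A) < r (insert i (rcl A))" using rank_rcl[OF A] by simp
qed

lemma rcl_minimal: "rflat F ==> A <= F ==> rcl A <= F"
 using rflat_strict[of F A] unfolding rcl_def by fastforce

text \<open>For large \<open>s\<close> the condition says that the empty set is a flat, so the space
  is empty for a matroid with loops.\<close>

definition trop_space :: "'a fvec set" where
 "trop_space = {x:coords E. ALL s. rflat {i:E. s <= lookup x i}}"

lemma trop_space_coords: "x:trop_space ==> x:coords E"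
 by (simp add: trop_space_def)

lemma trop_space_empty: assumes "x:trop_space" shows "rflat {}"
proof -
 have "{i:E. (\<Sum>i\<in>E. \<bar>lookup x i\<bar>) + 1 <= lookup x i} = {}"
 proof (clarsimp simp: not_le)
  fix i assume "i:E"
  hence "\<bar>lookup x i\<bar> <= (\<Sum>i\<in>E. \<bar>lookup x i\<bar>)" using fin by (intro member_le_sum) auto
  thus "lookup x i < (\<Sum>i\<in>E. \<bar>lookup x i\<bar>) + 1" by linarith
 qed
 moreover have "rflat {i:E. (\<Sum>i\<in>E. \<bar>lookup x i\<bar>) + 1 <= lookup x i}"
  using assms unfolding trop_space_def by blast
 ultimately show ?thesis by metis
qed

lemma superlevel_min:
 assumes "S <= E" "S ~= {}" shows "EX i:S. ALL j:S. f i <= (f j :: real)"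
proof -
 have fS: "finite S" using finite_subset_E[OF assms(1)] .
 have "Min (f ` S):f ` S" using fS assms(2) by simp
 then obtain i where "i:S" "f i = Min (f ` S)" by force
 thus ?thesis using fS by (metis Min_le finite_imageI imageI)
qed

lemma trop_space_iff:
 "x:trop_space <-> x:coords E & rflat {} & (ALL i:E. rflat {j:E. lookup x i <= lookup x j})"
proof
 assume "x:trop_space"
 thus "x:coords E & rflat {} & (ALL i:E. rflat {j:E. lookup x i <= lookup x j})"
  using trop_space_empty unfolding trop_space_def by blast
next
 assume R: "x:coords E & rflat {} & (ALL i:E. rflat {j:E. lookup x i <= lookup x j})"
 have "rflat {i:E. s <= lookup x i}" for s
 proof (cases "{i:E. s <= lookup x i} = {}")
  case True thus ?thesis unfolding True using R by simp
 next
  case False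
  then obtain i where i: "i:{i:E. s <= lookup x i}" "ALL j:{i:E. s <= lookup x i}. lookup x i <= lookup x j"
   using superlevel_min[of "{i:E. s <= lookup x i}" "lookup x"] by blast
  hence "{i:E. s <= lookup x i} = {j:E. lookup x i <= lookup x j}" by force
  moreover have "rflat {j:E. lookup x i <= lookup x j}" using R i(1) by blast
  ultimately show ?thesis by (simp only:)
 qed
 thus "x:trop_space" using R unfolding trop_space_def by blast
qed

lemma rflat_strict_superlevel:
 assumes "x:trop_space" shows "rflat {i:E. s < lookup x i}"
proof (cases "{i:E. s < lookup x i} = {}")
 case True thus ?thesis unfolding True using trop_space_empty[OF assms] by simp
next
 case False
 then obtain i where i: "i:{i:E. s < lookup x i}" "ALL j:{i:E. s < lookup x i}. lookup x i <= lookup x j"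
  using superlevel_min[of "{i:E. s < lookup x i}" "lookup x"] by blast
 hence "{i:E. s < lookup x i} = {j:E. lookup x i <= lookup x j}" by force
 moreover have "rflat {j:E. lookup x i <= lookup x j}"
  using assms unfolding trop_space_def by blast
 ultimately show ?thesis by (simp only:)
qed

lemma trop_space_zero: "rflat {} ==> 0:trop_space"
 unfolding trop_space_iff using rflat_E by (simp add: coords_iff)

lemma chain_sum_lookup:
 assumes "!!F. F:S ==> F <= E"
 shows "lookup (\<Sum>F\<in>S. a F *R evec F) i = (\<Sum>F\<in>S. a F * of_bool (i:F))"
 unfolding lookup_sum_scaleR using assms finite_subset_E by (intro sum.cong refl) (auto simp: lookup_evec)

text \<open>For positive \<open>s\<close> a superlevel set contains with \<open>j\<close> the
  smallest member of the chain through \<open>j\<close>. So it is the union of the members inside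
  it, which is the largest of them or the empty flat.\<close>

lemma chain_sum_trop_space:
 assumes e: "rflat {}" and S: "finite S" "!!F G. F:S ==> G:S ==> F <= G | G <= F" "!!F. F:S ==> rflat F"
  and a: "!!F. F:S ==> 0 <= a F"
 shows "(\<Sum>F\<in>S. a F *R evec F):trop_space"
proof -
 let ?x = "\<Sum>F\<in>S. a F *R evec F"
 have SE: "F <= E" if "F:S" for F using S(3) rflat_subset that by blast
 have c: "?x:coords E"
  using SE finite_subset_E by (intro subspace_sum[OF coords_subspace] coords_scale evec_coords) auto
 have l: "lookup ?x i = (\<Sum>F\<in>S. a F * of_bool (i:F))" for i by (rule chain_sum_lookup[OF SE])
 have "rflat {j:E. s <= lookup ?x j}" for s
 proof -
  define U where "U = {j:E. s <= lookup ?x j}"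
  have nn: "0 <= lookup ?x j" for j unfolding l using a by (intro sum_nonneg) auto
  have "U = E | U = \<Union>{G\<in>S. G <= U}"
  proof (cases "s <= 0")
   case True
   hence "U = E" unfolding U_def using nn order_trans[OF True] by blast
   thus ?thesis ..
  next
   case False
   have "EX G:S. j:G & G <= U" if j: "j:U" for j
   proof -
    have "{G:S. j:G} ~= {}"
    proof
     assume "{G:S. j:G} = {}"
     hence "lookup ?x j = 0" unfolding l by (intro sum.neutral) auto
     thus False using j False unfolding U_def by auto
    qed
    hence "\<Inter>{G\<in>S. j:G}:{G:S. j:G}" using S by (intro chain_Union_mem) auto
    then obtain G where G: "G:S" "j:G" "!!G'. G':S ==> j:G' ==> G <= G'" by blast
    have "G <= U"
    proof
     fix k assume k: "k:G"
     have "lookup ?x j <= lookup ?x k"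
      unfolding l using a G(3) k by (intro sum_mono mult_left_mono) (auto simp: of_bool_def)
     thus "k:U" using j k G(1) SE unfolding U_def by auto
    qed
    thus ?thesis using G by blast
   qed
   thus ?thesis by blast
  qed
  moreover have "rflat (\<Union>{G\<in>S. G <= U})"
  proof (cases "{G:S. G <= U} = {}")
   case False
   hence "\<Union>{G\<in>S. G <= U}:{G:S. G <= U}" using S(1,2) by (intro chain_Union_mem) auto
   thus ?thesis using S(3) by blast
  next
   case True
   show ?thesis unfolding True using e by simp
  qed
  ultimately show ?thesis unfolding U_def[symmetric] using rflat_E by metis
 qed
 thus ?thesis unfolding trop_space_def using c by blast
qed

text \<open>Peeling off the highest value of \<open>x\<close>; \<open>V\<close> bounds the number of steps.\<close>

lemma level_decomposition:
 assumes x: "x:coords E" and E: "E ~= {}"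
 obtains S a c where "finite S" "ALL F:S. F ~= {} & F ~= E & (EX t. F = {i:E. t < lookup x i})"
  "ALL F:S. 0 <= a F" "x = (\<Sum>F\<in>S. a F *R evec F) + c *R evec E"
proof -
 have "EX S a c. finite S & (ALL F:S. 0 <= a F & (EX t. F = {i:E. t < lookup x i})) &
  x = (\<Sum>F\<in>S. a F *R evec F) + (c::real) *R evec E"
  if "finite V" "x:coords E" "lookup x ` E <= V" for V x
  using that
 proof (induction V arbitrary: x rule: finite_linorder_max_induct)
  case (insert b V)
  note x = insert.prems(1)
  show ?case
  proof (cases "V = {}")
   case True
   hence "x = b *R evec E" using insert.prems(2) fin
    by (intro coords_eqI[OF x] coords_scale evec_coords) (auto simp: lookup_evec)
   thus ?thesis by (intro exI[of _ "{}"] exI[of _ "%_. 0"] exI[of _ b]) simp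
  next
   case False
   define F where "F = {i:E. Max V < lookup x i}"
   have low: "v <= Max V" if "v:V" for v using that insert.hyps(1) by simp
   have Fb: "lookup x i = b" if "i:F" for i using that insert.prems(2) low unfolding F_def by force
   have F: "F <= E" "finite F" unfolding F_def using fin by auto
   have M: "Max V:V" "Max V < b" using False insert.hyps by auto
   define y where "y = x - (b - Max V) *R evec F"
   have ly: "lookup y i = (if i:F then Max V else lookup x i)" for i
    unfolding y_def using Fb F by (simp add: lookup_minus lookup_evec)
   have yc: "y:coords E" unfolding y_def
    by (intro subspace_diff[OF coords_subspace x] coords_scale evec_coords F)
   have yV: "lookup y ` E <= V" using insert.prems(2) M unfolding ly by (force simp: F_def)
   obtain S a c where S: "finite S" "ALL G:S. 0 <= a G & (EX t. G = {i:E. t < lookup y i})"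
    and y: "y = (\<Sum>G\<in>S. a G *R evec G) + c *R evec E" using insert.IH[OF yc yV] by blast
   \<comment> \<open>All values of \<open>y\<close> are at most \<open>Max V\<close>, so from there
     on its superlevel set is empty, as is the one of \<open>x\<close> at \<open>b\<close>.\<close>
   have lev: "{i:E. t < lookup y i} = {i:E. (if t < Max V then t else b) < lookup x i}" for t
    using Fb M yV low insert.prems(2) unfolding ly by (force simp: F_def)
   \<comment> \<open>Adding the coefficients avoids deciding whether \<open>F\<close> already occurs
     in \<open>S\<close>.\<close>
   define a' where "a' G = (if G:S then a G else 0) + (if G = F then b - Max V else 0)" for G
   have "(\<Sum>G\<in>insert F S. (if G:S then a G else 0) *R evec G) = (\<Sum>G\<in>S. a G *R evec G)"
    using S(1) by (intro sum.mono_neutral_cong_right) auto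
   moreover have "(\<Sum>G\<in>insert F S. (if G = F then b - Max V else 0) *R evec G) = (b - Max V) *R evec F"
    using S(1) by (simp add: if_distrib[of "%c. c *R _"] cong: if_cong)
   ultimately have eq: "(\<Sum>G\<in>insert F S. a' G *R evec G) = (\<Sum>G\<in>S. a G *R evec G) + (b - Max V) *R evec F"
    unfolding a'_def scaleR_left_distrib sum.distrib by (simp only:)
   have "x = y + (b - Max V) *R evec F" unfolding y_def by simp
   hence "x = (\<Sum>G\<in>insert F S. a' G *R evec G) + c *R evec E" unfolding eq y by (simp only: ac_simps)
   moreover have "ALL G:insert F S. 0 <= a' G & (EX t. G = {i:E. t < lookup x i})"
    using S(2) M unfolding lev a'_def F_def by auto
   ultimately show ?thesis using S(1) by blast
  qed
 qed (use E in auto)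
 from this[OF _ x order_refl] obtain S a c where S: "finite S" "ALL F:S. 0 <= a F & (EX t. F = {i:E. t < lookup x i})"
  "x = (\<Sum>F\<in>S. a F *R evec F) + c *R evec E" using fin by blast
 have "(\<Sum>F\<in>S. a F *R evec F) = (\<Sum>F\<in>S - {{}, E}. a F *R evec F) + (if E:S then a E else 0) *R evec E"
 proof -
  have "(\<Sum>F\<in>S. a F *R evec F) = (\<Sum>F\<in>S. if F:{{}, E} then 0 else a F *R evec F) + (\<Sum>F\<in>S. if F = E then a E *R evec E else 0)"
   unfolding sum.distrib[symmetric] by (intro sum.cong) (auto simp: evec_def)
  thus ?thesis using S(1) by (simp add: sum.If_cases Diff_eq Int_def)
 qed
 thus ?thesis
  using S by (intro that[of "S - {{}, E}" a "c + (if E:S then a E else 0)"]) (auto simp: scaleR_left_distrib)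
qed

lemma flag_trop_space:
 assumes "rflat {}" "rflat F" "rflat G" "F <= G" "0 <= a" "0 <= b"
 shows "a *R evec F + b *R evec G:trop_space"
proof (cases "F = G")
 case True
 thus ?thesis using chain_sum_trop_space[of "{F}" "%_. a + b"] assms by (simp add: scaleR_left_distrib)
next
 case False
 have "(\<Sum>H\<in>{F, G}. (if H = F then a else b) *R evec H):trop_space"
  by (rule chain_sum_trop_space[OF assms(1)]) (use assms in auto)
 thus ?thesis using False by simp
qed

lemma evec_trop_space: "rflat {} ==> rflat F ==> evec F:trop_space"
 using flag_trop_space[of F F 1 0] by simp

text \<open>The superlevel set of \<open>x + t *R y\<close> at the value of \<open>i\<close>, for
  infinitesimal positive \<open>t\<close>.\<close>

definition lex_superlevel :: "'a fvec => 'a fvec => 'a => 'a set" where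
 "lex_superlevel x y i = {j:E. lookup x i < lookup x j |
   (lookup x i = lookup x j & lookup y i <= lookup y j)}"

text \<open>\<open>D\<close> collects the positive gaps of \<open>f\<close>, each divided by a bound
  for the corresponding difference of \<open>g\<close>; below its minimum no strict inequality is
  reversed.\<close>

lemma perturbation:
 fixes f g :: "'a => real"
 obtains e where "0 < e" "!!t i j. 0 < t ==> t < e ==> i:E ==> j:E ==>
   f i + t * g i <= f j + t * g j <-> f i < f j | (f i = f j & g i <= g j)"
proof -
 define D where "D = {(f j - f i) / (1 + \<bar>g i\<bar> + \<bar>g j\<bar>) | i j. i:E & j:E & f i < f j}"
 have "D <= (%(i, j). (f j - f i) / (1 + \<bar>g i\<bar> + \<bar>g j\<bar>)) ` (E \<times> E)" unfolding D_def by auto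
 hence fD: "finite D" using fin by (meson finite_SigmaI finite_imageI finite_subset)
 define e where "e = Min (insert 1 D)"
 have Dpos: "d > 0" if "d:D" for d using that unfolding D_def by (auto intro!: divide_pos_pos)
 have e: "e > 0" unfolding e_def using fD Dpos by (subst Min_gr_iff) auto
 have strict: "f i + t * g i < f j + t * g j" if t: "0 < t" "t < e" and ij: "i:E" "j:E" "f i < f j" for t i j
 proof -
  have "e <= (f j - f i) / (1 + \<bar>g i\<bar> + \<bar>g j\<bar>)" unfolding e_def using fD ij by (intro Min_le) (auto simp: D_def)
  hence "t < (f j - f i) / (1 + \<bar>g i\<bar> + \<bar>g j\<bar>)" using t by linarith
  hence "t * (1 + \<bar>g i\<bar> + \<bar>g j\<bar>) < f j - f i" by (simp add: pos_less_divide_eq add_pos_nonneg)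
  moreover have "t * (g i - g j) <= t * (1 + \<bar>g i\<bar> + \<bar>g j\<bar>)" using t by (intro mult_left_mono) auto
  ultimately show ?thesis by (simp add: algebra_simps)
 qed
 show ?thesis
 proof (rule that[OF e])
  fix t i j assume *: "0 < t" "t < e" "i:E" "j:E"
  consider "f i < f j" | "f j < f i" | "f i = f j" by linarith
  thus "f i + t * g i <= f j + t * g j <-> f i < f j | (f i = f j & g i <= g j)"
  proof cases
   case 1 thus ?thesis using strict[of t i j] * by simp
  next
   case 2 thus ?thesis using strict[of t j i] * by (simp add: not_le)
  next
   case 3 thus ?thesis using * by simp
  qed
 qed
qed

lemma tcone_trop_space_iff:
 assumes x: "x:coords E"
 shows "y:tcone trop_space x <-> y:coords E & rflat {} & (ALL i:E. rflat (lex_superlevel x y i))"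
proof -
 obtain e where e: "0 < e" "!!t i j. 0 < t ==> t < e ==> i:E ==> j:E ==>
   lookup x i + t * lookup y i <= lookup x j + t * lookup y j <->
   lookup x i < lookup x j | (lookup x i = lookup x j & lookup y i <= lookup y j)"
  using perturbation[of "lookup x" "lookup y"] by blast
 have iff: "x + t *R y:trop_space <-> y:coords E & rflat {} & (ALL i:E. rflat (lex_superlevel x y i))"
  if t: "0 < t" "t < e" for t
 proof -
  have "x + t *R y:coords E <-> y:coords E" using x t unfolding coords_iff by (simp add: lookup_add)
  moreover have "{j:E. lookup (x + t *R y) i <= lookup (x + t *R y) j} = lex_superlevel x y i"
   if "i:E" for i
   unfolding lex_superlevel_def using e(2)[OF t that] by (auto simp: lookup_add)
  ultimately show ?thesis unfolding trop_space_iff by simp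
 qed
 show ?thesis
 proof
  assume "y:tcone trop_space x"
  then obtain d where d: "d > 0" "!!t. 0 < t ==> t < d ==> x + t *R y:trop_space" unfolding tcone_def by blast
  define t where "t = min d e / 2"
  have "0 < t" "t < d" "t < e" using d(1) e(1) by (auto simp: t_def min_def)
  thus "y:coords E & rflat {} & (ALL i:E. rflat (lex_superlevel x y i))" using d(2) iff by blast
 next
  assume "y:coords E & rflat {} & (ALL i:E. rflat (lex_superlevel x y i))"
  thus "y:tcone trop_space x" using iff e(1) unfolding tcone_def by blast
 qed
qed

subsection \<open>Initial matroids\<close>

text \<open>The rank function of the initial matroid at \<open>x\<close>: the direct sum, over the
  values \<open>c\<close> of \<open>x\<close>, of the minors on the level sets, each restricted to
  coordinates at least \<open>c\<close> and contracted by those above \<open>c\<close>.\<close>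

definition init_rank :: "'a fvec => 'a set => int" where
 "init_rank x A = (\<Sum>c\<in>lookup x ` E.
   r ({i:E. c < lookup x i} Un (A Int {i:E. c <= lookup x i})) - r {i:E. c < lookup x i})"

text \<open>Only the level of \<open>i\<close> contributes: at lower levels \<open>i\<close> is
  already contracted, at higher levels it is discarded.\<close>

lemma init_rank_insert:
 assumes A: "A <= E" and i: "i:E"
 shows "init_rank x (insert i A) - init_rank x A =
  r (insert i ({j:E. lookup x i < lookup x j} Un (A Int {j:E. lookup x i <= lookup x j})))
  - r ({j:E. lookup x i < lookup x j} Un (A Int {j:E. lookup x i <= lookup x j}))"
proof -
 let ?c = "lookup x i"
 define g where "g A c = r ({i:E. c < lookup x i} Un (A Int {i:E. c <= lookup x i})) - r {i:E. c < lookup x i}" for A c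
 have other: "g (insert i A) c = g A c" if "c ~= ?c" for c
 proof (cases "c < ?c")
  case True
  hence "{i:E. c < lookup x i} Un (insert i A Int {i:E. c <= lookup x i})
   = {i:E. c < lookup x i} Un (A Int {i:E. c <= lookup x i})" using i by auto
  thus ?thesis unfolding g_def by simp
 next
  case False
  hence "insert i A Int {i:E. c <= lookup x i} = A Int {i:E. c <= lookup x i}" using that by auto
  thus ?thesis unfolding g_def by simp
 qed
 have "init_rank x B = g B ?c + (\<Sum>c\<in>lookup x ` E - {?c}. g B c)" for B
  unfolding init_rank_def g_def using fin i by (intro sum.remove) auto
 moreover have "(\<Sum>c\<in>lookup x ` E - {?c}. g (insert i A) c) = (\<Sum>c\<in>lookup x ` E - {?c}. g A c)"
  by (intro sum.cong) (auto simp: other)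
 moreover have "{j:E. ?c < lookup x j} Un (insert i A Int {j:E. ?c <= lookup x j})
   = insert i ({j:E. ?c < lookup x j} Un (A Int {j:E. ?c <= lookup x j}))" using i by auto
 ultimately show ?thesis unfolding g_def by simp
qed

lemma rank_function_init: "rank_function E (init_rank x)"
proof
 show "finite E" by (rule fin)
 show "init_rank x {} = 0" unfolding init_rank_def by simp
 show "init_rank x A <= init_rank x (insert i A)" "init_rank x (insert i A) <= init_rank x A + 1"
  if "A <= E" "i:E" for A i
 proof -
  define G where "G = {j:E. lookup x i < lookup x j} Un (A Int {j:E. lookup x i <= lookup x j})"
  have "G <= E" unfolding G_def by blast
  thus "init_rank x A <= init_rank x (insert i A)" "init_rank x (insert i A) <= init_rank x A + 1"
   using init_rank_insert[OF that, of x, folded G_def] rank_insert_mono[of G i] rank_insert_le[of G i] that by auto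
 qed
 fix A B assume AB: "A <= E" "B <= E"
 show "init_rank x (A Un B) + init_rank x (A Int B) <= init_rank x A + init_rank x B"
  unfolding init_rank_def sum.distrib[symmetric]
 proof (rule sum_mono)
  fix c
  let ?U = "{i:E. c < lookup x i}" and ?V = "{i:E. c <= lookup x i}"
  have "r ((?U Un (A Int ?V)) Un (?U Un (B Int ?V))) + r ((?U Un (A Int ?V)) Int (?U Un (B Int ?V)))
    <= r (?U Un (A Int ?V)) + r (?U Un (B Int ?V))"
   by (rule rank_submodular) auto
  moreover have "(?U Un (A Int ?V)) Un (?U Un (B Int ?V)) = ?U Un ((A Un B) Int ?V)"
   "(?U Un (A Int ?V)) Int (?U Un (B Int ?V)) = ?U Un ((A Int B) Int ?V)" by auto
  ultimately show "r (?U Un ((A Un B) Int ?V)) - r ?U + (r (?U Un ((A Int B) Int ?V)) - r ?U)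
   <= r (?U Un (A Int ?V)) - r ?U + (r (?U Un (B Int ?V)) - r ?U)" by simp
 qed
qed

text \<open>The sum telescopes, because the strict superlevel set of one value is the weak
  superlevel set of the next larger one.\<close>

lemma init_rank_E: "init_rank x E = r E"
proof -
 let ?U = "%c. {i:E. c < lookup x i}" and ?V = "%c. {i:E. c <= lookup x i}"
 let ?C = "lookup x ` E"
 have fC: "finite ?C" using fin by simp
 have T: "(\<Sum>c\<in>{c:?C. s < c}. r (?V c) - r (?U c)) = r (?U s)" for s
 proof (induction "card {c:?C. s < c}" arbitrary: s rule: less_induct)
  case less
  show ?case
  proof (cases "{c:?C. s < c} = {}")
   case True
   hence "?U s = {}" by auto
   moreover have "(\<Sum>c\<in>{c:?C. s < c}. r (?V c) - r (?U c)) = 0" unfolding True by simp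
   ultimately show ?thesis using rank_empty by metis
  next
   case False
   define m where "m = Min {c:?C. s < c}"
   have m: "m:{c:?C. s < c}" unfolding m_def using fC False by (intro Min_in) auto
   have mle: "m <= c" if "c:{c:?C. s < c}" for c unfolding m_def using fC that by (intro Min_le) auto
   have eq: "{c:?C. s < c} = insert m {c:?C. m < c}"
   proof (intro equalityI subsetI)
    fix c assume c: "c:{c:?C. s < c}"
    thus "c:insert m {c:?C. m < c}" using mle[OF c] by auto
   qed (use m in auto)
   have "{c:?C. m < c} \<subset> {c:?C. s < c}" using m eq by auto
   hence "card {c:?C. m < c} < card {c:?C. s < c}" using fC by (intro psubset_card_mono) auto
   hence IH: "(\<Sum>c\<in>{c:?C. m < c}. r (?V c) - r (?U c)) = r (?U m)" by (rule less)
   have "?U s = ?V m"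
   proof (intro equalityI subsetI)
    fix i assume "i:?U s" thus "i:?V m" using mle[of "lookup x i"] by auto
   qed (use m in auto)
   thus ?thesis unfolding eq using IH fC by simp
  qed
 qed
 show ?thesis
 proof (cases "E = {}")
  case True thus ?thesis unfolding init_rank_def using rank_empty by simp
 next
  case False
  define s where "s = Min ?C - 1"
  have sl: "s < c" if "c:?C" for c
   using Min_le[OF fC that] unfolding s_def by linarith
  have "{c:?C. s < c} = ?C" "?U s = E" using sl by auto
  moreover have "init_rank x E = (\<Sum>c\<in>?C. r (?V c) - r (?U c))"
   unfolding init_rank_def
  proof (intro sum.cong refl)
   fix c
   have "?U c Un (E Int ?V c) = ?V c" by auto
   thus "r (?U c Un (E Int ?V c)) - r (?U c) = r (?V c) - r (?U c)" by simp
  qed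
  ultimately show ?thesis using T[of s] by simp
 qed
qed

end

text \<open>By \<open>init_rank_insert\<close> flatness for the initial matroid is tested level by
  level: the effect of adding \<open>i\<close> is decided by \<open>G F i\<close>, the part of
  \<open>F\<close> on the level of \<open>i\<close> together with everything above. If
  \<open>F\<close> is a superlevel set of \<open>y\<close>, this is a lexicographic superlevel set
  or a strict superlevel set of \<open>x\<close>.\<close>

lemma tcone_trop_space:
 assumes "rank_function E r" and x: "x:rank_function.trop_space E r"
 shows "tcone (rank_function.trop_space E r) x = rank_function.trop_space E (rank_function.init_rank E r x)"
proof -
 interpret rank_function E r by fact
 let ?l = "lookup"
 interpret I: rank_function E "init_rank x" by (rule rank_function_init)
 define G where "G F i = {j:E. ?l x i < ?l x j} Un (F Int {j:E. ?l x i <= ?l x j})" for F i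
 have Iflat: "I.rflat F <-> F <= E & (ALL i:E - F. r (G F i) < r (insert i (G F i)))" for F
 proof -
  have "init_rank x F < init_rank x (insert i F) <-> r (G F i) < r (insert i (G F i))" if "F <= E" "i:E" for i
   using init_rank_insert[OF that, of x] unfolding G_def by linarith
  thus ?thesis unfolding I.rflat_def by blast
 qed
 have U: "rflat {j:E. s < ?l x j}" and V: "rflat {j:E. s <= ?l x j}" for s
  using rflat_strict_superlevel[OF x] x unfolding trop_space_def by blast+
 have e: "rflat {}" using trop_space_empty[OF x] .
 show ?thesis
 proof (intro equalityI subsetI)
  fix y assume "y:tcone trop_space x"
  hence y: "y:coords E" "!!i. i:E ==> rflat (lex_superlevel x y i)"
   using tcone_trop_space_iff[OF trop_space_coords[OF x]] by auto
  have "I.rflat {j:E. u <= ?l y j}" for u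
   unfolding Iflat
  proof (intro conjI ballI)
   fix i assume i: "i:E - {j:E. u <= ?l y j}"
   define W where "W = {j:E. ?l x j = ?l x i & u <= ?l y j}"
   have GW: "G {j:E. u <= ?l y j} i = {j:E. ?l x i < ?l x j} Un W" unfolding G_def W_def by auto
   have "rflat (G {j:E. u <= ?l y j} i)"
   proof (cases "W = {}")
    case True thus ?thesis using GW U by simp
   next
    case False
    then obtain k where k: "k:W" "ALL j:W. ?l y k <= ?l y j"
     using superlevel_min[of W "?l y"] unfolding W_def by blast
    hence "lex_superlevel x y k = {j:E. ?l x i < ?l x j} Un W"
     unfolding lex_superlevel_def W_def by fastforce
    thus ?thesis using GW y(2)[of k] k unfolding W_def by simp
   qed
   moreover have "i~:G {j:E. u <= ?l y j} i" unfolding G_def using i by auto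
   ultimately show "r (G {j:E. u <= ?l y j} i) < r (insert i (G {j:E. u <= ?l y j} i))"
    using i unfolding rflat_def by blast
  qed auto
  thus "y:I.trop_space" unfolding I.trop_space_def using y by blast
 next
  fix y assume "y:I.trop_space"
  hence y: "y:coords E" "!!u. I.rflat {j:E. u <= ?l y j}" unfolding I.trop_space_def by auto
  have "rflat (lex_superlevel x y i)" if i: "i:E" for i
   unfolding rflat_def
  proof (intro conjI ballI)
   show "lex_superlevel x y i <= E" unfolding lex_superlevel_def by blast
   fix k assume k: "k:E - lex_superlevel x y i"
   let ?F = "{j:E. ?l y i <= ?l y j}"
   consider "?l x k = ?l x i" "?l y k < ?l y i" | "?l x k < ?l x i"
    using k unfolding lex_superlevel_def by force
   thus "r (lex_superlevel x y i) < r (insert k (lex_superlevel x y i))"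
   proof cases
    case 1
    hence "lex_superlevel x y i = G ?F k" unfolding lex_superlevel_def G_def by auto
    moreover have "k:E - ?F" using 1 k by auto
    ultimately show ?thesis using y(2)[of "?l y i"] unfolding Iflat by simp
   next
    case 2
    show ?thesis
     by (rule rflat_strict[OF V[of "?l x i"]]) (use 2 k in \<open>auto simp: lex_superlevel_def\<close>)
   qed
  qed
  thus "y:tcone trop_space x"
   using tcone_trop_space_iff[OF trop_space_coords[OF x]] y e by blast
 qed
qed

subsection \<open>Lineality and balancing\<close>

lemma Ints_inverse_eq_1:
 fixes c :: real assumes "0 < c" "c:\<int>" "1 / c:\<int>" shows "c = 1"
proof -
 obtain m n where mn: "c = of_int m" "1 / c = of_int n" using assms by (auto elim!: Ints_cases)
 have "c * (1 / c) = 1" using assms by simp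
 hence "real_of_int (m * n) = 1" unfolding mn(2) unfolding mn(1) by simp
 hence "m * n = 1" by (simp only: of_int_eq_1_iff)
 moreover have "0 < m" using mn assms(1) by simp
 ultimately show ?thesis using mn by (simp add: pos_zmult_eq_1_iff)
qed

locale loopless_rank_function = rank_function +
 assumes loopless: "rflat {}"
begin

text \<open>
 The level sets of lineality vectors are separators of the matroid; \<open>good_set\<close> is the part of
 this property which concerns one superlevel set.
\<close>

definition good_set :: "'a set => bool" where
 "good_set A <-> A <= E & (ALL Z Z'. rflat Z --> rflat Z' --> Z <= Z' --> rflat (Z Un (A Int Z')))"

definition separator :: "'a set => bool" where
 "separator A <-> good_set A & good_set (E - A)"

definition lineality :: "'a fvec set" where
 "lineality = {y:coords E. ALL x:trop_space. ALL t. x + t *R y:trop_space}"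

lemma good_setD: "good_set A ==> rflat Z ==> rflat Z' ==> Z <= Z' ==> rflat (Z Un (A Int Z'))"
 unfolding good_set_def by blast

lemma good_set_subset: "good_set A ==> A <= E"
 unfolding good_set_def by blast

lemma good_set_Int:
 assumes "good_set A" "good_set B" shows "good_set (A Int B)"
 unfolding good_set_def
proof (intro conjI allI impI)
 show "A Int B <= E" using good_set_subset assms by blast
 fix Z Z' assume Z: "rflat Z" "rflat Z'" "Z <= Z'"
 have "rflat (Z Un (B Int Z'))" using good_setD[OF assms(2) Z] .
 hence "rflat (Z Un (A Int (Z Un (B Int Z'))))" using good_setD[OF assms(1) Z(1)] by blast
 moreover have "Z Un (A Int (Z Un (B Int Z'))) = Z Un (A Int B Int Z')" by blast
 ultimately show "rflat (Z Un (A Int B Int Z'))" by metis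
qed

lemma good_set_Un:
 assumes "good_set A" "good_set B" shows "good_set (A Un B)"
 unfolding good_set_def
proof (intro conjI allI impI)
 show "A Un B <= E" using good_set_subset assms by blast
 fix Z Z' assume Z: "rflat Z" "rflat Z'" "Z <= Z'"
 have "rflat (Z Un (A Int Z'))" using good_setD[OF assms(1) Z] .
 moreover have "Z Un (A Int Z') <= Z'" using Z by blast
 ultimately have "rflat ((Z Un (A Int Z')) Un (B Int Z'))" using good_setD[OF assms(2) _ Z(2)] by blast
 moreover have "(Z Un (A Int Z')) Un (B Int Z') = Z Un ((A Un B) Int Z')" by blast
 ultimately show "rflat (Z Un ((A Un B) Int Z'))" by metis
qed

lemma separator_subset: "separator A ==> A <= E"
 unfolding separator_def using good_set_subset by blast

lemma separator_Int: "separator A ==> separator B ==> separator (A Int B)"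
 unfolding separator_def using good_set_Int good_set_Un[of "E - A" "E - B"] by (simp add: Diff_Int)

lemma good_set_E: "good_set E"
 unfolding good_set_def
proof (intro conjI allI impI)
 fix Z Z' assume Z: "rflat Z" "rflat Z'" "Z <= Z'"
 hence "Z Un (E Int Z') = Z'" using rflat_subset by blast
 thus "rflat (Z Un (E Int Z'))" using Z by metis
qed simp

lemma separator_E: "separator E"
 unfolding separator_def using good_set_E by (simp add: good_set_def)

lemma lineality_coords: "y:lineality ==> y:coords E"
 by (simp add: lineality_def)

lemma lineality_uminus: "y:lineality ==> - y:lineality"
proof -
 assume y: "y:lineality"
 hence "- y:coords E" using lineality_coords subspace_neg[OF coords_subspace] by blast
 moreover have "x + t *R (- y):trop_space" if "x:trop_space" for x t
 proof -
  have "x + (- t) *R y:trop_space" using y that unfolding lineality_def by blast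
  thus ?thesis by simp
 qed
 ultimately show ?thesis unfolding lineality_def by blast
qed

text \<open>It is enough to test \<open>y\<close> at the point \<open>evec Z + evec Z'\<close>:
  there the perturbed superlevel set, taken at the right height, is the required set.\<close>

lemma lineality_superlevel_good:
 assumes y: "y:lineality" shows "good_set {i:E. s <= lookup y i}"
 unfolding good_set_def
proof (intro conjI allI impI)
 let ?l = "lookup"
 let ?A = "{i:E. s <= ?l y i}"
 fix Z Z' assume Z: "rflat Z" "rflat Z'" "Z <= Z'"
 define W where "W = {i:Z' - Z. s <= ?l y i}"
 have WE: "W <= E" using rflat_subset[OF Z(2)] unfolding W_def by blast
 show "rflat (Z Un (?A Int Z'))"
 proof (cases "W = {}")
  case True
  hence "Z Un (?A Int Z') = Z" unfolding W_def by auto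
  thus ?thesis using Z by simp
 next
  case False
  \<comment> \<open>Among the elements of \<open>Z' - Z\<close> with value at least
    \<open>s\<close>, the one with smallest value makes the lexicographic superlevel set at
    \<open>i\<close> equal to \<open>Z Un (?A Int Z')\<close>.\<close>
  then obtain i where i: "i:W" "ALL j:W. ?l y i <= ?l y j" using superlevel_min[OF WE, of "?l y"] by blast
  define x where "x = 1 *R evec Z + 1 *R evec Z'"
  have x: "x:trop_space" unfolding x_def by (rule flag_trop_space[OF loopless Z]) auto
  have lx: "?l x j = (if j:Z then 1 else 0) + (if j:Z' then 1 else 0)" for j
   unfolding x_def using finite_subset_E[OF rflat_subset[OF Z(1)]] finite_subset_E[OF rflat_subset[OF Z(2)]]
   by (simp add: lookup_add lookup_evec)
  have "y:tcone trop_space x" unfolding tcone_def using y x by (auto simp: lineality_def intro!: exI[of _ 1])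
  hence "rflat (lex_superlevel x y i)"
   using tcone_trop_space_iff[OF trop_space_coords[OF x]] i(1) WE by blast
  moreover have "lex_superlevel x y i = Z Un (?A Int Z')"
  proof (intro equalityI subsetI)
   fix j assume j: "j:lex_superlevel x y i"
   thus "j:Z Un (?A Int Z')" using i(1) unfolding lex_superlevel_def lx W_def by (auto split: if_splits)
  next
   fix j assume j: "j:Z Un (?A Int Z')"
   show "j:lex_superlevel x y i"
   proof (cases "j:Z")
    case True
    thus ?thesis using i(1) Z(3) rflat_subset[OF Z(1)] unfolding lex_superlevel_def lx W_def by auto
   next
    case False
    hence "j:W" using j unfolding W_def by auto
    hence "?l y i <= ?l y j" "j:E" "j:Z' - Z" using i(2) WE unfolding W_def by auto
    moreover have "i:Z' - Z" using i(1) unfolding W_def by blast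
    ultimately show ?thesis unfolding lex_superlevel_def lx by simp
   qed
  qed
  ultimately show ?thesis by metis
 qed
qed auto

lemma lineality_superlevel_separator:
 assumes y: "y:lineality" shows "separator {i:E. s <= lookup y i}"
proof -
 let ?B = "{i:E. - s < lookup (- y) i}"
 have "good_set ?B"
 proof (cases "?B = {}")
  case True
  show ?thesis unfolding True good_set_def by simp
 next
  case False
  then obtain i where i: "i:?B" "ALL j:?B. lookup (- y) i <= lookup (- y) j"
   using superlevel_min[of ?B "lookup (- y)"] by blast
  hence "?B = {j:E. lookup (- y) i <= lookup (- y) j}" by force
  thus ?thesis using lineality_superlevel_good[OF lineality_uminus[OF y]] by metis
 qed
 moreover have "E - {i:E. s <= lookup y i} = ?B" by auto
 ultimately show ?thesis unfolding separator_def using lineality_superlevel_good[OF y] by simp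
qed

lemma lineality_level_separator:
 assumes y: "y:lineality" shows "separator {i:E. lookup y i = s}"
proof -
 have "{i:E. lookup y i = s} = {i:E. s <= lookup y i} Int {i:E. - s <= lookup (- y) i}"
  by auto
 thus ?thesis
  using separator_Int[OF lineality_superlevel_separator[OF y, of s] lineality_superlevel_separator[OF lineality_uminus[OF y], of "- s"]]
  by simp
qed

text \<open>Raising the coordinates in \<open>A\<close> by \<open>t\<close> turns a superlevel set
  into its union with the part in \<open>A\<close> of a larger superlevel set, the situation of
  \<open>good_set\<close>. For negative \<open>t\<close> the complement takes the role of
  \<open>A\<close>.\<close>

lemma separator_lineality: assumes A: "separator A" shows "evec A:lineality"
 unfolding lineality_def
proof (intro CollectI conjI ballI allI)
 let ?l = "lookup"
 have AE: "A <= E" using separator_subset[OF A] .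
 show c: "evec A:coords E" using evec_coords finite_subset_E AE by blast
 fix x t assume x: "x:trop_space"
 have lx: "?l (x + t *R evec A) i = ?l x i + (if i:A then t else 0)" for i
  using finite_subset_E[OF AE] by (simp add: lookup_add lookup_evec)
 have fl: "rflat {i:E. s <= ?l x i}" for s using x unfolding trop_space_def by blast
 have "rflat {i:E. s <= ?l (x + t *R evec A) i}" for s
 proof (cases "t >= 0")
  case True
  have "{i:E. s <= ?l (x + t *R evec A) i} = {i:E. s <= ?l x i} Un (A Int {i:E. s - t <= ?l x i})"
   unfolding lx using True by auto
  moreover have "rflat ({i:E. s <= ?l x i} Un (A Int {i:E. s - t <= ?l x i}))"
   by (rule good_setD[OF _ fl fl]) (use A True in \<open>auto simp: separator_def\<close>)
  ultimately show ?thesis by simp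
 next
  case False
  have "{i:E. s <= ?l (x + t *R evec A) i} = {i:E. s - t <= ?l x i} Un ((E - A) Int {i:E. s <= ?l x i})"
   unfolding lx using False by auto
  moreover have "rflat ({i:E. s - t <= ?l x i} Un ((E - A) Int {i:E. s <= ?l x i}))"
   by (rule good_setD[OF _ fl fl]) (use A False in \<open>auto simp: separator_def\<close>)
  ultimately show ?thesis by simp
 qed
 moreover have "x + t *R evec A:coords E"
  using c trop_space_coords[OF x] by (intro subspace_add subspace_scale coords_subspace)
 ultimately show "x + t *R evec A:trop_space" unfolding trop_space_def by blast
qed

lemma separator_iff: "F <= E ==> separator F <-> evec F:lineality"
proof
 assume F: "F <= E" "evec F:lineality"
 hence "{i:E. lookup (evec F :: 'a fvec) i = 1} = F"
  using finite_subset_E by (auto simp: lookup_evec split: if_splits)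
 thus "separator F" using lineality_level_separator[OF F(2), of 1] by simp
qed (rule separator_lineality)

lemma evec_E_lineality: "evec E:lineality"
 by (rule separator_lineality[OF separator_E])

text \<open>The parallel classes, that is, the flats of rank one of a loopless matroid; they
  partition \<open>E\<close>.\<close>

definition atoms :: "'a set set" where
 "atoms = (%i. rcl {i}) ` E"

lemma rank_single: "i:E ==> r {i} = 1"
 using rank_insert_le[of "{}" i] rflat_strict[OF loopless, of "{}" i] rank_empty by auto

lemma rcl_single_mem: "i:E ==> i:rcl {i}"
 using rcl_superset[of "{i}"] by auto

lemma rcl_single_eq: assumes i: "i:E" and j: "j:rcl {i}" shows "rcl {j} = rcl {i}"
proof
 have jE: "j:E" and "r {j, i} = r {i}" using j unfolding rcl_def by auto
 hence "r (insert i {j}) = r {j}" using rank_single i by (simp add: insert_commute)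
 hence "i:rcl {j}" using i unfolding rcl_def by blast
 thus "rcl {i} <= rcl {j}" using rcl_minimal rflat_rcl jE by simp
 show "rcl {j} <= rcl {i}" using rcl_minimal rflat_rcl i j by simp
qed

lemma atoms_disjoint: "G:atoms ==> G':atoms ==> G ~= G' ==> G Int G' = {}"
proof (rule ccontr)
 assume G: "G:atoms" "G':atoms" "G ~= G'" "G Int G' ~= {}"
 then obtain i j k where "i:E" "G = rcl {i}" "j:E" "G' = rcl {j}" "k:G" "k:G'" unfolding atoms_def by blast
 thus False using rcl_single_eq[of i k] rcl_single_eq[of j k] G(3) by simp
qed

lemma atoms_rflat: "G:atoms ==> rflat G"
 unfolding atoms_def using rflat_rcl by auto

lemma atoms_subset: "G:atoms ==> G <= E"
 using atoms_rflat rflat_subset by blast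

lemma atoms_nonempty: "G:atoms ==> G ~= {}"
 unfolding atoms_def using rcl_single_mem by blast

lemma atoms_finite: "finite atoms"
 unfolding atoms_def using fin by simp

lemma atom_of: "i:E ==> EX G:atoms. i:G"
 unfolding atoms_def using rcl_single_mem by blast

lemma atom_rflat_cases: "G:atoms ==> rflat F ==> G <= F | G Int F = {}"
proof (rule ccontr)
 assume G: "G:atoms" "rflat F" "~ (G <= F | G Int F = {})"
 then obtain i j where i: "i:E" "G = rcl {i}" "j:G" "j:F" unfolding atoms_def by blast
 hence "rcl {j} <= F" using rcl_minimal[OF G(2)] by simp
 thus False using rcl_single_eq[of i j] i G(3) by simp
qed

lemma sum_atoms_lookup:
 assumes "\<A> <= atoms" "i:G" "G:atoms"
 shows "lookup (\<Sum>G\<in>\<A>. c G *R evec G) i = (if G:\<A> then c G else 0)"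
proof -
 have fA: "finite \<A>" using assms(1) atoms_finite finite_subset by blast
 have "lookup (\<Sum>G\<in>\<A>. c G *R evec G) i = (\<Sum>G'\<in>\<A>. c G' * (if i:G' then 1 else 0))"
  unfolding lookup_sum_scaleR
 proof (intro sum.cong refl)
  fix G' assume "G':\<A>"
  hence "finite G'" using assms(1) atoms_subset finite_subset_E by blast
  thus "c G' * lookup (evec G') i = c G' * (if i:G' then 1 else 0)" by (simp add: lookup_evec)
 qed
 also have "... = (\<Sum>G'\<in>\<A>. if G' = G then c G else 0)"
  by (intro sum.cong refl) (use assms atoms_disjoint in auto)
 also have "... = (if G:\<A> then c G else 0)" using fA by simp
 finally show ?thesis .
qed

lemma sum_atoms_coords: "\<A> <= atoms ==> (\<Sum>G\<in>\<A>. c G *R evec G):coords E"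
 by (intro subspace_sum subspace_scale coords_subspace evec_coords finite_subset_E atoms_subset) auto

definition atom_value :: "'a fvec => 'a set => real" where
 "atom_value v G = lookup v (SOME i. i:G)"

lemma atom_value:
 assumes v: "v:trop_space" and G: "G:atoms" "i:G" shows "atom_value v G = lookup v i"
proof -
 have eq: "lookup v i <= lookup v j" if "i:G" "j:G" for i j
 proof -
  have "rflat {k:E. lookup v i <= lookup v k}" using v unfolding trop_space_def by blast
  hence "G <= {k:E. lookup v i <= lookup v k}"
   using atom_rflat_cases[OF G(1)] that atoms_subset[OF G(1)] by blast
  thus ?thesis using that by blast
 qed
 have "(SOME i. i:G):G" using G(2) by (rule someI)
 thus ?thesis unfolding atom_value_def using eq G(2) by (simp add: order_antisym)
qed

lemma trop_space_atoms:
 assumes v: "v:trop_space" shows "v = (\<Sum>G\<in>atoms. atom_value v G *R evec G)"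
proof (rule coords_eqI[OF trop_space_coords[OF v] sum_atoms_coords[OF order_refl]])
 fix i assume "i:E"
 then obtain G where "G:atoms" "i:G" using atom_of by blast
 thus "lookup v i = lookup (\<Sum>G\<in>atoms. atom_value v G *R evec G) i"
  using sum_atoms_lookup[OF order_refl] atom_value[OF v] by simp
qed

lemma rflat_atoms:
 assumes F: "rflat F" shows "evec F = (\<Sum>G\<in>{G:atoms. G <= F}. 1 *R evec G)"
proof (rule coords_eqI)
 show "evec F:coords E" using evec_coords finite_subset_E rflat_subset[OF F] by blast
 show "(\<Sum>G\<in>{G:atoms. G <= F}. 1 *R evec G):coords E" by (rule sum_atoms_coords) auto
 fix i assume "i:E"
 then obtain G where G: "G:atoms" "i:G" using atom_of by blast
 have "i:F <-> G <= F" using atom_rflat_cases[OF G(1) F] G(2) by blast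
 thus "lookup (evec F) i = lookup (\<Sum>G\<in>{G:atoms. G <= F}. 1 *R evec G) i"
  using sum_atoms_lookup[of "{G:atoms. G <= F}" i G "%_. 1"] G
  by (simp add: lookup_evec[OF finite_subset_E[OF rflat_subset[OF F]]])
qed

text \<open>If all of the space is lineality, every atom is a separator, so unions of atoms are
  flats and the rank counts atoms; the indicator vectors of the atoms form a basis.\<close>

lemma linear_trop_space_dim:
 assumes lin: "trop_space <= lineality" shows "int (dim trop_space) = r E"
proof -
 have sep: "separator G" if G: "G:atoms" for G
  using separator_iff[OF atoms_subset[OF G]] lin evec_trop_space[OF loopless atoms_rflat[OF G]] by blast
 have un: "r (\<Union>\<A>) = int (card \<A>) & rflat (\<Union>\<A>)" if "finite \<A>" "\<A> <= atoms" for \<A>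
  using that
 proof (induction \<A> rule: finite_induct)
  case empty thus ?case using rank_empty loopless by simp
 next
  case (insert G \<A>)
  hence IH: "r (\<Union>\<A>) = int (card \<A>)" "rflat (\<Union>\<A>)" and G: "G:atoms" by auto
  obtain i where i: "i:E" "G = rcl {i}" using G unfolding atoms_def by blast
  have iG: "i:G" using i rcl_single_mem by simp
  have dis: "G Int \<Union>\<A> = {}" using atoms_disjoint[OF G] insert by blast
  have sub: "\<Union>\<A> <= E" "G <= E" using rflat_subset IH atoms_subset G by auto
  have "r (G Un \<Union>\<A>) + r (G Int \<Union>\<A>) <= r G + r (\<Union>\<A>)" using rank_submodular sub by blast
  moreover have "r G = 1" using rank_rcl[of "{i}"] rank_single i by simp
  ultimately have le: "r (G Un \<Union>\<A>) <= 1 + r (\<Union>\<A>)" using dis rank_empty by simp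
  have "r (\<Union>\<A>) < r (insert i (\<Union>\<A>))" using rflat_strict[OF IH(2) order_refl] i dis iG by blast
  also have "... <= r (G Un \<Union>\<A>)" using iG sub by (intro rank_mono) auto
  finally have "r (\<Union>(insert G \<A>)) = int (card (insert G \<A>))" using le IH insert.hyps by simp
  moreover have "rflat (\<Union>\<A> Un (G Int E))"
   using good_setD[OF _ IH(2) rflat_E] sep[OF G] sub unfolding separator_def by blast
  hence "rflat (\<Union>(insert G \<A>))" using sub by (simp add: Int_absorb2 Un_commute)
  ultimately show ?case by blast
 qed
 have "\<Union>atoms = E" using atom_of atoms_subset by blast
 hence rE: "r E = int (card atoms)" using un[OF atoms_finite order_refl] by simp
 have zero: "c G = 0" if z: "(\<Sum>G\<in>atoms. c G *R evec G) = 0" "G:atoms" for c G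
 proof -
  obtain i where "i:G" using atoms_nonempty[OF z(2)] by blast
  thus ?thesis using sum_atoms_lookup[OF order_refl _ z(2), of i c] z by simp
 qed
 have inj: "inj_on evec atoms"
 proof (rule inj_onI)
  fix G G' assume G: "G:atoms" "G':atoms" "(evec G :: 'a fvec) = evec G'"
  obtain i where i: "i:G" using atoms_nonempty[OF G(1)] by blast
  have "lookup (evec G :: 'a fvec) i = lookup (evec G') i" using G(3) by simp
  hence "i:G'" using i lookup_evec finite_subset_E atoms_subset G(1,2) by (metis zero_neq_one)
  thus "G = G'" using atoms_disjoint[OF G(1,2)] i by blast
 qed
 have ind: "independent (evec ` atoms :: 'a fvec set)"
 proof (rule independent_if_scalars_zero)
  show "finite (evec ` atoms :: 'a fvec set)" using atoms_finite by simp
  fix f and x :: "'a fvec" assume "(\<Sum>x\<in>evec ` atoms. f x *R x) = 0" "x:evec ` atoms"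
  thus "f x = 0" using zero[of "%G. f (evec G)"] by (auto simp: sum.reindex[OF inj])
 qed
 have "dim trop_space = card (evec ` atoms :: 'a fvec set)"
 proof (rule dim_unique[OF _ _ ind refl])
  show "evec ` atoms <= trop_space" using evec_trop_space[OF loopless] atoms_rflat by blast
  show "trop_space <= span (evec ` atoms)"
  proof
   fix v assume "v:trop_space"
   hence "v = (\<Sum>G\<in>atoms. atom_value v G *R evec G)" by (rule trop_space_atoms)
   also have "...:span (evec ` atoms)" by (intro span_sum span_scale span_base) auto
   finally show "v:span (evec ` atoms)" .
  qed
 qed
 thus ?thesis using rE card_image[OF inj] by simp
qed

text \<open>Only finitely many halfspaces are available, so two of the points \<open>u + s *\<^sub>R v\<close> lie in the same one.\<close>

lemma proportional_modulo:
 fixes u v :: "'v::real_vector"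
 assumes L: "subspace La" and A: "finite A" and v: "v~:La"
  and h: "!!s. 0 <= s ==> EX a:A. EX l:La. EX c::real. u + s *R v = l + c *R a"
 shows "EX k::real. u - k *R v:La"
proof -
 have "ALL n. EX a. a:A & (EX l:La. EX c::real. u + of_nat n *R v = l + c *R a)" using h by (metis of_nat_0_le_iff)
 then obtain a where a: "!!n. a n:A" "!!n::nat. EX l:La. EX c::real. u + of_nat n *R v = l + c *R a n" by metis
 have "~ inj a" using a(1) A by (metis finite_imageD finite_subset image_subsetI infinite_UNIV_nat)
 then obtain m n where mn: "a m = a n" "m ~= n" unfolding inj_def by blast
 obtain l c where l: "l:La" "u + of_nat m *R v = l + c *R a m" using a(2) by blast
 obtain l' c' where l': "l':La" "u + of_nat n *R v = l' + c' *R a m" using a(2)[of n] mn by metis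
 define d where "d = real m - real n"
 have d: "d ~= 0" using mn unfolding d_def by simp
 have e1: "d *R v = (l - l') + (c - c') *R a m"
 proof -
  have "(u + of_nat m *R v) - (u + of_nat n *R v) = (l + c *R a m) - (l' + c' *R a m)" using l l' by simp
  thus ?thesis unfolding d_def by (simp add: algebra_simps)
 qed
 have ll: "l - l':La" using l l' L by (simp add: subspace_diff)
 have cc: "c ~= c'"
 proof
  assume "c = c'"
  hence "d *R v:La" using e1 ll by simp
  hence "(1 / d) *R (d *R v):La" by (rule subspace_scale[OF L])
  hence "(1 / d * d) *R v:La" by (simp only: scaleR_scaleR)
  thus False using v d by simp
 qed
 \<comment> \<open>Modulo \<open>La\<close>, the vector \<open>a m\<close> is
   \<open>d / (c - c')\<close> times \<open>v\<close>, and \<open>u\<close> is \<open>c\<close>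
   times \<open>a m\<close> minus \<open>m\<close> times \<open>v\<close>.\<close>
 define k where "k = c * d / (c - c') - real m"
 have "a m = (1 / (c - c')) *R ((c - c') *R a m)" using cc by simp
 also have "... = (1 / (c - c')) *R (d *R v - (l - l'))" using e1 by (metis add_diff_cancel_left')
 finally have am: "a m = (d / (c - c')) *R v - (1 / (c - c')) *R (l - l')" by (simp add: scaleR_diff_right)
 have "u = l + c *R a m - of_nat m *R v" using l(2) by (metis add_diff_cancel_right')
 also have "... = l + c *R ((d / (c - c')) *R v - (1 / (c - c')) *R (l - l')) - of_nat m *R v" using am by simp
 also have "... - k *R v = l - (c / (c - c')) *R (l - l')"
  unfolding k_def scaleR_diff_right scaleR_diff_left scaleR_scaleR by (simp add: algebra_simps)
 also have "...:La" by (rule subspace_diff[OF L l(1) subspace_scale[OF L ll]])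
 finally show ?thesis by blast
qed

text \<open>Modulo \<open>La\<close> the space is a finite union of rays with primitive generators
  \<open>A\<close>. Either it has more lineality than \<open>La\<close>, and then it is a line with
  two opposite generators. Or \<open>La\<close> is the lineality space, and then the generators are
  the images of the atoms that are not separators; the other atoms vanish modulo \<open>La\<close>,
  so the sum is the image of \<open>evec E\<close>, which is 0.\<close>

theorem balancing:
 assumes L: "subspace La" "La <= coords E" and A: "finite A" "A <= int_lattice E"
  and T: "!!v. v:trop_space <-> (EX a:A. EX l:La. EX c>=0. v = l + c *R a)"
  and out: "!!a. a:A ==> a~:La"
  and prim: "!!a z c. a:A ==> z:int_lattice E ==> z - c *R a:La ==> c:\<int>"
  and dist: "!!a b c. a:A ==> b:A ==> 0 <= c ==> b - c *R a:La ==> a = b"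
 shows "\<Sum>A \<in> La"
proof -
 define p where "p = quot_map La"
 have p: "linear p" and p0: "p x = 0 <-> x:La" for x unfolding p_def using quot_map(1)[OF L(1)] quot_map_zero_iff[OF L(1)] .
 note lin = linear_add[OF p] linear_diff[OF p] linear_scale[OF p] linear_neg[OF p]
 have mem: "v:trop_space" if "a:A" "0 <= c" "p v = c *R p a" for a c v
 proof -
  have "v - c *R a:La" "v = (v - c *R a) + c *R a" using that(3) by (simp_all add: p0[symmetric] lin)
  thus ?thesis using T that by blast
 qed
 have AT: "a:trop_space" if "a:A" for a using mem[OF that, of 1] by simp
 have dec: "EX a:A. EX c>=0. p v = c *R p a" if v: "v:trop_space" for v
 proof -
  obtain a l c where "a:A" "l:La" "0 <= c" "v = l + c *R a" using v T by blast
  thus ?thesis using p0[of l] by (intro bexI[of _ a] exI[of _ c]) (auto simp: lin)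
 qed
 have prim: "c:\<int>" if "a:A" "z:int_lattice E" "p z = c *R p a" for a z c
  using prim[OF that(1,2), of c] that(3) by (simp add: p0[symmetric] lin)
 have dist: "a = b" if "a:A" "b:A" "0 <= c" "p b = c *R p a" for a b c
  using dist[OF that(1-3)] that(4) by (simp add: p0[symmetric] lin)
 have propl: "EX k. p u = k *R p v" if v: "p v ~= 0" and m: "!!s. 0 <= s ==> u + s *R v:trop_space" for u v
 proof -
  have "EX k. u - k *R v:La" by (rule proportional_modulo[OF L(1) A(1)]) (use v m T p0 in blast)+
  thus ?thesis by (simp add: p0[symmetric] lin)
 qed
 show ?thesis
 proof (cases "lineality <= La")
  case False
  then obtain y where y: "y:lineality" "p y ~= 0" using p0 by blast
  have "0 + t *R y:trop_space" for t
   using y(1) trop_space_zero[OF loopless] unfolding lineality_def by blast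
  \<comment> \<open>Both \<open>y\<close> and \<open>- y\<close> lie in the space and span opposite
    rays; comparing their primitive generators in both directions will force
    \<open>c / d = 1\<close>.\<close>
  from dec[OF this[of 1]] dec[OF this[of "- 1"]] obtain a c b d
   where a: "a:A" "c >= 0" "p y = c *R p a" and b: "b:A" "d >= 0" "- p y = d *R p b" by (auto simp: lin)
  have cd: "c > 0" "d > 0" using a b y by (auto simp: less_le)
  have b': "p y = - (d *R p b)" using b(3) by (metis minus_minus)
  have pab: "p b = (- (c / d)) *R p a" "p a = (- (d / c)) *R p b"
  proof -
   have "(1 / d) *R (d *R p b) = (1 / d) *R (- (c *R p a))" "(1 / c) *R (c *R p a) = (1 / c) *R (- (d *R p b))"
    using a(3) b' b(3) by metis+
   thus "p b = (- (c / d)) *R p a" "p a = (- (d / c)) *R p b" using cd by simp_all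
  qed
  have "c / d:\<int>" "1 / (c / d):\<int>"
   using prim[OF a(1) _ pab(1)] prim[OF b(1) _ pab(2)] a(1) b(1) A(2) by auto
  hence "c / d = 1" using Ints_inverse_eq_1[of "c / d"] cd by simp
  hence ab: "p b = - p a" using pab(1) by simp
  \<comment> \<open>All points \<open>e + s *R y\<close> stay in the space, so \<open>e\<close> is a
    multiple of \<open>y\<close> modulo \<open>La\<close>; the sign selects \<open>a\<close> or
    \<open>b\<close>.\<close>
  have "e = a | e = b" if e: "e:A" for e
  proof -
   have "e + s *R y:trop_space" for s using y(1) AT[OF e] unfolding lineality_def by blast
   then obtain k where k: "p e = k *R p y" using propl[OF y(2)] by blast
   show ?thesis
   proof (cases "k >= 0")
    case True
    thus ?thesis using dist[OF a(1) e, of "k * c"] k a by simp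
   next
    case False
    thus ?thesis using dist[OF b(1) e, of "- (k * d)"] k b' b by (simp add: mult_nonpos_nonneg)
   qed
  qed
  hence "A = {a, b}" using a(1) b(1) by blast
  moreover have "a ~= b"
  proof
   assume "a = b"
   hence "2 *R p a = 0" using ab by (metis add.right_inverse scaleR_2)
   thus False using out[OF a(1)] p0 by simp
  qed
  ultimately show ?thesis using ab by (simp add: p0[symmetric] lin)
 next
  case True
  have "x + t *R l:trop_space" if x: "x:trop_space" "l:La" for x t l
  proof -
   obtain a c where "a:A" "0 <= c" "p x = c *R p a" using dec[OF x(1)] by blast
   thus ?thesis using mem[of a c "x + t *R l"] x(2) p0[of l] by (simp add: lin)
  qed
  hence La: "La = lineality" using True L(2) unfolding lineality_def by blast
  have sep: "separator F <-> p (evec F) = 0" if "F <= E" for F using separator_iff[OF that] p0 La by simp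
  define \<G> where "\<G> = {G:atoms. p (evec G) ~= 0}"
  have GA: "\<G> <= atoms" and fG: "finite \<G>" unfolding \<G>_def using atoms_finite by auto
  have ns: "~ separator G" if "G:\<G>" for G using that sep atoms_subset unfolding \<G>_def by blast
  have level: "separator {i:E. lookup y i = k}" if "p y = 0" for y k
   using lineality_level_separator p0 that La by blast
  \<comment> \<open>If \<open>m\<close> and \<open>k\<close> differed, \<open>G\<close> would be the
    level set at \<open>k\<close> of a lineality vector, hence a separator; \<open>k ~= 0\<close>
    separates \<open>G\<close> from the coordinates outside both atoms.\<close>
  have two: "m = k" if G: "G:\<G>" "G':atoms" "G ~= G'" and k: "k ~= 0" and y: "k *R p (evec G) + m *R p (evec G') = 0" for G G' k m
  proof (rule ccontr)
   assume mk: "m ~= k"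
   have s: "G <= E" "G' <= E" "G Int G' = {}" using G GA atoms_subset atoms_disjoint by blast+
   hence "{i:E. lookup (k *R evec G + m *R evec G') i = k} = G"
    using k mk by (auto simp: lookup_add lookup_evec finite_subset_E split: if_splits)
   thus False using level[of "k *R evec G + m *R evec G'" k] y ns[OF G(1)] by (simp add: lin)
  qed
  have pF: "p (evec F) = (\<Sum>G\<in>{G:\<G>. G <= F}. p (evec G))" if "rflat F" for F
   unfolding rflat_atoms[OF that] linear_sum[OF p] scaleR_one
   by (rule sum.mono_neutral_right) (use atoms_finite in \<open>auto simp: \<G>_def\<close>)
  \<comment> \<open>By flags, all atoms in \<open>F\<close> that are not separators are proportional
    to \<open>F\<close> modulo \<open>La\<close>, with pairwise opposite factors by
    \<open>two\<close>. So there are at most two of them, and two would add up to 0.\<close>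
  have one: "EX G. {G:\<G>. G <= F} = {G}" if F: "rflat F" "p (evec F) ~= 0" for F
  proof -
   let ?K = "{G:\<G>. G <= F}"
   have "ALL G:?K. EX k. p (evec G) = k *R p (evec F)"
   proof
    fix G assume G: "G:?K"
    hence "evec G + s *R evec F:trop_space" if "0 <= s" for s
     using flag_trop_space[OF loopless _ F(1), of G 1 s] atoms_rflat GA that by auto
    thus "EX k. p (evec G) = k *R p (evec F)" using propl[OF F(2)] by blast
   qed
   from bchoice[OF this] obtain k where k: "ALL G:?K. p (evec G) = k G *R p (evec F)" ..
   hence k0: "k G ~= 0" if "G:?K" for G using that unfolding \<G>_def by auto
   have opp: "k G' = - k G" if G: "G:?K" "G':?K" "G ~= G'" for G G'
   proof -
    have "k G' *R p (evec G) + (- k G) *R p (evec G') = 0" using k G by simp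
    thus ?thesis using two[of G G' "k G'" "- k G"] G k0 GA by auto
   qed
   have "?K ~= {}" using pF[OF F(1)] F(2) by (metis (lifting) sum.empty)
   then obtain G where G: "G:?K" by blast
   have "G' = G" if G': "G':?K" for G'
   proof (rule ccontr)
    assume n: "G' ~= G"
    have "G'' = G | G'' = G'" if "G'':?K" for G''
     using opp[OF G that] opp[OF G' that] opp[OF G G'] k0[OF G] n by force
    hence "?K = {G, G'}" using G G' by blast
    hence "p (evec F) = k G *R p (evec F) + k G' *R p (evec F)" using pF[OF F(1)] k n G G' by simp
    thus False using opp[OF G G'] n F(2) by simp
   qed
   thus ?thesis using G by blast
  qed
  have E: "p (evec E) = 0" using separator_E sep by blast
  \<comment> \<open>The flats in the level decomposition of \<open>v\<close> that survive modulo
    \<open>La\<close> form a chain, and each contains exactly one atom that is not a separator; so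
    it is the same atom for all.\<close>
  have ray: "EX G:\<G>. EX c>0. p v = c *R p (evec G)" if v: "v:trop_space" "p v ~= 0" for v
  proof -
   have "E ~= {}"
   proof
    assume "E = {}"
    hence "v = 0" using trop_space_coords[OF v(1)] by (intro coords_eqI[of _ "{}"]) (auto simp: coords_iff)
    thus False using v(2) linear_0[OF p] by simp
   qed
   then obtain S a c where S: "finite S" "ALL F:S. F ~= {} & F ~= E & (EX t. F = {i:E. t < lookup v i})"
    "ALL F:S. 0 <= a F" "v = (\<Sum>F\<in>S. a F *R evec F) + c *R evec E"
    by (rule level_decomposition[OF trop_space_coords[OF v(1)]])
   have fl: "rflat F" if "F:S" for F using bspec[OF S(2) that] rflat_strict_superlevel[OF v(1)] by metis
   have ch: "F <= G | G <= F" if F: "F:S" and G: "G:S" for F G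
   proof -
    obtain s t where "F = {i:E. s < lookup v i}" "G = {i:E. t < lookup v i}"
     using bspec[OF S(2) F] bspec[OF S(2) G] by blast
    thus ?thesis by (cases "s <= t") auto
   qed
   define S' where "S' = {F:S. p (evec F) ~= 0}"
   have "p v = (\<Sum>F\<in>S. a F *R p (evec F))" unfolding S(4) by (simp add: lin linear_sum[OF p] E)
   also have "... = (\<Sum>F\<in>S'. a F *R p (evec F))" unfolding S'_def using S(1) by (intro sum.mono_neutral_right) auto
   finally have pv: "p v = (\<Sum>F\<in>S'. a F *R p (evec F))" .
   hence "S' ~= {}" using v(2) by auto
   then obtain F0 where F0: "F0:S'" by blast
   have one': "EX G. {G:\<G>. G <= F} = {G}" if "F:S'" for F
    by (rule one) (use that fl in \<open>auto simp: S'_def\<close>)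
   obtain G where G: "{G:\<G>. G <= F0} = {G}" using one'[OF F0] ..
   have "p (evec F) = p (evec G)" if F: "F:S'" for F
   proof -
    obtain H where H: "{G:\<G>. G <= F} = {H}" using one'[OF F] ..
    have "F <= F0 | F0 <= F" using ch F F0 unfolding S'_def by simp
    moreover have "H:{G:\<G>. G <= F}" "G:{G:\<G>. G <= F0}" unfolding G H by simp_all
    ultimately have "H:{G:\<G>. G <= F0} | G:{G:\<G>. G <= F}" by blast
    hence "H = G" unfolding G H by auto
    thus ?thesis using pF[of F] H fl F unfolding S'_def by simp
   qed
   hence pv': "p v = (\<Sum>F\<in>S'. a F) *R p (evec G)" unfolding pv scaleR_left.sum by simp
   moreover have "0 <= (\<Sum>F\<in>S'. a F)" using S(3) unfolding S'_def by (intro sum_nonneg) auto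
   ultimately have "0 < (\<Sum>F\<in>S'. a F)" using v(2) by (auto simp: less_le)
   moreover have "G:\<G>" using G by blast
   ultimately show ?thesis using pv' by blast
  qed
  have "ALL a:A. EX G. G:\<G> & p a = p (evec G)"
  proof
   fix a assume a: "a:A"
   obtain G c where G: "G:\<G>" "0 < c" "p a = c *R p (evec G)" using ray AT out p0 a by metis
   have GE: "G <= E" "G:atoms" using G(1) GA atoms_subset by auto
   hence "1 / c:\<int>" using G prim[OF a evec_int_lattice[OF finite_subset_E]] by simp
   \<comment> \<open>The coordinates of \<open>a\<close> are integers and constant on
     \<open>G\<close>. If \<open>c\<close> were not an integer, subtracting
     \<open>c *R evec G\<close> would make \<open>G\<close> a level set of a lineality
     vector.\<close>
   moreover have "c:\<int>"
   proof (rule ccontr)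
    assume n: "c~:\<int>"
    let ?l = "lookup"
    have aint: "?l a j:\<int>" for j using subsetD[OF A(2) a] unfolding int_lattice_iff by simp
    have ly: "?l (a - c *R evec G) j = ?l a j - (if j:G then c else 0)" for j
     using GE finite_subset_E by (simp add: lookup_minus lookup_evec)
    obtain i where i: "i:G" using atoms_nonempty[OF GE(2)] by blast
    have "?l a j = ?l a i" if "j:G" for j using atom_value[OF AT[OF a] GE(2)] i that by metis
    moreover have "?l a j ~= ?l a i - c" for j using n Ints_diff[OF aint[of i] aint[of j]] by auto
    ultimately have "{j:E. ?l (a - c *R evec G) j = ?l a i - c} = G" unfolding ly using GE by (auto split: if_splits)
    thus False using level[of "a - c *R evec G" "?l a i - c"] G(3) ns[OF G(1)] by (simp add: lin)
   qed
   ultimately have "c = 1" using Ints_inverse_eq_1 G(2) by blast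
   thus "EX G. G:\<G> & p a = p (evec G)" using G by auto
  qed
  from bchoice[OF this] obtain g where g: "ALL a:A. g a:\<G> & p a = p (evec (g a))" ..
  have inj: "inj_on g A"
  proof (rule inj_onI)
   fix a b assume "a:A" "b:A" "g a = g b"
   thus "a = b" using dist[of a b 1] g by simp
  qed
  have "G:g ` A" if G: "G:\<G>" for G
  proof -
   obtain a c where a: "a:A" "0 <= c" "p (evec G) = c *R p a"
    using dec[OF evec_trop_space[OF loopless atoms_rflat]] G GA by blast
   hence "1 *R p (evec G) + (- c) *R p (evec (g a)) = 0" using g by simp
   hence "G = g a" using two[OF G, of "g a" 1 "- c"] g a GA by force
   thus ?thesis using a by blast
  qed
  hence surj: "g ` A = \<G>" using g by blast
  have "p (\<Sum>A) = (\<Sum>a\<in>A. p (evec (g a)))" unfolding linear_sum[OF p] using g by simp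
  also have "... = (\<Sum>G\<in>\<G>. p (evec G))" unfolding surj[symmetric] by (simp add: sum.reindex[OF inj])
  also have "... = p (evec E)" unfolding pF[OF rflat_E] using GA atoms_subset by (intro sum.cong) auto
  finally show ?thesis using E p0 by simp
 qed
qed

end

section \<open>Normal vectors\<close>

text \<open>The condition by which \<open>normal_vector\<close> is selected; the arguments below
  apply to any vector satisfying it.\<close>

definition is_normal :: "'v::real_vector set => 'v set => 'v set => 'v => bool" where
 "is_normal N si ta n <-> n:cone_lattice N si & n:si + span ta &
   cone_lattice N ta + range (%k::int. of_int k *R n) = cone_lattice N si"

lemma span_proper:
 assumes "fin_dim si" "ta <= si" "dim si = Suc (dim ta)" shows "~ span si <= span ta"
proof
 assume "span si <= span ta"
 hence "dim si <= dim ta" using fin_dim_dim_mono[of ta si] assms(1,2) fin_dim_subset span_superset by blast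
 thus False using assms(3) by simp
qed

lemma fin_dim_rational_cone: "is_lattice N ==> rational_cone N si ==> fin_dim si"
 using fin_dim_subset[OF fin_dim_span[OF fin_dim_lattice]] rational_cone_span by blast

locale facet_pair =
 fixes N :: "'v::real_vector set" and si ta :: "'v set"
 assumes lattice: "is_lattice N" and rational: "rational_cone N si" and face: "cface ta si"
  and codim: "dim si = Suc (dim ta)"
begin

lemma cone: "convex_cone si"
 using rational rational_cone_convex_cone by blast

lemma rational_face: "rational_cone N ta"
 using rational_cone_cface rational face by blast

lemma subset: "ta <= si"
 using cface_subset face by blast

lemma span_subset: "span ta <= span si"
 by (rule span_mono[OF subset])

lemma not_span: "~ span si <= span ta"
 using span_proper fin_dim_rational_cone lattice rational subset codim by blast

text \<open>Modulo \<open>span ta\<close> the lattice of \<open>span si\<close> becomes a lattice of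
  rank one. A generator is lifted, with the sign for which a lattice vector of \<open>si\<close>
  outside \<open>span ta\<close> is a positive multiple of it.\<close>

lemma normal_exists: "EX n. is_normal N si ta n"
proof -
 define p where "p = quot_map (span ta)"
 have p: "linear p" "!!x. p x = 0 <-> x:span ta"
  unfolding p_def using quot_map(1) quot_map_zero_iff by auto
 define G where "G = N Int span si"
 have G: "is_lattice G" unfolding G_def by (rule is_lattice_Int_subspace[OF lattice subspace_span])
 have spG: "span G = span si"
 proof
  show "span G <= span si" unfolding G_def by (metis inf_le2 span_mono span_span)
  have "N Int si <= G" unfolding G_def using span_superset by blast
  thus "span si <= span G" using span_rational_cone[OF rational] span_mono by metis
 qed
 have ker: "{x:span G. p x = 0} = span (N Int ta)"
  unfolding spG p(2) span_rational_cone[OF rational_face] using span_subset by blast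
 have sub: "N Int ta <= G" unfolding G_def using subset span_superset by blast
 have pG: "is_lattice (p ` G)" by (rule quotient_lattice[OF G p(1) sub ker])
 then obtain B where B: "finite B" "independent B" "p ` G = int_span B" by (auto simp: is_lattice_iff)
 have "dim (p ` span si) + dim (span ta) = dim (span si)"
  using rank_nullity[OF p(1) subspace_span, of G] ker spG span_rational_cone[OF rational_face]
   fin_dim_span[OF fin_dim_lattice[OF G]] by simp
 hence d1: "dim (p ` span si) = 1" using codim by simp
 have "span B = p ` span si" using B span_int_span linear_span_image[OF p(1), of G] spG by metis
 hence "card B = 1" using d1 dim_span_eq_card_independent[OF B(2)] by simp
 then obtain b where b: "B = {b}" by (auto simp: card_1_singleton_iff)
 have pGb: "p ` G = range (%k. of_int k *R b)" unfolding B(3) int_span_def b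
 proof safe
  fix k :: int
  show "of_int k *R b:range (%c. \<Sum>b\<in>{b}. of_int (c b) *R b)" by (rule range_eqI[of _ _ "%_. k"]) simp
 qed auto
 have sG: "add_subgroup G" using is_lattice_add_subgroup[OF G] .
 have "~ N Int si <= span ta" using not_span span_minimal[OF _ subspace_span] span_rational_cone[OF rational] by metis
 then obtain v where v: "v:N" "v:si" "v~:span ta" by blast
 hence "p v:p ` G" unfolding G_def using span_base by blast
 then obtain k0 where k0: "p v = of_int k0 *R b" unfolding pGb by blast
 obtain n k where n: "n:G" "p ` G = range (%k. of_int k *R p n)" and k: "k > 0" "p v = of_int k *R p n"
 proof -
  have "of_int 1 *R b:p ` G" unfolding pGb by (rule rangeI)
  then obtain n0 where n0: "n0:G" "b = p n0" by auto
  show ?thesis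
  proof (cases "k0 > 0")
   case True thus ?thesis using that[of n0 k0] n0 pGb k0 by simp
  next
   case False
   have "range (%k. of_int k *R p n0) = range (%k. of_int (- k) *R p n0)"
    using range_composition[of "%k. of_int k *R p n0" uminus] surj_uminus by simp
   moreover have "k0 ~= 0" using k0 p(2)[of v] v by auto
   moreover have "- n0:G" using add_subgroup_scale[OF sG n0(1), of "- 1"] by simp
   ultimately show ?thesis using that[of "- n0" "- k0"] False n0 pGb k0 by (simp add: linear_neg[OF p(1)])
  qed
 qed
 have "p (v - of_int k *R n) = 0" using k by (simp add: linear_diff[OF p(1)] linear_scale[OF p(1)])
 hence "- (1 / of_int k) *R (v - of_int k *R n):span ta" using p span_scale by blast
 moreover have "n = (1 / of_int k) *R v + (- (1 / of_int k) *R (v - of_int k *R n))"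
  using k by (simp add: scaleR_diff_right)
 moreover have "(1 / of_int k) *R v:si" using v k by (intro convex_cone_scaleR[OF cone]) auto
 ultimately have side: "n:si + span ta" unfolding set_plus_def by blast
 have nG: "n:G" by (rule n(1))
 have "cone_lattice N ta + range (%k::int. of_int k *R n) = G"
 proof
  show "cone_lattice N ta + range (%k::int. of_int k *R n) <= G"
   unfolding set_plus_def cone_lattice_def
   using span_subset nG by (auto intro!: add_subgroup_add[OF sG] add_subgroup_scale[OF sG] simp: G_def[symmetric]) (auto simp: G_def)
  show "G <= cone_lattice N ta + range (%k::int. of_int k *R n)"
  proof
   fix u assume u: "u:G"
   then obtain m where "p u = of_int m *R p n" using n(2) by blast
   hence "p (u - of_int m *R n) = 0" by (simp add: linear_diff[OF p(1)] linear_scale[OF p(1)])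
   moreover have "u - of_int m *R n:G" using u nG by (intro add_subgroup_diff[OF sG] add_subgroup_scale[OF sG])
   ultimately have "u - of_int m *R n:cone_lattice N ta" using p unfolding cone_lattice_def G_def by blast
   moreover have "u = (u - of_int m *R n) + of_int m *R n" by simp
   ultimately show "u:cone_lattice N ta + range (%k::int. of_int k *R n)" unfolding set_plus_def by blast
  qed
 qed
 thus ?thesis using nG side unfolding is_normal_def cone_lattice_def G_def by blast
qed

lemma normal_vector: "is_normal N si ta (normal_vector N si ta)"
 unfolding normal_vector_def is_normal_def[symmetric] using someI_ex[OF normal_exists] .

context
 fixes n assumes n: "is_normal N si ta n"
begin

lemma normal_lattice: "n:N" "n:span si"
 using n unfolding is_normal_def cone_lattice_def by auto

lemma normal_decompose:
 assumes "u:N" "u:span si" obtains t and k :: int where "t:span ta" "u = t + of_int k *R n"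
proof -
 have "u:cone_lattice N ta + range (%k::int. of_int k *R n)" using n assms unfolding is_normal_def cone_lattice_def by blast
 thus ?thesis using that unfolding set_plus_def cone_lattice_def by blast
qed

lemma normal_not_span: "n~:span ta"
proof
 assume nt: "n:span ta"
 have "N Int si <= span ta"
 proof
  fix u assume "u:N Int si"
  then obtain t and k :: int where "t:span ta" "u = t + of_int k *R n"
   using normal_decompose[of u] span_base by blast
  thus "u:span ta" using nt by (auto intro: span_add span_scale)
 qed
 hence "span (N Int si) <= span ta" by (simp add: span_minimal)
 thus False using not_span span_rational_cone[OF rational] by simp
qed

lemma normal_scale_span: "c *R n:span ta ==> c = 0"
 using span_scale[of "c *R n" ta "1 / c"] normal_not_span by (auto split: if_splits)

lemma normal_side: obtains y s where "y:si" "s:span ta" "n = y + s"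
 using n unfolding is_normal_def set_plus_def by blast

text \<open>A point of \<open>si\<close> on the negative side plus a suitable multiple of a point on
  the side of \<open>n\<close> would lie in \<open>ta\<close>; the face property would then put
  \<open>n\<close> into \<open>span ta\<close>.\<close>

lemma normal_halfspace:
 assumes y: "y:si" obtains t c where "t:span ta" "0 <= c" "y = t + c *R n"
proof -
 have "span si <= {t + c *R n | t c. t:span ta}" (is "_ <= ?W")
 proof -
  have "u:?W <-> u:span (insert n ta)" for u
  proof -
   have "u - c *R n:span ta <-> (EX t. t:span ta & u = t + c *R n)" for c by (auto intro: exI[of _ "u - c *R n"])
   thus ?thesis unfolding span_insert by blast
  qed
  hence "?W = span (insert n ta)" by blast
  moreover have "N Int si <= ?W"
  proof
   fix u assume "u:N Int si"
   then obtain t and k :: int where "t:span ta" "u = t + of_int k *R n"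
    using normal_decompose[of u] span_base by blast
   thus "u:?W" by blast
  qed
  ultimately have "span (N Int si) <= ?W" by (simp add: span_minimal)
  thus ?thesis using span_rational_cone[OF rational] by simp
 qed
 then obtain t c where tc: "t:span ta" "y = t + c *R n" using span_base[OF y] by blast
 have "0 <= c"
 proof (rule ccontr)
  assume c: "~ 0 <= c"
  obtain z s where z: "z:si" "s:span ta" "n = z + s" using normal_side .
  have "y + (- c) *R z = t + c *R s" unfolding tc(2) z(3) by (simp add: algebra_simps)
  moreover have "t + c *R s:span ta" using tc z by (intro span_add span_scale)
  moreover have cz: "(- c) *R z:si" using c z by (intro convex_cone_scaleR[OF cone]) auto
  moreover have "y + (- c) *R z:si" using y cz by (rule convex_cone_add[OF cone])
  ultimately have "y + (- c) *R z:ta" using cface_span_Int[OF cone face] by auto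
  hence "(- c) *R z:ta" using cfaceD2[OF face y cz] by blast
  hence "z:ta" using cface_scale[OF face, of "- c" z] c by simp
  hence "n:span ta" unfolding z(3) using z(2) by (rule span_add[OF span_base])
  thus False using normal_not_span by blast
 qed
 thus ?thesis using that tc by blast
qed

lemma normal_primitive:
 assumes "u:N" "u - c *R n:span ta" shows "c:\<int>"
proof -
 have "(u - c *R n) + c *R n:span si" using assms(2) span_subset normal_lattice(2) by (intro span_add span_scale) auto
 hence us: "u:span si" by simp
 obtain t and k :: int where tk: "t:span ta" "u = t + of_int k *R n" using normal_decompose[OF assms(1) us] .
 have "(u - c *R n) - t:span ta" using assms(2) tk(1) by (rule span_diff)
 moreover have "(u - c *R n) - t = (of_int k - c) *R n" unfolding tk(2) by (simp add: algebra_simps)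
 ultimately have "c = of_int k" using normal_scale_span[of "of_int k - c"] by simp
 thus ?thesis by simp
qed

text \<open>Modulo \<open>span ta\<close> one of the two is a nonnegative multiple \<open>c\<close>
  of the other, and primitivity in both directions makes \<open>c\<close> and \<open>1 / c\<close>
  integers. Normal vectors may thus be exchanged in balancing sums.\<close>

lemma normal_positive:
 assumes m: "is_normal N si ta m" shows "n - m:span ta"
proof -
 interpret M: facet_pair N si ta by unfold_locales
 obtain y s where y: "y:si" "s:span ta" "m = y + s"
  using m unfolding is_normal_def set_plus_def by blast
 obtain t c where tc: "t:span ta" "0 <= c" "y = t + c *R n" using normal_halfspace[OF y(1)] .
 have mc: "m - c *R n:span ta" unfolding y(3) tc(3) using tc(1) y(2) by (simp add: span_add)
 have mN: "m:N" using m unfolding is_normal_def cone_lattice_def by blast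
 have "n:cone_lattice N ta + range (%k::int. of_int k *R m)" using m normal_lattice unfolding is_normal_def cone_lattice_def by blast
 then obtain w and k :: int where w: "w:span ta" "n = w + of_int k *R m" unfolding set_plus_def cone_lattice_def by blast
 have "w + of_int k *R (m - c *R n):span ta" using w(1) mc by (intro span_add span_scale)
 moreover have "w + of_int k *R (m - c *R n) = n - (of_int k * c) *R n" using w(2) by (simp add: algebra_simps)
 ultimately have "(1 - of_int k * c) *R n:span ta" by (simp add: algebra_simps)
 hence kc: "of_int k * c = 1" using normal_scale_span by fastforce
 hence "0 < c" using tc(2) by (auto simp: less_le)
 moreover from this have "1 / c = of_int k" using kc by (simp add: divide_eq_eq)
 ultimately have i: "c = 1" using Ints_inverse_eq_1[of c] normal_primitive[OF mN mc] by simp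
 hence "m - n:span ta" using mc i by simp
 thus ?thesis using span_neg by fastforce
qed

end

end

lemma fan_facet_pair:
 assumes "rational_fan N Si" "si:Si" "ta:Si" "ta <= si" "dim si = Suc (dim ta)"
 shows "facet_pair N si ta"
 using assms fan_lattice fan_rational fan_subset_cface by unfold_locales blast+

lemma cface_same_dim:
 assumes "convex_cone si" "cface ta si" "fin_dim si" "dim si <= dim ta" shows "ta = si"
proof -
 have "span ta = span si" using fin_dim_span_eq[OF assms(3) _ assms(4)] cface_subset[OF assms(2)] span_superset by blast
 thus ?thesis using cface_span_Int[OF assms(1,2)] span_superset by blast
qed

text \<open>Equal directions modulo \<open>span ta\<close> give the two cones a common point outside
  \<open>span ta\<close>. Their intersection then has the dimension of both, and a face of full
  dimension is the whole cone.\<close>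

lemma fan_normal_distinct:
 assumes f: "rational_fan N Si" and s: "si:Si" "si':Si" and t: "ta:Si" "ta <= si" "ta <= si'"
  and d: "dim si = Suc (dim ta)" "dim si' = Suc (dim ta)"
  and n: "is_normal N si ta n" "is_normal N si' ta n'" and c: "0 <= c" "n' - c *R n:span ta"
 shows "si = si'"
proof -
 interpret A: facet_pair N si ta by (rule fan_facet_pair[OF f s(1) t(1,2) d(1)])
 interpret B: facet_pair N si' ta by (rule fan_facet_pair[OF f s(2) t(1,3) d(2)])
 note tac = fan_cone[OF f t(1)]
 obtain y s where y: "y:si" "s:span ta" "n = y + s" using A.normal_side[OF n(1)] .
 obtain y' s' where y': "y':si'" "s':span ta" "n' = y' + s'" using B.normal_side[OF n(2)] .
 have "(n' - c *R n) - s' + c *R s:span ta" by (rule span_add[OF span_diff[OF c(2) y'(2)] span_scale[OF y(2)]])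
 moreover have "(n' - c *R n) - s' + c *R s = y' - c *R y" unfolding y(3) y'(3) by (simp add: algebra_simps)
 ultimately obtain a b where ab: "y' - c *R y = a - b" "a:ta" "b:ta" unfolding span_convex_cone[OF tac] by auto
 have eq: "y' + b = c *R y + a" using ab(1) by (simp add: algebra_simps)
 have m': "y' + b:si'" using y'(1) ab t by (intro convex_cone_add[OF B.cone]) auto
 have "c *R y + a:si" using y(1) ab t c by (intro convex_cone_add[OF A.cone] convex_cone_scaleR[OF A.cone]) auto
 hence m: "y' + b:si' Int si" using eq m' by simp
 have I: "cface (si' Int si) si'" "cface (si Int si') si" using fan_Int[OF f] s by blast+
 have "b:si'" using ab t by blast
 hence yI: "y':si' Int si" using cfaceD1[OF I(1) y'(1) _ m] by blast
 have "y'~:span ta"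
 proof
  assume "y':span ta"
  hence "n':span ta" unfolding y'(3) using y'(2) by (rule span_add)
  thus False using B.normal_not_span[OF n(2)] by blast
 qed
 have fd: "fin_dim si" "fin_dim si'" using fin_dim_rational_cone A.lattice A.rational B.rational by blast+
 have "dim (insert y' ta) = Suc (dim ta)"
  by (rule dim_insert_notin[OF fin_dim_subset[OF fd(1) t(2)] \<open>y'~:span ta\<close>])
 moreover have "insert y' ta <= si' Int si" using yI t by blast
 hence "dim (insert y' ta) <= dim (si' Int si)"
  using fin_dim_dim_mono[of "si' Int si"] fin_dim_subset[OF fd(1)] span_superset by (metis inf_le2 subset_trans)
 ultimately have ge: "dim si' <= dim (si' Int si)" "dim si <= dim (si Int si')" using d by (simp_all add: Int_commute)
 have "si' Int si = si'" by (rule cface_same_dim[OF B.cone I(1) fd(2) ge(1)])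
 moreover have "si Int si' = si" by (rule cface_same_dim[OF A.cone I(2) fd(1) ge(2)])
 ultimately show ?thesis by blast
qed

lemma fan_facet_above:
 assumes f: "rational_fan N Si" and ta: "ta:Si"
 obtains si where "si:facets Si" "ta <= si"
proof -
 define F where "F = {si:Si. ta <= si}"
 have "finite F" "F ~= {}" using fan_finite[OF f] ta by (auto simp: F_def)
 then obtain si where "si:F" "!!et. et:F ==> si <= et ==> si = et" using finite_has_maximal[of F] by blast
 hence "si:facets Si" "ta <= si" unfolding facets_def F_def by auto
 thus ?thesis using that by blast
qed

lemma fan_dim_facets:
 assumes f: "rational_fan N Si" and d: "!!si. si:facets Si ==> dim si = d"
 shows "fan_dim Si = d" and "si:Si ==> dim si = d ==> si:facets Si"
proof -
 have le: "dim ta <= d" if t: "ta:Si" for ta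
 proof -
  obtain si where s: "si:facets Si" "ta <= si" using fan_facet_above[OF f t] .
  hence "si:Si" unfolding facets_def by blast
  hence "fin_dim si" using fin_dim_rational_cone fan_lattice[OF f] fan_rational[OF f] by blast
  hence "dim ta <= dim si" using fin_dim_dim_mono s(2) span_superset by blast
  thus ?thesis using d s by simp
 qed
 obtain si0 where s0: "si0:facets Si" using fan_facet_above[OF f] fan_nonempty[OF f] by blast
 hence "si0:Si" unfolding facets_def by blast
 hence "d:dim ` Si" using d[OF s0] by force
 thus "fan_dim Si = d" unfolding fan_dim_def using fan_finite[OF f] le by (intro Max_eqI) auto
 show "si:Si ==> dim si = d ==> si:facets Si"
 proof -
  assume s: "si:Si" "dim si = d"
  have "et = si" if e: "et:Si" "si <= et" for et
   using cface_same_dim[OF fan_cone[OF f e(1)] fan_subset_cface[OF f e(1) s(1) e(2)]] le[OF e(1)] s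
    fin_dim_rational_cone[OF fan_lattice[OF f] fan_rational[OF f e(1)]] by simp
  thus "si:facets Si" unfolding facets_def using s by blast
 qed
qed

lemma minkowski_weight_unit:
 assumes "!!ta. ta:Si ==> dim ta + 1 = d ==> (\<Sum>si\<in>{si:cones_of_dim Si d. ta <= si}. normal_vector N si ta):span ta"
 shows "minkowski_weight N Si d (%_. 1)"
 unfolding minkowski_weight_def
proof (intro ballI impI)
 fix ta assume t: "ta:Si" "dim ta + 1 = d"
 have "(\<Sum>si\<in>{si:cones_of_dim Si d. ta <= si}. of_int 1 *R quot_map (span ta) (normal_vector N si ta))
  = quot_map (span ta) (\<Sum>si\<in>{si:cones_of_dim Si d. ta <= si}. normal_vector N si ta)"
  by (simp add: linear_sum[OF quot_map(1)[OF subspace_span]])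
 also have "... = 0" using assms[OF t] by (simp add: quot_map_zero_iff)
 finally show "(\<Sum>si\<in>{si:cones_of_dim Si d. ta <= si}. of_int 1 *R quot_map (span ta) (normal_vector N si ta)) = 0" .
qed

section \<open>Supports of matroidal fans\<close>

lemma coords_expand: "finite E ==> x:coords E ==> x = (\<Sum>i\<in>E. lookup x i *R evec {i})"
 by (rule poly_mapping_eqI)
   (auto simp: lookup_sum_scaleR lookup_evec coords_iff if_distrib[of "%r. _ * r"] cong: if_cong)

lemma span_int_lattice: "finite E ==> span (int_lattice E) = coords E"
proof
 show "span (int_lattice E) <= coords E"
  by (rule span_minimal[OF _ coords_subspace]) (auto simp: int_lattice_iff)
 assume E: "finite E"
 show "coords E <= span (int_lattice E)"
 proof
  fix x assume "x:coords E"
  hence "x = (\<Sum>i\<in>E. lookup x i *R evec {i})" by (rule coords_expand[OF E])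
  also have "...:span (int_lattice E)" by (intro span_sum span_scale span_base evec_int_lattice) auto
  finally show "x:span (int_lattice E)" .
 qed
qed

lemma fin_dim_coords: "finite E ==> fin_dim (coords E)"
 unfolding fin_dim_def
proof (intro exI[of _ "(%i. evec {i}) ` E"] conjI subsetI)
 fix x assume E: "finite E" "x:coords E"
 hence "x = (\<Sum>i\<in>E. lookup x i *R evec {i})" by (rule coords_expand)
 also have "...:span ((%i. evec {i}) ` E)" by (intro span_sum span_scale span_base) auto
 finally show "x:span ((%i. evec {i}) ` E)" .
qed auto

text \<open>By \<open>kernel_invariant\<close> the preimage of \<open>P\<close> in
  \<open>coords E\<close> is exactly \<open>trop_space\<close> (\<open>mem_P_iff\<close>), so local
  questions about \<open>P\<close> can be lifted to coordinates.\<close>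

locale matroidal_support = loopless_rank_function E r for E :: "'a set" and r +
 fixes q :: "'a fvec => 'v::real_vector" and N P
 assumes linear_q: "linear q" and lattice_image: "q ` int_lattice E = N" and lattice_N: "is_lattice N"
  and support_image: "P = q ` trop_space"
  and kernel_invariant: "x:trop_space ==> z:coords E ==> q z = 0 ==> x + z:trop_space"
begin

lemmas q_add = linear_add[OF linear_q] and q_diff = linear_diff[OF linear_q] and q_scale = linear_scale[OF linear_q]

lemma span_N: "span N = q ` coords E"
 using linear_span_image[OF linear_q, of "int_lattice E"] span_int_lattice[OF fin] lattice_image by simp

lemma mem_P_iff: "x:coords E ==> q x:P <-> x:trop_space"
proof
 assume x: "x:coords E" and "q x:P"
 then obtain y where y: "y:trop_space" "q x = q y" unfolding support_image by blast
 have "y + (x - y):trop_space"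
  using kernel_invariant[OF y(1), of "x - y"] y x trop_space_coords[OF y(1)]
  by (simp add: q_diff coords_diff)
 thus "x:trop_space" by simp
qed (simp add: support_image)

lemma P_span: "P <= span N"
 unfolding support_image span_N using trop_space_coords by blast

lemma tcone_P:
 assumes x: "x:coords E" shows "tcone P (q x) = q ` tcone trop_space x"
  and "y:coords E ==> q y:tcone P (q x) <-> y:tcone trop_space x"
proof -
 have iff: "q y:tcone P (q x) <-> y:tcone trop_space x" if y: "y:coords E" for y
 proof -
  have "q x + t *R q y:P <-> x + t *R y:trop_space" for t
   using mem_P_iff[of "x + t *R y"] x y
   by (simp add: q_add q_scale coords_add coords_scale)
  thus ?thesis unfolding tcone_def by simp
 qed
 have tc: "y:coords E" if y: "y:tcone trop_space x" for y
  using y tcone_trop_space_iff[OF x] by blast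
 have sp: "v:q ` coords E" if v: "v:tcone P (q x)" for v
 proof -
  obtain e where e: "e > 0" "!!t. 0 < t ==> t < e ==> q x + t *R v:P" using v unfolding tcone_def by blast
  have "q x + (e / 2) *R v:span N" using e P_span by force
  moreover have "q x:span N" unfolding span_N using x by blast
  ultimately have "(q x + (e / 2) *R v) - q x:span N" by (rule span_diff)
  hence "(2 / e) *R ((q x + (e / 2) *R v) - q x):span N" by (rule span_scale)
  thus ?thesis using e(1) span_N by simp
 qed
 show "tcone P (q x) = q ` tcone trop_space x"
 proof (intro equalityI subsetI)
  fix v assume v: "v:tcone P (q x)"
  then obtain y where "y:coords E" "v = q y" using sp by blast
  thus "v:q ` tcone trop_space x" using v iff by blast
 next
  fix v assume "v:q ` tcone trop_space x"
  thus "v:tcone P (q x)" using iff tc by blast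
 qed
 show "y:coords E ==> q y:tcone P (q x) <-> y:tcone trop_space x" by (rule iff)
qed

text \<open>The zero direction is always tangent, so the tropical space of the initial matroid is
  nonempty, which excludes loops.\<close>

lemma init_loopless:
 assumes x: "x:trop_space" shows "loopless_rank_function E (init_rank x)"
proof -
 interpret I: rank_function E "init_rank x" by (rule rank_function_init)
 have "0:tcone trop_space x" unfolding tcone_def using x by (auto intro: exI[of _ 1])
 hence "0:I.trop_space" using tcone_trop_space[OF rank_function_axioms x] by simp
 thus ?thesis by unfold_locales (rule I.trop_space_empty)
qed

text \<open>The natural subtraction is a true one as soon as \<open>P\<close> carries a fan, by
  \<open>support_dim_plus\<close>.\<close>

definition support_dim :: nat where
 "support_dim = nat (r E) - dim {z:coords E. q z = 0}"

context
 fixes Si assumes fan: "rational_fan N Si" and support: "\<Union>Si = P"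
begin

text \<open>At an interior point of a facet the tangent cone is the span of the facet. So the
  tropical space of the initial matroid there is linear, of dimension equal to the unchanged rank
  \<open>r E\<close>, and rank-nullity accounts for the kernel of \<open>q\<close>.\<close>

lemma facet_dim: assumes si: "si:facets Si" shows "dim si + dim {z:coords E. q z = 0} = nat (r E)"
proof -
 have s: "si:Si" "!!et. et:Si ==> si <= et ==> et = si" using si unfolding facets_def by auto
 obtain x where x: "x:N" "x:rint si"
  using rational_cone_rint[OF is_lattice_add_subgroup[OF lattice_N] fan_rational[OF fan s(1)]] .
 have "x:P" using x s(1) rint_subset support by blast
 then obtain w where w: "w:trop_space" "x = q w" unfolding support_image by blast
 note wc = trop_space_coords[OF w(1)]
 interpret I: loopless_rank_function E "init_rank w" by (rule init_loopless[OF w(1)])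
 have T: "tcone P x = span si"
 proof
  show "tcone P x <= span si"
   unfolding tcone_fan[OF fan s(1) x(2), unfolded support] using s(2) by (auto intro: span_add span_base)
  show "span si <= tcone P x"
  proof
   fix v assume "v:span si"
   moreover have "v = 0 + v" "0:si" using convex_cone_contains_0[OF fan_cone[OF fan s(1)]] by auto
   ultimately show "v:tcone P x" unfolding tcone_fan[OF fan s(1) x(2), unfolded support] using s(1) by blast
  qed
 qed
 have IT: "I.trop_space = {y:coords E. q y:span si}"
  using tcone_P(2)[OF wc] T w(2) tcone_trop_space[OF rank_function_axioms w(1)] I.trop_space_coords by blast
 have W: "subspace I.trop_space"
  unfolding IT subspace_def 
  by (auto simp: subspace_0[OF coords_subspace] coords_add coords_scale linear_0[OF linear_q] q_add q_scale span_zero span_add span_scale)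
 hence "I.trop_space <= I.lineality"
  unfolding I.lineality_def using I.trop_space_coords by (auto intro: subspace_add subspace_scale)
 hence d: "int (dim I.trop_space) = r E" using I.linear_trop_space_dim init_rank_E by simp
 have "q ` I.trop_space = span si"
 proof
  show "span si <= q ` I.trop_space"
  proof
   fix v assume v: "v:span si"
   have "si <= span N" using fan_support_span[OF fan] s(1) by blast
   hence "v:span N" using v by (metis span_mono span_span subsetD)
   then obtain y where "y:coords E" "v = q y" unfolding span_N by blast
   thus "v:q ` I.trop_space" using v unfolding IT by blast
  qed
 qed (auto simp: IT)
 moreover have "{z:I.trop_space. q z = 0} = {z:coords E. q z = 0}" unfolding IT by (auto simp: span_zero)
 moreover have "fin_dim I.trop_space" using fin_dim_subset[OF fin_dim_coords[OF fin]] I.trop_space_coords by blast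
 ultimately have "dim (span si) + dim {z:coords E. q z = 0} = dim I.trop_space"
  using rank_nullity[OF linear_q W] by simp
 thus ?thesis using d by simp
qed

lemma fan_dim_support: "fan_dim Si = support_dim" and facet_dim': "si:facets Si ==> dim si = support_dim"
 and facetI: "si:Si ==> dim si = support_dim ==> si:facets Si"
 and support_dim_plus: "support_dim + dim {z:coords E. q z = 0} = nat (r E)"
proof -
 have d: "dim si = support_dim" if "si:facets Si" for si using facet_dim[OF that] unfolding support_dim_def by simp
 show "fan_dim Si = support_dim" "si:Si ==> dim si = support_dim ==> si:facets Si"
  using fan_dim_facets[OF fan d] by blast+
 show "si:facets Si ==> dim si = support_dim" by (rule d)
 obtain si where "si:facets Si" using fan_facet_above[OF fan] fan_nonempty[OF fan] by blast
 thus "support_dim + dim {z:coords E. q z = 0} = nat (r E)" using facet_dim d by metis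
qed

text \<open>\<open>balancing\<close> is applied to the initial matroid at an interior point of
  \<open>ta\<close>. The generators are integral lifts of the normal vectors and \<open>La\<close>
  is the preimage of \<open>span ta\<close>; primitivity and distinctness are properties of normal
  vectors.\<close>

lemma support_balanced:
 assumes ta: "ta:Si" "dim ta + 1 = support_dim"
 shows "(\<Sum>si\<in>{si:cones_of_dim Si support_dim. ta <= si}. normal_vector N si ta):span ta"
proof -
 define A0 where "A0 = {si:cones_of_dim Si support_dim. ta <= si}"
 define n where "n si = normal_vector N si ta" for si
 have fA: "finite A0" unfolding A0_def cones_of_dim_def using fan_finite[OF fan] by simp
 have A0: "si:Si" "ta <= si" "dim si = Suc (dim ta)" if "si:A0" for si
  using that ta(2) unfolding A0_def cones_of_dim_def by auto
 have fp: "facet_pair N si ta" if "si:A0" for si using fan_facet_pair[OF fan A0(1)[OF that] ta(1) A0(2,3)[OF that]] .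
 have nn: "is_normal N si ta (n si)" if "si:A0" for si unfolding n_def using facet_pair.normal_vector[OF fp[OF that]] .
 have "EX m. m:int_lattice E & q m = n si" if "si:A0" for si
  using facet_pair.normal_lattice(1)[OF fp[OF that] nn[OF that]] unfolding lattice_image[symmetric] by force
 hence "ALL si:A0. EX m. m:int_lattice E & q m = n si" by blast
 from bchoice[OF this] obtain m where m: "ALL si:A0. m si:int_lattice E & q (m si) = n si" ..
 obtain x where x: "x:N" "x:rint ta"
  using rational_cone_rint[OF is_lattice_add_subgroup[OF lattice_N] fan_rational[OF fan ta(1)]] .
 have "x:P" using x ta(1) rint_subset support by blast
 then obtain w where w: "w:trop_space" "x = q w" unfolding support_image by blast
 note wc = trop_space_coords[OF w(1)]
 interpret I: loopless_rank_function E "init_rank w" by (rule init_loopless[OF w(1)])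
 have IT: "y:I.trop_space <-> y:coords E & q y:tcone P x" for y
  using tcone_P(2)[OF wc] w(2) tcone_trop_space[OF rank_function_axioms w(1)] I.trop_space_coords by blast
 define La where "La = {z:coords E. q z:span ta}"
 have sL: "subspace La"
  unfolding La_def subspace_def 
  by (auto simp: subspace_0[OF coords_subspace] coords_add coords_scale linear_0[OF linear_q] q_add q_scale span_zero span_add span_scale)
 have mc: "m si:coords E" if "si:A0" for si using m that int_lattice_iff by blast
 have dist0: "si = si'" if s: "si:A0" "si':A0" and c: "0 <= c" "m si' - c *R m si:La" for si si' c
 proof (rule fan_normal_distinct[OF fan A0(1)[OF s(1)] A0(1)[OF s(2)] ta(1) A0(2)[OF s(1)] A0(2)[OF s(2)] A0(3)[OF s(1)] A0(3)[OF s(2)] nn[OF s(1)] nn[OF s(2)] c(1)])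
  show "n si' - c *R n si:span ta"
   using c(2) m s unfolding La_def by (simp add: q_diff q_scale)
 qed
 have "\<Sum>(m ` A0) \<in> La"
 proof (rule I.balancing[OF sL])
  show "La <= coords E" unfolding La_def by blast
  show "finite (m ` A0)" using fA by simp
  show "m ` A0 <= int_lattice E" using m by blast
  fix v
  show "v:I.trop_space <-> (EX a:m ` A0. EX l:La. EX c>=0. v = l + c *R a)"
  proof
   assume "v:I.trop_space"
   hence v: "v:coords E" "q v:tcone P x" using IT by auto
   then obtain y s et where y: "q v = y + s" "et:Si" "ta <= et" "y:et" "s:span ta"
    unfolding tcone_fan[OF fan ta(1) x(2), unfolded support] by blast
   obtain si where si: "si:facets Si" "et <= si" using fan_facet_above[OF fan y(2)] .
   have sA: "si:A0" unfolding A0_def cones_of_dim_def using si y(3) facet_dim' by (auto simp: facets_def)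
   obtain t c where tc: "t:span ta" "0 <= c" "y = t + c *R n si"
    using facet_pair.normal_halfspace[OF fp[OF sA] nn[OF sA], of y] y(4) si(2) by blast
   have "q (v - c *R m si) = t + s"
    using m sA by (simp add: q_diff q_scale y(1) tc(3))
   hence "v - c *R m si:La"
    unfolding La_def using tc(1) y(5) v(1) mc[OF sA] by (simp add: span_add coords_diff coords_scale)
   moreover have "v = (v - c *R m si) + c *R m si" by simp
   ultimately show "EX a:m ` A0. EX l:La. EX c>=0. v = l + c *R a" using sA tc(2) by blast
  next
   assume "EX a:m ` A0. EX l:La. EX c>=0. v = l + c *R a"
   then obtain si l c where v: "si:A0" "l:La" "c >= 0" "v = l + c *R m si" by blast
   obtain y s where y: "y:si" "s:span ta" "n si = y + s" using facet_pair.normal_side[OF fp[OF v(1)] nn[OF v(1)]] .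
   have "q v = c *R y + (c *R s + q l)"
    using m v(1) by (simp add: v(4) q_add q_scale y(3) algebra_simps)
   moreover have "c *R y:si" using v y fan_cone[OF fan A0(1)[OF v(1)]] by (intro convex_cone_scaleR)
   moreover have "c *R s + q l:span ta" using y v unfolding La_def by (intro span_add span_scale) auto
   ultimately have "q v:tcone P x"
    unfolding tcone_fan[OF fan ta(1) x(2), unfolded support] using A0[OF v(1)] by blast
   moreover have "v:coords E"
    using v mc coords_subspace unfolding La_def by (auto intro: subspace_add subspace_scale)
   ultimately show "v:I.trop_space" using IT by blast
  qed
 next
  fix a assume "a:m ` A0"
  then obtain si where s: "si:A0" "a = m si" by blast
  hence qa: "q a = n si" using m by blast
  show "a~:La" unfolding La_def using facet_pair.normal_not_span[OF fp[OF s(1)] nn[OF s(1)]] qa by simp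
  fix z c assume z: "z:int_lattice E" "z - c *R a:La"
  have "q z:N" using z(1) lattice_image by blast
  moreover have "q z - c *R n si:span ta"
   using z(2) qa unfolding La_def by (simp add: q_diff q_scale)
  ultimately show "c:\<int>" by (rule facet_pair.normal_primitive[OF fp[OF s(1)] nn[OF s(1)]])
 next
  fix a b c assume "a:m ` A0" "b:m ` A0" "0 <= c" "b - c *R a:La"
  thus "a = b" using dist0 by blast
 qed
 moreover have "inj_on m A0"
 proof (rule inj_onI)
  fix si si' assume "si:A0" "si':A0" "m si = m si'"
  thus "si = si'" using dist0[of si si' 1] subspace_0[OF sL] by simp
 qed
 ultimately have "sum m A0:La" by (simp add: sum.reindex)
 hence "q (sum m A0):span ta" unfolding La_def by blast
 moreover have "q (sum m A0) = sum n A0" using m by (simp add: linear_sum[OF linear_q])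
 ultimately show ?thesis unfolding A0_def n_def by simp
qed

theorem tropical_unit_fan: "tropical_fan (unit_fan N Si)"
 unfolding tropical_fan_def
proof (intro conjI ballI)
 show "rational_fan (lat (unit_fan N Si)) (cones (unit_fan N Si))" using fan by simp
 show "minkowski_weight (lat (unit_fan N Si)) (cones (unit_fan N Si)) (fan_dim (cones (unit_fan N Si))) (orient (unit_fan N Si))"
  using minkowski_weight_unit[OF support_balanced] by (simp add: fan_dim_support unit_fan_def)
qed (use fan_dim_support facet_dim' in auto)

end

end

section \<open>Products and modifications of fans\<close>

lemma is_lattice_insert:
 assumes N: "is_lattice N" and v: "v~:span N"
 shows "is_lattice {of_int k *R v + y | k y. y:N}"
proof -
 obtain B where B: "finite B" "independent B" "N = int_span B" using N unfolding is_lattice_iff by blast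
 have "v~:span B" using v span_int_span[OF B(1)] B(3) by simp
 hence "independent (insert v B)" "v~:B" using B(2) by (auto simp: independent_insert span_base)
 thus ?thesis unfolding is_lattice_iff B(3) using int_span_insert[OF B(1), of v] B(1)
  by (intro exI[of _ "insert v B"]) auto
qed

lemma span_Times_subset: "span (A \<times> B) <= span A \<times> span B"
 by (rule span_minimal) (auto simp: span_base intro: subspace_Times)

lemma is_lattice_Times_Ints: assumes N: "is_lattice N" shows "is_lattice (N \<times> (\<int>::real set))"
proof -
 have l: "linear (%x. (x, 0::real))" by (rule linearI) auto
 have "inj_on (%x. (x, 0::real)) (span N)" by (rule inj_onI) simp
 hence "is_lattice ((%x. (x, 0::real)) ` N)" by (rule is_lattice_linear_image[OF N l])
 moreover have "(0, 1)~:span ((%x. (x, 0::real)) ` N)" unfolding linear_span_image[OF l] by auto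
 ultimately have "is_lattice {of_int k *R (0, 1) + y | k y. y:(%x. (x, 0::real)) ` N}" by (rule is_lattice_insert)
 moreover have "{of_int k *R (0, 1) + y | k y. y:(%x. (x, 0::real)) ` N} = N \<times> \<int>"
  by (auto simp: Ints_def image_def)
 ultimately show ?thesis by simp
qed

lemma convex_cone_Times: "convex_cone si ==> convex_cone ta ==> convex_cone (si \<times> ta)"
 by (rule convex_coneI) (auto simp: zero_prod_def intro: convex_cone_add convex_cone_scaleR convex_cone_contains_0)

lemma rational_cone_mono: "rational_cone N si ==> N <= M ==> rational_cone M si"
 unfolding rational_cone_def by blast

lemma rational_cone_Times:
 assumes "rational_cone N si" "rational_cone M ta" "0:N" "0:M"
 shows "rational_cone (N \<times> M) (si \<times> ta)"
proof -
 obtain V W where V: "finite V" "V <= N" "si = convex_cone hull V" and W: "finite W" "W <= M" "ta = convex_cone hull W"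
  using assms(1,2) unfolding rational_cone_def by blast
 let ?i = "%x. (x, 0)" and ?j = "%y. (0, y)"
 have l: "linear ?i" "linear ?j" by (auto intro!: linearI)
 let ?U = "?i ` V Un ?j ` W"
 have cU: "convex_cone (convex_cone hull ?U)" by (rule convex_cone_convex_cone_hull)
 have i: "?i ` si <= convex_cone hull ?U" unfolding V(3) convex_cone_hull_linear_image[OF l(1)] by (rule hull_mono) simp
 have j: "?j ` ta <= convex_cone hull ?U" unfolding W(3) convex_cone_hull_linear_image[OF l(2)] by (rule hull_mono) simp
 have "convex_cone hull ?U = si \<times> ta"
 proof
  show "convex_cone hull ?U <= si \<times> ta"
  proof (rule convex_cone_hull_minimal)
   have c: "convex_cone si" "convex_cone ta" unfolding V W by (auto intro: convex_cone_convex_cone_hull)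
   thus "convex_cone (si \<times> ta)" by (rule convex_cone_Times)
   have "V <= si" "W <= ta" unfolding V W by (auto intro: hull_inc)
   thus "?U <= si \<times> ta" using convex_cone_contains_0[OF c(1)] convex_cone_contains_0[OF c(2)] by auto
  qed
  show "si \<times> ta <= convex_cone hull ?U"
  proof safe
   fix x y assume "x:si" "y:ta"
   hence "(x, 0) + (0, y):convex_cone hull ?U" using i j by (intro convex_cone_add[OF cU]) auto
   thus "(x, y):convex_cone hull ?U" by simp
  qed
 qed
 moreover have "?U <= N \<times> M" using V W assms(3,4) by blast
 ultimately show ?thesis unfolding rational_cone_def using V(1) W(1) by (metis finite_Un finite_imageI)
qed

text \<open>A point \<open>(x, y)\<close> of a face is the sum of \<open>(x, 0)\<close> and
  \<open>(0, y)\<close>, which both lie in the product cone; so a face is the product of its two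
  slices.\<close>

lemma product_rational_fan:
 assumes Si: "rational_fan N Si" and De: "rational_fan M De" and l: "is_lattice (N \<times> M)"
 shows "rational_fan (N \<times> M) {si \<times> ta | si ta. si:Si & ta:De}"
proof (rule rational_fanI[OF l])
 let ?F = "{si \<times> ta | si ta. si:Si & ta:De}"
 have F: "?F = (%(si, ta). si \<times> ta) ` (Si \<times> De)" by auto
 show "finite ?F" "?F ~= {}" unfolding F using fan_finite[OF Si] fan_finite[OF De] fan_nonempty[OF Si] fan_nonempty[OF De] by auto
 fix C assume "C:?F"
 then obtain si ta where C: "C = si \<times> ta" and s: "si:Si" and t: "ta:De" by blast
 note c = fan_cone[OF Si s] fan_cone[OF De t]
 have cC: "convex_cone C" unfolding C using c by (rule convex_cone_Times)
 show "rational_cone (N \<times> M) C"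
  unfolding C using add_subgroup_0[OF is_lattice_add_subgroup[OF fan_lattice[OF Si]]] add_subgroup_0[OF is_lattice_add_subgroup[OF fan_lattice[OF De]]]
  by (intro rational_cone_Times fan_rational[OF Si s] fan_rational[OF De t])
 show "strongly_convex C"
  by (rule strongly_convexI[OF cC])
    (auto simp: C zero_prod_def dest: strongly_convexD[OF fan_strongly[OF Si s]] strongly_convexD[OF fan_strongly[OF De t]])
 {
  fix K assume K: "cface K C"
  note Kc = cface_cone[OF K]
  define al where "al = {x:si. (x, 0):K}"
  define be where "be = {y:ta. (0, y):K}"
  have z: "0:si" "0:ta" "(0, 0):K" using c convex_cone_contains_0 convex_cone_contains_0[OF Kc] by (auto simp: zero_prod_def)
  have "cface al si"
  proof (rule cfaceI)
   show "convex_cone al"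
    using convex_cone_add[OF c(1)] convex_cone_scaleR[OF c(1)] convex_cone_add[OF Kc, of "(_, 0)" "(_, 0)"] convex_cone_scaleR[OF Kc, of _ "(_, 0)"] z
    by (intro convex_coneI) (auto simp: al_def)
   show "a:al" if "a:si" "b:si" "a + b:al" for a b
    using that cfaceD1[OF K, of "(a, 0)" "(b, 0)"] z unfolding al_def C by simp
  qed (auto simp: al_def)
  moreover have "cface be ta"
  proof (rule cfaceI)
   show "convex_cone be"
    using convex_cone_add[OF c(2)] convex_cone_scaleR[OF c(2)] convex_cone_add[OF Kc, of "(0, _)" "(0, _)"] convex_cone_scaleR[OF Kc, of _ "(0, _)"] z
    by (intro convex_coneI) (auto simp: be_def)
   show "a:be" if "a:ta" "b:ta" "a + b:be" for a b
    using that cfaceD1[OF K, of "(0, a)" "(0, b)"] z unfolding be_def C by simp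
  qed (auto simp: be_def)
  moreover have "K = al \<times> be"
  proof
   show "K <= al \<times> be"
   proof safe
    fix x y assume k: "(x, y):K"
    hence "x:si" "y:ta" using cface_subset[OF K] unfolding C by auto
    moreover from this have "(x, 0):C" "(0, y):C" "(x, 0) + (0, y):K" using k z unfolding C by auto
    ultimately show "x:al" "y:be" using cfaceD1[OF K] cfaceD2[OF K] unfolding al_def be_def by blast+
   qed
   show "al \<times> be <= K" using convex_cone_add[OF Kc, of "(_, 0)" "(0, _)"] unfolding al_def be_def by fastforce
  qed
  ultimately show "K:?F" using fan_face[OF Si s] fan_face[OF De t] by blast
 }
 fix C' assume "C':?F"
 then obtain si' ta' where C': "C' = si' \<times> ta'" and s': "si':Si" and t': "ta':De" by blast
 have I: "cface (si Int si') si" "cface (ta Int ta') ta" using fan_Int[OF Si s s'] fan_Int[OF De t t'] .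
 have CI: "C Int C' = (si Int si') \<times> (ta Int ta')" unfolding C C' by blast
 show "cface (C Int C') C"
  unfolding CI unfolding C
 proof (rule cfaceI)
  show "convex_cone ((si Int si') \<times> (ta Int ta'))" using convex_cone_Times[OF cface_cone[OF I(1)] cface_cone[OF I(2)]] .
  fix a b assume "a:si \<times> ta" "b:si \<times> ta" "a + b:(si Int si') \<times> (ta Int ta')"
  thus "a:(si Int si') \<times> (ta Int ta')"
   using cfaceD1[OF I(1), of "fst a" "fst b"] cfaceD1[OF I(2), of "snd a" "snd b"] by (auto simp: mem_Times_iff)
 qed blast
qed

definition modification_cones :: "('v::real_vector => real) => 'v set set => 'v set set => ('v \<times> real) set set" where
 "modification_cones f Si D = graph_cone f ` Si Un up_cone f ` D"

lemma mem_graph_cone: "(x, s):graph_cone f si <-> x:si & s = f x"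
 unfolding graph_cone_def by auto

lemma mem_up_cone: "(x, s):up_cone f si <-> x:si & f x <= s"
proof
 assume "x:si & f x <= s"
 hence "(x, s) = (x, f x) + (0, s - f x)" "(x, f x):graph_cone f si" "(0, s - f x):{0} \<times> {0..}"
  unfolding mem_graph_cone by auto
 thus "(x, s):up_cone f si" unfolding up_cone_def by (metis set_plus_intro)
qed (auto simp: up_cone_def set_plus_def mem_graph_cone)

lemma dim_zero: "dim {0 :: 'v::real_vector} = 0"
 using dim_span[of "{} :: 'v set"] dim_eq_card_independent[of "{} :: 'v set"] by (simp add: independent_empty)

text \<open>\<open>D\<close> is any set of cones closed under faces, possibly empty, over which
  vertical cones are erected. That it is the divisor of \<open>f\<close> is concluded afterwards
  from balancing.\<close>

locale modification =
 fixes N :: "'v::real_vector set" and Si f D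
 assumes fan: "rational_fan N Si"
  and form: "si:Si ==> EX g. int_form N g & (ALL x:si. f x = g x)"
  and D: "D <= Si" and D_face: "de:D ==> cface ta de ==> ta:D"
begin

lemma f_linear:
 assumes s: "si:Si"
 shows "f 0 = 0" "x:si ==> y:si ==> f (x + y) = f x + f y" "x:si ==> 0 <= c ==> f (c *R x) = c * f x"
proof -
 obtain g where g: "linear g" "!!x. x:si ==> f x = g x" using form[OF s] int_form_linear by blast
 note c = fan_cone[OF fan s]
 show "f 0 = 0" using g(2)[OF convex_cone_contains_0[OF c]] linear_0[OF g(1)] by simp
 show "x:si ==> y:si ==> f (x + y) = f x + f y"
  using g(2) convex_cone_add[OF c] by (simp add: linear_add[OF g(1)])
 show "x:si ==> 0 <= c ==> f (c *R x) = c * f x"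
  using g(2) convex_cone_scaleR[OF c] by (simp add: linear_scale[OF g(1)])
qed

lemma cone_lift: "si:Si ==> convex_cone (graph_cone f si)" "si:Si ==> convex_cone (up_cone f si)"
proof -
 assume s: "si:Si"
 note c = fan_cone[OF fan s]
 show "convex_cone (graph_cone f si)" "convex_cone (up_cone f si)"
  by (auto intro!: convex_coneI simp: mem_graph_cone mem_up_cone zero_prod_def f_linear[OF s] convex_cone_contains_0[OF c]
     convex_cone_add[OF c] convex_cone_scaleR[OF c] mult_left_mono intro: add_mono)
qed

lemma cface_lift:
 assumes s: "si:Si" and t: "cface ta si"
 shows "cface (graph_cone f ta) (graph_cone f si)" "cface (graph_cone f ta) (up_cone f si)" "cface (up_cone f ta) (up_cone f si)"
proof -
 have tS: "ta:Si" by (rule fan_face[OF fan s t])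
 note c = cone_lift[OF tS] and sub = cface_subset[OF t]
 have gu: "graph_cone f ta <= up_cone f ta" "graph_cone f ta <= graph_cone f si" "up_cone f ta <= up_cone f si"
  "graph_cone f si <= up_cone f si"
  using sub by (auto simp: mem_graph_cone mem_up_cone)
 have e: "fst a:ta & (snd a + snd b <= f (fst a + fst b) --> snd a <= f (fst a))"
  if "a:up_cone f si" "b:up_cone f si" "fst a + fst b:ta" for a b
 proof -
  have "fst a:si" "f (fst a) <= snd a" "fst b:si" "f (fst b) <= snd b" using that mem_up_cone by (metis prod.collapse)+
  thus ?thesis using cfaceD1[OF t _ _ that(3)] f_linear(2)[OF s, of "fst a" "fst b"] by auto
 qed
 show 2: "cface (graph_cone f ta) (up_cone f si)"
 proof (rule cfaceI[OF _ c(1)])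
  show "graph_cone f ta <= up_cone f si" using gu by blast
  fix a b assume ab: "a:up_cone f si" "b:up_cone f si" "a + b:graph_cone f ta"
  hence "fst a + fst b:ta" "snd a + snd b = f (fst a + fst b)" by (cases a; cases b; auto simp: mem_graph_cone)+
  thus "a:graph_cone f ta" using e[OF ab(1,2)] ab(1) by (cases a) (auto simp: mem_graph_cone mem_up_cone)
 qed
 thus "cface (graph_cone f ta) (graph_cone f si)" using cface_mono gu by blast
 show "cface (up_cone f ta) (up_cone f si)"
 proof (rule cfaceI[OF gu(3) c(2)])
  fix a b assume ab: "a:up_cone f si" "b:up_cone f si" "a + b:up_cone f ta"
  hence "fst a + fst b:ta" by (cases a, cases b) (auto simp: mem_up_cone)
  thus "a:up_cone f ta" using e[OF ab(1,2)] ab(1) by (cases a) (auto simp: mem_up_cone)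
 qed
qed

text \<open>Splitting \<open>(x, t)\<close> into a point of the graph and a vertical vector shows
  that a face contains the vertical direction or has no vertical part at all.\<close>

lemma cface_up_coneD:
 assumes s: "si:Si" and K: "cface K (up_cone f si)"
 shows "EX ta. cface ta si & (K = graph_cone f ta | K = up_cone f ta)"
proof -
 note Kc = cface_cone[OF K] and c = fan_cone[OF fan s]
 define ta where "ta = {x:si. (x, f x):K}"
 have "cface ta si"
 proof (rule cfaceI)
  show "convex_cone ta"
   using convex_cone_add[OF Kc, of "(_, _)" "(_, _)"] convex_cone_scaleR[OF Kc, of _ "(_, _)"] convex_cone_contains_0[OF Kc]
    convex_cone_contains_0[OF c] convex_cone_add[OF c] convex_cone_scaleR[OF c]
   by (intro convex_coneI) (auto simp: ta_def f_linear[OF s] zero_prod_def)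
  show "a:ta" if "a:si" "b:si" "a + b:ta" for a b
   using that cfaceD1[OF K, of "(a, f a)" "(b, f b)"] by (simp add: ta_def mem_up_cone f_linear[OF s])
 qed (auto simp: ta_def)
 have split: "(x, f x):K & (0, t - f x):K" if k: "(x, t):K" for x t
 proof -
  have "x:si" "f x <= t" using cface_subset[OF K] k mem_up_cone by blast+
  hence "(x, f x):up_cone f si" "(0, t - f x):up_cone f si" "(x, f x) + (0, t - f x):K"
   using k convex_cone_contains_0[OF c] f_linear(1)[OF s] by (simp_all add: mem_up_cone)
  thus ?thesis using cfaceD1[OF K] cfaceD2[OF K] by blast
 qed
 have memK: "x:si" "f x <= t" if "(x, t):K" for x t using cface_subset[OF K] that mem_up_cone by blast+
 have "K = graph_cone f ta | K = up_cone f ta"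
 proof (cases "(0, 1):K")
  case True
  have "K = up_cone f ta"
  proof safe
   fix x t assume "(x, t):K" thus "(x, t):up_cone f ta" using split memK unfolding mem_up_cone ta_def by blast
  next
   fix x t assume "(x, t):up_cone f ta"
   hence "(x, f x):K" "0 <= t - f x" unfolding mem_up_cone ta_def by auto
   hence "(x, f x) + (t - f x) *R (0, 1):K" using True by (intro convex_cone_add[OF Kc] convex_cone_scaleR[OF Kc])
   thus "(x, t):K" by simp
  qed
  thus ?thesis ..
 next
  case False
  have "K = graph_cone f ta"
  proof safe
   fix x t assume k: "(x, t):K"
   have "t - f x = 0"
   proof (rule ccontr)
    assume n: "t - f x ~= 0"
    hence "0 < t - f x" using memK[OF k] by simp
    hence "(1 / (t - f x)) *R (0, t - f x):K" using split[OF k] by (intro convex_cone_scaleR[OF Kc]) auto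
    thus False using False n by simp
   qed
   thus "(x, t):graph_cone f ta" using k memK[OF k] unfolding mem_graph_cone ta_def by simp
  qed (auto simp: mem_graph_cone ta_def)
  thus ?thesis ..
 qed
 thus ?thesis using \<open>cface ta si\<close> by blast
qed

lemma graph_cone_linear:
 assumes "!!x. x:si ==> f x = g x" shows "graph_cone f si = (%x. (x, g x)) ` si"
 unfolding graph_cone_def using assms by auto

lemma linear_graph: "linear g ==> linear (%x. (x, g x :: real))"
 by (rule linearI) (auto simp: linear_add linear_scale)

lemma rational_cone_lift:
 assumes s: "si:Si" shows "rational_cone (N \<times> \<int>) (graph_cone f si)" "rational_cone (N \<times> \<int>) (up_cone f si)"
proof -
 obtain g where g: "int_form N g" "!!x. x:si ==> f x = g x" using form[OF s] by blast
 have "rational_cone ((%x. (x, g x)) ` N) (graph_cone f si)"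
  using rational_cone_linear_image[OF linear_graph[OF int_form_linear[OF g(1)]] fan_rational[OF fan s]] graph_cone_linear[of si g] g(2) by simp
 moreover have "(%x. (x, g x)) ` N <= N \<times> \<int>" using int_form_Ints[OF g(1)] by auto
 ultimately show r: "rational_cone (N \<times> \<int>) (graph_cone f si)" by (rule rational_cone_mono)
 have "join (graph_cone f si) (0, 1) = up_cone f si"
 proof safe
  fix x t assume "(x, t):up_cone f si"
  hence "(x, f x):graph_cone f si" "0 <= t - f x" by (auto simp: mem_up_cone mem_graph_cone)
  from join_mem[OF this, of "(0, 1)"] show "(x, t):join (graph_cone f si) (0, 1)" by simp
 qed (auto simp: join_def mem_graph_cone mem_up_cone)
 moreover have "(0, 1):N \<times> (\<int>::real set)" using add_subgroup_0[OF is_lattice_add_subgroup[OF fan_lattice[OF fan]]] by simp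
 ultimately show "rational_cone (N \<times> \<int>) (up_cone f si)" using rational_join[OF r, of "(0, 1)"] by simp
qed

lemma modification_fan: "rational_fan (N \<times> \<int>) (modification_cones f Si D)"
proof (rule rational_fanI[OF is_lattice_Times_Ints[OF fan_lattice[OF fan]]])
 let ?F = "modification_cones f Si D"
 show "finite ?F" "?F ~= {}"
  unfolding modification_cones_def using fan_finite[OF fan] fan_nonempty[OF fan] finite_subset[OF D] by auto
 fix C assume "C:?F"
 then obtain si where s: "si:Si" and C: "C = graph_cone f si | C = up_cone f si & si:D"
  unfolding modification_cones_def using D by blast
 have sub: "graph_cone f si <= up_cone f si" by (auto simp: mem_graph_cone mem_up_cone)
 show "rational_cone (N \<times> \<int>) C" using C rational_cone_lift[OF s] by blast
 have "strongly_convex (up_cone f si)"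
 proof (rule strongly_convexI[OF cone_lift(2)[OF s]], clarify)
  fix x t assume "(x, t):up_cone f si" "- (x, t):up_cone f si"
  hence xt: "x:si" "- x:si" "f x <= t" "f (- x) <= - t" by (auto simp: mem_up_cone)
  hence "x = 0" using strongly_convexD[OF fan_strongly[OF fan s]] by blast
  thus "(x, t) = 0" using xt f_linear(1)[OF s] by (simp add: zero_prod_def)
 qed
 thus "strongly_convex C" using C sub cone_lift[OF s] strongly_convex_subset by blast
 {
  fix K assume K: "cface K C"
  have Ku: "cface K (up_cone f si)"
   using C K cface_trans[OF K] cface_lift(2)[OF s cface_refl[OF fan_cone[OF fan s]]] by blast
  obtain ta where t: "cface ta si" and cs: "K = graph_cone f ta | K = up_cone f ta" using cface_up_coneD[OF s Ku] by blast
  have tS: "ta:Si" by (rule fan_face[OF fan s t])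
  show "K:?F"
  proof (cases "C = up_cone f si & si:D")
   case True
   hence "ta:D" using D_face t by blast
   thus ?thesis using cs tS unfolding modification_cones_def by blast
  next
   case False
   hence Cg: "C = graph_cone f si" using C by blast
   have "K ~= up_cone f ta"
   proof
    assume "K = up_cone f ta"
    hence "(0, 1):K" using convex_cone_contains_0[OF fan_cone[OF fan tS]] f_linear(1)[OF s] by (simp add: mem_up_cone)
    thus False using cface_subset[OF K] Cg f_linear(1)[OF s] by (auto simp: mem_graph_cone)
   qed
   thus ?thesis using cs tS unfolding modification_cones_def by blast
  qed
 }
 fix C' assume "C':?F"
 then obtain si' where s': "si':Si" and C': "C' = graph_cone f si' | C' = up_cone f si' & si':D"
  unfolding modification_cones_def using D by blast
 have I: "cface (si Int si') si" by (rule fan_Int[OF fan s s'])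
 have "graph_cone f si Int graph_cone f si' = graph_cone f (si Int si')" "graph_cone f si Int up_cone f si' = graph_cone f (si Int si')"
  "up_cone f si Int graph_cone f si' = graph_cone f (si Int si')" "up_cone f si Int up_cone f si' = up_cone f (si Int si')"
  by (auto simp: mem_graph_cone mem_up_cone)
 thus "cface (C Int C') C" using C C' cface_lift[OF s I] by auto
qed

lemma modification_support: "(x, t):\<Union>(modification_cones f Si D) <-> x:\<Union>Si & (t = f x | f x < t & x:\<Union>D)"
 unfolding modification_cones_def using D by (auto simp: mem_graph_cone mem_up_cone)

lemma dim_graph_cone: assumes s: "si:Si" shows "dim (graph_cone f si) = dim si"
proof -
 obtain g where g: "linear g" "!!x. x:si ==> f x = g x" using form[OF s] int_form_linear by blast
 note l = linear_graph[OF g(1)]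
 have fd: "fin_dim (span si)" using fin_dim_span[OF fin_dim_rational_cone[OF fan_lattice[OF fan] fan_rational[OF fan s]]] .
 have "{z:span si. (z, g z) = 0} = {0}" using linear_0[OF g(1)] by (auto simp: zero_prod_def span_zero)
 hence "dim ((%x. (x, g x)) ` span si) = dim (span si)"
  using rank_nullity[OF l subspace_span fd] by (simp only: dim_zero dim_span add_0_right)
 moreover have "(%x. (x, g x)) ` span si = span (graph_cone f si)"
  using graph_cone_linear[of si g] g(2) linear_span_image[OF l, of si] by simp
 ultimately show ?thesis by simp
qed

lemma span_up_cone: assumes s: "si:Si" shows "span (up_cone f si) = span (insert (0, 1) (graph_cone f si))"
proof
 have "up_cone f si <= span (insert (0, 1) (graph_cone f si))"
 proof safe
  fix x t assume "(x, t):up_cone f si"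
  hence "(x, f x):graph_cone f si" by (simp add: mem_up_cone mem_graph_cone)
  hence "(x, f x) + (t - f x) *R (0, 1):span (insert (0, 1) (graph_cone f si))"
   by (intro span_add span_scale span_base) auto
  thus "(x, t):span (insert (0, 1) (graph_cone f si))" by simp
 qed
 thus "span (up_cone f si) <= span (insert (0, 1) (graph_cone f si))" by (simp add: span_minimal)
 have "insert (0, 1) (graph_cone f si) <= up_cone f si"
  using convex_cone_contains_0[OF fan_cone[OF fan s]] f_linear(1)[OF s] by (auto simp: mem_up_cone mem_graph_cone)
 thus "span (insert (0, 1) (graph_cone f si)) <= span (up_cone f si)" by (rule span_mono)
qed

lemma span_graph_cone:
 assumes s: "si:Si" and g: "linear g" "!!x. x:si ==> f x = g x"
 shows "(x, t):span (graph_cone f si) <-> x:span si & t = g x"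
proof -
 have "graph_cone f si = (%x. (x, g x)) ` si" by (rule graph_cone_linear) (rule g(2))
 thus ?thesis by (auto simp: linear_span_image[OF linear_graph[OF g(1)]])
qed

lemma dim_up_cone: assumes s: "si:Si" shows "dim (up_cone f si) = Suc (dim si)"
proof -
 obtain g where g: "linear g" "!!x. x:si ==> f x = g x" using form[OF s] int_form_linear by blast
 have "(0, 1)~:span (graph_cone f si)" using span_graph_cone[OF s g] linear_0[OF g(1)] by simp
 moreover have "fin_dim (graph_cone f si)"
  using fin_dim_rational_cone[OF is_lattice_Times_Ints[OF fan_lattice[OF fan]] rational_cone_lift(1)[OF s]] .
 ultimately have "dim (insert (0, 1) (graph_cone f si)) = Suc (dim (graph_cone f si))" by (rule dim_insert_notin[rotated])
 thus ?thesis using dim_graph_cone[OF s] span_up_cone[OF s] by (metis dim_span)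
qed

lemma graph_cone_inject: "graph_cone f si = graph_cone f ta <-> si = ta"
 unfolding set_eq_iff split_paired_All mem_graph_cone by auto

lemma up_cone_inject: "up_cone f si <= up_cone f ta <-> si <= ta"
 unfolding subset_iff split_paired_All mem_up_cone by auto

lemma graph_up_distinct: assumes "si:Si" "ta:Si" shows "graph_cone f si ~= up_cone f ta"
proof
 assume "graph_cone f si = up_cone f ta"
 moreover have "(0, 1):up_cone f ta" "(0, 1)~:graph_cone f si"
  using convex_cone_contains_0[OF fan_cone[OF fan assms(2)]] f_linear(1)[OF assms(2)] by (auto simp: mem_up_cone mem_graph_cone)
 ultimately show False by blast
qed

section \<open>The divisor determined by the balancing of the modification\<close>

context
 assumes tropical: "tropical_fan (unit_fan N Si)" "tropical_fan (unit_fan (N \<times> \<int>) (modification_cones f Si D))"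
  and D_dim: "!!de. de:D ==> EX ta:D. de <= ta & dim ta + 1 = fan_dim Si"
begin

lemma dim_le_fan_dim: "si:Si ==> dim si <= fan_dim Si"
 unfolding fan_dim_def using fan_finite[OF fan] by simp

lemma dim_D: assumes d: "de:D" shows "dim de + 1 <= fan_dim Si"
proof -
 obtain ta where t: "ta:D" "de <= ta" "dim ta + 1 = fan_dim Si" using D_dim[OF d] by blast
 hence "fin_dim ta" using fin_dim_rational_cone fan_lattice[OF fan] fan_rational[OF fan] D by blast
 hence "dim de <= dim ta" using fin_dim_dim_mono t(2) span_superset by blast
 thus ?thesis using t(3) by simp
qed

lemma fan_dim_modification: "fan_dim (modification_cones f Si D) = fan_dim Si"
proof -
 have fin: "finite (modification_cones f Si D)" using fan_finite[OF modification_fan] .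
 have "fan_dim Si:dim ` Si" unfolding fan_dim_def using fan_finite[OF fan] fan_nonempty[OF fan] by (intro Max_in) auto
 then obtain si where s: "si:Si" "dim si = fan_dim Si" by auto
 have "fan_dim Si:dim ` modification_cones f Si D"
  unfolding modification_cones_def using s dim_graph_cone[OF s(1)] by (intro image_eqI[of _ _ "graph_cone f si"]) auto
 moreover have "dim C <= fan_dim Si" if "C:modification_cones f Si D" for C
  using that dim_graph_cone dim_le_fan_dim dim_up_cone dim_D D unfolding modification_cones_def by fastforce
 ultimately show ?thesis unfolding fan_dim_def[of "modification_cones f Si D"] using fin by (intro Max_eqI) auto
qed

lemma form_on:
 assumes s: "si:Si"
 shows "linear (form_on (unit_fan N Si) f si)" "!!x. x:N ==> x:span si ==> form_on (unit_fan N Si) f si x:\<int>"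
  "!!x. x:si ==> f x = form_on (unit_fan N Si) f si x"
proof -
 obtain g where g: "int_form N g" "ALL x:si. f x = g x" using form[OF s] by blast
 hence "integral_form_on N f si g" unfolding integral_form_on_def int_form_def cone_lattice_def by blast
 hence "integral_form_on N f si (form_on (unit_fan N Si) f si)" unfolding form_on_def by (simp add: someI[of "integral_form_on N f si"])
 thus "linear (form_on (unit_fan N Si) f si)" "!!x. x:N ==> x:span si ==> form_on (unit_fan N Si) f si x:\<int>"
  "!!x. x:si ==> f x = form_on (unit_fan N Si) f si x"
  unfolding integral_form_on_def cone_lattice_def by auto
qed

text \<open>The balancing condition of the modification at the graph of \<open>ta\<close> computes the order along \<open>ta\<close>.\<close>

lemma ord_modification:
 assumes t: "ta:Si" "dim ta + 1 = fan_dim Si"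
 shows "ord_fun (unit_fan N Si) f ta = (if ta:D then 1 else 0)"
proof -
 define F where "F = form_on (unit_fan N Si) f"
 define A where "A = {si:cones_of_dim Si (fan_dim Si). ta <= si}"
 define n where "n si = normal_vector N si ta" for si
 define M where "M = N \<times> (\<int>::real set)"
 define T where "T = graph_cone f ta"
 define U where "U = (if ta:D then {up_cone f ta} else {})"
 note F = form_on[folded F_def]
 have A: "si:Si" "ta <= si" "dim si = Suc (dim ta)" if "si:A" for si
  using that t(2) unfolding A_def cones_of_dim_def by auto
 have finA: "finite A" unfolding A_def cones_of_dim_def using fan_finite[OF fan] by simp
 have fp: "facet_pair N si ta" if "si:A" for si using fan_facet_pair[OF fan A(1)[OF that] t(1) A(2,3)[OF that]] .
 have nn: "is_normal N si ta (n si)" if "si:A" for si unfolding n_def using facet_pair.normal_vector[OF fp[OF that]] .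
 have T: "T:modification_cones f Si D" unfolding T_def modification_cones_def using t by blast
 have spT: "(x, s):span T <-> x:span ta & s = F ta x" for x s
  unfolding T_def by (rule span_graph_cone[OF t(1) F(1,3)[OF t(1)]])
 have FF: "F si x = F ta x" if s: "si:A" and x: "x:span ta" for si x
 proof (rule linear_eq_on[OF F(1)[OF A(1)[OF s]] F(1)[OF t(1)] x])
  show "F si b = F ta b" if "b:ta" for b using F(3)[OF A(1)[OF s], of b] F(3)[OF t(1) that] A(2)[OF s] that by auto
 qed
 have above: "{C:cones_of_dim (modification_cones f Si D) (fan_dim Si). T <= C} = graph_cone f ` A Un U" (is "?L = _")
 proof
  show "?L <= graph_cone f ` A Un U"
  proof
   fix C assume "C:?L"
   hence C: "C:modification_cones f Si D" "dim C = fan_dim Si" "T <= C" unfolding cones_of_dim_def by auto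
   from C(1) consider si where "si:Si" "C = graph_cone f si" | de where "de:D" "C = up_cone f de"
    unfolding modification_cones_def by blast
   thus "C:graph_cone f ` A Un U"
   proof cases
    case 1
    have "ta <= si" using C(3) unfolding T_def 1(2) subset_iff split_paired_All mem_graph_cone by blast
    hence "si:A" unfolding A_def cones_of_dim_def using 1 C(2) dim_graph_cone by auto
    thus ?thesis using 1 by blast
   next
    case 2
    hence d: "de:Si" using D by blast
    have sub: "ta <= de" using C(3) unfolding T_def 2(2) subset_iff split_paired_All mem_graph_cone mem_up_cone by blast
    have "dim de = dim ta" using C(2) dim_up_cone[OF d] t(2) 2 by simp
    hence "ta = de"
     using cface_same_dim[OF fan_cone[OF fan d] fan_subset_cface[OF fan d t(1) sub]]
      fin_dim_rational_cone[OF fan_lattice[OF fan] fan_rational[OF fan d]] by simp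
    thus ?thesis unfolding U_def using 2 by simp
   qed
  qed
  show "graph_cone f ` A Un U <= ?L"
   using A dim_graph_cone dim_up_cone[OF t(1)] t unfolding T_def U_def cones_of_dim_def modification_cones_def
   by (auto simp: mem_graph_cone mem_up_cone subset_iff)
 qed
 have norm_graph: "is_normal M (graph_cone f si) T (n si, F si (n si))" if s: "si:A" for si
 proof -
  note sS = A(1)[OF s] and l = F(1)[OF A(1)[OF s]]
  have sp: "(x, r):span (graph_cone f si) <-> x:span si & r = F si x" for x r
   by (rule span_graph_cone[OF sS F(1,3)[OF sS]])
  have cl: "cone_lattice M (graph_cone f si) = (%x. (x, F si x)) ` cone_lattice N si"
   unfolding cone_lattice_def M_def using F(2)[OF sS] sp by auto
  have clT: "cone_lattice M T = (%x. (x, F si x)) ` cone_lattice N ta"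
   unfolding cone_lattice_def M_def using F(2)[OF t(1)] spT FF[OF s] by auto
  have "n si:cone_lattice N si" and sum: "cone_lattice N ta + range (%k::int. of_int k *R n si) = cone_lattice N si"
   using nn[OF s] unfolding is_normal_def by auto
  obtain y z where y: "y:si" "z:span ta" "n si = y + z" using facet_pair.normal_side[OF fp[OF s] nn[OF s]] .
  have "(n si, F si (n si)) = (y, f y) + (z, F ta z)" using y FF[OF s y(2)] F(3)[OF sS y(1)] by (simp add: linear_add[OF l])
  moreover have "(y, f y):graph_cone f si" "(z, F ta z):span T" using y spT by (auto simp: mem_graph_cone)
  ultimately have "(n si, F si (n si)):graph_cone f si + span T" by (metis set_plus_intro)
  moreover have "(%x. (x, F si x)) ` (X + range (%k::int. of_int k *R v)) =
    (%x. (x, F si x)) ` X + range (%k::int. of_int k *R (v, F si v))" for X v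
   unfolding set_plus_def by (force simp: linear_add[OF l] linear_scale[OF l] image_iff)
  hence "cone_lattice M T + range (%k::int. of_int k *R (n si, F si (n si))) = cone_lattice M (graph_cone f si)"
   unfolding cl clT sum[symmetric] by metis
  ultimately show ?thesis unfolding is_normal_def cl using \<open>n si:cone_lattice N si\<close> by blast
 qed
 have norm_up: "is_normal M (up_cone f ta) T (0, 1)"
 proof -
  have z: "0:ta" "f 0 = 0" using convex_cone_contains_0[OF fan_cone[OF fan t(1)]] f_linear(1)[OF t(1)] .
  have m: "(0, 1):up_cone f ta" using z by (simp add: mem_up_cone)
  have N0: "0:N" using add_subgroup_0[OF is_lattice_add_subgroup[OF fan_lattice[OF fan]]] .
  have sp: "(x, s):span (up_cone f ta) <-> x:span ta" for x s
  proof -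
   have "(x, s):span (up_cone f ta) <-> (EX k. (x, s - k):span T)"
    unfolding span_up_cone[OF t(1)] span_insert T_def by simp
   also have "... <-> x:span ta" unfolding spT by (auto intro: exI[of _ "s - F ta x"])
   finally show ?thesis .
  qed
  have "(0, 1) + 0:up_cone f ta + span T" using m by (intro set_plus_intro) (auto simp: span_zero)
  moreover have "cone_lattice M T + range (%k::int. of_int k *R (0, 1)) = cone_lattice M (up_cone f ta)"
  proof
   show "cone_lattice M T + range (%k::int. of_int k *R (0, 1)) <= cone_lattice M (up_cone f ta)"
    unfolding cone_lattice_def M_def set_plus_def by (auto simp: spT sp)
   show "cone_lattice M (up_cone f ta) <= cone_lattice M T + range (%k::int. of_int k *R (0, 1))"
   proof safe
    fix x s assume "(x, s):cone_lattice M (up_cone f ta)"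
    hence x: "x:N" "x:span ta" "s:\<int>" unfolding cone_lattice_def M_def sp by (auto simp: sp)
    hence Fx: "F ta x:\<int>" using F(2)[OF t(1)] by blast
    hence "s - F ta x:\<int>" using x(3) by (rule Ints_diff[rotated])
    then obtain k :: int where k: "s - F ta x = of_int k" by (auto elim: Ints_cases)
    have "(x, F ta x):cone_lattice M T" unfolding cone_lattice_def M_def using x Fx spT by simp
    hence "(x, F ta x) + of_int k *R (0, 1):cone_lattice M T + range (%k::int. of_int k *R (0, 1))" by (intro set_plus_intro) auto
    thus "(x, s):cone_lattice M T + range (%k::int. of_int k *R (0, 1))" using k by (metis add.commute add.right_neutral add_Pair diff_add_cancel mult.right_neutral real_scaleR_def scaleR_Pair scaleR_zero_right)
   qed
  qed
  ultimately show ?thesis unfolding is_normal_def using span_base[OF m] N0 by (simp add: cone_lattice_def M_def)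
 qed
 have mfp: "facet_pair M C T" if "C:graph_cone f ` A Un U" for C
 proof -
  have "C:modification_cones f Si D" "dim C = fan_dim Si" "T <= C" using that above unfolding cones_of_dim_def by auto
  moreover have "dim T + 1 = fan_dim Si" unfolding T_def using dim_graph_cone[OF t(1)] t(2) by simp
  ultimately show ?thesis unfolding M_def using fan_facet_pair[OF modification_fan _ T] by simp
 qed
 \<comment> \<open>Explicit normal vectors, the vertical one for the cone over \<open>ta\<close>.
   They may replace the chosen ones because normal vectors are unique modulo
   \<open>span T\<close>.\<close>
 define m where "m C = (if C:U then (0, 1) else (let si = fst ` C in (n si, F si (n si))))" for C
 have fstg: "fst ` graph_cone f si = si" for si by (auto simp: graph_cone_def image_image)
 have gU: "graph_cone f si~:U" if "si:A" for si unfolding U_def using graph_up_distinct[OF A(1)[OF that] t(1)] by simp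
 have mn: "is_normal M C T (m C)" if "C:graph_cone f ` A Un U" for C
  using that norm_graph norm_up gU unfolding m_def by (auto simp: fstg U_def split: if_splits)
 let ?c = "(if ta:D then 1 else 0) :: real"
 have "(\<Sum>C\<in>graph_cone f ` A Un U. normal_vector M C T):span T"
  using tropical(2) T dim_graph_cone[OF t(1)] t(2)
  unfolding tropical_fan_def minkowski_weight_def unit_fan_simps fan_dim_modification M_def[symmetric] above[symmetric]
  by (auto simp: T_def linear_sum[OF quot_map(1)[OF subspace_span], symmetric] quot_map_zero_iff)
 moreover have "(\<Sum>C\<in>graph_cone f ` A Un U. m C - normal_vector M C T):span T"
  by (rule span_sum) (rule facet_pair.normal_positive[OF mfp mn facet_pair.normal_vector[OF mfp]])
 ultimately have "(\<Sum>C\<in>graph_cone f ` A Un U. m C - normal_vector M C T) + (\<Sum>C\<in>graph_cone f ` A Un U. normal_vector M C T):span T"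
  by (rule span_add[rotated])
 hence "sum m (graph_cone f ` A Un U):span T" by (simp add: sum_subtractf)
 moreover have "sum m (graph_cone f ` A Un U) = sum m (graph_cone f ` A) + sum m U"
 proof (rule sum.union_disjoint)
  show "graph_cone f ` A Int U = {}" using gU by blast
 qed (auto simp: finA U_def)
 moreover have "sum m (graph_cone f ` A) = (\<Sum>si\<in>A. (n si, F si (n si)))"
  using gU by (subst sum.reindex) (auto simp: inj_on_def graph_cone_inject m_def fstg intro!: sum.cong)
 moreover have "sum m U = (0, ?c)" unfolding U_def m_def by (simp add: zero_prod_def)
 moreover have "(\<Sum>si\<in>A. (n si, F si (n si))) = (sum n A, \<Sum>si\<in>A. F si (n si))"
  by (intro prod_eqI) (auto simp: fst_sum snd_sum)
 ultimately have "(sum n A, (\<Sum>si\<in>A. F si (n si)) + ?c):span T" by simp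
 \<comment> \<open>\<open>span T\<close> is the graph of \<open>F ta\<close> over
   \<open>span ta\<close>, so the last coordinate of the sum is determined by the first; the
   vertical vector accounts for the order.\<close>
 hence "F ta (sum n A) = (\<Sum>si\<in>A. F si (n si)) + ?c" unfolding spT by simp
 moreover have "ord_fun (unit_fan N Si) f ta = \<lfloor>- (\<Sum>si\<in>A. F si (n si)) + F ta (sum n A)\<rfloor>"
  unfolding ord_fun_def Let_def F_def A_def n_def by simp
 ultimately show ?thesis by simp
qed

lemma div_modification:
 shows "div_facets (unit_fan N Si) f = {ta:D. dim ta + 1 = fan_dim Si}"
  and "cones (div_fan (unit_fan N Si) f) = D"
  and "trop_iso (div_fan (unit_fan N Si) f) (unit_fan N D)"
  and "trop_iso (tropical_modification (unit_fan N Si) f) (unit_fan (N \<times> \<int>) (modification_cones f Si D))"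
proof -
 show df: "div_facets (unit_fan N Si) f = {ta:D. dim ta + 1 = fan_dim Si}"
  unfolding div_facets_def using ord_modification D by (auto split: if_splits)
 have c: "convex_cone ta" if "ta:D" for ta using that fan_cone[OF fan] D by blast
 show cD: "cones (div_fan (unit_fan N Si) f) = D"
 proof
  show "cones (div_fan (unit_fan N Si) f) <= D"
   unfolding div_fan_def using D_face c by (auto simp: df cone_face_iff)
  show "D <= cones (div_fan (unit_fan N Si) f)"
  proof
   fix de assume d: "de:D"
   obtain ta where t: "ta:D" "de <= ta" "dim ta + 1 = fan_dim Si" using D_dim[OF d] by blast
   hence "cone_face de ta" using fan_subset_cface[OF fan] d D c by (simp add: cone_face_iff subset_iff)
   thus "de:cones (div_fan (unit_fan N Si) f)" unfolding div_fan_def using t by (auto simp: df)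
  qed
 qed
 have ordD: "ord_fun (unit_fan N Si) f de = 1" if d: "de:D" "!!ta. ta:D ==> de <= ta ==> ta = de" for de
 proof -
  have "dim de + 1 = fan_dim Si" using D_dim[OF d(1)] d(2) by auto
  thus ?thesis using ord_modification d(1) D by auto
 qed
 show "trop_iso (div_fan (unit_fan N Si) f) (unit_fan N D)"
 proof (rule trop_iso_same)
  fix de assume "de:facets (cones (div_fan (unit_fan N Si) f))"
  hence "ord_fun (unit_fan N Si) f de = 1" unfolding cD facets_def by (intro ordD) auto
  thus "orient (div_fan (unit_fan N Si) f) de = orient (unit_fan N D) de" by (simp add: div_fan_def)
 qed (simp_all add: cD, simp add: div_fan_def)
 have cT: "cones (tropical_modification (unit_fan N Si) f) = modification_cones f Si D"
  unfolding tropical_modification_def modification_cones_def by (simp add: cD)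
 show "trop_iso (tropical_modification (unit_fan N Si) f) (unit_fan (N \<times> \<int>) (modification_cones f Si D))"
 proof (rule trop_iso_same)
  fix C assume C: "C:facets (cones (tropical_modification (unit_fan N Si) f))"
  have "orient (tropical_modification (unit_fan N Si) f) C = 1"
  proof (cases "C:graph_cone f ` Si")
   case False
   then obtain de where d: "de:D" "C = up_cone f de" using C unfolding cT facets_def modification_cones_def by blast
   have "fst ` C = de" unfolding d(2) by (auto simp: image_iff Bex_def split_paired_Ex mem_up_cone)
   moreover have "ord_fun (unit_fan N Si) f de = 1"
   proof (rule ordD[OF d(1)])
    fix ta assume t: "ta:D" "de <= ta"
    hence "up_cone f ta:modification_cones f Si D" "up_cone f de <= up_cone f ta"
     unfolding modification_cones_def up_cone_inject by blast+
    hence "up_cone f ta = up_cone f de" using C d(2) unfolding cT facets_def by blast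
    thus "ta = de" using up_cone_inject by blast
   qed
   ultimately show ?thesis unfolding tropical_modification_def using False by simp
  qed (simp add: tropical_modification_def)
  thus "orient (tropical_modification (unit_fan N Si) f) C = orient (unit_fan (N \<times> \<int>) (modification_cones f Si D)) C" by simp
 qed (simp_all add: cT, simp add: tropical_modification_def)
qed

end

end

section \<open>Deletion and contraction\<close>

text \<open>\<open>K\<close> keeps the dependencies of \<open>i\<close> local: whether
  \<open>i\<close> is spanned is decided inside \<open>K\<close> (\<open>rcl_separator\<close>), so
  its coordinate is compared only with those in \<open>K\<close>.\<close>

locale deletion_contraction = loopless_rank_function +
 fixes i :: 'a and K :: "'a set"
 assumes i: "i:E" and not_coloop: "~ rflat (E - {i})" and separator_K: "separator K" and i_K: "i:K"
begin

definition contraction :: "'a set => int" where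
 "contraction A = r (insert i A) - r {i}"

sublocale Del: loopless_rank_function "E - {i}" r
proof -
 have sub: "A <= E" if "A <= E - {i}" for A using that by blast
 interpret D: rank_function "E - {i}" r
 proof
  show "r (A Un B) + r (A Int B) <= r A + r B" if "A <= E - {i}" "B <= E - {i}" for A B
   using rank_submodular[OF sub sub] that .
  show "r A <= r (insert k A)" "r (insert k A) <= r A + 1" if "A <= E - {i}" "k:E - {i}" for A k
   using rank_insert_mono[OF sub] rank_insert_le[OF sub] that by simp_all
 qed (simp_all add: fin rank_empty)
 show "loopless_rank_function (E - {i}) r"
  by unfold_locales (use loopless in \<open>auto simp: rflat_def D.rflat_def\<close>)
qed

sublocale Con: rank_function "E - {i}" contraction
proof
 fix A B assume A: "A <= E - {i}" and B: "B <= E - {i}"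
 have "insert i A Int insert i B = insert i (A Int B)" "insert i A Un insert i B = insert i (A Un B)" by auto
 thus "contraction (A Un B) + contraction (A Int B) <= contraction A + contraction B"
  using rank_submodular[of "insert i A" "insert i B"] A B i unfolding contraction_def by auto
next
 fix A k assume A: "A <= E - {i}" and k: "k:E - {i}"
 hence "insert i A <= E" "k:E" using i by auto
 thus "contraction A <= contraction (insert k A)" "contraction (insert k A) <= contraction A + 1"
  using rank_insert_mono[of "insert i A" k] rank_insert_le[of "insert i A" k] unfolding contraction_def by (simp_all add: insert_commute)
qed (use fin in \<open>auto simp: contraction_def\<close>)

lemma rank_deletion: "r (E - {i}) = r E"
proof -
 have "~ r (E - {i}) < r (insert i (E - {i}))" using not_coloop unfolding rflat_def using i by auto
 moreover have "insert i (E - {i}) = E" using i by blast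
 moreover have "r (E - {i}) <= r E" by (rule rank_mono) auto
 ultimately show ?thesis by simp
qed

lemma Con_rflat_iff: "Con.rflat A <-> A <= E - {i} & rflat (insert i A)"
proof -
 have "E - {i} - A = E - insert i A" by blast
 thus ?thesis unfolding rflat_def Con.rflat_def contraction_def using i by (auto simp: insert_commute)
qed

lemma rflat_deletion: assumes F: "rflat F" shows "Del.rflat (F - {i})"
 unfolding Del.rflat_def using rflat_subset[OF F] rflat_strict[OF F, of "F - {i}"] by blast

lemma rflat_of_deletion:
 assumes A: "Del.rflat A" and n: "i~:rcl A" shows "rflat A"
 unfolding rflat_def
proof (intro conjI ballI)
 show sub: "A <= E" using Del.rflat_subset[OF A] by blast
 fix k assume k: "k:E - A"
 show "r A < r (insert k A)"
 proof (cases "k = i")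
  case True
  thus ?thesis using n i rank_insert_mono[OF sub i] unfolding rcl_def by auto
 next
  case False
  thus ?thesis using k A unfolding Del.rflat_def by blast
 qed
qed

lemma rflat_insert_of_deletion:
 assumes A: "Del.rflat A" and m: "i:rcl A" shows "rflat (insert i A)"
 unfolding rflat_def
proof (intro conjI ballI)
 show "insert i A <= E" using Del.rflat_subset[OF A] i by blast
 fix k assume k: "k:E - insert i A"
 hence "r A < r (insert k A)" using A unfolding Del.rflat_def by blast
 also have "... <= r (insert k (insert i A))" using k Del.rflat_subset[OF A] i by (intro rank_mono) auto
 finally show "r (insert i A) < r (insert k (insert i A))" using m unfolding rcl_def by simp
qed

text \<open>An element \<open>k\<close> of \<open>B\<close> outside \<open>A\<close> raises the rank
  of \<open>A\<close>, and \<open>i\<close> raises it once more, while \<open>i\<close> alone adds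
  at most one to the rank of \<open>A\<close>; so \<open>k\<close> still raises the rank after
  \<open>i\<close>. Elements outside \<open>B\<close> are handled by the flat
  \<open>insert i B\<close>.\<close>

lemma rflat_insert_mono:
 assumes A: "A <= B" "rflat A" and B: "rflat B" "i~:B" "rflat (insert i B)"
 shows "rflat (insert i A)"
 unfolding rflat_def
proof (intro conjI ballI)
 note AE = rflat_subset[OF A(2)]
 show "insert i A <= E" using AE i by blast
 fix k assume k: "k:E - insert i A"
 show "r (insert i A) < r (insert k (insert i A))"
 proof (cases "k:B")
  case True
  have "insert k A <= B" using True A by blast
  hence "r (insert k A) < r (insert i (insert k A))" using rflat_strict[OF B(1)] i B(2) by blast
  moreover have "r A < r (insert k A)" using rflat_strict[OF A(2) order_refl] k by blast
  moreover have "r (insert i A) <= r A + 1" by (rule rank_insert_le[OF AE i])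
  ultimately show ?thesis by (simp add: insert_commute)
 next
  case False
  thus ?thesis using rflat_strict[OF B(3), of "insert i A" k] k A(1) by blast
 qed
qed

text \<open>The complement of \<open>K\<close> is a good set, so its union with the closure of
  \<open>A Int K\<close> is a flat. This flat contains \<open>A\<close> but, if the claim failed,
  not \<open>i\<close>.\<close>

lemma rcl_separator:
 assumes A: "A <= E - {i}" "i:rcl A" shows "i:rcl (A Int K)"
proof (rule ccontr)
 assume n: "i~:rcl (A Int K)"
 have AK: "A Int K <= E" using A by blast
 have "good_set (E - K)" using separator_K unfolding separator_def by blast
 hence "rflat (rcl (A Int K) Un ((E - K) Int E))" using good_setD rflat_rcl[OF AK] rflat_E rflat_subset by blast
 moreover have "A <= rcl (A Int K) Un ((E - K) Int E)" using rcl_superset[OF AK] A(1) by blast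
 moreover have "i~:rcl (A Int K) Un ((E - K) Int E)" using n i_K by blast
 ultimately show False using rcl_minimal A(2) by blast
qed

text \<open>The minimal sets among these are the circuits through \<open>i\<close> inside
  \<open>K\<close>, with \<open>i\<close> removed. The others do not affect the max-min in
  \<open>span_level\<close>, since enlarging a set cannot raise its minimum.\<close>

definition circuits :: "'a set set" where
 "circuits = {C. C <= K - {i} & i:rcl C}"

lemma circuits_finite: "finite circuits" "C:circuits ==> finite C" "C:circuits ==> C <= E - {i}"
proof -
 have fK: "finite (K - {i})" "K <= E" using separator_subset[OF separator_K] finite_subset_E by auto
 show "finite circuits" unfolding circuits_def by (rule finite_subset[of _ "Pow (K - {i})"]) (use fK in auto)
 show "C:circuits ==> finite C" "C:circuits ==> C <= E - {i}" using fK finite_subset unfolding circuits_def by auto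
qed

lemma circuits_nonempty: "circuits ~= {}" "C:circuits ==> C ~= {}"
proof -
 have "i:rcl (E - {i})" unfolding rcl_def using i rank_deletion by (auto simp: insert_absorb)
 hence "(E - {i}) Int K:circuits" unfolding circuits_def using rcl_separator[of "E - {i}"] by auto
 thus "circuits ~= {}" by blast
 have "i~:rcl {}" using rank_single[OF i] rank_empty unfolding rcl_def by simp
 thus "C:circuits ==> C ~= {}" unfolding circuits_def by blast
qed

text \<open>The largest height at which the superlevel set spans \<open>i\<close>, see
  \<open>le_span_level\<close>. As a max-min of coordinates it is visibly piecewise linear with
  integral pieces.\<close>

definition span_level :: "'a fvec => real" where
 "span_level x = Max ((%C. Min (lookup x ` C)) ` circuits)"

abbreviation superlevel :: "'a fvec => real => 'a set" where
 "superlevel x t == {k:E - {i}. t <= lookup x k}"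

lemma le_span_level: "t <= span_level x <-> i:rcl (superlevel x t)"
proof -
 have "t <= span_level x <-> (EX C:circuits. t <= Min (lookup x ` C))"
  unfolding span_level_def using circuits_finite circuits_nonempty by (subst Max_ge_iff) auto
 also have "... <-> (EX C:circuits. C <= superlevel x t)"
  using circuits_finite circuits_nonempty by (intro bex_cong refl, subst Min_ge_iff) auto
 also have "... <-> i:rcl (superlevel x t)"
 proof
  assume "EX C:circuits. C <= superlevel x t"
  then obtain C where C: "C <= superlevel x t" "r (insert i C) = r C" unfolding circuits_def rcl_def by auto
  have "superlevel x t <= E" by blast
  hence "r (insert i (superlevel x t)) = r (superlevel x t)" by (rule rank_stable[OF C(1) _ i C(2)])
  thus "i:rcl (superlevel x t)" unfolding rcl_def using i by blast
 next
  assume "i:rcl (superlevel x t)"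
  hence "i:rcl (superlevel x t Int K)" using rcl_separator[of "superlevel x t"] by auto
  hence "superlevel x t Int K:circuits" unfolding circuits_def by auto
  thus "EX C:circuits. C <= superlevel x t" by (rule bexI[rotated]) auto
 qed
 finally show ?thesis .
qed

lemma coords_deletion: "x:coords (E - {i}) ==> x:coords E"
 unfolding coords_iff by blast

lemma coords_split:
 assumes "y:coords E"
 obtains x where "x:coords (E - {i})" "y = x + lookup y i *R evec {i}"
 using assms by (intro that[of "y - lookup y i *R evec {i}"]) (auto simp: coords_iff lookup_minus lookup_evec)

lemma superlevel_extension:
 assumes "x:coords (E - {i})"
 shows "{k:E. t <= lookup (x + s *R evec {i}) k} = (if t <= s then insert i (superlevel x t) else superlevel x t)"
proof -
 have "lookup x i = 0" using assms by (auto simp: coords_iff)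
 thus ?thesis using i by (auto simp: lookup_add lookup_evec)
qed

lemma Con_trop_space_subset: "Con.trop_space <= Del.trop_space"
proof
 fix x assume x: "x:Con.trop_space"
 have "Del.rflat (superlevel x s)" for s
 proof -
  have "rflat (insert i (superlevel x s))" using x unfolding Con.trop_space_def Con_rflat_iff by blast
  hence "Del.rflat (insert i (superlevel x s) - {i})" by (rule rflat_deletion)
  moreover have "insert i (superlevel x s) - {i} = superlevel x s" by blast
  ultimately show ?thesis by simp
 qed
 thus "x:Del.trop_space" using Con.trop_space_coords[OF x] unfolding Del.trop_space_def by blast
qed

text \<open>Below \<open>span_level x\<close> some flat would span \<open>i\<close> without
  containing it. Above it, the superlevel set of \<open>x\<close> at height \<open>s\<close> is a
  flat with and without \<open>i\<close>; \<open>rflat_insert_mono\<close> passes this to the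
  smaller superlevel sets, so \<open>x\<close> belongs to the contraction.\<close>

lemma trop_space_fibre:
 assumes x: "x:coords (E - {i})"
 shows "x + s *R evec {i}:trop_space <->
  x:Del.trop_space & (s = span_level x | (span_level x < s & x:Con.trop_space))"
proof
 have lvl: "{k:E. t <= lookup (x + s *R evec {i}) k} = (if t <= s then insert i (superlevel x t) else superlevel x t)" for t
  by (rule superlevel_extension[OF x])
 {
  assume y: "x + s *R evec {i}:trop_space"
  have fl: "rflat (if t <= s then insert i (superlevel x t) else superlevel x t)" for t
   using y unfolding lvl[symmetric] trop_space_def by blast
  have "Del.rflat (superlevel x t)" for t
  proof -
   have "(if t <= s then insert i (superlevel x t) else superlevel x t) - {i} = superlevel x t" by auto
   thus ?thesis using rflat_deletion[OF fl[of t]] by simp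
  qed
  hence D: "x:Del.trop_space" unfolding Del.trop_space_def using x by blast
  have le: "span_level x <= s"
  proof (rule ccontr)
   assume "~ span_level x <= s"
   hence t: "~ span_level x <= s" "rflat (superlevel x (span_level x))" using fl[of "span_level x"] by auto
   have "i:rcl (superlevel x (span_level x))" using le_span_level by blast
   thus False using rcl_minimal[OF t(2) order_refl] by blast
  qed
  have "x:Con.trop_space" if lt: "span_level x < s"
  proof -
   have nB: "i~:rcl (superlevel x s)" using lt le_span_level by (simp add: not_le[symmetric])
   have B: "rflat (superlevel x s)" by (rule rflat_of_deletion) (use D nB in \<open>auto simp: Del.trop_space_def\<close>)
   have iB: "rflat (insert i (superlevel x s))" using fl[of s] by simp
   have "rflat (insert i (superlevel x t))" for t
   proof (cases "t <= s")
    case True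
    thus ?thesis using fl[of t] by simp
   next
    case False
    hence "superlevel x t <= superlevel x s" "rflat (superlevel x t)" using fl[of t] by auto
    thus ?thesis using rflat_insert_mono B iB by blast
   qed
   thus ?thesis unfolding Con.trop_space_def Con_rflat_iff using x by blast
  qed
  thus "x:Del.trop_space & (s = span_level x | (span_level x < s & x:Con.trop_space))" using D le by fastforce
 }
 {
  assume h: "x:Del.trop_space & (s = span_level x | (span_level x < s & x:Con.trop_space))"
  have fl: "rflat (if t <= s then insert i (superlevel x t) else superlevel x t)" for t
  proof -
   have Dt: "Del.rflat (superlevel x t)" using h unfolding Del.trop_space_def by blast
   show ?thesis
   proof (cases "t <= s")
    case True
    thus ?thesis
     using h rflat_insert_of_deletion[OF Dt] le_span_level[of t x] unfolding Con.trop_space_def Con_rflat_iff by auto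
   next
    case False
    hence "i~:rcl (superlevel x t)" using h le_span_level[of t x] by auto
    thus ?thesis using rflat_of_deletion[OF Dt] False by simp
   qed
  qed
  have "x + s *R evec {i}:coords E"
   using coords_deletion[OF x] evec_coords[of "{i}" E] i by (intro coords_add coords_scale) auto
  thus "x + s *R evec {i}:trop_space" unfolding trop_space_def using fl lvl by auto
 }
qed

end

lemma (in loopless_rank_function) separator_Inter:
 assumes "finite \<A>" "!!A. A:\<A> ==> separator A" shows "separator (E Int \<Inter>\<A>)"
 using assms
proof (induction \<A> rule: finite_induct)
 case (insert A \<A>)
 have "E Int \<Inter>(insert A \<A>) = A Int (E Int \<Inter>\<A>)" using separator_subset insert.prems by blast
 thus ?case using separator_Int insert by simp
qed (simp add: separator_E)

locale matroidal_deletion = matroidal_support +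
 fixes i :: 'a
 assumes i: "i:E" and not_coloop: "~ rflat (E - {i})"
begin

text \<open>Differences of coordinates from this set vanish on the kernel of \<open>q\<close>, so
  they descend through \<open>q\<close>. The set is a separator because it is an intersection of
  level sets of lineality vectors.\<close>

definition block :: "'a set" where
 "block = {k:E. ALL z:coords E. q z = 0 --> lookup z k = lookup z i}"

lemma kernel_lineality: "z:coords E ==> q z = 0 ==> z:lineality"
 unfolding lineality_def
 by (auto intro!: kernel_invariant coords_scale simp: q_scale)

lemma separator_block: "separator block"
proof -
 define \<A> where "\<A> = (%z. {k:E. lookup z k = lookup z i}) ` {z:coords E. q z = 0}"
 have "\<A> <= Pow E" unfolding \<A>_def by blast
 hence "finite \<A>" using fin finite_subset by blast
 moreover have "separator A" if "A:\<A>" for A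
  using that lineality_level_separator kernel_lineality unfolding \<A>_def by blast
 ultimately have "separator (E Int \<Inter>\<A>)" by (rule separator_Inter)
 moreover have "E Int \<Inter>\<A> = block" unfolding \<A>_def block_def by auto
 ultimately show ?thesis by simp
qed

lemma i_block: "i:block"
 unfolding block_def using i by blast

sublocale deletion_contraction E r i block
 using i not_coloop separator_block i_block by unfold_locales auto

text \<open>Otherwise the complement of \<open>i\<close> would be a good set and hence a flat,
  against \<open>not_coloop\<close>.\<close>

lemma block_other: obtains j where "j:block" "j ~= i"
proof -
 have "block ~= {i}"
 proof
  assume "block = {i}"
  hence "good_set (E - {i})" using separator_block unfolding separator_def by simp
  hence "rflat ({} Un (E - {i}) Int E)" using good_setD loopless rflat_E by blast
  thus False using not_coloop by (simp add: Int_absorb2)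
 qed
 thus ?thesis using that i_block by blast
qed

lemma q_i_nonzero: "q (evec {i}) ~= 0"
proof
 assume "q (evec {i}) = 0"
 moreover have "evec {i}:coords E" using evec_coords[of "{i}" E] i by simp
 moreover obtain j where "j:block" "j ~= i" using block_other .
 ultimately show False unfolding block_def by (auto simp: lookup_evec)
qed

definition proj :: "'b => 'b" where
 "proj = quot_map (span {q (evec {i})})"

lemma linear_proj: "linear proj"
 unfolding proj_def using quot_map(1)[OF subspace_span] .

lemma proj_zero_iff: "proj u = 0 <-> (EX c. u = c *R q (evec {i}))"
 unfolding proj_def quot_map_zero_iff[OF subspace_span] by (auto simp: span_singleton)

lemma proj_i: "proj (q (x + s *R evec {i})) = proj (q x)"
proof -
 have "proj (q (evec {i})) = 0" unfolding proj_zero_iff by (rule exI[of _ 1]) simp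
 thus ?thesis by (simp add: q_add q_scale linear_add[OF linear_proj] linear_scale[OF linear_proj])
qed

lemma proj_kernel:
 assumes z: "z:coords (E - {i})" "proj (q z) = 0"
 obtains c where "z - c *R evec {i}:coords E" "q (z - c *R evec {i}) = 0"
proof -
 obtain c where "q z = c *R q (evec {i})" using z(2) proj_zero_iff by blast
 hence "q (z - c *R evec {i}) = 0" by (simp add: q_diff q_scale)
 moreover have "z - c *R evec {i}:coords E"
  using coords_deletion[OF z(1)] evec_coords[of "{i}" E] i by (simp add: coords_diff coords_scale)
 ultimately show ?thesis using that by blast
qed

lemma trop_space_proj_kernel:
 assumes z: "z:coords (E - {i})" "proj (q z) = 0"
 obtains c where "!!x s. x + s *R evec {i}:trop_space ==> (x + z) + (s - c) *R evec {i}:trop_space"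
proof -
 obtain c where c: "z - c *R evec {i}:coords E" "q (z - c *R evec {i}) = 0" using proj_kernel[OF z] .
 have "(x + z) + (s - c) *R evec {i}:trop_space" if "x + s *R evec {i}:trop_space" for x s
  using kernel_invariant[OF that c] by (simp add: algebra_simps)
 thus ?thesis using that by blast
qed

definition Q :: "'b set" where
 "Q = (proj o q) ` Con.trop_space"

lemma proj_lattice: "(proj o q) ` int_lattice (E - {i}) = proj ` N"
proof -
 have "proj (q y):(proj o q) ` int_lattice (E - {i})" if y: "y:int_lattice E" for y
 proof -
  obtain x where x: "x:coords (E - {i})" "y = x + lookup y i *R evec {i}"
   using coords_split y int_lattice_iff by blast
  have "x = y - lookup y i *R evec {i}" using x(2) by (metis add_diff_cancel_right')
  hence "x:int_lattice (E - {i})" using y x(1) unfolding int_lattice_iff by (auto simp: lookup_minus lookup_evec)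
  moreover have "proj (q y) = proj (q x)" using x(2) proj_i by metis
  ultimately show ?thesis by force
 qed
 moreover have "int_lattice (E - {i}) <= int_lattice E" unfolding int_lattice_def by blast
 ultimately show ?thesis unfolding lattice_image[symmetric] by auto
qed

lemma lattice_proj: "is_lattice (proj ` N)"
proof (rule quotient_lattice[OF lattice_N linear_proj])
 have N: "q (evec {i}):N" unfolding lattice_image[symmetric] using evec_int_lattice[of "{i}" E] i by blast
 thus "{q (evec {i})} <= N" by blast
 show "{x:span N. proj x = 0} = span {q (evec {i})}"
  unfolding proj_zero_iff span_singleton using span_scale[OF span_base[OF N]] by auto
qed

lemma dim_proj: "dim (proj ` N) < dim N"
proof -
 have fd: "fin_dim (span N)" using fin_dim_span[OF fin_dim_lattice[OF lattice_N]] .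
 have N: "q (evec {i}):N" unfolding lattice_image[symmetric] using evec_int_lattice[of "{i}" E] i by blast
 have "q (evec {i}):{z:span N. proj z = 0}" using span_base[OF N] proj_zero_iff by (auto intro: exI[of _ 1])
 moreover have "fin_dim {z:span N. proj z = 0}" by (rule fin_dim_subset[OF fd]) blast
 ultimately have "0 < dim {z:span N. proj z = 0}" using dim_pos q_i_nonzero by blast
 moreover have "dim (proj ` N) = dim (proj ` span N)" by (metis dim_span linear_span_image[OF linear_proj])
 ultimately show ?thesis using rank_nullity[OF linear_proj subspace_span fd] by simp
qed

lemma proj_P_iff: "w:proj ` P <-> (EX x:Del.trop_space. w = proj (q x))"
proof
 assume "w:proj ` P"
 then obtain y where y: "y:trop_space" "w = proj (q y)" unfolding support_image by blast
 obtain x where x: "x:coords (E - {i})" "y = x + lookup y i *R evec {i}"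
  using coords_split trop_space_coords[OF y(1)] by blast
 have "x:Del.trop_space" using y(1) trop_space_fibre[OF x(1)] x(2) by metis
 thus "EX x:Del.trop_space. w = proj (q x)" using y(2) proj_i x(2) by metis
next
 assume "EX x:Del.trop_space. w = proj (q x)"
 then obtain x where x: "x:Del.trop_space" "w = proj (q x)" by blast
 hence "x + span_level x *R evec {i}:trop_space" using trop_space_fibre[OF Del.trop_space_coords[OF x(1)]] by blast
 hence "q (x + span_level x *R evec {i}):P" unfolding support_image by blast
 thus "w:proj ` P" using x(2) proj_i[of x "span_level x"] by (metis image_eqI)
qed

lemma deletion_matroidal: "matroidal_support (E - {i}) r (proj o q) (proj ` N) (proj ` P)"
proof (rule matroidal_support.intro[OF Del.loopless_rank_function_axioms], rule matroidal_support_axioms.intro)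
 show "linear (proj o q)" using linear_compose[OF linear_q linear_proj] .
 show "(proj o q) ` int_lattice (E - {i}) = proj ` N" by (rule proj_lattice)
 show "is_lattice (proj ` N)" by (rule lattice_proj)
 show "proj ` P = (proj o q) ` Del.trop_space" using proj_P_iff by auto
 fix x z assume x: "x:Del.trop_space" and z: "z:coords (E - {i})" "(proj o q) z = 0"
 note xc = Del.trop_space_coords[OF x]
 obtain c where c: "!!x s. x + s *R evec {i}:trop_space ==> (x + z) + (s - c) *R evec {i}:trop_space"
  using trop_space_proj_kernel z by auto
 have "x + span_level x *R evec {i}:trop_space" using trop_space_fibre[OF xc] x by blast
 hence "(x + z) + (span_level x - c) *R evec {i}:trop_space" by (rule c)
 thus "x + z:Del.trop_space" using trop_space_fibre[OF subspace_add[OF coords_subspace xc z(1)]] by blast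
qed

lemma Con_trop_space_invariant:
 assumes x: "x:Con.trop_space" and z: "z:coords (E - {i})" "proj (q z) = 0"
 shows "x + z:Con.trop_space"
proof -
 note xc = Con.trop_space_coords[OF x]
 obtain c where c: "!!x s. x + s *R evec {i}:trop_space ==> (x + z) + (s - c) *R evec {i}:trop_space"
  using trop_space_proj_kernel z by blast
 \<comment> \<open>High enough that both points lie strictly above the graph, in the part of the
   fibre that detects the contraction.\<close>
 define s where "s = max (span_level x) (span_level (x + z) + c) + 1"
 have "x + s *R evec {i}:trop_space" using trop_space_fibre[OF xc] x Con_trop_space_subset unfolding s_def by auto
 hence "(x + z) + (s - c) *R evec {i}:trop_space" by (rule c)
 moreover have "span_level (x + z) < s - c" unfolding s_def by auto
 ultimately show ?thesis using trop_space_fibre[OF subspace_add[OF coords_subspace xc z(1)]] by force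
qed

lemma contraction_matroidal:
 assumes "rflat {i}" shows "matroidal_support (E - {i}) contraction (proj o q) (proj ` N) Q"
proof (rule matroidal_support.intro, rule loopless_rank_function.intro[OF Con.rank_function_axioms],
  rule loopless_rank_function_axioms.intro, unfold Con_rflat_iff, simp add: assms, rule matroidal_support_axioms.intro)
 show "linear (proj o q)" using linear_compose[OF linear_q linear_proj] .
 show "(proj o q) ` int_lattice (E - {i}) = proj ` N" by (rule proj_lattice)
 show "is_lattice (proj ` N)" by (rule lattice_proj)
 show "Q = (proj o q) ` Con.trop_space" by (rule Q_def)
qed (use Con_trop_space_invariant in auto)

lemma Q_empty: "~ rflat {i} ==> Q = {}"
 unfolding Q_def using Con.trop_space_empty unfolding Con_rflat_iff by auto

lemma Q_iff: assumes x: "x:coords (E - {i})" shows "proj (q x):Q <-> x:Con.trop_space"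
proof
 assume "proj (q x):Q"
 then obtain y where y: "y:Con.trop_space" "proj (q x) = proj (q y)" unfolding Q_def by auto
 have "y + (x - y):Con.trop_space"
  using Con_trop_space_invariant[OF y(1), of "x - y"] x y Con.trop_space_coords[OF y(1)]
  by (simp add: q_diff linear_diff[OF linear_proj] coords_diff)
 thus "x:Con.trop_space" by simp
qed (auto simp: Q_def)

lemma Q_subset: "Q <= proj ` P"
 using Con_trop_space_subset unfolding Q_def subset_iff proj_P_iff by auto

text \<open>The coordinates \<open>x\<^sub>k - x\<^sub>j\<close> with \<open>j\<close>, \<open>k\<close> in the block of \<open>i\<close> descend to the quotient, and the
 coordinate of \<open>i\<close> relative to \<open>j\<close> on \<open>P\<close> is bounded below by their max-min over the circuits through \<open>i\<close>.\<close>

lemma modification_data: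
 obtains g0 :: "'b => real" and g :: "'a => 'b => real" and f where
  "linear g0" "ALL k:block - {i}. int_form (proj ` N) (g k)"
  "f = (%u. Max ((%C. Min ((%k. g k u) ` C)) ` circuits))"
  "inj_on (%u. (proj u, g0 u)) (span N)" "(%u. (proj u, g0 u)) ` N = proj ` N \<times> \<int>"
  "ALL w s. (w, s):(%u. (proj u, g0 u)) ` P <-> w:proj ` P & (s = f w | (f w < s & w:Q))"
proof -
 obtain j where j: "j:block" "j ~= i" using block_other .
 have jE: "j:E" "j:E - {i}" using j unfolding block_def by auto
 note lq' = linear_compose[OF linear_q linear_proj]
 have lin: "linear (%x. lookup x a - lookup x b :: real)" for a b :: 'a
  by (rule linearI) (auto simp: lookup_add algebra_simps)
 have sub': "subspace (coords (E - {i}) :: 'a fvec set)" "fin_dim (coords (E - {i}))" "fin_dim (coords E)"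
  using coords_subspace fin_dim_coords[of E] fin_dim_coords[of "E - {i}"] fin by auto
 have ker: "lookup z k - lookup z j = 0" if z: "z:coords (E - {i})" "proj (q z) = 0" and k: "k:block - {i}" for z k
 proof -
  obtain c where c: "z - c *R evec {i}:coords E" "q (z - c *R evec {i}) = 0" using proj_kernel[OF z] .
  have "lookup (z - c *R evec {i}) k = lookup (z - c *R evec {i}) i"
   "lookup (z - c *R evec {i}) j = lookup (z - c *R evec {i}) i"
   using k j c unfolding block_def by blast+
  thus ?thesis using k j by (simp add: lookup_minus lookup_evec)
 qed
 have "EX h. linear h & (ALL x:coords (E - {i}). h (proj (q x)) = lookup x k - lookup x j)" if k: "k:block - {i}" for k
 proof -
  obtain h where "linear h" "!!x. x:coords (E - {i}) ==> h ((proj o q) x) = lookup x k - lookup x j"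
   using factor_through[OF lq' sub'(1,2) lin[of k j]] ker[OF _ _ k] by auto
  thus ?thesis by auto
 qed
 hence "ALL k:block - {i}. EX h. linear h & (ALL x:coords (E - {i}). h (proj (q x)) = lookup x k - lookup x j)" by blast
 from bchoice[OF this] obtain g :: "'a => 'b => real"
  where g: "ALL k:block - {i}. linear (g k) & (ALL x:coords (E - {i}). g k (proj (q x)) = lookup x k - lookup x j)" ..
 have ker0: "lookup z i - lookup z j = 0" if "z:coords E" "q z = 0" for z
  using that j unfolding block_def by auto
 obtain g0 :: "'b => real" where g0: "linear g0" "!!x. x:coords E ==> g0 (q x) = lookup x i - lookup x j"
  using factor_through[OF linear_q coords_subspace sub'(3) lin[of i j]] ker0 by auto
 \<comment> \<open>The kernel of \<open>proj\<close> is spanned by \<open>q (evec {i})\<close>,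
   where \<open>g0\<close> takes the value 1; hence \<open>proj\<close> and \<open>g0\<close>
   together identify \<open>N\<close> with the product of its projection and the integers.\<close>
 have g0i: "g0 (q (evec {i})) = 1" using g0(2)[of "evec {i}"] evec_coords[of "{i}" E] i j by (simp add: lookup_evec)
 define f where "f = (%u. Max ((%C. Min ((%k. g k u) ` C)) ` circuits))"
 \<comment> \<open>Subtracting the coordinate of \<open>j\<close> from all coordinates commutes with
   minimum and maximum.\<close>
 have f: "f (proj (q x)) = span_level x - lookup x j" if x: "x:coords (E - {i})" for x
 proof -
  have "Min ((%k. g k (proj (q x))) ` C) = Min (lookup x ` C) + - lookup x j" if C: "C:circuits" for C
  proof -
   have "(%k. g k (proj (q x))) ` C = (%k. lookup x k + - lookup x j) ` C"
    using C g x unfolding circuits_def by (intro image_cong) auto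
   thus ?thesis using Min_add_commute[of C "lookup x" "- lookup x j"] circuits_finite(2)[OF C] circuits_nonempty(2)[OF C] by simp
  qed
  hence "(%C. Min ((%k. g k (proj (q x))) ` C)) ` circuits = (%C. Min (lookup x ` C) + - lookup x j) ` circuits"
   by (rule image_cong[OF refl])
  thus ?thesis
   unfolding f_def span_level_def
   using Max_add_commute[of circuits "%C. Min (lookup x ` C)" "- lookup x j"] circuits_finite(1) circuits_nonempty(1) by simp
 qed
 show ?thesis
 proof (rule that[OF g0(1) _ f_def])
  show "ALL k:block - {i}. int_form (proj ` N) (g k)"
   unfolding int_form_def proj_lattice[symmetric] using g by (auto simp: int_lattice_iff)
  show "inj_on (%u. (proj u, g0 u)) (span N)"
  proof (rule inj_onI)
   fix u v assume "(proj u, g0 u) = (proj v, g0 v)"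
   hence "proj (u - v) = 0" and e: "g0 (u - v) = 0" by (simp_all add: linear_diff[OF linear_proj] linear_diff[OF g0(1)])
   then obtain c where c: "u - v = c *R q (evec {i})" using proj_zero_iff by blast
   hence "c = 0" using e g0i by (simp add: linear_scale[OF g0(1)])
   thus "u = v" using c by simp
  qed
  show "(%u. (proj u, g0 u)) ` N = proj ` N \<times> \<int>"
  proof
   show "(%u. (proj u, g0 u)) ` N <= proj ` N \<times> \<int>"
    unfolding lattice_image[symmetric] using g0(2) by (auto simp: int_lattice_iff)
   show "proj ` N \<times> \<int> <= (%u. (proj u, g0 u)) ` N"
   proof safe
    fix v and m :: real assume "v:N" "m:\<int>"
    then obtain x where x: "x:int_lattice E" "v = q x" and m: "m:\<int>" unfolding lattice_image[symmetric] by blast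
    define c where "c = m - g0 v"
    have "c:\<int>" unfolding c_def x(2) using m x(1) g0(2) by (auto simp: int_lattice_iff)
    moreover have "lookup x k:\<int>" for k using x(1) by (simp add: int_lattice_iff)
    ultimately have y: "x + c *R evec {i}:int_lattice E"
     using x(1) i evec_coords[of "{i}" E]
     by (auto simp: int_lattice_iff lookup_add lookup_evec intro!: coords_add coords_scale)
    have "proj (q (x + c *R evec {i})) = proj v" using proj_i x(2) by simp
    moreover have "g0 (q (x + c *R evec {i})) = m"
     using g0i unfolding c_def by (simp add: q_add q_scale linear_add[OF g0(1)] linear_scale[OF g0(1)] x(2))
    ultimately show "(proj v, m):(%u. (proj u, g0 u)) ` N"
     using y lattice_image by (intro image_eqI[of _ _ "q (x + c *R evec {i})"]) auto
   qed
  qed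
  show "ALL w s. (w, s):(%u. (proj u, g0 u)) ` P <-> w:proj ` P & (s = f w | (f w < s & w:Q))"
  proof (intro allI iffI)
   have g0x: "g0 (q (x + s *R evec {i})) = s - lookup x j" if x: "x:coords (E - {i})" for x s
   proof -
    have "lookup x i = 0" using x by (auto simp: coords_iff)
    thus ?thesis
     using g0(2)[OF coords_deletion[OF x]] g0i by (simp add: q_add q_scale linear_add[OF g0(1)] linear_scale[OF g0(1)])
   qed
   fix w s
   {
    assume "(w, s):(%u. (proj u, g0 u)) ` P"
    then obtain y where y: "y:trop_space" "w = proj (q y)" "s = g0 (q y)" unfolding support_image by blast
    obtain x where x: "x:coords (E - {i})" "y = x + lookup y i *R evec {i}"
     using coords_split trop_space_coords[OF y(1)] by blast
    define t where "t = lookup y i"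
    have yt: "y = x + t *R evec {i}" using x(2) unfolding t_def .
    have w: "w = proj (q x)" "s = t - lookup x j" using y(2,3) unfolding yt g0x[OF x(1)] proj_i by auto
    have "x:Del.trop_space & (t = span_level x | (span_level x < t & x:Con.trop_space))"
     using y(1) trop_space_fibre[OF x(1)] unfolding yt by blast
    thus "w:proj ` P & (s = f w | (f w < s & w:Q))"
     unfolding w f[OF x(1)] Q_iff[OF x(1)] using proj_P_iff by auto
   }
   {
    assume h: "w:proj ` P & (s = f w | (f w < s & w:Q))"
    then obtain x where x: "x:Del.trop_space" "w = proj (q x)" using proj_P_iff by blast
    note xc = Del.trop_space_coords[OF x(1)]
    define t where "t = s + lookup x j"
    have "t = span_level x | (span_level x < t & x:Con.trop_space)"
     using h unfolding x(2) f[OF xc] Q_iff[OF xc] t_def by auto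
    hence "x + t *R evec {i}:trop_space" using trop_space_fibre[OF xc] x(1) by blast
    hence "q (x + t *R evec {i}):P" unfolding support_image by blast
    moreover have "(w, s) = (proj (q (x + t *R evec {i})), g0 (q (x + t *R evec {i})))"
     unfolding proj_i g0x[OF xc] x(2) t_def by simp
    ultimately show "(w, s):(%u. (proj u, g0 u)) ` P" by blast
   }
  qed
 qed
qed

end

section \<open>Topology of the space of finitely supported functions\<close>

lemma bounded_linear_lookup: "bounded_linear (%x :: 'a fvec. lookup x k)"
proof (rule bounded_linear_intro[where K = 1])
 fix x :: "'a fvec"
 have "norm (lookup x k) <= (\<Sum>n\<in>Poly_Mapping.keys x. norm (lookup x n))"
 proof (cases "k:Poly_Mapping.keys x")
  case True
  thus ?thesis by (intro member_le_sum) auto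
 qed (simp add: in_keys_iff sum_nonneg)
 thus "norm (lookup x k) <= norm x * 1" by (simp add: norm_poly_mapping_def dist_poly_mapping_def)
qed (simp_all add: lookup_add)

text \<open>A linear form on an infinite-dimensional space need not be continuous; on the coordinate
  space of a finite set it agrees with a finite combination of coordinates, which is continuous
  everywhere.\<close>

lemma linear_continuous_extension:
 fixes h :: "'a fvec => real"
 assumes K: "finite K" and h: "linear h"
 obtains h' where "continuous_on UNIV h'" "ALL x:coords K. h' x = h x"
proof (rule that[of "%x. \<Sum>k\<in>K. lookup x k * h (evec {k})"])
 show "continuous_on UNIV (%x. \<Sum>k\<in>K. lookup x k * h (evec {k}))"
  by (intro continuous_intros linear_continuous_on bounded_linear_lookup)
 show "ALL x:coords K. (\<Sum>k\<in>K. lookup x k * h (evec {k})) = h x"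
 proof
 fix x assume "x:coords K"
 hence "x = (\<Sum>k\<in>K. lookup x k *R evec {k})" by (rule coords_expand[OF K])
 hence "h x = h (\<Sum>k\<in>K. lookup x k *R evec {k})" by simp
 thus "(\<Sum>k\<in>K. lookup x k * h (evec {k})) = h x"
  by (simp add: linear_sum[OF h] linear_scale[OF h])
 qed
qed

lemma lattice_coords:
 fixes N :: "'a fvec set"
 assumes "is_lattice N" obtains K where "finite K" "span N <= coords K"
proof -
 obtain B where B: "finite B" "N = int_span B" using assms unfolding is_lattice_iff by blast
 let ?K = "\<Union>(Poly_Mapping.keys ` B)"
 have "B <= coords ?K" unfolding coords_def by blast
 hence "span B <= coords ?K" using span_minimal coords_subspace by blast
 moreover have "span N = span B" unfolding B(2) by (rule span_int_span[OF B(1)])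
 ultimately show ?thesis using that[of ?K] B(1) by simp
qed

lemma linear_continuous_on_lattice:
 fixes N :: "'a fvec set" and h :: "'a fvec => real"
 assumes N: "is_lattice N" and h: "linear h" shows "continuous_on (span N) h"
proof -
 obtain K where K: "finite K" "span N <= coords K" using lattice_coords[OF N] .
 obtain h' where h': "continuous_on UNIV h'" "ALL x:coords K. h' x = h x" using linear_continuous_extension[OF K(1) h] .
 have "continuous_on (span N) h'" using h'(1) continuous_on_subset by blast
 thus ?thesis using continuous_on_cong[of "span N" "span N" h' h] h'(2) K(2) by blast
qed

text \<open>Forms vanishing at \<open>v\<close> vanish on all of the cone and its span; the others
  are positive at \<open>v\<close> and stay positive on an open set \<open>T\<close>. So the part of
  the affine hull in \<open>T\<close> lies in the cone.\<close>

lemma rint_rel_interior: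
 fixes N :: "'a fvec set"
 assumes N: "is_lattice N" and si: "rational_cone N si" and v: "v:rint si"
 shows "v:rel_interior si"
proof -
 obtain H where H: "finite H" "ALL h:H. int_form N h" and siH: "si = {x:span N. ALL h:H. 0 <= h x}"
  using rational_cone_halfspaces[OF N si] by blast
 define H' where "H' = {h:H. h v ~= 0}"
 obtain K where K: "finite K" "span N <= coords K" using lattice_coords[OF N] .
 have "ALL h:H. EX h'. continuous_on UNIV h' & (ALL x:coords K. h' x = h x)"
  using linear_continuous_extension[OF K(1)] H(2) int_form_linear by metis
 from bchoice[OF this] obtain e where e: "ALL h:H. continuous_on UNIV (e h) & (ALL x:coords K. e h x = h x)" ..
 define T where "T = (\<Inter>h\<in>H'. {x. 0 < e h x})"
 have "open T" unfolding T_def using H(1) e by (intro open_INT) (auto simp: H'_def intro!: open_Collect_less)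
 have vs: "v:si" "v:span N" "!!h. h:H ==> 0 <= h v" using v rint_subset unfolding siH by auto
 have "v:T" unfolding T_def H'_def using vs K(2) e by (fastforce simp: less_le)
 have aff: "affine hull si <= span si" by (rule affine_hull_subset_span)
 have "affine hull si Int T <= si"
 proof
  fix x assume x: "x:affine hull si Int T"
  have "si <= span N" unfolding siH by blast
  hence "span si <= span N" by (metis span_mono span_span)
  hence xN: "x:span N" using x aff by blast
  have "0 <= h x" if h: "h:H" for h
  proof (cases "h v = 0")
   case True
   have l: "linear h" using H(2) h int_form_linear by blast
   have "h y = 0" if y: "y:si" for y
   proof -
    obtain d where d: "d > 0" "v - d *R y:si" using v y unfolding rint_def by blast
    hence "0 <= h (v - d *R y)" "0 <= h y" using h y unfolding siH by auto
    thus ?thesis using True d(1) by (simp add: linear_diff[OF l] linear_scale[OF l] mult_le_0_iff)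
   qed
   hence "h x = 0" using linear_eq_0_on_span[OF l] x aff by blast
   thus ?thesis by simp
  next
   case False
   hence "0 < e h x" using x h unfolding T_def H'_def by blast
   thus ?thesis using e h xN K(2) by fastforce
  qed
  thus "x:si" unfolding siH using xN by blast
 qed
 moreover have "openin (top_of_set (affine hull si)) (affine hull si Int T)" using \<open>open T\<close> by (rule openin_open_Int)
 moreover have "v:affine hull si Int T" using \<open>v:T\<close> hull_inc[OF vs(1)] by simp
 ultimately show ?thesis unfolding rel_interior_def by blast
qed

lemma ray_rel_interior:
 fixes N :: "'a fvec set"
 assumes N: "is_lattice N" and si: "rational_cone N si" and v: "v:rint si"
 shows "convex_cone hull {v} - {0} <= rel_interior si"
proof
 fix x assume "x:convex_cone hull {v} - {0}"
 then obtain c where "x = c *R v" "0 <= c" "x ~= 0" by (auto simp: convex_cone_hull_finite)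
 hence "x:rint si" using rint_scale[OF rational_cone_convex_cone[OF si] v, of c] by (cases "c = 0") auto
 thus "x:rel_interior si" by (rule rint_rel_interior[OF N si])
qed

lemma continuous_on_Max_image:
 fixes g :: "'i => 'b::topological_space => real"
 assumes "finite C" "C ~= {}" "!!k. k:C ==> continuous_on A (g k)"
 shows "continuous_on A (%u. Max ((%k. g k u) ` C))" "continuous_on A (%u. Min ((%k. g k u) ` C))"
proof -
 have "continuous_on A (%u. Max ((%k. g k u) ` C)) & continuous_on A (%u. Min ((%k. g k u) ` C))"
  using assms by (induction C rule: finite_ne_induct) (auto intro!: continuous_on_max continuous_on_min)
 thus "continuous_on A (%u. Max ((%k. g k u) ` C))" "continuous_on A (%u. Min ((%k. g k u) ` C))" by auto
qed

section \<open>Complete fans\<close>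

text \<open>The whole space is the tropical space of the free matroid on a lattice basis, where
  every set is a flat and the rank is the cardinality. Balancing thus comes from the general
  result.\<close>

theorem complete_unit_fan_tropical:
 assumes f: "rational_fan N Si" "\<Union>Si = span N" shows "tropical_fan (unit_fan N Si)"
proof -
 note N = fan_lattice[OF f(1)]
 obtain B where B: "finite B" "independent B" "N = int_span B" using N unfolding is_lattice_iff by blast
 interpret R: rank_function B "%A. int (card A)"
 proof
  fix A C assume "A <= B" "C <= B"
  hence "finite A" "finite C" using B(1) finite_subset by auto
  thus "int (card (A Un C)) + int (card (A Int C)) <= int (card A) + int (card C)" using card_Un_Int[of A C] by simp
 next
  fix A i assume "A <= B"
  hence "finite A" using B(1) finite_subset by auto
  thus "int (card A) <= int (card (insert i A))" "int (card (insert i A)) <= int (card A) + 1"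
   by (auto simp: card_insert_if)
 qed (simp_all add: B(1))
 have flat: "R.rflat A" if "A <= B" for A
  unfolding R.rflat_def using that finite_subset[OF that B(1)] by auto
 have ts: "R.trop_space = coords B" unfolding R.trop_space_def using flat by auto
 define q where "q x = (\<Sum>b\<in>B. lookup x b *R b)" for x :: "'a fvec"
 have q: "linear q"
  unfolding q_def by (rule linearI) (simp_all add: lookup_add scaleR_left_distrib sum.distrib scaleR_sum_right)
 have qN: "q ` int_lattice B = N"
 proof
  have sG: "add_subgroup N" using is_lattice_add_subgroup[OF N] .
  show "q ` int_lattice B <= N"
   unfolding q_def using int_span_base[OF B(1), folded B(3)]
   by (auto simp: int_lattice_iff intro!: add_subgroup_sum[OF sG] add_subgroup_scale_Ints[OF sG])
  show "N <= q ` int_lattice B"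
  proof
   fix u assume "u:N"
   then obtain c :: "'a => int" where u: "u = (\<Sum>b\<in>B. of_int (c b) *R b)" unfolding B(3) int_span_def by blast
   define x :: "'a fvec" where "x = (\<Sum>b\<in>B. of_int (c b) *R evec {b})"
   have lx: "lookup x b = (if b:B then of_int (c b) else 0)" for b
    unfolding x_def lookup_sum_scaleR using B(1) by (simp add: lookup_evec if_distrib[of "%r. _ * r"] cong: if_cong)
   hence "x:int_lattice B" "q x = u" unfolding q_def u by (auto simp: int_lattice_iff coords_iff intro!: sum.cong)
   thus "u:q ` int_lattice B" by blast
  qed
 qed
 interpret M: matroidal_support B "%A. int (card A)" q N "span N"
 proof (rule matroidal_support.intro, rule loopless_rank_function.intro[OF R.rank_function_axioms],
   rule loopless_rank_function_axioms.intro[OF flat], simp, rule matroidal_support_axioms.intro[OF q qN N])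
  show "span N = q ` R.trop_space"
   unfolding ts using linear_span_image[OF q, of "int_lattice B"] span_int_lattice[OF B(1)] qN by simp
 qed (simp add: ts coords_add)
 show ?thesis by (rule M.tropical_unit_fan[OF f])
qed

lemma zero_fan: "rational_fan {0} {{0 :: 'v::real_vector}}"
proof (rule rational_fanI)
 show "is_lattice {0 :: 'v}" unfolding is_lattice_iff int_span_def by (intro exI[of _ "{}"]) (auto simp: independent_empty)
 have c: "convex_cone {0 :: 'v}" by (rule convex_coneI) auto
 fix si :: "'v set" assume s: "si:{{0}}"
 show "rational_cone {0} si" unfolding rational_cone_def using s by (intro exI[of _ "{}"]) (simp add: convex_cone_hull_finite)
 show "strongly_convex si" unfolding strongly_convex_def using s by auto
 show "ta:{{0}}" if "cface ta si" for ta
  using s cface_subset[OF that] convex_cone_contains_0[OF cface_cone[OF that]] by auto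
 show "cface (si Int si') si" if "si':{{0}}" for si' using s that cface_refl[OF c] by simp
qed auto

lemma line_rational_fan: "rational_fan (\<int> :: real set) {{0}, {0..}, {..0}}"
proof (rule rational_fanI)
 have "(\<int> :: real set) = int_span {1}" unfolding int_span_def Ints_def by (auto simp: image_iff)
 moreover have "independent {1 :: real}" by (simp add: dependent_single)
 ultimately show "is_lattice (\<int> :: real set)" unfolding is_lattice_iff by (intro exI[of _ "{1}"]) auto
 have c: "convex_cone {0 :: real}" "convex_cone {0 :: real..}" "convex_cone {..0 :: real}"
  by (auto intro!: convex_coneI simp: mult_nonneg_nonpos)
 fix si :: "real set" assume s: "si:{{0}, {0..}, {..0}}"
 have h: "convex_cone hull {1 :: real} = {0..}" "convex_cone hull {- 1 :: real} = {..0}" "convex_cone hull {} = {0 :: real}"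
  by (auto simp: convex_cone_hull_finite intro: exI[of _ "%_. _"]) (rule_tac x = "%_. - x" in exI, simp)
 have "(1 :: real):\<int>" "(- 1 :: real):\<int>" by auto
 thus "rational_cone \<int> si"
  unfolding rational_cone_def using s h by (metis finite.emptyI finite.insertI empty_subsetI insert_subset insertE singletonD)
 show "strongly_convex si" unfolding strongly_convex_def using s by (force simp: image_iff)
 show "ta:{{0}, {0..}, {..0}}" if t: "cface ta si" for ta
 proof (cases "ta <= {0}")
  case True
  thus ?thesis using convex_cone_contains_0[OF cface_cone[OF t]] by auto
 next
  case False
  then obtain y where y: "y:ta" "y ~= 0" by blast
  have "si <= ta"
  proof
   fix x assume x: "x:si"
   have "y:si" using y cface_subset[OF t] by blast
   hence "0 <= x / y" using x s y(2) by (auto simp: zero_le_divide_iff)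
   hence "(x / y) *R y:ta" using y convex_cone_scaleR[OF cface_cone[OF t]] by blast
   thus "x:ta" using y by simp
  qed
  thus ?thesis using cface_subset[OF t] s by blast
 qed
 show "cface (si Int si') si" if s': "si':{{0}, {0..}, {..0}}" for si'
 proof -
  have z: "cface {0} ta" if "ta:{{0}, {0..}, {..0 :: real}}" for ta
   using that c by (intro cfaceI) auto
  have "si Int si' = {0} | si Int si' = si" using s s' by auto
  thus ?thesis using z[OF s] cface_refl c s by auto
 qed
qed auto

section \<open>Fans on matroidal supports belong to stable classes\<close>

lemma min_max_selection:
 fixes g :: "'a => 'v => real"
 assumes total: "!!a b. a:V ==> b:V ==> (ALL x:si. g a x <= g b x) | (ALL x:si. g b x <= g a x)"
  and C: "finite C" "C ~= {}" "C <= V"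
 shows "EX a:C. ALL b:C. ALL x:si. g a x <= g b x" "EX a:C. ALL b:C. ALL x:si. g b x <= g a x"
proof -
 have "(EX a:C. ALL b:C. ALL x:si. g a x <= g b x) & (EX a:C. ALL b:C. ALL x:si. g b x <= g a x)"
  using C
 proof (induction C rule: finite_ne_induct)
  case (insert c C)
  then obtain a a' where a: "a:C" "ALL b:C. ALL x:si. g a x <= g b x" and a': "a':C" "ALL b:C. ALL x:si. g b x <= g a' x" by auto
  have "c:V" "a:V" "a':V" using insert.prems a(1) a'(1) by auto
  hence t: "(ALL x:si. g a x <= g c x) | (ALL x:si. g c x <= g a x)" "(ALL x:si. g c x <= g a' x) | (ALL x:si. g a' x <= g c x)"
   using total by blast+
  have "EX a:insert c C. ALL b:insert c C. ALL x:si. g a x <= g b x"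
   using t(1) a by (metis insert_iff order.trans order_refl)
  moreover have "EX a:insert c C. ALL b:insert c C. ALL x:si. g b x <= g a x"
   using t(2) a' by (metis insert_iff order.trans order_refl)
  ultimately show ?case ..
 qed auto
 thus "EX a:C. ALL b:C. ALL x:si. g a x <= g b x" "EX a:C. ALL b:C. ALL x:si. g b x <= g a x" by auto
qed

text \<open>On \<open>si\<close> the forms are totally ordered, so each inner minimum is attained by
  one form throughout, and so is the maximum of these.\<close>

lemma max_min_linear:
 fixes g :: "'a => 'v => real"
 assumes total: "!!a b. a:V ==> b:V ==> (ALL x:si. g a x <= g b x) | (ALL x:si. g b x <= g a x)"
  and \<C>: "finite \<C>" "\<C> ~= {}" "!!C. C:\<C> ==> finite C & C ~= {} & C <= V"
 shows "EX a:V. ALL x:si. Max ((%C. Min ((%k. g k x) ` C)) ` \<C>) = g a x"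
proof -
 have "ALL C:\<C>. EX a. a:C & (ALL b:C. ALL x:si. g a x <= g b x)"
 proof
  fix C assume "C:\<C>"
  hence "finite C" "C ~= {}" "C <= V" using \<C>(3) by auto
  from min_max_selection(1)[where V = V and si = si and g = g, OF total this]
  show "EX a. a:C & (ALL b:C. ALL x:si. g a x <= g b x)" by (simp add: Bex_def)
 qed
 from bchoice[OF this] obtain m where m: "ALL C:\<C>. m C:C & (ALL b:C. ALL x:si. g (m C) x <= g b x)" ..
 have Min: "Min ((%k. g k x) ` C) = g (m C) x" if "C:\<C>" "x:si" for C x
  using m that \<C>(3) by (intro Min_eqI) auto
 have "m ` \<C> <= V" using m \<C>(3) by blast
 then obtain a where a: "a:m ` \<C>" "ALL b:m ` \<C>. ALL x:si. g b x <= g a x"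
  using min_max_selection(2)[where V = V and si = si and g = g and C = "m ` \<C>", OF total] \<C>(1,2) by blast
 have "Max ((%C. Min ((%k. g k x) ` C)) ` \<C>) = g a x" if x: "x:si" for x
 proof -
  have "(%C. Min ((%k. g k x) ` C)) ` \<C> = (%C. g (m C) x) ` \<C>" using Min x by (intro image_cong) auto
  thus ?thesis using a x \<C>(1) by (auto intro!: Max_eqI)
 qed
 thus ?thesis using a(1) \<open>m ` \<C> <= V\<close> by blast
qed

lemma uncrossed_rint:
 assumes "linear h" "uncrossed h Si" "ta:Si" "x:rint ta" "0 <= h x" "y:ta" shows "0 <= (h y :: real)"
proof (rule ccontr)
 assume n: "~ 0 <= h y"
 hence le: "ALL z:ta. h z <= 0" using assms(2,3,6) unfolding uncrossed_def by blast
 obtain e where e: "e > 0" "x - e *R y:ta" using assms(4,6) unfolding rint_def by blast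
 hence "h x - e * h y <= 0" using le by (metis linear_diff[OF assms(1)] linear_scale[OF assms(1)] real_scaleR_def)
 moreover have "e * h y < 0" using e(1) n by (simp add: mult_less_0_iff)
 ultimately show False using assms(5) by simp
qed

lemma (in matroidal_support) matroidal_linear_image:
 assumes f: "linear f" "inj_on f (span N)"
 shows "matroidal_support E r (f o q) (f ` N) (f ` P)"
proof (rule matroidal_support.intro[OF loopless_rank_function_axioms], rule matroidal_support_axioms.intro)
 show "linear (f o q)" by (rule linear_compose[OF linear_q f(1)])
 show "(f o q) ` int_lattice E = f ` N" unfolding lattice_image[symmetric] by (simp add: image_comp)
 show "is_lattice (f ` N)" by (rule is_lattice_linear_image[OF lattice_N f])
 show "f ` P = (f o q) ` trop_space" unfolding support_image by (simp add: image_comp)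
 fix x z assume x: "x:trop_space" and z: "z:coords E" "(f o q) z = 0"
 have "q z:span N" "0:span N" unfolding span_N using z(1) by (auto simp: linear_0[OF linear_q] intro!: image_eqI[of 0 _ 0] subspace_0[OF coords_subspace])
 hence "q z = 0" using inj_onD[OF f(2), of "q z" 0] z(2) linear_0[OF f(1)] by simp
 thus "x + z:trop_space" using kernel_invariant[OF x z(1)] by blast
qed

text \<open>The support of the star is the image of the tangent cone, which is the tropical space of
  an initial matroid. The directions of \<open>span si\<close> become additional invariant
  directions.\<close>

lemma (in matroidal_support) star_matroidal:
 assumes f: "rational_fan N Si" "\<Union>Si = P" and si: "si:Si"
 obtains r' q' where "matroidal_support E r' q' (quot_map (span si) ` N) (\<Union>(star (quot_map (span si)) Si si))"
proof -
 define p where "p = quot_map (span si)"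
 have p: "linear p" "!!x. p x = 0 <-> x:span si"
  unfolding p_def using quot_map(1)[OF subspace_span] quot_map_zero_iff[OF subspace_span] by auto
 obtain x where x: "x:N" "x:rint si"
  using rational_cone_rint[OF is_lattice_add_subgroup[OF lattice_N] fan_rational[OF f(1) si]] .
 have "x:P" using x(2) si rint_subset f(2) by blast
 then obtain w where w: "w:trop_space" "x = q w" unfolding support_image by blast
 note wc = trop_space_coords[OF w(1)]
 interpret I: loopless_rank_function E "init_rank w" by (rule init_loopless[OF w(1)])
 have T: "tcone trop_space w = I.trop_space" by (rule tcone_trop_space[OF rank_function_axioms w(1)])
 have "matroidal_support E (init_rank w) (p o q) (p ` N) (\<Union>(star p Si si))"
 proof (rule matroidal_support.intro[OF I.loopless_rank_function_axioms], rule matroidal_support_axioms.intro)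
  show "linear (p o q)" by (rule linear_compose[OF linear_q p(1)])
  show "(p o q) ` int_lattice E = p ` N" unfolding lattice_image[symmetric] by (simp add: image_comp)
  show "is_lattice (p ` N)" by (rule quotient_by_cone(1)[OF lattice_N fan_rational[OF f(1) si] p])
  show "\<Union>(star p Si si) = (p o q) ` I.trop_space"
   using star_support[OF f(1) si x(2) p] tcone_P(1)[OF wc] T w(2) f(2) by (simp add: image_comp)
  fix y z assume y: "y:I.trop_space" and z: "z:coords E" "(p o q) z = 0"
  note yc = I.trop_space_coords[OF y]
  have "q y:tcone (\<Union>Si) x" using tcone_P(2)[OF wc yc] y T w(2) f(2) by simp
  hence "q y + q z:tcone (\<Union>Si) x" using tcone_invariant[OF f(1) si x(2)] z(2) p(2) by simp
  hence "q (y + z):tcone P (q w)" using f(2) w(2) by (simp add: q_add)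
  thus "y + z:I.trop_space" using tcone_P(2)[OF wc subspace_add[OF coords_subspace yc z(1)]] T by simp
 qed
 thus ?thesis using that unfolding p_def by blast
qed

text \<open>If every element is a coloop, every set is an intersection of flats of the form
  \<open>E - {i}\<close>, so all coordinate vectors belong to the tropical space.\<close>

lemma (in matroidal_support) support_independent_of_flats:
 assumes "!!i. i:E ==> rflat (E - {i})" shows "P = span N"
proof -
 have "rflat (E - A)" if "finite A" "A <= E" for A
  using that
 proof (induction A rule: finite_induct)
  case (insert i A)
  have "E - insert i A = (E - A) Int (E - {i})" by blast
  thus ?case using insert assms rflat_Int by auto
 qed (simp add: rflat_E)
 hence "rflat A" if "A <= E" for A
  using that fin by (metis Diff_subset double_diff finite_Diff order_refl)
 hence "trop_space = coords E" unfolding trop_space_def by auto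
 thus ?thesis unfolding support_image span_N by simp
qed

section \<open>Membership in a fixed stable class, by induction on the dimension of the
  lattice\<close>

context
 fixes \<S> :: "universe tfan set"
 assumes stable: "T_stable \<S>" and base: "contains_base \<S>"
begin

lemma tropical_S: "tropical_class \<S>"
 using stable unfolding T_stable_def by blast

lemma in_class_unit_fan:
 assumes "tropical_fan (unit_fan N Si)" shows "in_class (unit_fan N Si) \<S> <-> unit_fan N Si:\<S>"
proof
 have r: "trop_iso (unit_fan N Si) (unit_fan N Si)" by (rule trop_iso_same) auto
 have "rational_fan (lat (unit_fan N Si)) (cones (unit_fan N Si))" using assms unfolding tropical_fan_def by blast
 thus "in_class (unit_fan N Si) \<S> ==> unit_fan N Si:\<S>" using in_class_iso[OF tropical_S _ _ r assms] by blast
 show "unit_fan N Si:\<S> ==> in_class (unit_fan N Si) \<S>" unfolding in_class_def using r by blast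
qed

lemma transport_unit_fan:
 assumes X: "rational_fan N Si" "in_class (unit_fan N Si) \<S>" and f: "linear f" "inj_on f (span N)"
  and t: "tropical_fan (unit_fan (f ` N) ((`) f ` Si))"
 shows "unit_fan (f ` N) ((`) f ` Si):\<S>"
 using in_class_iso[OF tropical_S _ X(2) trop_iso_unit_fan[OF X(1) f] t] X(1) by simp

text \<open>The basis is built up one vector at a time: the line fan is moved to the line of
  \<open>b\<close>, multiplied with the fan obtained so far, and brought back to one space by
  addition, which is injective since \<open>b\<close> is independent of the others.\<close>

theorem complete_fan:
 assumes "is_lattice N" obtains Si where "rational_fan N Si" "\<Union>Si = span N" "unit_fan N Si:\<S>"
proof -
 obtain B where B: "finite B" "independent B" "N = int_span B" using assms unfolding is_lattice_iff by blast
 have "EX Si. rational_fan (int_span B) Si & \<Union>Si = span (int_span B) & unit_fan (int_span B) Si:\<S>"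
  using B(1,2)
 proof (induction B rule: finite_induct)
  case empty
  have i: "int_span {} = {0 :: universe}" unfolding int_span_def by auto
  let ?f = "%_ :: real. 0 :: universe"
  have "point_fan 1 = unit_fan {0} {{0}}" unfolding point_fan_def unit_fan_def by simp
  moreover have "in_class (point_fan 1) \<S>" using base unfolding contains_base_def by simp
  ultimately have c: "in_class (unit_fan {0 :: real} {{0}}) \<S>" by simp
  have "tropical_fan (unit_fan {0 :: universe} {{0}})" by (rule complete_unit_fan_tropical[OF zero_fan]) simp
  hence "unit_fan (?f ` {0}) ((`) ?f ` {{0}}):\<S>"
   by (intro transport_unit_fan[OF zero_fan c]) (auto intro: linearI inj_onI)
  thus ?case unfolding i using zero_fan by (intro exI[of _ "{{0}}"]) auto
 next
  case (insert b B)
  have ind: "independent B" "b~:span B" using insert.prems insert.hyps(2) by (auto simp: independent_insert)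
  then obtain Si where s: "rational_fan (int_span B) Si" "\<Union>Si = span (int_span B)" "unit_fan (int_span B) Si:\<S>"
   using insert.IH by blast
  have sB: "span (int_span B) = span B" by (rule span_int_span[OF insert.hyps(1)])
  define l where "l = (%t :: real. t *R b)"
  define L where "L = (`) l ` {{0}, {0..}, {..0}}"
  have b0: "b ~= 0" using ind(2) span_zero by blast
  have l: "linear l" "inj_on l UNIV" unfolding l_def using b0 by (auto intro!: linearI inj_onI simp: algebra_simps)
  have ZU: "span (\<int> :: real set) = UNIV"
  proof -
   have "t:span \<int>" for t :: real using span_scale[OF span_base[of "1 :: real" \<int>], of t] by simp
   thus ?thesis by blast
  qed
  have spl: "span (l ` \<int>) = range l" by (simp add: linear_span_image[OF l(1)] ZU)
  have Lf: "rational_fan (l ` \<int>) L" unfolding L_def by (rule fan_linear_image[OF line_rational_fan l(1)]) (simp add: ZU l(2))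
  have "\<Union>{{0}, {0..}, {..0}} = (UNIV :: real set)" by auto
  hence UL: "\<Union>L = span (l ` \<int>)" unfolding L_def spl image_Union[symmetric] by simp
  have "line_fan = unit_fan \<int> {{0}, {0..}, {..0}}" unfolding line_fan_def unit_fan_def ..
  hence "in_class (unit_fan \<int> {{0 :: real}, {0..}, {..0}}) \<S>" using base unfolding contains_base_def by simp
  hence LS: "unit_fan (l ` \<int>) L:\<S>"
   unfolding L_def using complete_unit_fan_tropical[OF Lf UL] l ZU
   by (intro transport_unit_fan[OF line_rational_fan]) (simp_all add: L_def)
  define M where "M = int_span B \<times> l ` \<int>"
  define Om where "Om = {si \<times> ta | si ta. si:Si & ta:L}"
  let ?m = "%(x, t). (x, l t)"
  have "linear ?m" by (rule linearI) (auto simp: l_def algebra_simps)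
  moreover have "inj_on ?m A" for A using l(2) by (auto simp: inj_on_def)
  ultimately have "is_lattice (?m ` (int_span B \<times> \<int>))"
   by (intro is_lattice_linear_image[OF is_lattice_Times_Ints[OF fan_lattice[OF s(1)]]])
  moreover have "?m ` (int_span B \<times> \<int>) = M" unfolding M_def by auto
  ultimately have Om: "rational_fan M Om" unfolding M_def Om_def by (intro product_rational_fan[OF s(1) Lf]) simp
  have "product_fan (unit_fan (int_span B) Si) (unit_fan (l ` \<int>) L) = unit_fan M Om"
   unfolding product_fan_def unit_fan_def M_def Om_def by simp
  hence OmS: "in_class (unit_fan M Om) \<S>" using stable s(3) LS unfolding T_stable_def by metis
  define a where "a = (%(x, y). x + y :: universe)"
  have a: "linear a" unfolding a_def by (rule linearI) (auto simp: algebra_simps)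
  have "span M <= span B \<times> range l" using span_Times_subset[of "int_span B" "l ` \<int>"] unfolding M_def sB spl .
  moreover have "inj_on a (span B \<times> range l)"
  proof (rule inj_onI, clarify)
   fix x y t u assume xy: "x:span B" "y:span B" and "a (x, l t) = a (y, l u)"
   hence e: "x - y = (u - t) *R b" unfolding a_def l_def by (simp add: algebra_simps)
   hence m: "(u - t) *R b:span B" using span_diff[OF xy] by simp
   have "u - t = 0"
   proof (rule ccontr)
    assume "u - t ~= 0"
    hence "b:span B" using span_scale[OF m, of "1 / (u - t)"] by simp
    thus False using ind(2) by blast
   qed
   thus "x = y & l t = l u" using e by simp
  qed
  ultimately have inj: "inj_on a (span M)" using inj_on_subset by blast
  have aM: "a ` M = int_span (insert b B)"
   unfolding int_span_insert[OF insert.hyps(1,2)] M_def a_def l_def by (force simp: Ints_def image_iff add.commute)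
  have f: "rational_fan (int_span (insert b B)) ((`) a ` Om)" using fan_linear_image[OF Om a inj] aM by simp
  have "\<Union>Om = \<Union>Si \<times> \<Union>L" unfolding Om_def by auto
  hence "\<Union>((`) a ` Om) = a ` (span B \<times> range l)" using s(2) UL sB spl by (metis image_Union)
  also have "... = span (insert b B)"
  proof
   show "a ` (span B \<times> range l) <= span (insert b B)"
   proof clarify
    fix x t assume "x:span B"
    hence "x:span (insert b B)" "b:span (insert b B)" using span_mono[of B "insert b B"] span_base[of b "insert b B"] by auto
    thus "a (x, l t):span (insert b B)" unfolding a_def l_def by (simp add: span_add span_scale)
   qed
   show "span (insert b B) <= a ` (span B \<times> range l)"
   proof
    fix x assume "x:span (insert b B)"
    then obtain k where "x - k *R b:span B" unfolding span_insert by blast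
    thus "x:a ` (span B \<times> range l)" unfolding a_def l_def by (intro image_eqI[of _ _ "(x - k *R b, k *R b)"]) auto
   qed
  qed
  finally have U: "\<Union>((`) a ` Om) = span (int_span (insert b B))" using span_int_span[of "insert b B"] insert.hyps(1) by simp
  have "unit_fan (int_span (insert b B)) ((`) a ` Om):\<S>"
   using transport_unit_fan[OF Om OmS a inj] complete_unit_fan_tropical[OF f U] unfolding aM by blast
  thus ?case using f U by blast
 qed
 thus ?thesis using that B(3) by blast
qed

text \<open>Existence is included because it provides the starting fans on the deletion and the
  contraction; the second part alone could hold vacuously.\<close>

definition all_fans_in :: "universe set => universe set => bool" where
 "all_fans_in N P <-> (EX Si. rational_fan N Si & \<Union>Si = P) & (ALL Si. rational_fan N Si --> \<Union>Si = P --> unit_fan N Si:\<S>)"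

text \<open>A nonzero \<open>v\<close> makes \<open>si\<close> positive-dimensional, so the star
  lives in a smaller lattice and belongs to the class by the induction hypothesis; the blow-up
  condition of stability then applies.\<close>

lemma blow_in_class:
 assumes M: "matroidal_support (E :: 'a set) r q N P"
  and IH: "!!r' (q' :: 'a fvec => universe) N' P'. matroidal_support E r' q' N' P' ==> dim N' < dim N ==> all_fans_in N' P'"
  and f: "rational_fan N Si" "\<Union>Si = P" and si: "si:Si" and v: "v:N" "v:rint si" "v ~= 0"
 shows "unit_fan N Si:\<S> <-> unit_fan N (blow Si v):\<S>"
proof -
 interpret M: matroidal_support E r q N P by (rule M)
 let ?p = "quot_map (span si)"
 have p: "linear ?p" "!!x. ?p x = 0 <-> x:span si"
  using quot_map(1)[OF subspace_span] quot_map_zero_iff[OF subspace_span] by auto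
 have vsi: "v:si" using v(2) rint_subset by blast
 have b: "rational_fan N (blow Si v)" "\<Union>(blow Si v) = P" using blow_fan[OF f(1) v(1,3)] blow_support[OF f(1) v(3)] f(2) by auto
 have t: "tropical_fan (unit_fan N Si)" "tropical_fan (unit_fan N (blow Si v))"
  using M.tropical_unit_fan f b by blast+
 note sir = fan_rational[OF f(1) si]
 have "0 < dim si" using dim_pos[OF fin_dim_rational_cone[OF M.lattice_N sir] vsi v(3)] .
 hence d: "dim (?p ` N) < dim N" using quotient_by_cone(2)[OF M.lattice_N sir p] by simp
 obtain r' q' where "matroidal_support E r' q' (?p ` N) (\<Union>(star ?p Si si))" using M.star_matroidal[OF f si] .
 hence st: "all_fans_in (?p ` N) (\<Union>(star ?p Si si))" "tropical_fan (unit_fan (?p ` N) (star ?p Si si))"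
  using IH d matroidal_support.tropical_unit_fan star_rational_fan[OF f(1) si p] by blast+
 have "in_class (star_fan (unit_fan N Si) si) \<S>"
  unfolding star_fan_unit_fan in_class_unit_fan[OF st(2)] using st(1) star_rational_fan[OF f(1) si p] unfolding all_fans_in_def by blast
 moreover have "rational_ray (lat (unit_fan N Si)) (convex_cone hull {v})" unfolding rational_ray_def using v by auto
 moreover have "convex_cone hull {v} - {0} <= rel_interior si" by (rule ray_rel_interior[OF M.lattice_N sir v(2)])
 moreover have "si:cones (unit_fan N Si)" using si by simp
 moreover have "ALL X :: universe tfan. tropical_fan X --> (ALL si:cones X. ALL rh. rational_ray (lat X) rh &
   rh - {0} <= rel_interior si & in_class (star_fan X si) \<S> --> (in_class X \<S> <-> in_class (blow_up X si rh) \<S>))"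
  using stable unfolding T_stable_def by (elim conjE)
 ultimately have "in_class (unit_fan N Si) \<S> <-> in_class (blow_up (unit_fan N Si) si (convex_cone hull {v})) \<S>"
  using t(1) by (auto simp del: unit_fan_simps)
 thus ?thesis unfolding blow_up_unit_fan[OF f(1) si v(2)] in_class_unit_fan[OF t(1)] in_class_unit_fan[OF t(2)] .
qed

text \<open>A fan on the support of the deletion is refined until \<open>f\<close> is linear on its
  cones and the support of the contraction is a union of cones. In the coordinates given by
  \<open>proj\<close> and \<open>g0\<close> its modification has the support \<open>P\<close>, and
  it is moved back to \<open>N\<close>.\<close>

lemma modification_in_class:
 fixes q :: "'a fvec => universe"
 assumes M: "matroidal_deletion E r q N P i"
  and IH: "!!E' r' (q' :: 'a fvec => universe) N' P'. matroidal_support E' r' q' N' P' ==> dim N' < dim N ==> all_fans_in N' P'"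
 obtains Si where "rational_fan N Si" "\<Union>Si = P" "unit_fan N Si:\<S>"
proof -
 interpret M: matroidal_deletion E r q N P i by (rule M)
 let ?N = "M.proj ` N" and ?P = "M.proj ` P"
 note N' = M.lattice_proj
 interpret D: matroidal_support "E - {i}" r "M.proj o q" ?N ?P by (rule M.deletion_matroidal)
 obtain g0 :: "universe => real" and g :: "'a => universe => real" and f where g0: "linear g0"
  and g: "ALL k:M.block - {i}. int_form ?N (g k)"
  and f: "f = (%u. Max ((%C. Min ((%k. g k u) ` C)) ` M.circuits))"
  and inj: "inj_on (%u. (M.proj u, g0 u)) (span N)" and imN: "(%u. (M.proj u, g0 u)) ` N = ?N \<times> \<int>"
  and imP: "ALL w s. (w, s):(%u. (M.proj u, g0 u)) ` P <-> w:?P & (s = f w | (f w < s & w:M.Q))"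
  by (rule M.modification_data)
 define pz where "pz = (%u. (M.proj u, g0 u))"
 note inj = inj[folded pz_def] and imN = imN[folded pz_def] and imP = imP[folded pz_def]
 have pz: "linear pz" unfolding pz_def
  by (rule linearI) (simp_all add: linear_add[OF M.linear_proj] linear_scale[OF M.linear_proj] linear_add[OF g0] linear_scale[OF g0])
 \<comment> \<open>If \<open>{i}\<close> is not a flat, the contraction has loops and
   \<open>M.Q\<close> is empty; the divisor will then be trivial.\<close>
 obtain De where De: "\<Union>De = M.Q" "finite De" "ALL C:De. rational_cone ?N C"
 proof (cases "M.rflat {i}")
  case True
  then obtain De where "rational_fan ?N De" "\<Union>De = M.Q"
   using IH[OF M.contraction_matroidal M.dim_proj] unfolding all_fans_in_def by blast
  thus ?thesis using that[of De] fan_finite[of ?N De] fan_rational[of ?N De] by auto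
 next
  case False
  thus ?thesis using that[of "{}"] M.Q_empty by simp
 qed
 have "ALL C:De. EX H. finite H & (ALL h:H. int_form ?N h) & C = {x:span ?N. ALL h:H. 0 <= h x}"
  using De(3) rational_cone_halfspaces[OF N'] by blast
 from bchoice[OF this] obtain H where H: "ALL C:De. finite (H C) & (ALL h:H C. int_form ?N h) & C = {x:span ?N. ALL h:H C. 0 <= h x}" ..
 \<comment> \<open>Differences of the coordinate functions make \<open>f\<close> linear on uncrossed
   cones; the forms defining the cones of \<open>De\<close> make \<open>M.Q\<close> a union of
   cones.\<close>
 define G where "G = (%(a, b) x. g a x - g b x) ` ((M.block - {i}) \<times> (M.block - {i})) Un \<Union>(H ` De)"
 have "finite (M.block - {i})" using M.separator_subset[OF M.separator_block] M.finite_subset_E by blast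
 hence finG: "finite G" unfolding G_def using De(2) H by auto
 have formG: "int_form ?N h" if hG: "h:G" for h
 proof -
  consider a b where "h = (%x. g a x - g b x)" "int_form ?N (g a)" "int_form ?N (g b)" | C where "C:De" "h:H C"
   using hG g unfolding G_def by auto
  thus ?thesis
  proof cases
   case 1
   thus ?thesis unfolding int_form_def by (auto intro!: linear_compose_sub Ints_diff simp: image_subset_iff)
  qed (use H in blast)
 qed
 obtain Si\<^sub>0 where s0: "rational_fan ?N Si\<^sub>0" "\<Union>Si\<^sub>0 = ?P"
  using IH[OF M.deletion_matroidal M.dim_proj] unfolding all_fans_in_def by blast
 obtain Si where Si: "rational_fan ?N Si" "\<Union>Si = ?P" and unc: "ALL h:G. uncrossed h Si"
  using fan_refine[where Q = "%_. True" and H = "{}", OF refl finG formG s0] by auto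
 have SiS: "unit_fan ?N Si:\<S>" using IH[OF M.deletion_matroidal M.dim_proj] Si unfolding all_fans_in_def by blast
 \<comment> \<open>A cone of \<open>Si\<close> with an interior point in \<open>M.Q\<close> lies in
   a cone of \<open>De\<close>, since the defining forms do not change sign on it; so these cones
   cover \<open>M.Q\<close>.\<close>
 define D where "D = {de:Si. de <= M.Q}"
 have UD: "\<Union>D = M.Q"
 proof
  show "M.Q <= \<Union>D"
  proof
   fix x assume x: "x:M.Q"
   then obtain si where "si:Si" "x:si" using M.Q_subset Si(2) by blast
   then obtain ta where t: "ta:Si" "x:rint ta" using fan_rint[OF Si(1)] by metis
   obtain C where C: "C:De" "x:C" using x De(1) by blast
   have HC: "C = {x:span ?N. ALL h:H C. 0 <= h x}" using H C(1) by blast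
   have "ta <= C"
   proof
    fix y assume y: "y:ta"
    have "y:span ?N" using fan_support_span[OF Si(1)] t(1) y by blast
    moreover have "0 <= h y" if h: "h:H C" for h
    proof -
     have hG: "h:G" unfolding G_def using h C(1) by blast
     have "0 <= h x" using C(2) h HC by blast
     thus ?thesis using uncrossed_rint[OF int_form_linear[OF formG[OF hG]] _ t _ y] unc hG by blast
    qed
    ultimately show "y:C" using HC by blast
   qed
   hence "ta:D" unfolding D_def using t(1) C(1) De(1) by blast
   thus "x:\<Union>D" using t(2) rint_subset by blast
  qed
 qed (auto simp: D_def)
 have form: "EX h. int_form ?N h & (ALL x:si. f x = h x)" if s: "si:Si" for si
 proof -
  have "(ALL x:si. g a x <= g b x) | (ALL x:si. g b x <= g a x)" if "a:M.block - {i}" "b:M.block - {i}" for a b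
  proof -
   have "(%x. g a x - g b x):G" unfolding G_def using that by force
   hence "uncrossed (%x. g a x - g b x) Si" using unc by blast
   thus ?thesis using s unfolding uncrossed_def by auto
  qed
  moreover have "finite C & C ~= {} & C <= M.block - {i}" if "C:M.circuits" for C
   using M.circuits_finite(2)[OF that] M.circuits_nonempty(2)[OF that] that unfolding M.circuits_def by blast
  ultimately have "EX a:M.block - {i}. ALL x:si. Max ((%C. Min ((%k. g k x) ` C)) ` M.circuits) = g a x"
   by (rule max_min_linear[OF _ M.circuits_finite(1) M.circuits_nonempty(1)])
  thus ?thesis using g unfolding f by blast
 qed
 have Dface: "ta:D" if "de:D" "cface ta de" for de ta
  using that fan_face[OF Si(1)] cface_subset unfolding D_def by blast
 have DS: "D <= Si" unfolding D_def by blast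
 interpret mod: modification ?N Si f D
  by (rule modification.intro, rule Si(1), erule form, rule DS, erule (1) Dface)
 define T where "T = modification_cones f Si D"
 have UT: "\<Union>T = pz ` P"
 proof (rule set_eqI, clarify)
  fix x t show "(x, t):\<Union>T <-> (x, t):pz ` P"
   unfolding T_def mod.modification_support imP[rule_format] Si(2) UD ..
 qed
 note Tf = mod.modification_fan[folded T_def]
 interpret L: matroidal_support E r "pz o q" "pz ` N" "pz ` P" by (rule M.matroidal_linear_image[OF pz inj])
 have trop: "tropical_fan (unit_fan ?N Si)" "tropical_fan (unit_fan (?N \<times> \<int>) (modification_cones f Si D))"
  using D.tropical_unit_fan[OF Si] L.tropical_unit_fan[OF _ UT] Tf unfolding T_def imN by blast+
 have DF: "M.rflat {i} & rational_fan ?N D" if ne: "D ~= {}"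
 proof
  show "M.rflat {i}"
  proof (rule ccontr)
   assume "~ M.rflat {i}"
   hence "\<Union>D = {}" using M.Q_empty UD by blast
   moreover obtain de where "de:D" using ne by blast
   hence "0:\<Union>D" using convex_cone_contains_0[OF fan_cone[OF Si(1)]] unfolding D_def by blast
   ultimately show False by blast
  qed
  show "rational_fan ?N D"
  proof (rule rational_fanI[OF N' finite_subset[OF DS fan_finite[OF Si(1)]] ne])
   show "rational_cone ?N si" "strongly_convex si" if "si:D" for si
    using fan_rational[OF Si(1)] fan_strongly[OF Si(1)] DS that by blast+
   show "cface (si Int si') si" if "si:D" "si':D" for si si'
    using fan_Int[OF Si(1)] DS that by blast
  qed (rule Dface)
 qed
 \<comment> \<open>Deletion and contraction are seen through the same map with the same kernel, so
   the dimensions of their supports differ as their ranks do, by one.\<close>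
 have Ddim: "EX ta:D. de <= ta & dim ta + 1 = fan_dim Si" if d: "de:D" for de
 proof -
  have fi: "M.rflat {i}" and Df: "rational_fan ?N D" using DF d by blast+
  interpret C: matroidal_support "E - {i}" M.contraction "M.proj o q" ?N M.Q by (rule M.contraction_matroidal[OF fi])
  obtain ta where t: "ta:facets D" "de <= ta" using fan_facet_above[OF Df d] .
  have "r {i} <= r E" by (rule M.rank_mono) (use M.i in auto)
  hence "nat (M.contraction (E - {i})) + 1 = nat (r (E - {i}))"
   unfolding M.contraction_def M.rank_deletion using M.rank_single[OF M.i] insert_Diff[OF M.i] by simp
  hence "C.support_dim + 1 = D.support_dim"
   using C.support_dim_plus[OF Df UD] D.support_dim_plus[OF Si] by simp
  thus ?thesis using t C.facet_dim'[OF Df UD t(1)] D.fan_dim_support[OF Si] unfolding facets_def by auto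
 qed
 have div: "div_facets (unit_fan ?N Si) f = {ta:D. dim ta + 1 = fan_dim Si}" "cones (div_fan (unit_fan ?N Si) f) = D"
  "trop_iso (div_fan (unit_fan ?N Si) f) (unit_fan ?N D)"
  "trop_iso (tropical_modification (unit_fan ?N Si) f) (unit_fan (?N \<times> \<int>) (modification_cones f Si D))"
  by (rule mod.div_modification[OF trop], erule Ddim)+
 have "div_trivial (unit_fan ?N Si) f | in_class (div_fan (unit_fan ?N Si) f) \<S>"
 proof (cases "D = {}")
  case True
  thus ?thesis unfolding div_trivial_def div(1) by simp
 next
  case False
  hence "unit_fan ?N D:\<S>"
   using DF IH[OF M.contraction_matroidal M.dim_proj] UD unfolding all_fans_in_def by blast
  thus ?thesis unfolding in_class_def using div(3) by blast
 qed
 moreover have "meromorphic_on (unit_fan ?N Si) f"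
  unfolding meromorphic_on_def
 proof
  have cg: "continuous_on (span ?N) (g k)" if "k:M.block - {i}" for k
   using linear_continuous_on_lattice[OF N'] g int_form_linear that by blast
  have "continuous_on (span ?N) f"
   unfolding f
  proof (rule continuous_on_Max_image(1))
   fix C assume C: "C:M.circuits"
   show "continuous_on (span ?N) (%u. Min ((%k. g k u) ` C))"
    by (rule continuous_on_Max_image(2)[OF M.circuits_finite(2)[OF C] M.circuits_nonempty(2)[OF C]], rule cg)
     (use C in \<open>auto simp: M.circuits_def\<close>)
  qed (use M.circuits_finite M.circuits_nonempty in auto)
  thus "continuous_on (support (unit_fan ?N Si)) f"
   using continuous_on_subset fan_support_span[OF Si(1)] by auto
  show "ALL si:cones (unit_fan ?N Si). EX h. integral_form_on (lat (unit_fan ?N Si)) f si h"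
  proof
   fix si assume "si:cones (unit_fan ?N Si)"
   then obtain h where "int_form ?N h" "ALL x:si. f x = h x" using form[of si] by auto
   hence "integral_form_on ?N f si h" unfolding integral_form_on_def int_form_def cone_lattice_def by blast
   thus "EX h. integral_form_on (lat (unit_fan ?N Si)) f si h" by auto
  qed
 qed
 ultimately have TM: "in_class (tropical_modification (unit_fan ?N Si) f) \<S>"
 proof -
  have "ALL X:\<S>. ALL f. meromorphic_on X f & (div_trivial X f | in_class (div_fan X f) \<S>) --> in_class (tropical_modification X f) \<S>"
   using stable unfolding T_stable_def by (elim conjE)
  from bspec[OF this SiS] show "div_trivial (unit_fan ?N Si) f | in_class (div_fan (unit_fan ?N Si) f) \<S> ==>
   meromorphic_on (unit_fan ?N Si) f ==> ?thesis" by simp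
 qed
 \<comment> \<open>A left inverse of \<open>pz\<close> on \<open>span N\<close> moves the modified
   fan from the product lattice back to \<open>N\<close>.\<close>
 obtain th where th: "linear th" "ALL x:span N. th (pz x) = x"
  using linear_inj_on_left_inverse[OF pz inj] by blast
 have thA: "th ` pz ` A = A" if "A <= span N" for A
 proof -
  have "(%x. th (pz x)) ` A = (%x. x) ` A" by (rule image_cong) (use th(2) that in auto)
  thus ?thesis by (simp add: image_image)
 qed
 have thN: "th ` (?N \<times> \<int>) = N" unfolding imN[symmetric] by (rule thA[OF span_superset])
 have thP: "\<Union>((`) th ` T) = P"
 proof -
  have "\<Union>((`) th ` T) = th ` pz ` P" unfolding UT[symmetric] by blast
  thus ?thesis using thA[OF M.P_span] by simp
 qed
 have "span (?N \<times> \<int>) = pz ` span N" unfolding imN[symmetric] by (rule linear_span_image[OF pz])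
 hence thinj: "inj_on th (span (?N \<times> \<int>))" using th(2) by (auto simp: inj_on_def)
 have F: "rational_fan N ((`) th ` T)" using fan_linear_image[OF Tf th(1) thinj] thN by simp
 have "trop_iso (unit_fan (?N \<times> \<int>) T) (unit_fan N ((`) th ` T))" using trop_iso_unit_fan[OF Tf th(1) thinj] thN by simp
 moreover have TMf: "rational_fan (lat (tropical_modification (unit_fan ?N Si) f)) (cones (tropical_modification (unit_fan ?N Si) f))"
  using Tf unfolding tropical_modification_def by (simp add: div(2) T_def modification_cones_def)
 moreover have "is_lattice (lat (unit_fan (?N \<times> \<int>) T))" using is_lattice_Times_Ints[OF N'] by simp
 ultimately have "trop_iso (tropical_modification (unit_fan ?N Si) f) (unit_fan N ((`) th ` T))"
  using trop_iso_trans[OF div(4)[folded T_def]] by blast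
 hence "unit_fan N ((`) th ` T):\<S>"
  using in_class_iso[OF tropical_S TMf TM] M.tropical_unit_fan[OF F thP] by blast
 thus ?thesis using that F thP by blast
qed

text \<open>One fan with support \<open>P\<close> comes from a complete fan if all elements are
  coloops and from a modification otherwise. Blow-up invariance, through
  \<open>fan_support_equiv\<close>, spreads membership to all fans with this support.\<close>

theorem matroidal_in_class:
 fixes q :: "'a fvec => universe"
 assumes "matroidal_support E r q N P" shows "all_fans_in N P"
 using assms
proof (induction "dim N" arbitrary: E r q N P rule: less_induct)
 case less
 interpret M: matroidal_support E r q N P by (rule less.prems)
 have IH: "all_fans_in N' P'" if "matroidal_support E' r' q' N' P'" "dim N' < dim N"
  for E' :: "'a set" and r' and q' :: "'a fvec => universe" and N' P'
  using less.hyps[OF that(2,1)] .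
 obtain Si\<^sub>0 where s0: "rational_fan N Si\<^sub>0" "\<Union>Si\<^sub>0 = P" "unit_fan N Si\<^sub>0:\<S>"
 proof (cases "ALL i:E. M.rflat (E - {i})")
  case True
  hence "P = span N" using M.support_independent_of_flats by blast
  thus ?thesis using that complete_fan[OF M.lattice_N] by metis
 next
  case False
  then obtain i where i: "i:E" "~ M.rflat (E - {i})" by blast
  have "matroidal_deletion E r q N P i"
   by (rule matroidal_deletion.intro[OF M.matroidal_support_axioms], rule matroidal_deletion_axioms.intro[OF i])
  thus ?thesis using that modification_in_class IH by metis
 qed
 have "unit_fan N Si:\<S>" if f: "rational_fan N Si" "\<Union>Si = P" for Si
 proof -
  have "unit_fan N De:\<S> <-> unit_fan N (blow De v):\<S>"
   if "rational_fan N De" "\<Union>De = P" "si:De" "v:N" "v:rint si" "v ~= 0" for De si v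
   by (rule blow_in_class[OF M.matroidal_support_axioms IH that])
  hence "unit_fan N Si\<^sub>0:\<S> <-> unit_fan N Si:\<S>"
   by (rule fan_support_equiv[where Q = "%Si. unit_fan N Si:\<S>", OF _ s0(1,2) f])
  thus ?thesis using s0(3) by simp
 qed
 thus ?case unfolding all_fans_in_def using s0 by blast
qed

end

section \<open>Simplicial fans\<close>

lemma convex_cone_hull_image:
 assumes "finite S"
 shows "convex_cone hull (rh ` S) = {\<Sum>l\<in>S. c l *R rh l | c. ALL l:S. 0 <= c l}" (is "_ = ?R")
proof
 show "convex_cone hull (rh ` S) <= ?R"
 proof (rule convex_cone_hull_minimal)
  show "convex_cone ?R"
  proof (rule convex_coneI)
   show "0:?R" by (rule CollectI, rule exI[of _ "%_. 0"]) simp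
   fix x y assume "x:?R" "y:?R"
   then obtain c d where "x = (\<Sum>l\<in>S. c l *R rh l)" "y = (\<Sum>l\<in>S. d l *R rh l)" "ALL l:S. 0 <= c l" "ALL l:S. 0 <= d l" by blast
   thus "x + y:?R" by (intro CollectI exI[of _ "%l. c l + d l"]) (simp add: scaleR_left_distrib sum.distrib)
  next
   fix x and t :: real assume "x:?R" and t: "0 <= t"
   then obtain c where "x = (\<Sum>l\<in>S. c l *R rh l)" "ALL l:S. 0 <= c l" by blast
   thus "t *R x:?R" using t by (intro CollectI exI[of _ "%l. t * c l"]) (simp add: scaleR_sum_right)
  qed
  show "rh ` S <= ?R"
  proof clarify
   fix l assume "l:S"
   thus "EX c. rh l = (\<Sum>l\<in>S. c l *R rh l) & (ALL l:S. 0 <= c l)"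
    using assms by (intro exI[of _ "%m. if m = l then 1 else 0"]) (simp add: if_distrib[of "%r. r *R _"] cong: if_cong)
  qed
 qed
 show "?R <= convex_cone hull (rh ` S)"
 proof clarify
  fix c assume "ALL l:S. 0 <= (c l :: real)"
  thus "(\<Sum>l\<in>S. c l *R rh l):convex_cone hull (rh ` S)"
   by (intro convex_cone_sum[OF convex_cone_convex_cone_hull] convex_cone_scaleR[OF convex_cone_convex_cone_hull]) (auto intro: hull_inc)
 qed
qed

text \<open>By \<open>uniq\<close> nonnegative combinations over index sets in \<open>I\<close>
  determine their coefficients; the face and intersection properties and strong convexity follow by
  comparing them.\<close>

lemma simplicial_fan:
 fixes rh :: "'l => 'v::real_vector"
 assumes N: "is_lattice N" and I: "finite I" "{}:I" "!!S. S:I ==> finite S" "!!S T. S:I ==> T <= S ==> T:I"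
  and rh: "!!S l. S:I ==> l:S ==> rh l:N"
  and uniq: "!!S T a b l. S:I ==> T:I ==> (!!l. l:S ==> 0 <= a l) ==> (!!l. l:T ==> 0 <= b l) ==>
   (\<Sum>l\<in>S. a l *R rh l) = (\<Sum>l\<in>T. b l *R rh l) ==> l:S ==> a l = (if l:T then b l else (0::real))"
 shows "rational_fan N ((%S. convex_cone hull (rh ` S)) ` I)"
proof (rule rational_fanI[OF N])
 let ?c = "%S. convex_cone hull (rh ` S)"
 note hull = convex_cone_hull_image[OF I(3), of _ rh]
 show "finite (?c ` I)" "?c ` I ~= {}" using I(1,2) by auto
 have sub: "cface (?c T) (?c S)" if S: "S:I" "T <= S" for S T
 proof (rule cfaceI)
  show "?c T <= ?c S" by (rule hull_mono) (use S in blast)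
  show "convex_cone (?c T)" by (rule convex_cone_convex_cone_hull)
  fix x y assume "x:?c S" "y:?c S" and xy: "x + y:?c T"
  then obtain a b where a: "x = (\<Sum>l\<in>S. a l *R rh l)" "ALL l:S. 0 <= a l" and b: "y = (\<Sum>l\<in>S. b l *R rh l)" "ALL l:S. 0 <= b l"
   unfolding hull[OF S(1)] by blast
  note T = I(4)[OF S]
  obtain c where c: "x + y = (\<Sum>l\<in>T. c l *R rh l)" "ALL l:T. 0 <= c l" using xy unfolding hull[OF T] by blast
  have "(\<Sum>l\<in>S. (a l + b l) *R rh l) = (\<Sum>l\<in>T. c l *R rh l)" using c(1) a(1) b(1) by (simp add: scaleR_left_distrib sum.distrib)
  hence e: "a l + b l = (if l:T then c l else 0)" if "l:S" for l using uniq[OF S(1) T, of "%l. a l + b l" c l] a b c that by simp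
  have "a l = 0" if "l:S - T" for l
  proof -
   have "a l + b l = 0" "0 <= a l" "0 <= b l" using e[of l] a(2) b(2) that by auto
   thus ?thesis by simp
  qed
  hence "x = (\<Sum>l\<in>T. a l *R rh l)" unfolding a(1) using S(2) I(3)[OF S(1)] by (intro sum.mono_neutral_right) auto
  thus "x:?c T" unfolding hull[OF T] using a(2) S(2) by blast
 qed
 fix C assume "C:?c ` I"
 then obtain S where C: "C = ?c S" and S: "S:I" by blast
 show "rational_cone N C" unfolding rational_cone_def C using I(3)[OF S] rh[OF S] by (intro exI[of _ "rh ` S"]) auto
 show "strongly_convex C"
  unfolding C
 proof (rule strongly_convexI[OF convex_cone_convex_cone_hull])
  fix x assume "x:?c S" "- x:?c S"
  then obtain a b where a: "x = (\<Sum>l\<in>S. a l *R rh l)" "ALL l:S. 0 <= a l" and b: "- x = (\<Sum>l\<in>S. b l *R rh l)" "ALL l:S. 0 <= b l"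
   unfolding hull[OF S] by blast
  have "(\<Sum>l\<in>S. (a l + b l) *R rh l) = x + - x" unfolding b(1) unfolding a(1) by (simp add: scaleR_left_distrib sum.distrib)
  \<comment> \<open>Written as the empty combination, 0 forces all the sums \<open>a l + b l\<close>
    to vanish.\<close>
  hence "(\<Sum>l\<in>S. (a l + b l) *R rh l) = (\<Sum>l\<in>{}. 0 *R rh l)" by simp
  hence e: "a l + b l = 0" if "l:S" for l using uniq[OF S I(2), of "%l. a l + b l" "%_. 0" l] a(2) b(2) that by simp
  have "a l = 0" if "l:S" for l
   using e[OF that] bspec[OF a(2) that] bspec[OF b(2) that] by linarith
  thus "x = 0" unfolding a(1) by simp
 qed
 show "G:?c ` I" if G: "cface G C" for G
 proof -
  have "G = convex_cone hull (rh ` S Int G)" using cface_hull[of "rh ` S" G] G C I(3)[OF S] by simp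
  also have "rh ` S Int G = rh ` {l:S. rh l:G}" by blast
  finally have "G = ?c {l:S. rh l:G}" .
  moreover have "{l:S. rh l:G}:I" by (rule I(4)[OF S]) blast
  ultimately show ?thesis by (rule image_eqI)
 qed
 fix C' assume "C':?c ` I"
 then obtain T where C': "C' = ?c T" and T: "T:I" by blast
 have "?c S Int ?c T = ?c (S Int T)"
 proof
  show "?c (S Int T) <= ?c S Int ?c T" using hull_mono[of "rh ` (S Int T)" "rh ` S"] hull_mono[of "rh ` (S Int T)" "rh ` T"] by blast
  show "?c S Int ?c T <= ?c (S Int T)"
  proof
   fix x assume x: "x:?c S Int ?c T"
   obtain a b where a: "x = (\<Sum>l\<in>S. a l *R rh l)" "ALL l:S. 0 <= a l" and b: "x = (\<Sum>l\<in>T. b l *R rh l)" "ALL l:T. 0 <= b l"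
    using x unfolding hull[OF S] hull[OF T] by blast
   have "a l = 0" if "l:S - T" for l using uniq[OF S T, of a b l] a b that by simp
   hence "x = (\<Sum>l\<in>S Int T. a l *R rh l)" unfolding a(1) using I(3)[OF S] by (intro sum.mono_neutral_right) auto
   thus "x:?c (S Int T)" unfolding hull[OF I(4)[OF S Int_lower1]] using a(2) by blast
  qed
 qed
 thus "cface (C Int C') C" unfolding C C' using sub[OF S, of "S Int T"] by simp
qed

section \<open>Chains of sets\<close>

text \<open>\<open>i\<close> avoids all members strictly inside \<open>F\<close>, and
  \<open>j\<close> lies in all members not contained in \<open>F\<close>; so a member containing
  \<open>i\<close> but not \<open>j\<close> can only be \<open>F\<close>.\<close>

lemma chain_separation:
 assumes T: "finite T" "!!F G. F:T ==> G:T ==> F <= G | G <= F" "!!G. G:T ==> G <= W"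
  and F: "F ~= {}" "F <= W" "F ~= W"
 obtains i j where "i:F" "j:W - F" "!!G. G:T ==> i:G ==> j~:G ==> G = F"
proof -
 define A where "A = {G:T. G \<subset> F}"
 \<comment> \<open>\<open>W\<close> keeps the family nonempty and is comparable with all
   members.\<close>
 define B where "B = insert W {G:T. ~ G <= F}"
 have "\<Union>A \<subset> F"
 proof (cases "A = {}")
  case False
  hence "\<Union>A \<in> A" using T unfolding A_def by (intro chain_Union_mem) auto
  thus ?thesis unfolding A_def by blast
 qed (use F in auto)
 then obtain i where i: "i:F" "i~:\<Union>A" by blast
 have "\<Inter>B \<in> B" using T unfolding B_def by (intro chain_Union_mem) auto
 hence "~ \<Inter>B <= F" "\<Inter>B <= W" using F unfolding B_def by auto
 then obtain j where j: "j:\<Inter>B" "j:W - F" by blast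
 show ?thesis
 proof (rule that[OF i(1) j(2)])
  fix G assume G: "G:T" "i:G" "j~:G"
  hence "G <= F" using j(1) unfolding B_def by blast
  thus "G = F" using G i(2) unfolding A_def by blast
 qed
qed

text \<open>For \<open>i\<close> and \<open>j\<close> from \<open>chain_separation\<close> the
  coordinate difference has only nonnegative terms on the left, one of them \<open>a F\<close>, and
  at most the term of \<open>F\<close> is positive on the right. Working with differences makes the
  result applicable modulo \<open>evec W\<close>.\<close>

lemma chain_coefficients_le:
 fixes a b :: "'a set => real"
 assumes S: "finite S" "!!F G. F:S ==> G:S ==> F <= G | G <= F" "!!G. G:S ==> 0 <= a G"
  and T: "finite T" "!!F G. F:T ==> G:T ==> F <= G | G <= F" "!!G. G:T ==> G <= W" "!!G. G:T ==> 0 <= b G"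
  and eq: "!!i j. i:W ==> j:W ==> (\<Sum>G\<in>S. a G * of_bool (i:G)) - (\<Sum>G\<in>S. a G * of_bool (j:G)) =
   (\<Sum>G\<in>T. b G * of_bool (i:G)) - (\<Sum>G\<in>T. b G * of_bool (j:G))"
  and F: "F:S" "F ~= {}" "F <= W" "F ~= W"
 shows "a F <= (if F:T then b F else 0)"
proof -
 obtain i j where ij: "i:F" "j:W - F" "!!G. G:T ==> i:G ==> j~:G ==> G = F"
  using chain_separation[OF T(1-3) F(2-4)] by metis
 have "a F * (of_bool (i:F) - of_bool (j:F)) <= (\<Sum>G\<in>S. a G * (of_bool (i:G) - of_bool (j:G)))"
 proof (rule member_le_sum[OF F(1) _ S(1)])
  fix G assume G: "G:S - {F}"
  hence "j:G ==> i:G" using S(2)[of F G] F(1) ij by blast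
  thus "0 <= a G * (of_bool (i:G) - of_bool (j:G))" using S(3) G by auto
 qed
 also have "... = (\<Sum>G\<in>T. b G * (of_bool (i:G) - of_bool (j:G)))"
 proof -
  have "i:W" "j:W" using ij F(3) by auto
  from eq[OF this] show ?thesis by (simp add: right_diff_distrib sum_subtractf)
 qed
 also have "... <= (\<Sum>G\<in>T. if G = F then b F else 0)"
 proof (rule sum_mono)
  fix G assume G: "G:T"
  show "b G * (of_bool (i:G) - of_bool (j:G)) <= (if G = F then b F else 0)"
   using ij(3)[OF G] T(4)[OF G] ij(1,2) by (cases "i:G"; cases "j:G") auto
 qed
 also have "... = (if F:T then b F else 0)" using T(1) by simp
 finally show ?thesis using ij by simp
qed

lemma chain_coefficients_unique:
 fixes a b :: "'a set => real"
 assumes S: "finite S" "!!F G. F:S ==> G:S ==> F <= G | G <= F" "!!G. G:S ==> 0 <= a G"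
   "!!G. G:S ==> G ~= {} & G <= W & G ~= W"
  and T: "finite T" "!!F G. F:T ==> G:T ==> F <= G | G <= F" "!!G. G:T ==> 0 <= b G"
   "!!G. G:T ==> G ~= {} & G <= W & G ~= W"
  and eq: "!!i j. i:W ==> j:W ==> (\<Sum>G\<in>S. a G * of_bool (i:G)) - (\<Sum>G\<in>S. a G * of_bool (j:G)) =
   (\<Sum>G\<in>T. b G * of_bool (i:G)) - (\<Sum>G\<in>T. b G * of_bool (j:G))"
  and F: "F:S"
 shows "a F = (if F:T then b F else 0)"
proof (rule antisym)
 show "a F <= (if F:T then b F else 0)"
  by (rule chain_coefficients_le[OF S(1-3) T(1,2) _ T(3) eq]) (use S(4) T(4) F in auto)
 show "(if F:T then b F else 0) <= a F"
 proof (cases "F:T")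
  case True
  have "b F <= (if F:S then a F else 0)"
   by (rule chain_coefficients_le[OF T(1-3) S(1,2) _ S(3) eq[symmetric]]) (use S(4) T(4) F True in auto)
  thus ?thesis using True F by simp
 qed (use S(3) F in simp)
qed

section \<open>Fans of matroidal support are quasilinear\<close>

lemma embedding_into_universe:
 fixes N :: "'v::real_vector set" assumes N: "is_lattice N"
 obtains f :: "'v => universe" where "linear f" "inj_on f (span N)"
proof -
 obtain B where B: "finite B" "independent B" "N = int_span B" using N unfolding is_lattice_iff by blast
 obtain d :: "'v => 'v => real" where d: "ALL b. linear (d b)" "ALL x:span B. (\<Sum>b\<in>B. d b x *R b) = x"
  using dual_coordinates[OF B(1,2)] by metis
 obtain h :: "'v => nat" where h: "inj_on h B" using finite_imp_inj_to_nat_seg[OF B(1)] by blast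
 define f where "f x = (\<Sum>b\<in>B. d b x *R (evec {h b} :: universe))" for x
 have f: "linear f"
  unfolding f_def using d(1) by (intro linearI) (simp_all add: linear_add linear_scale scaleR_left_distrib sum.distrib scaleR_sum_right)
 have lk: "lookup (f x) (h b) = d b x" if "b:B" for x b
 proof -
  have "lookup (f x) (h b) = (\<Sum>c\<in>B. if c = b then d b x else 0)"
   unfolding f_def lookup_sum_scaleR using inj_onD[OF h] that by (intro sum.cong refl) (auto simp: lookup_evec)
  thus ?thesis using B(1) that by simp
 qed
 have "inj_on f (span N)"
  unfolding B(3) span_int_span[OF B(1)]
 proof (rule inj_onI)
  fix x y assume xy: "x:span B" "y:span B" "f x = f y"
  have "x = (\<Sum>b\<in>B. d b x *R b)" using d(2) xy(1) by simp
  also have "... = (\<Sum>b\<in>B. d b y *R b)" using lk xy(3) by (intro sum.cong refl) metis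
  also have "... = y" using d(2) xy(2) by simp
  finally show "x = y" .
 qed
 thus ?thesis using that f by blast
qed

context matroidal_support
begin

lemma in_quasilinear_class:
 assumes f: "rational_fan N Si" "\<Union>Si = P" obtains Y where "Y:quasilinear_class" "trop_iso (unit_fan N Si) Y" "is_lattice (lat Y)"
proof -
 obtain ph :: "'v => universe" where ph: "linear ph" "inj_on ph (span N)" using embedding_into_universe[OF lattice_N] .
 have g: "rational_fan (ph ` N) ((`) ph ` Si)" by (rule fan_linear_image[OF f(1) ph])
 have u: "\<Union>((`) ph ` Si) = ph ` P" unfolding f(2)[symmetric] by blast
 have "unit_fan (ph ` N) ((`) ph ` Si):\<S>" if "T_stable \<S>" "contains_base \<S>" for \<S>
  using matroidal_in_class[OF that matroidal_linear_image[OF ph]] g u unfolding all_fans_in_def[OF that] by blast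
 hence "unit_fan (ph ` N) ((`) ph ` Si):quasilinear_class" unfolding quasilinear_class_def by blast
 thus ?thesis using that trop_iso_unit_fan[OF f(1) ph] fan_lattice[OF g] by simp
qed

lemma quasilinear_unit_fan: "rational_fan N Si ==> \<Union>Si = P ==> quasilinear (unit_fan N Si)"
 unfolding quasilinear_def in_class_def using tropical_unit_fan in_quasilinear_class by metis

text \<open>\<open>X\<close> is only known to agree with a unit fan inside the span of its support
  and on facets. Normal vectors and the weights of top-dimensional cones see no more than that, so
  balancing carries over; \<open>sp\<close> identifies the lattices.\<close>

lemma quasilinear_trop_iso:
 assumes f: "rational_fan N Si" "\<Union>Si = P" and sp: "N <= span P"
  and X: "rational_fan (lat X) (cones X)" "trop_iso (unit_fan N Si) X"
 shows "quasilinear X"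
proof -
 obtain Y where Y: "Y:quasilinear_class" "trop_iso (unit_fan N Si) Y" "is_lattice (lat Y)" using in_quasilinear_class[OF f] .
 have u: "rational_fan (lat (unit_fan N Si)) (cones (unit_fan N Si))" using f(1) by simp
 note lX = fan_lattice[OF X(1)]
 have "trop_iso X (unit_fan N Si)" by (rule trop_iso_sym[OF X(2) u lX])
 hence "trop_iso X Y" using trop_iso_trans[OF _ Y(2) X(1)] lattice_N by simp
 hence cl: "in_class X quasilinear_class" unfolding in_class_def using Y(1) by blast
 obtain ph g where ph: "linear ph" and g: "ALL x:span P. g (ph x) = x"
  and im: "ph ` (N Int span P) = lat X Int span (support X)" and cX: "cones X = (%si. ph ` si) ` Si"
  and oX: "ALL si:facets Si. orient X (ph ` si) = 1"
  by (rule trop_iso_inverse[OF X(2) u lX]) (simp add: f(2))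
 have spN: "span N <= span P" by (rule span_minimal[OF sp subspace_span])
 hence inj: "inj_on ph (span N)" using g by (metis inj_onI subsetD)
 define M where "M = ph ` N"
 have M: "M = lat X Int span (support X)" unfolding M_def im[symmetric] using sp by (simp add: Int_absorb2)
 interpret L: matroidal_support E r "ph o q" M "ph ` P" unfolding M_def by (rule matroidal_linear_image[OF ph inj])
 have F: "rational_fan M (cones X)" unfolding cX M_def by (rule fan_linear_image[OF f(1) ph inj])
 have UF: "\<Union>(cones X) = ph ` P" unfolding cX f(2)[symmetric] by blast
 have t: "tropical_fan (unit_fan M (cones X))" by (rule L.tropical_unit_fan[OF F UF])
 have fac: "facets (cones X) = (%si. ph ` si) ` facets Si"
  using facets_image[of X ph "unit_fan N Si" g] cX g f(2) by simp
 have o1: "orient X si = 1" if "si:cones X" "dim si = fan_dim (cones X)" for si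
  using L.facetI[OF F UF that(1)] that(2) L.fan_dim_support[OF F UF] oX unfolding fac by auto
 have cl': "cone_lattice (lat X) si = cone_lattice M si" if "si:cones X" for si
 proof -
  have "span si <= span (support X)" using that by (intro span_mono) (auto simp: support_def)
  thus ?thesis unfolding cone_lattice_def M by blast
 qed
 have nv: "normal_vector (lat X) si ta = normal_vector M si ta" if "si:cones X" "ta:cones X" for si ta
  unfolding normal_vector_def cl'[OF that(1)] cl'[OF that(2)] ..
 have "minkowski_weight (lat X) (cones X) (fan_dim (cones X)) (orient X)"
  unfolding minkowski_weight_def
 proof (intro ballI impI)
  fix ta assume ta: "ta:cones X" "dim ta + 1 = fan_dim (cones X)"
  have "(\<Sum>si\<in>{si:cones_of_dim (cones X) (fan_dim (cones X)). ta <= si}.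
    of_int (orient X si) *R quot_map (span ta) (normal_vector (lat X) si ta)) =
   (\<Sum>si\<in>{si:cones_of_dim (cones X) (fan_dim (cones X)). ta <= si}.
    of_int 1 *R quot_map (span ta) (normal_vector M si ta))"
   using ta(1) by (intro sum.cong) (auto simp: cones_of_dim_def o1 nv)
  also have "... = 0" using t ta unfolding tropical_fan_def minkowski_weight_def by auto
  finally show "(\<Sum>si\<in>{si:cones_of_dim (cones X) (fan_dim (cones X)). ta <= si}.
    of_int (orient X si) *R quot_map (span ta) (normal_vector (lat X) si ta)) = 0" .
 qed
 hence "tropical_fan X" using X(1) t o1 unfolding tropical_fan_def by (auto simp: cones_of_dim_def)
 thus ?thesis unfolding quasilinear_def using cl by blast
qed

end

section \<open>Bergman fans\<close>

lemma lattice_int_lattice: assumes "finite E" shows "is_lattice (int_lattice E)"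
 using assms
proof (induction E rule: finite_induct)
 case empty
 have "int_lattice {} = ({0} :: 'a fvec set)" unfolding int_lattice_def by auto
 thus ?case using fan_lattice[OF zero_fan] by simp
next
 case (insert i E)
 have "evec {i}~:span (int_lattice E)" unfolding span_int_lattice[OF insert.hyps(1)] coords_iff using insert.hyps(2) by (auto simp: lookup_evec)
 hence "is_lattice {of_int k *R evec {i} + y | k y. y:int_lattice E}" by (rule is_lattice_insert[OF insert.IH])
 moreover have "{of_int k *R evec {i} + y | k y. y:int_lattice E} = int_lattice (insert i E)"
 proof (intro equalityI subsetI)
  fix x :: "'a fvec" assume "x:{of_int k *R evec {i} + y | k y. y:int_lattice E}"
  thus "x:int_lattice (insert i E)" by (auto simp: int_lattice_iff coords_iff lookup_add lookup_evec)
 next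
  fix x :: "'a fvec" assume x: "x:int_lattice (insert i E)"
  then obtain k where k: "lookup x i = of_int k" by (auto simp: int_lattice_iff elim: Ints_cases)
  have "x - of_int k *R evec {i}:int_lattice E"
   using x k by (auto simp: int_lattice_iff coords_iff lookup_minus lookup_evec)
  moreover have "x = of_int k *R evec {i} + (x - of_int k *R evec {i})" by simp
  ultimately show "x:{of_int k *R evec {i} + y | k y. y:int_lattice E}" by blast
 qed
 ultimately show ?case by simp
qed

context loopless_rank_function
begin

definition proper :: "'a set set" where
 "proper = {F. rflat F & F ~= E}"

definition flag :: "'a set set => bool" where
 "flag \<F> <-> \<F> <= proper & (ALL F:\<F>. ALL G:\<F>. F <= G | G <= F)"

lemma flagD: "flag \<F> ==> F:\<F> ==> rflat F & F <= E & F ~= E" "flag \<F> ==> F:\<F> ==> G:\<F> ==> F <= G | G <= F"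
 unfolding flag_def proper_def using rflat_subset by auto

lemma flag_mono: assumes "flag S" "T <= S" shows "flag T"
 unfolding flag_def
proof (intro conjI ballI)
 show "T <= proper" using assms unfolding flag_def by (meson subset_trans)
 show "F <= G | G <= F" if "F:T" "G:T" for F G using flagD(2)[OF assms(1)] assms(2) that by blast
qed

lemma flag_finite: "flag \<F> ==> finite \<F>" "finite {\<F>. flag \<F>}"
proof -
 have "proper <= Pow E" unfolding proper_def using rflat_subset by blast
 hence p: "finite proper" using fin finite_subset by blast
 thus "flag \<F> ==> finite \<F>" unfolding flag_def using finite_subset by blast
 show "finite {\<F>. flag \<F>}" by (rule finite_subset[of _ "Pow proper"]) (use p in \<open>auto simp: flag_def\<close>)
qed

definition qm :: "'a fvec => 'a fvec" where
 "qm = quot_map (span {evec E})"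

lemma qm: "linear qm" "qm x = 0 <-> (EX c. x = c *R evec E)"
 unfolding qm_def quot_map_zero_iff[OF subspace_span] by (rule quot_map(1)[OF subspace_span]) (auto simp: span_singleton)

lemma bergman_matroidal: "matroidal_support E r qm (bergman_lattice E) (qm ` trop_space)"
proof (rule matroidal_support.intro[OF loopless_rank_function_axioms], rule matroidal_support_axioms.intro[OF qm(1)])
 show "qm ` int_lattice E = bergman_lattice E" unfolding bergman_lattice_def qm_def ..
 hence b: "bergman_lattice E = qm ` int_lattice E" ..
 have e: "evec E:int_lattice E" by (rule evec_int_lattice[OF fin order_refl])
 show "is_lattice (bergman_lattice E)"
  unfolding b
 proof (rule quotient_lattice[OF lattice_int_lattice[OF fin] qm(1)])
  show "{evec E} <= int_lattice E" using e by blast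
  show "{x:span (int_lattice E). qm x = 0} = span {evec E}"
   unfolding qm(2) using span_scale[OF span_base[OF e]] by (auto simp: span_singleton)
 qed
 fix x z assume "x:trop_space" "z:coords E" "qm z = 0"
 thus "x + z:trop_space" using qm(2) evec_E_lineality unfolding lineality_def by auto
qed simp

text \<open>Equality modulo \<open>evec E\<close> is equality of all coordinate differences, and
  these determine the coefficients of a chain.\<close>

lemma bergman_uniq:
 assumes S: "flag S" "{}~:S" "!!F. F:S ==> 0 <= a F" and T: "flag T" "{}~:T" "!!F. F:T ==> 0 <= b F"
  and eq: "(\<Sum>F\<in>S. a F *R qm (evec F)) = (\<Sum>F\<in>T. b F *R qm (evec F))" and F: "F:S"
 shows "a F = (if F:T then b F else 0)"
proof -
 have "qm ((\<Sum>F\<in>S. a F *R evec F) - (\<Sum>F\<in>T. b F *R evec F)) = 0"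
  using eq by (simp add: linear_diff[OF qm(1)] linear_sum[OF qm(1)] linear_scale[OF qm(1)])
 then obtain c where "(\<Sum>F\<in>S. a F *R evec F) - (\<Sum>F\<in>T. b F *R evec F) = c *R evec E" unfolding qm(2) by blast
 hence "lookup ((\<Sum>F\<in>S. a F *R evec F) - (\<Sum>F\<in>T. b F *R evec F)) i = lookup (c *R evec E) i" for i by simp
 hence l: "(\<Sum>G\<in>S. a G * of_bool (i:G)) - (\<Sum>G\<in>T. b G * of_bool (i:G)) = (if i:E then c else 0)" for i
  using flagD(1)[OF S(1)] flagD(1)[OF T(1)] by (simp add: lookup_minus chain_sum_lookup lookup_evec fin)
 show ?thesis
 proof (rule chain_coefficients_unique[OF flag_finite(1)[OF S(1)] flagD(2)[OF S(1)] S(3) _ flag_finite(1)[OF T(1)] flagD(2)[OF T(1)] T(3) _ _ F])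
  show "F ~= {} & F <= E & F ~= E" if "F:S" for F using flagD(1)[OF S(1) that] S(2) that by blast
  show "F ~= {} & F <= E & F ~= E" if "F:T" for F using flagD(1)[OF T(1) that] T(2) that by blast
  show "(\<Sum>G\<in>S. a G * of_bool (i:G)) - (\<Sum>G\<in>S. a G * of_bool (j:G)) =
   (\<Sum>G\<in>T. b G * of_bool (i:G)) - (\<Sum>G\<in>T. b G * of_bool (j:G))" if "i:E" "j:E" for i j
   using l[of i] l[of j] that by simp
 qed
qed

definition bergman_cones :: "'a fvec set set" where
 "bergman_cones = (%\<F>. convex_cone hull ((%F. qm (evec F)) ` \<F>)) ` {\<F>. flag \<F> & {}~:\<F>}"

lemma bergman_rational_fan: "rational_fan (bergman_lattice E) bergman_cones"
 unfolding bergman_cones_def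
proof (rule simplicial_fan)
 interpret M: matroidal_support E r qm "bergman_lattice E" "qm ` trop_space" by (rule bergman_matroidal)
 show "is_lattice (bergman_lattice E)" by (rule M.lattice_N)
 show "finite {\<F>. flag \<F> & {}~:\<F>}" using flag_finite(2) by (rule finite_subset[rotated]) blast
 show "{}:{\<F>. flag \<F> & {}~:\<F>}" by (simp add: flag_def)
 show "S:{\<F>. flag \<F> & {}~:\<F>} ==> finite S" for S using flag_finite(1) by blast
 show "S:{\<F>. flag \<F> & {}~:\<F>} ==> T <= S ==> T:{\<F>. flag \<F> & {}~:\<F>}" for S T
  using flag_mono[of S T] by auto
 show "qm (evec F):bergman_lattice E" if "S:{\<F>. flag \<F> & {}~:\<F>}" "F:S" for S F
 proof -
  have "flag S" using that(1) by blast
  from flagD(1)[OF this that(2)] have "F <= E" by blast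
  hence "evec F:int_lattice E" using evec_int_lattice finite_subset_E by blast
  thus ?thesis unfolding M.lattice_image[symmetric] by (rule imageI)
 qed
 fix S T a b F
 assume "S:{\<F>. flag \<F> & {}~:\<F>}" "T:{\<F>. flag \<F> & {}~:\<F>}" "!!F. F:S ==> 0 <= a F" "!!F. F:T ==> 0 <= b F"
  "(\<Sum>F\<in>S. a F *R qm (evec F)) = (\<Sum>F\<in>T. b F *R qm (evec F))" "F:S"
 thus "a F = (if F:T then b F else 0)" by (intro bergman_uniq[of S a T b]) auto
qed

lemma bergman_support: assumes E: "E ~= {}" shows "\<Union>bergman_cones = qm ` trop_space"
proof
 show "\<Union>bergman_cones <= qm ` trop_space"
 proof
  fix x assume "x:\<Union>bergman_cones"
  then obtain \<F> a where F: "flag \<F>" "x = (\<Sum>F\<in>\<F>. a F *R qm (evec F))" "ALL F:\<F>. 0 <= a F"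
   unfolding bergman_cones_def by (auto simp: convex_cone_hull_image flag_finite)
  have "(\<Sum>F\<in>\<F>. a F *R evec F):trop_space"
   using F(3) flagD[OF F(1)] by (intro chain_sum_trop_space[OF loopless flag_finite(1)[OF F(1)]]) auto
  moreover have "x = qm (\<Sum>F\<in>\<F>. a F *R evec F)" using F(2) by (simp add: linear_sum[OF qm(1)] linear_scale[OF qm(1)])
  ultimately show "x:qm ` trop_space" by blast
 qed
 show "qm ` trop_space <= \<Union>bergman_cones"
 proof clarify
  fix x assume x: "x:trop_space"
  obtain S a c where S: "finite S" "ALL F:S. F ~= {} & F ~= E & (EX t. F = {i:E. t < lookup x i})"
   "ALL F:S. 0 <= a F" "x = (\<Sum>F\<in>S. a F *R evec F) + c *R evec E"
   by (rule level_decomposition[OF trop_space_coords[OF x] E])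
  have "flag S"
   unfolding flag_def proper_def
  proof (intro conjI ballI subsetI CollectI)
   show "rflat F" "F ~= E" if "F:S" for F using bspec[OF S(2) that] rflat_strict_superlevel[OF x] by auto
   show "F <= G | G <= F" if FG: "F:S" "G:S" for F G
   proof -
    obtain s t where "F = {i:E. s < lookup x i}" "G = {i:E. t < lookup x i}" using bspec[OF S(2) FG(1)] bspec[OF S(2) FG(2)] by blast
    thus ?thesis by (cases "s <= t") auto
   qed
  qed
  moreover have "{}~:S" using S(2) by blast
  moreover have "qm (c *R evec E) = 0" unfolding qm(2) by blast
  hence "qm x = (\<Sum>F\<in>S. a F *R qm (evec F))"
   by (subst S(4)) (simp add: linear_add[OF qm(1)] linear_sum[OF qm(1)] linear_scale[OF qm(1)])
  hence "qm x:convex_cone hull ((%F. qm (evec F)) ` S)" unfolding convex_cone_hull_image[OF S(1)] using S(3) by blast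
  ultimately show "qm x:\<Union>bergman_cones" unfolding bergman_cones_def by blast
 qed
qed

text \<open>Singletons are flats, so the vectors \<open>evec {i}\<close>, which generate, belong to
  the tropical space.\<close>

lemma bergman_lattice_span:
 assumes "!!i. i:E ==> rflat {i}" shows "bergman_lattice E <= span (qm ` trop_space)"
proof
 fix v assume "v:bergman_lattice E"
 then obtain x where x: "x:coords E" "v = qm x" by (auto simp: bergman_lattice_def qm_def int_lattice_iff)
 have "qm x = qm (\<Sum>i\<in>E. lookup x i *R evec {i})" by (subst coords_expand[OF fin x(1)]) simp
 also have "... = (\<Sum>i\<in>E. lookup x i *R qm (evec {i}))"
  by (simp add: linear_sum[OF qm(1)] linear_scale[OF qm(1)])
 also have "...:span (qm ` trop_space)"
  using evec_trop_space[OF loopless] assms by (intro span_sum span_scale span_base) auto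
 finally show "v:span (qm ` trop_space)" using x(2) by simp
qed

end

section \<open>Augmented Bergman fans\<close>

context loopless_rank_function
begin

lemma rank_add_card: "finite C ==> C <= E ==> A <= E ==> r (A Un C) <= r A + int (card C)"
proof (induction C rule: finite_induct)
 case (insert k C)
 have "r (insert k (A Un C)) <= r (A Un C) + 1" using insert.prems by (intro rank_insert_le) auto
 thus ?case using insert by simp
qed simp

lemma rank_le_card: "A <= E ==> r A <= int (card A)"
 using rank_add_card[of A "{}"] finite_subset_E rank_empty by simp

text \<open>The case of submodularity of \<open>aug_rank\<close> in which one set is measured by its
  size and the other by its rank.\<close>

lemma rank_Un_card:
 assumes A: "A <= E" and B: "B <= E" shows "r (A Un B) + int (card (A Int B)) <= int (card A) + r B"
proof -
 have "r ((A Int B) Un (A - B)) <= r (A Int B) + int (card (A - B))" using A finite_subset_E by (intro rank_add_card) auto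
 moreover have "(A Int B) Un (A - B) = A" by blast
 moreover have "card A = card (A Int B) + card (A - B)" using card_Int_Diff finite_subset_E[OF A] by blast
 ultimately show ?thesis using rank_submodular[OF A B] by simp
qed

definition indep :: "'a set => bool" where
 "indep A <-> A <= E & r A = int (card A)"

lemma indep_subset: assumes B: "indep B" and A: "A <= B" shows "indep A"
proof -
 have BE: "B <= E" "finite B" using B finite_subset_E unfolding indep_def by auto
 have "r (A Un (B - A)) <= r A + int (card (B - A))" using BE A by (intro rank_add_card) auto
 moreover have "A Un (B - A) = B" using A by blast
 moreover have "card B = card A + card (B - A)" using card_Int_Diff[OF BE(2), of A] A by (simp add: Int_absorb1)
 moreover have "r A <= int (card A)" using A BE by (intro rank_le_card) auto
 ultimately show ?thesis using B A BE(1) unfolding indep_def by auto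
qed

text \<open>The free coextension by \<open>None\<close>: its flats are the independent sets and the flats with \<open>None\<close> added, so
 that its Bergman fan, normalised to vanish at \<open>None\<close>, has the support of the augmented Bergman fan.\<close>

definition aug_rank :: "'a option set => int" where
 "aug_rank A = (if None:A then r (Some -` A) + 1 else min (int (card (Some -` A))) (r (Some -` A) + 1))"

abbreviation aug_ground :: "'a option set" where
 "aug_ground == insert None (Some ` E)"

lemma vimage_Some_insert: "Some -` insert None A = Some -` A" "Some -` insert (Some k) A = insert k (Some -` A)"
 by auto

sublocale Aug: rank_function aug_ground aug_rank
proof
 have v: "Some -` A <= E" if "A <= aug_ground" for A using that by auto
 have fv: "finite (Some -` A)" if "A <= aug_ground" for A using v[OF that] finite_subset_E by blast
 show "finite aug_ground" using fin by simp
 show "aug_rank {} = 0" unfolding aug_rank_def using rank_empty by simp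
 fix A assume A: "A <= aug_ground"
 note lc = rank_le_card[OF v[OF A]]
 {
  fix k assume k: "k:aug_ground"
  show "aug_rank A <= aug_rank (insert k A)" "aug_rank (insert k A) <= aug_rank A + 1"
  proof (atomize (full), cases k)
   case None
   thus "aug_rank A <= aug_rank (insert k A) & aug_rank (insert k A) <= aug_rank A + 1"
    unfolding aug_rank_def using lc by (auto simp: vimage_Some_insert)
  next
   case (Some j)
   hence j: "j:E" using k by auto
   have "r (Some -` A) <= r (insert j (Some -` A))" "r (insert j (Some -` A)) <= r (Some -` A) + 1"
    using rank_insert_mono[OF v[OF A] j] rank_insert_le[OF v[OF A] j] .
   moreover have "card (Some -` A) <= card (insert j (Some -` A))" "card (insert j (Some -` A)) <= card (Some -` A) + 1"
    using fv[OF A] by (auto simp: card_insert_if)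
   ultimately show "aug_rank A <= aug_rank (insert k A) & aug_rank (insert k A) <= aug_rank A + 1"
    unfolding aug_rank_def Some vimage_Some_insert by auto
  qed
 }
 fix B assume B: "B <= aug_ground"
 have "card (Some -` A Un Some -` B) + card (Some -` A Int Some -` B) = card (Some -` A) + card (Some -` B)"
  using card_Un_Int fv A B by metis
 moreover note rank_submodular[OF v[OF A] v[OF B]] rank_Un_card[OF v[OF A] v[OF B]] rank_Un_card[OF v[OF B] v[OF A]]
 ultimately show "aug_rank (A Un B) + aug_rank (A Int B) <= aug_rank A + aug_rank B"
  unfolding aug_rank_def vimage_Un vimage_Int by (auto simp: Un_commute Int_commute min_def)
qed

lemma aug_rflat_None: assumes "None:F" shows "Aug.rflat F <-> F <= aug_ground & rflat (Some -` F)"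
proof -
 have "aug_ground - F = Some ` (E - Some -` F)" using assms by auto
 moreover have "aug_rank F < aug_rank (insert (Some i) F) <-> r (Some -` F) < r (insert i (Some -` F))" for i
  unfolding aug_rank_def using assms by (simp add: vimage_Some_insert) linarith
 ultimately show ?thesis unfolding Aug.rflat_def rflat_def by auto
qed

text \<open>For dependent \<open>A\<close> the augmented rank is already \<open>r A + 1\<close>, so
  adding \<open>None\<close> does not raise it; for independent \<open>A\<close> every new element
  does.\<close>

lemma aug_rflat_Some: "Aug.rflat (Some ` A) <-> indep A"
proof
 have vS: "Some -` Some ` A = A" by auto
 {
  assume f: "Aug.rflat (Some ` A)"
  hence A: "A <= E" unfolding Aug.rflat_def by auto
  have "None:aug_ground - Some ` A" by auto
  hence "aug_rank (Some ` A) < aug_rank (insert None (Some ` A))" using f unfolding Aug.rflat_def by blast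
  moreover have "aug_rank (Some ` A) = min (int (card A)) (r A + 1)" "aug_rank (insert None (Some ` A)) = r A + 1"
   unfolding aug_rank_def vimage_Some_insert vS by auto
  ultimately show "indep A" unfolding indep_def using A rank_le_card[OF A] by simp
 }
 {
  assume i: "indep A"
  hence A: "A <= E" "r A = int (card A)" unfolding indep_def by auto
  have "aug_rank (Some ` A) < aug_rank (insert k (Some ` A))" if k: "k:aug_ground - Some ` A" for k
  proof (cases k)
   case None
   show ?thesis unfolding aug_rank_def None vimage_Some_insert vS using A by auto
  next
   case (Some j)
   hence "j:E" "j~:A" using k by auto
   thus ?thesis
    unfolding aug_rank_def Some vimage_Some_insert vS using A rank_insert_mono[of A j] finite_subset_E[of A] by auto
  qed
  thus "Aug.rflat (Some ` A)" unfolding Aug.rflat_def using A by auto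
 }
qed

definition aug_map :: "('a option \<Rightarrow>\<^sub>0 real) => 'a fvec" where
 "aug_map x = (\<Sum>k\<in>E. (lookup x (Some k) - lookup x None) *R evec {k})"

lemma lookup_combination:
 "finite A ==> lookup (\<Sum>k\<in>A. c k *R evec {h k}) j = (\<Sum>k\<in>A. if j = h k then c k else 0)"
 by (simp add: lookup_sum_scaleR lookup_evec if_distrib[of "%r. _ * r"] cong: if_cong)

lemma lookup_aug_map:
 "lookup (aug_map x) k = (if k:E then lookup x (Some k) - lookup x None else 0)"
 unfolding aug_map_def lookup_combination[OF fin] using fin by simp

definition aug_lift :: "'a fvec => 'a option \<Rightarrow>\<^sub>0 real" where
 "aug_lift y = (\<Sum>k\<in>E. lookup y k *R evec {Some k})"

lemma lookup_aug_lift: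
 "lookup (aug_lift y) (Some k) = (if k:E then lookup y k else 0)"
 "lookup (aug_lift y) None = 0"
 unfolding aug_lift_def lookup_combination[OF fin] using fin by auto

lemma aug_lift: assumes "y:coords E" shows "aug_map (aug_lift y) = y" "aug_lift y:coords aug_ground"
proof -
 show "aug_map (aug_lift y) = y"
  by (rule poly_mapping_eqI) (use assms in \<open>auto simp: lookup_aug_map lookup_aug_lift coords_iff\<close>)
 have "lookup (aug_lift y) w = 0" if "w~:aug_ground" for w
  using that by (cases w) (auto simp: lookup_aug_lift)
 thus "aug_lift y:coords aug_ground" unfolding coords_iff by blast
qed

text \<open>With the coordinate of \<open>None\<close> equal to 0, superlevel sets at positive
  heights lack \<open>None\<close> and must be independent, for which the largest suffices; those at
  heights \<open>t <= 0\<close> contain \<open>None\<close> and must be flats.\<close>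

definition aug_support :: "'a fvec set" where
 "aug_support = {y:coords E. indep {k:E. 0 < lookup y k} & (ALL t<=0. rflat {k:E. t <= lookup y k})}"

lemma aug_matroidal: "matroidal_support aug_ground aug_rank aug_map (int_lattice E) aug_support"
proof (rule matroidal_support.intro)
 have "indep {}" unfolding indep_def using rank_empty by simp
 hence "Aug.rflat {}" using aug_rflat_Some[of "{}"] by simp
 thus "loopless_rank_function aug_ground aug_rank"
  by (intro loopless_rank_function.intro[OF Aug.rank_function_axioms] loopless_rank_function_axioms.intro)
 then interpret A: loopless_rank_function aug_ground aug_rank .
 show "matroidal_support_axioms aug_ground aug_rank aug_map (int_lattice E) aug_support"
 proof (rule matroidal_support_axioms.intro)
  show "linear aug_map"
   unfolding aug_map_def by (rule linearI) (auto simp: lookup_add scaleR_sum_right sum.distrib[symmetric] algebra_simps)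
  show "aug_map ` int_lattice aug_ground = int_lattice E"
  proof
   show "aug_map ` int_lattice aug_ground <= int_lattice E" by (auto simp: int_lattice_iff lookup_aug_map coords_iff)
   show "int_lattice E <= aug_map ` int_lattice aug_ground"
   proof
    fix y assume y: "y:int_lattice E"
    hence yc: "y:coords E" by (simp add: int_lattice_iff)
    have "lookup (aug_lift y) w:\<int>" for w
     using y by (cases w) (auto simp: lookup_aug_lift int_lattice_iff)
    hence "aug_lift y:int_lattice aug_ground" using aug_lift(2)[OF yc] by (simp add: int_lattice_iff)
    thus "y:aug_map ` int_lattice aug_ground" using aug_lift(1)[OF yc] by (metis image_eqI)
   qed
  qed
  show "is_lattice (int_lattice E)" by (rule lattice_int_lattice[OF fin])
  show "aug_support = aug_map ` Aug.trop_space"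
  proof (intro equalityI subsetI)
   fix y assume y: "y:aug_support"
   hence yc: "y:coords E" unfolding aug_support_def by blast
   have "Aug.rflat {w:aug_ground. s <= lookup (aug_lift y) w}" for s
   proof (cases "s <= 0")
    case True
    have "Some -` {w:aug_ground. s <= lookup (aug_lift y) w} = {k:E. s <= lookup y k}"
     by (auto simp: lookup_aug_lift)
    thus ?thesis using y True by (subst aug_rflat_None) (auto simp: lookup_aug_lift aug_support_def)
   next
    case False
    have "{w:aug_ground. s <= lookup (aug_lift y) w} = Some ` {k:E. s <= lookup y k}"
     using False by (auto simp: lookup_aug_lift)
    moreover have "indep {k:E. s <= lookup y k}"
    proof (rule indep_subset)
     show "indep {k:E. 0 < lookup y k}" using y unfolding aug_support_def by blast
    qed (use False in auto)
    ultimately show ?thesis using aug_rflat_Some by simp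
   qed
   hence "aug_lift y:Aug.trop_space" unfolding Aug.trop_space_def using aug_lift(2)[OF yc] by blast
   thus "y:aug_map ` Aug.trop_space" using aug_lift(1)[OF yc] by (metis image_eqI)
  next
   fix y assume "y:aug_map ` Aug.trop_space"
   then obtain x where x: "x:Aug.trop_space" "y = aug_map x" by blast
   let ?m = "lookup x None"
   have "y:coords E" unfolding x(2) coords_iff lookup_aug_map by simp
   moreover have "Aug.rflat {w:aug_ground. ?m < lookup x w}" by (rule Aug.rflat_strict_superlevel[OF x(1)])
   moreover have "{w:aug_ground. ?m < lookup x w} = Some ` {k:E. 0 < lookup y k}"
    unfolding x(2) by (auto simp: lookup_aug_map)
   moreover have "rflat {k:E. t <= lookup y k}" if t: "t <= 0" for t
   proof -
    have "Aug.rflat {w:aug_ground. ?m + t <= lookup x w}" using x(1) unfolding Aug.trop_space_def by blast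
    moreover have "None:{w:aug_ground. ?m + t <= lookup x w}" using t by simp
    ultimately have "rflat (Some -` {w:aug_ground. ?m + t <= lookup x w})" by (simp only: aug_rflat_None)
    moreover have "Some -` {w:aug_ground. ?m + t <= lookup x w} = {k:E. t <= lookup y k}"
     unfolding x(2) by (auto simp: lookup_aug_map)
    ultimately show ?thesis by simp
   qed
   ultimately show "y:aug_support" unfolding aug_support_def using aug_rflat_Some by simp
  qed
  fix x z assume x: "x:Aug.trop_space" and z: "z:coords aug_ground" "aug_map z = 0"
  have "lookup z (Some k) = lookup z None" if "k:E" for k
   using arg_cong[OF z(2), of "%y. lookup y k"] that by (simp add: lookup_aug_map)
  moreover have "lookup z None *R evec aug_ground:coords aug_ground"
   by (rule subspace_scale[OF coords_subspace evec_coords[OF Aug.fin order_refl]])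
  ultimately have "z = lookup z None *R evec aug_ground"
   by (intro coords_eqI[OF z(1)]) (auto simp: lookup_evec fin)
  thus "x + z:Aug.trop_space" using A.evec_E_lineality x unfolding A.lineality_def by (metis (mono_tags, lifting) mem_Collect_eq)
 qed
qed

fun aug_ray :: "'a + 'a set => 'a fvec" where
 "aug_ray (Inl i) = evec {i}"
| "aug_ray (Inr F) = - evec (E - F)"

definition aug_flags :: "('a + 'a set) set set" where
 "aug_flags = {Inl ` I Un Inr ` \<F> | I \<F>. indep I & flag \<F> & (ALL F:\<F>. I <= F)}"

lemma aug_flags_iff: "L:aug_flags <-> indep (Inl -` L) & flag (Inr -` L) & (ALL F:Inr -` L. Inl -` L <= F)"
proof
 assume "L:aug_flags"
 then obtain I \<F> where L: "L = Inl ` I Un Inr ` \<F>" "indep I" "flag \<F>" "ALL F:\<F>. I <= F" unfolding aug_flags_def by blast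
 have "Inl -` L = I" "Inr -` L = \<F>" unfolding L(1) by auto
 thus "indep (Inl -` L) & flag (Inr -` L) & (ALL F:Inr -` L. Inl -` L <= F)" using L by simp
next
 assume h: "indep (Inl -` L) & flag (Inr -` L) & (ALL F:Inr -` L. Inl -` L <= F)"
 have "l:Inl ` (Inl -` L) Un Inr ` (Inr -` L)" if "l:L" for l using that by (cases l) auto
 hence "L = Inl ` (Inl -` L) Un Inr ` (Inr -` L)" by blast
 thus "L:aug_flags" unfolding aug_flags_def using h by blast
qed

lemma aug_flags_finite: assumes "L:aug_flags" shows "finite (Inl -` L)" "finite (Inr -` L)" "finite L"
proof -
 note L = assms[unfolded aug_flags_iff]
 show f: "finite (Inl -` L)" "finite (Inr -` L)" using L finite_subset_E flag_finite unfolding indep_def by auto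
 have "l:Inl ` (Inl -` L) Un Inr ` (Inr -` L)" if "l:L" for l using that by (cases l) auto
 hence "L <= Inl ` (Inl -` L) Un Inr ` (Inr -` L)" by blast
 thus "finite L" using f finite_subset by blast
qed

lemma lookup_aug_sum:
 assumes L: "L:aug_flags" and k: "k:E"
 shows "lookup (\<Sum>l\<in>L. a l *R aug_ray l) k =
  (if Inl k:L then a (Inl k) else 0) - (\<Sum>F\<in>Inr -` L. a (Inr F) * of_bool (k~:F))"
proof -
 note f = aug_flags_finite[OF L]
 have "l:Inl ` (Inl -` L) Un Inr ` (Inr -` L)" if "l:L" for l using that by (cases l) auto
 hence e: "L = Inl ` (Inl -` L) Un Inr ` (Inr -` L)" by blast
 have "(\<Sum>l\<in>L. a l *R aug_ray l) = (\<Sum>l\<in>Inl ` (Inl -` L). a l *R aug_ray l) + (\<Sum>l\<in>Inr ` (Inr -` L). a l *R aug_ray l)"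
  by (subst e, rule sum.union_disjoint) (use f in auto)
 also have "... = (\<Sum>i\<in>Inl -` L. a (Inl i) *R evec {i}) + (\<Sum>F\<in>Inr -` L. - a (Inr F) *R evec (E - F))"
 proof -
  have i: "inj_on Inl A" "inj_on Inr B" for A :: "'a set" and B :: "'a set set" by auto
  show ?thesis by (simp only: sum.reindex[OF i(1)] sum.reindex[OF i(2)] comp_def aug_ray.simps scaleR_minus_left scaleR_minus_right)
 qed
 finally have "lookup (\<Sum>l\<in>L. a l *R aug_ray l) k =
   (\<Sum>i\<in>Inl -` L. if k = i then a (Inl i) else 0) + (\<Sum>F\<in>Inr -` L. - a (Inr F) * lookup (evec (E - F)) k)"
  using lookup_combination[OF f(1), of "%i. a (Inl i)" "%i. i" k] by (simp only: lookup_add lookup_sum_scaleR)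
 also have "... = (if Inl k:L then a (Inl k) else 0) - (\<Sum>F\<in>Inr -` L. a (Inr F) * of_bool (k~:F))"
 proof -
  have "(\<Sum>F\<in>Inr -` L. - a (Inr F) * lookup (evec (E - F)) k) = (\<Sum>F\<in>Inr -` L. - (a (Inr F) * of_bool (k~:F)))"
   using k fin by (intro sum.cong) (auto simp: lookup_evec)
  thus ?thesis using f(1) by (simp add: sum_negf)
 qed
 finally show ?thesis .
qed

text \<open>A member of the independent set lies in all flats of the flag, so the negative rays
  leave its coordinate alone.\<close>

lemma aug_value:
 assumes L: "L:aug_flags" and k: "k:E" and a: "ALL l:L. 0 <= a l"
 shows "Inl k:L ==> lookup (\<Sum>l\<in>L. a l *R aug_ray l) k = a (Inl k)"
  and "Inl k~:L ==> lookup (\<Sum>l\<in>L. a l *R aug_ray l) k <= 0"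
proof -
 assume kL: "Inl k:L"
 have "(\<Sum>F\<in>Inr -` L. a (Inr F) * of_bool (k~:F)) = 0"
  using L kL unfolding aug_flags_iff by (intro sum.neutral) auto
 thus "lookup (\<Sum>l\<in>L. a l *R aug_ray l) k = a (Inl k)" unfolding lookup_aug_sum[OF L k] using kL by simp
next
 assume "Inl k~:L"
 moreover have "0 <= (\<Sum>F\<in>Inr -` L. a (Inr F) * of_bool (k~:F))" using a by (intro sum_nonneg) auto
 ultimately show "lookup (\<Sum>l\<in>L. a l *R aug_ray l) k <= 0" unfolding lookup_aug_sum[OF L k] by simp
qed

text \<open>Positive coordinates give the coefficients of the independent part, by
  \<open>aug_value\<close>. What remains is a combination of the negative rays, treated as a chain
  on the augmented ground set.\<close>

lemma aug_uniq:
 assumes S: "S:aug_flags" "!!l. l:S ==> 0 <= a l" and T: "T:aug_flags" "!!l. l:T ==> 0 <= b l"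
  and eq: "(\<Sum>l\<in>S. a l *R aug_ray l) = (\<Sum>l\<in>T. b l *R aug_ray l)" and l: "l:S"
 shows "a l = (if l:T then b l else 0)"
proof -
 have inl: "(if Inl k:S then a (Inl k) else 0) = (if Inl k:T then b (Inl k) else 0)" if k: "k:E" for k
 proof -
  have "ALL l:S. 0 <= a l" "ALL l:T. 0 <= b l" using S(2) T(2) by auto
  note aug_value[OF S(1) k this(1), unfolded eq] aug_value[OF T(1) k this(2)]
  moreover have "Inl k:S ==> 0 <= a (Inl k)" "Inl k:T ==> 0 <= b (Inl k)" using S(2) T(2) by auto
  ultimately show ?thesis by (cases "Inl k:S"; cases "Inl k:T"; simp)
 qed
 show ?thesis
 proof (cases l)
  case (Inl k)
  hence "k:E" using S(1) l unfolding aug_flags_iff indep_def by blast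
  thus ?thesis using inl[of k] Inl l by simp
 next
  case (Inr F)
  \<comment> \<open>Adding \<open>None\<close> makes even the empty flat nonempty and turns
    coordinate values into differences to the coordinate of \<open>None\<close>, as
    \<open>chain_coefficients_unique\<close> requires.\<close>
  let ?g = "%F. insert None (Some ` F)" and ?h = "%G. Some -` G"
  have hg: "?h (?g F) = F" for F :: "'a set" by auto
  have inj: "inj_on ?g A" for A :: "'a set set" by (rule inj_on_inverseI[of _ ?h]) (rule hg)
  have re: "(\<Sum>G\<in>?g ` (Inr -` L). c (Inr (?h G)) * of_bool (w:G)) = (\<Sum>F\<in>Inr -` L. c (Inr F) * of_bool (w:?g F))" for c :: "'a + 'a set => real" and L w
   unfolding sum.reindex[OF inj] comp_def hg ..
  have fl: "flag (Inr -` S)" "flag (Inr -` T)" using S(1) T(1) unfolding aug_flags_iff by auto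
  have sets: "G ~= {} & G <= aug_ground & G ~= aug_ground" if f: "flag \<F>" and G: "G:?g ` \<F>" for \<F> G
  proof -
   obtain F where F: "F:\<F>" "G = ?g F" using G by blast
   have "F <= E" "F ~= E" using flagD(1)[OF f F(1)] by auto
   thus ?thesis unfolding F(2) by auto
  qed
  have comp: "F <= G | G <= F" if f: "flag \<F>" and G: "F:?g ` \<F>" "G:?g ` \<F>" for \<F> F G
   using flagD(2)[OF f] G by blast
  have val: "(\<Sum>F\<in>Inr -` L. c (Inr F) * of_bool (w:?g F)) = (\<Sum>F\<in>Inr -` L. c (Inr F)) - d w"
   if "!!k. w = Some k ==> (\<Sum>F\<in>Inr -` L. c (Inr F) * of_bool (k~:F)) = d w" "w = None ==> d w = 0" for c :: "'a + 'a set => real" and L w and d :: "'a option => real"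
  proof (cases w)
   case (Some k)
   have "(\<Sum>F\<in>Inr -` L. c (Inr F) * of_bool (w:?g F)) + (\<Sum>F\<in>Inr -` L. c (Inr F) * of_bool (k~:F)) = (\<Sum>F\<in>Inr -` L. c (Inr F))"
    unfolding sum.distrib[symmetric] Some by (intro sum.cong) auto
   thus ?thesis using that(1)[OF Some] by simp
  qed (use that in auto)
  define d where "d w = (case w of None => 0 | Some k => (\<Sum>F\<in>Inr -` S. a (Inr F) * of_bool (k~:F)))" for w
  have dT: "(\<Sum>F\<in>Inr -` T. b (Inr F) * of_bool (k~:F)) = d (Some k)" if k: "k:E" for k
   using lookup_aug_sum[OF S(1) k, of a] lookup_aug_sum[OF T(1) k, of b] inl[OF k] unfolding eq d_def by simp
  have "a (Inr (?h (?g F))) = (if ?g F:?g ` (Inr -` T) then b (Inr (?h (?g F))) else 0)"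
  proof (rule chain_coefficients_unique[where S = "?g ` (Inr -` S)" and T = "?g ` (Inr -` T)" and W = aug_ground
     and a = "%G. a (Inr (?h G))" and b = "%G. b (Inr (?h G))"])
   show "finite (?g ` (Inr -` S))" "finite (?g ` (Inr -` T))" using flag_finite(1) fl by auto
   show "0 <= a (Inr (?h G))" if "G:?g ` (Inr -` S)" for G using that S(2) hg by auto
   show "0 <= b (Inr (?h G))" if "G:?g ` (Inr -` T)" for G using that T(2) hg by auto
   show "?g F:?g ` (Inr -` S)" using l Inr by blast
   fix v w assume vw: "v:aug_ground" "w:aug_ground"
   have "(\<Sum>F\<in>Inr -` S. a (Inr F) * of_bool (w:?g F)) = (\<Sum>F\<in>Inr -` S. a (Inr F)) - d w" for w
    by (rule val) (auto simp: d_def)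
   moreover have "(\<Sum>F\<in>Inr -` T. b (Inr F) * of_bool (w:?g F)) = (\<Sum>F\<in>Inr -` T. b (Inr F)) - d w" if "w:aug_ground" for w
    by (rule val) (use dT that in \<open>auto simp: d_def\<close>)
   ultimately show "(\<Sum>G\<in>?g ` (Inr -` S). a (Inr (?h G)) * of_bool (v:G)) - (\<Sum>G\<in>?g ` (Inr -` S). a (Inr (?h G)) * of_bool (w:G)) =
    (\<Sum>G\<in>?g ` (Inr -` T). b (Inr (?h G)) * of_bool (v:G)) - (\<Sum>G\<in>?g ` (Inr -` T). b (Inr (?h G)) * of_bool (w:G))"
    unfolding re using vw by simp
  qed (erule sets[OF fl(1)] sets[OF fl(2)] | erule (1) comp[OF fl(1)] | erule (1) comp[OF fl(2)])+
  moreover have "?g F:?g ` (Inr -` T) <-> Inr F:T" by (simp only: inj_image_mem_iff[OF inj[of UNIV]] vimage_eq)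
  ultimately show ?thesis unfolding Inr hg by simp
 qed
qed

definition aug_cones :: "'a fvec set set" where
 "aug_cones = (%L. convex_cone hull (aug_ray ` L)) ` aug_flags"

lemma aug_rational_fan: "rational_fan (int_lattice E) aug_cones"
 unfolding aug_cones_def
proof (rule simplicial_fan[OF lattice_int_lattice[OF fin]])
 have "aug_flags <= Pow (Inl ` E Un Inr ` Pow E)"
 proof (intro subsetI PowI)
  fix L l assume L: "L:aug_flags" and l: "l:L"
  show "l:Inl ` E Un Inr ` Pow E"
  proof (cases l)
   case (Inl i) thus ?thesis using L l unfolding aug_flags_iff indep_def by blast
  next
   case (Inr F)
   have "flag (Inr -` L)" using L unfolding aug_flags_iff by blast
   thus ?thesis using flagD(1)[of "Inr -` L" F] l Inr by auto
  qed
 qed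
 thus "finite aug_flags" using fin finite_subset by blast
 show "{}:aug_flags" unfolding aug_flags_iff indep_def flag_def using rank_empty by simp
 show "finite L" if "L:aug_flags" for L using aug_flags_finite[OF that] by blast
 show "T:aug_flags" if L: "L:aug_flags" "T <= L" for L T
 proof -
  have "Inl -` T <= Inl -` L" "Inr -` T <= Inr -` L" using L(2) by auto
  thus ?thesis using L(1) indep_subset[of "Inl -` L" "Inl -` T"] flag_mono[of "Inr -` L" "Inr -` T"] unfolding aug_flags_iff by (meson subsetD subset_trans)
 qed
 show "aug_ray l:int_lattice E" if "L:aug_flags" "l:L" for L l
 proof (cases l)
  case (Inl i)
  hence "i:E" using that unfolding aug_flags_iff indep_def by blast
  thus ?thesis unfolding Inl using evec_int_lattice[of "{i}" E] by simp
 next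
  case (Inr F)
  have "evec (E - F):int_lattice E" using fin by (intro evec_int_lattice) auto
  thus ?thesis unfolding Inr aug_ray.simps by (rule add_subgroup_uminus[OF is_lattice_add_subgroup[OF lattice_int_lattice[OF fin]]])
 qed
 fix S T a b l
 assume "S:aug_flags" "T:aug_flags" "!!l. l:S ==> 0 <= a l" "!!l. l:T ==> 0 <= b l"
  "(\<Sum>l\<in>S. a l *R aug_ray l) = (\<Sum>l\<in>T. b l *R aug_ray l)" "l:S"
 thus "a l = (if l:T then b l else 0)" by (intro aug_uniq[of S a T b]) auto
qed

lemma aug_sum_coords: "(\<Sum>l\<in>L. a l *R aug_ray l):coords E" if L: "L:aug_flags"
proof (intro subspace_sum[OF coords_subspace] coords_scale)
 fix l assume l: "l:L"
 show "aug_ray l:coords E"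
 proof (cases l)
  case (Inl i)
  hence "i:E" using l L unfolding aug_flags_iff indep_def by blast
  thus ?thesis unfolding Inl using evec_coords[of "{i}" E] by simp
 next
  case (Inr F)
  show ?thesis unfolding Inr aug_ray.simps using fin by (intro subspace_neg[OF coords_subspace] evec_coords) auto
 qed
qed

lemma aug_cones_support: assumes E: "E ~= {}" shows "\<Union>aug_cones = aug_support"
proof (intro equalityI subsetI)
 fix y assume "y:\<Union>aug_cones"
 then obtain L where L: "L:aug_flags" and "y:convex_cone hull (aug_ray ` L)" unfolding aug_cones_def by blast
 then obtain a where a: "ALL l:L. 0 <= a l" and y: "y = (\<Sum>l\<in>L. a l *R aug_ray l)"
  unfolding convex_cone_hull_image[OF aug_flags_finite(3)[OF L]] by blast
 note val = aug_value[OF L _ a, folded y]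
 have h: "indep (Inl -` L)" "flag (Inr -` L)" "ALL F:Inr -` L. Inl -` L <= F" using L unfolding aug_flags_iff by auto
 have "indep {k:E. 0 < lookup y k}"
  by (rule indep_subset[OF h(1)]) (use val(2) in force)
 moreover have "rflat {k:E. t <= lookup y k}" if t: "t <= 0" for t
 proof -
  \<comment> \<open>Lowered by the constant \<open>s\<close>, this is the part of \<open>y\<close>
    that comes from the flag; heights \<open>t <= 0\<close> do not see the rest.\<close>
  define w where "w = (\<Sum>F\<in>Inr -` L. a (Inr F) *R evec F)"
  have "w:trop_space"
   unfolding w_def using flagD[OF h(2)] a by (intro chain_sum_trop_space[OF loopless flag_finite(1)[OF h(2)]]) auto
  define s where "s = (\<Sum>F\<in>Inr -` L. a (Inr F))"
  have lw: "lookup w k = s - (\<Sum>F\<in>Inr -` L. a (Inr F) * of_bool (k~:F))" for k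
  proof -
   have "lookup w k = (\<Sum>F\<in>Inr -` L. a (Inr F) * of_bool (k:F))"
    unfolding w_def using flagD(1)[OF h(2)] by (intro chain_sum_lookup) auto
   moreover have "(\<Sum>F\<in>Inr -` L. a (Inr F) * of_bool (k:F)) + (\<Sum>F\<in>Inr -` L. a (Inr F) * of_bool (k~:F)) = s"
    unfolding s_def sum.distrib[symmetric] by (intro sum.cong) auto
   ultimately show ?thesis by simp
  qed
  have "t <= lookup y k <-> t + s <= lookup w k" if k: "k:E" for k
  proof (cases "Inl k:L")
   case True
   have "(\<Sum>F\<in>Inr -` L. a (Inr F) * of_bool (k~:F)) = 0" using h(3) True by (intro sum.neutral) auto
   thus ?thesis using val(1)[OF k True] bspec[OF a True] t unfolding lw by simp
  next
   case False
   thus ?thesis unfolding lw y lookup_aug_sum[OF L k] by auto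
  qed
  hence "{k:E. t <= lookup y k} = {k:E. t + s <= lookup w k}" by blast
  thus ?thesis using \<open>w:trop_space\<close> unfolding trop_space_def by auto
 qed
 ultimately show "y:aug_support" unfolding aug_support_def using aug_sum_coords[OF L] y by simp
next
 fix y assume y: "y:aug_support"
 hence yc: "y:coords E" and I: "indep {k:E. 0 < lookup y k}"
  and fl: "!!t. t <= 0 ==> rflat {k:E. t <= lookup y k}" unfolding aug_support_def by auto
 \<comment> \<open>The nonpositive part of \<open>y\<close>; its superlevel sets are flats because
   those of \<open>y\<close> are at heights up to 0.\<close>
 define z where "z = (\<Sum>k\<in>E. min (lookup y k) 0 *R evec {k})"
 have lz: "lookup z k = (if k:E then min (lookup y k) 0 else 0)" for k
  unfolding z_def lookup_combination[OF fin] using fin by simp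
 have zc: "z:coords E" unfolding coords_iff lz by simp
 have "rflat {k:E. s <= lookup z k}" for s
 proof (cases "s <= 0")
  case True
  hence "{k:E. s <= lookup z k} = {k:E. s <= lookup y k}" by (auto simp: lz)
  thus ?thesis using fl[OF True] by simp
 next
  case False
  hence "{k:E. s <= lookup z k} = {}" by (auto simp: lz)
  thus ?thesis using loopless by metis
 qed
 hence zt: "z:trop_space" unfolding trop_space_def using zc by blast
 obtain S a c where S: "finite S" "ALL F:S. F ~= {} & F ~= E & (EX t. F = {i:E. t < lookup z i})"
  "ALL F:S. 0 <= a F" "z = (\<Sum>F\<in>S. a F *R evec F) + c *R evec E"
  by (rule level_decomposition[OF zc E])
 have SF: "rflat F" "F <= E" if "F:S" for F
  using bspec[OF S(2) that] rflat_strict_superlevel[OF zt] by auto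
 have Sch: "F <= G | G <= F" if FG: "F:S" "G:S" for F G
 proof -
  obtain s t where "F = {i:E. s < lookup z i}" "G = {i:E. t < lookup z i}"
   using bspec[OF S(2) FG(1)] bspec[OF S(2) FG(2)] by blast
  thus ?thesis by (cases "s <= t") auto
 qed
 \<comment> \<open>The value of \<open>z\<close> on elements lying in all sets of the chain, that
   is, its maximum. Rewriting with complements matches the rays of the augmented fan.\<close>
 define d where "d = (\<Sum>F\<in>S. a F) + c"
 have zk: "lookup z k = d - (\<Sum>F\<in>S. a F * of_bool (k~:F))" if "k:E" for k
 proof -
  have "lookup (\<Sum>F\<in>S. a F *R evec F) k = (\<Sum>F\<in>S. a F * of_bool (k:F))"
   by (rule chain_sum_lookup[OF SF(2)])
  moreover have "(\<Sum>F\<in>S. a F * of_bool (k:F)) + (\<Sum>F\<in>S. a F * of_bool (k~:F)) = (\<Sum>F\<in>S. a F)"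
   unfolding sum.distrib[symmetric] by (intro sum.cong) auto
  ultimately show ?thesis unfolding S(4) d_def using that fin by (simp add: lookup_add lookup_evec)
 qed
 obtain k0 where k0: "k0:E" "ALL F:S. k0:F"
 proof (cases "S = {}")
  case True thus ?thesis using that E by blast
 next
  case False
  hence "\<Inter>S \<in> S" using chain_Union_mem(2)[OF S(1)] Sch by blast
  hence "\<Inter>S ~= {}" "\<Inter>S <= E" using S(2) SF(2) by auto
  thus ?thesis using that by blast
 qed
 have "lookup z k0 = d" unfolding zk[OF k0(1)] using k0(2) by (simp add: sum.neutral)
 hence d0: "d <= 0" using lz[of k0] k0(1) by auto
 define I where "I = {k:E. 0 < lookup y k}"
 \<comment> \<open>A negative \<open>d\<close> is realised by the empty flat, whose ray is
   \<open>- evec E\<close>. This is compatible with \<open>I\<close>, which is empty in that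
   case.\<close>
 define \<F> where "\<F> = (if d < 0 then insert {} S else S)"
 have eS: "{}~:S" using S(2) by blast
 have zI: "lookup z k = 0" if "k:I" for k using that lz unfolding I_def by auto
 have "flag \<F>"
  unfolding flag_def proper_def \<F>_def using SF(1) S(2) Sch loopless E by (auto split: if_splits)
 moreover have "I <= F" if F: "F:\<F>" for F
 proof
  fix k assume k: "k:I"
  hence kE: "k:E" unfolding I_def by blast
  have "0 <= (\<Sum>F\<in>S. a F * of_bool (k~:F))" using S(3) by (intro sum_nonneg) auto
  hence "~ d < 0" using zk[OF kE] zI[OF k] by simp
  hence FS: "F:S" using F unfolding \<F>_def by simp
  then obtain t where t: "F = {i:E. t < lookup z i}" "F ~= {}" using S(2) by blast
  then obtain i where "i:E" "t < lookup z i" by blast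
  hence "t < 0" using lz[of i] by simp
  thus "k:F" unfolding t(1) using kE zI[OF k] by simp
 qed
 moreover have "indep I" unfolding I_def by (rule I)
 ultimately have L: "Inl ` I Un Inr ` \<F>:aug_flags" unfolding aug_flags_def by blast
 define b where "b l = (case l of Inl k => lookup y k | Inr F => if F = {} then - d else a F)" for l :: "'a + 'a set"
 have vi: "Inr -` (Inl ` I Un Inr ` \<F>) = \<F>" by auto
 have "y = (\<Sum>l\<in>Inl ` I Un Inr ` \<F>. b l *R aug_ray l)"
 proof (rule coords_eqI[OF yc aug_sum_coords[OF L]])
  fix k assume k: "k:E"
  have "(\<Sum>F\<in>S. b (Inr F) * of_bool (k~:F)) = (\<Sum>F\<in>S. a F * of_bool (k~:F))"
   unfolding b_def using eS by (intro sum.cong) auto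
  hence "(\<Sum>F\<in>\<F>. b (Inr F) * of_bool (k~:F)) = - d + (\<Sum>F\<in>S. a F * of_bool (k~:F))"
   unfolding \<F>_def using d0 S(1) eS by (auto simp: b_def)
  hence "lookup (\<Sum>l\<in>Inl ` I Un Inr ` \<F>. b l *R aug_ray l) k = (if k:I then lookup y k else 0) + lookup z k"
   unfolding lookup_aug_sum[OF L k] vi zk[OF k] by (auto simp: b_def)
  also have "... = lookup y k" unfolding lz I_def using k by auto
  finally show "lookup y k = lookup (\<Sum>l\<in>Inl ` I Un Inr ` \<F>. b l *R aug_ray l) k" ..
 qed
 moreover have "ALL l:Inl ` I Un Inr ` \<F>. 0 <= b l"
  unfolding b_def \<F>_def I_def using d0 S(3) by auto
 ultimately have "y:convex_cone hull (aug_ray ` (Inl ` I Un Inr ` \<F>))"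
  unfolding convex_cone_hull_image[OF aug_flags_finite(3)[OF L]] by blast
 thus "y:\<Union>aug_cones" unfolding aug_cones_def using L by blast
qed

end

section \<open>Matroids\<close>

context
 fixes E :: "'a set" and I :: "'a set => bool"
 assumes M: "matroid E I"
begin

lemma matroid_facts: "finite E" "I A ==> A <= E" "I {}" "I B ==> A <= B ==> I A"
 "I A ==> I B ==> card A < card B ==> EX x:B - A. I (insert x A)"
 using M unfolding matroid_def by blast+

lemma mrank_max: assumes A: "A <= E"
 shows "!!J. J <= A ==> I J ==> card J <= mrank I A" "EX J<=A. I J & card J = mrank I A"
proof -
 let ?S = "card ` {J. J <= A & I J}"
 have "{J. J <= A & I J} <= Pow A" by blast
 hence f: "finite ?S" using finite_subset[OF A matroid_facts(1)] by (meson finite_Pow_iff finite_imageI finite_subset)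
 have ne: "?S ~= {}" using matroid_facts(3) by blast
 show "card J <= mrank I A" if "J <= A" "I J" for J unfolding mrank_def using f that by (intro Max_ge) auto
 show "EX J<=A. I J & card J = mrank I A" using Max_in[OF f ne] unfolding mrank_def by auto
qed

lemma indep_extend:
 assumes A: "A <= E" and J: "J <= A" "I J"
 shows "EX K. J <= K & K <= A & I K & card K = mrank I A"
 using J
proof (induction "mrank I A - card J" arbitrary: J rule: less_induct)
 case less
 show ?case
 proof (cases "card J = mrank I A")
  case False
  hence lt: "card J < mrank I A" using mrank_max(1)[OF A less.prems] by simp
  obtain B where B: "B <= A" "I B" "card B = mrank I A" using mrank_max(2)[OF A] by blast
  then obtain x where x: "x:B - J" "I (insert x J)" using matroid_facts(5)[OF less.prems(2) B(2)] lt by auto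
  have "finite J" by (rule finite_subset[OF subset_trans[OF less.prems(1) A] matroid_facts(1)])
  hence "card (insert x J) = Suc (card J)" using x by simp
  hence "mrank I A - card (insert x J) < mrank I A - card J" using lt by simp
  moreover have "insert x J <= A" using x B(1) less.prems(1) by blast
  ultimately obtain K where "insert x J <= K" "K <= A" "I K" "card K = mrank I A"
   using less.hyps[of "insert x J", OF _ _ x(2)] by auto
  thus ?thesis by blast
 qed (use less.prems in blast)
qed

text \<open>Submodularity: a maximal independent set of the intersection is extended to one of the
  union, and the parts of the latter in \<open>A\<close> and in \<open>B\<close> are
  counted.\<close>

lemma mrank_rank_function: "rank_function E (%A. int (mrank I A))"
proof
 show "finite E" by (rule matroid_facts)
 show "int (mrank I {}) = 0" using mrank_max(2)[of "{}"] by auto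
 fix A assume A: "A <= E"
 {
  fix i assume i: "i:E"
  hence iA: "insert i A <= E" using A by blast
  obtain J where J: "J <= A" "I J" "card J = mrank I A" using mrank_max(2)[OF A] by blast
  have "card J <= mrank I (insert i A)" by (rule mrank_max(1)[OF iA]) (use J in auto)
  thus "int (mrank I A) <= int (mrank I (insert i A))" using J(3) by simp
  obtain K where K: "K <= insert i A" "I K" "card K = mrank I (insert i A)" using mrank_max(2)[OF iA] by blast
  have "card (K - {i}) <= mrank I A" by (rule mrank_max(1)[OF A]) (use K matroid_facts(4)[OF K(2)] in auto)
  moreover have "card K <= card (K - {i}) + 1" by (simp add: card_Diff_singleton_if, arith)
  ultimately show "int (mrank I (insert i A)) <= int (mrank I A) + 1" using K(3) by simp
 }
 fix B assume B: "B <= E"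
 have U: "A Un B <= E" "A Int B <= E" using A B by auto
 obtain J where J: "J <= A Int B" "I J" "card J = mrank I (A Int B)" using mrank_max(2)[OF U(2)] by blast
 have "J <= A Un B" using J by blast
 then obtain K where K: "J <= K" "K <= A Un B" "I K" "card K = mrank I (A Un B)" using indep_extend[OF U(1) _ J(2)] by blast
 have fK: "finite K" using finite_subset[OF matroid_facts(2)[OF K(3)] matroid_facts(1)] .
 have "card (K Int A) <= mrank I A" "card (K Int B) <= mrank I B"
  using mrank_max(1)[OF A, of "K Int A"] mrank_max(1)[OF B, of "K Int B"] matroid_facts(4)[OF K(3)] by auto
 moreover have "card (K Int A) + card (K Int B) = card K + card (K Int A Int B)"
 proof -
  have "(K Int A) Un (K Int B) = K" "(K Int A) Int (K Int B) = K Int A Int B" using K(2) by auto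
  thus ?thesis using card_Un_Int[of "K Int A" "K Int B"] fK by simp
 qed
 moreover have "card J <= card (K Int A Int B)" using J(1) K(1) fK by (intro card_mono) auto
 ultimately show "int (mrank I (A Un B)) + int (mrank I (A Int B)) <= int (mrank I A) + int (mrank I B)" using J(3) K(4) by simp
qed

lemma indep_iff_mrank: "A <= E ==> I A <-> mrank I A = card A"
proof
 assume A: "A <= E"
 have f: "finite A" using finite_subset[OF A matroid_facts(1)] .
 show "I A ==> mrank I A = card A"
  using mrank_max(1)[OF A order_refl] mrank_max(2)[OF A] card_mono[OF f] by (metis le_antisym)
 show "mrank I A = card A ==> I A" using mrank_max(2)[OF A] card_subset_eq[OF f] by metis
qed

end

theorem theorem8p1:
  fixes E :: "'a set" and indep :: "'a set \<Rightarrow> bool"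
  assumes "simple_matroid E indep" and "mrank indep E \<ge> 1"
  shows "quasilinear (bergman_fan E indep) \<and>
         quasilinear (augmented_bergman_fan E indep) \<and>
         (\<forall>X :: 'v::real_vector tfan. generalized_bergman_fan E indep X \<longrightarrow> quasilinear X)"
proof -
 have M: "matroid E indep" and s: "!!i. i:E ==> indep {i}" "!!i j. i:E ==> j:E ==> i ~= j ==> indep {i, j}"
  using assms(1) unfolding simple_matroid_def by auto
 interpret R: rank_function E "%A. int (mrank indep A)" by (rule mrank_rank_function[OF M])
 have E: "E ~= {}" using assms(2) R.rank_empty by auto
 have flat: "flat E indep F <-> R.rflat F" for F unfolding flat_def R.rflat_def by auto
 have "mrank indep {i} = 1" if "i:E" for i using indep_iff_mrank[OF M, of "{i}"] s(1)[OF that] that by simp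
 moreover have "mrank indep {i, j} = 2" if "i:E" "j:E" "i ~= j" for i j using indep_iff_mrank[OF M, of "{i, j}"] s(2)[OF that] that by simp
 ultimately have fl: "R.rflat {}" "!!i. i:E ==> R.rflat {i}" unfolding R.rflat_def using R.rank_empty by force+
 interpret R: loopless_rank_function E "%A. int (mrank indep A)" by unfold_locales (rule fl)
 have proper: "proper_flats E indep = R.proper" unfolding proper_flats_def R.proper_def flat ..
 have chain: "subset.chain \<A> \<F> <-> \<F> <= \<A> & (ALL F:\<F>. ALL G:\<F>. F <= G | G <= F)" for \<A> \<F> :: "'a set set"
  unfolding subset_chain_def by blast
 have "subset.chain (R.proper - {{}}) \<F> <-> R.flag \<F> & {}~:\<F>" for \<F> unfolding chain R.flag_def by blast
 hence bc: "cones (bergman_fan E indep) = R.bergman_cones"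
  unfolding bergman_fan_def R.bergman_cones_def R.qm_def proper by auto
 hence b: "bergman_fan E indep = unit_fan (bergman_lattice E) R.bergman_cones"
  unfolding bergman_fan_def unit_fan_def by simp
 interpret B: matroidal_support E "%A. int (mrank indep A)" R.qm "bergman_lattice E" "R.qm ` R.trop_space" by (rule R.bergman_matroidal)
 interpret A: matroidal_support R.aug_ground R.aug_rank R.aug_map "int_lattice E" R.aug_support by (rule R.aug_matroidal)
 have ind: "indep J <-> R.indep J" for J
  unfolding R.indep_def using matroid_facts(2)[OF M, of J] indep_iff_mrank[OF M, of J] by (cases "J <= E") auto
 have "cones (augmented_bergman_fan E indep) = R.aug_cones"
 proof -
  have im: "(%i. evec {i}) ` J Un (%F. - evec (E - F)) ` \<F> = R.aug_ray ` (Inl ` J Un Inr ` \<F>)" for J \<F>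
   by (simp add: image_Un image_image)
  have fl: "subset.chain R.proper \<F> <-> R.flag \<F>" for \<F> unfolding chain R.flag_def ..
  have "cones (augmented_bergman_fan E indep) = {convex_cone hull (R.aug_ray ` (Inl ` J Un Inr ` \<F>)) | J \<F>.
    R.indep J & R.flag \<F> & (ALL F:\<F>. J <= F)}"
   unfolding augmented_bergman_fan_def im[symmetric] proper ind[symmetric] fl by simp
  also have "... = R.aug_cones" unfolding R.aug_cones_def R.aug_flags_def by blast
  finally show ?thesis .
 qed
 hence a: "augmented_bergman_fan E indep = unit_fan (int_lattice E) R.aug_cones"
  unfolding augmented_bergman_fan_def unit_fan_def by simp
 have "quasilinear X" if X: "generalized_bergman_fan E indep X" for X :: "'v tfan"
 proof -
  obtain Si where "rational_fan (lat X) (cones X)" "rational_fan (bergman_lattice E) Si" "\<Union>Si = R.qm ` R.trop_space"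
   "trop_iso (unit_fan (bergman_lattice E) Si) X"
   using X unfolding generalized_bergman_fan_def b unit_fan_def[symmetric] support_unit_fan R.bergman_support[OF E] by blast
  thus ?thesis using B.quasilinear_trop_iso R.bergman_lattice_span fl(2) by blast
 qed
 thus ?thesis
  unfolding a b using B.quasilinear_unit_fan[OF R.bergman_rational_fan R.bergman_support[OF E]]
   A.quasilinear_unit_fan[OF R.aug_rational_fan R.aug_cones_support[OF E]] by blast
qed

end
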